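(* Let $s>0$ be fixed and let $h$ range over $\{\pi/(sm):\ m\in\mathbb{N}\}$. Let $\omega_j=(\cos(shj),\sin(shj))$, let $\psi\in C^\infty(S^1)$ be even, and let $f=f_h$ be semiclassically band limited on $\mathbb{R}^2$. Define the reconstruction from the discretized localized Radon transform $g_j(p)=\psi(\omega_j)\mathcal{R}f(\omega_j,p)$ by $$f_{\psi,\delta}(x)=2sh\sum_{j=1}^{\pi/(sh)}\psi(\omega_j)\,(\mathcal{H}\mathcal{R}f)(\omega_j,x\cdot\omega_j),$$ and let $f_\psi=\psi(D/|D|)f$, i.e. $\hat f_\psi(\xi)=\psi(\xi/|\xi|)\hat f(\xi)$. Then $$f_{\psi,\delta}=f_\psi+\sum_{k=-\infty,\,k\neq0}^{\infty}\mathcal{A}_kf_\psi,$$ where, for $k\in\mathbb{Z}\setminus\{0\}$, $\mathcal{A}_k$ is the Fourier multiplier $$\mathcal{A}_k:\ \mathcal{F}_hf(\xi)\longmapsto e^{2\pi i k\arg(\xi)/(sh)}\,\mathcal{F}_hf(\xi).$$ Also, the operators $\mathcal{A}_k$ are unitary, and away from the zero section they are elliptic semiclassical Fourier integral operators of order zero with canonical relations $$C_k:\ (x,\xi)\longmapsto\Big(x+\frac{2\pi k}{s|\xi|}\frac{\xi^\perp}{|\xi|},\ \xi\Big).$$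
   Context: The Radon transform in the plane is $\mathcal{R}f(\omega,p)=\int_{x\cdot\omega=p}f\,d\ell$, $\omega\in S^1$, $p\in\mathbb{R}$. The operator $\mathcal{H}=\frac1{4\pi}H\partial_p$ acts in the $p$ variable, with $Hg(p)=\frac1\pi\,\mathrm{pv}\!\int\frac{g(t)}{p-t}\,dt$ the Hilbert transform; equivalently $\mathcal{H}=\frac1{4\pi}|D_p|$. For $\xi=(\xi_1,\xi_2)$, $\xi^\perp=(-\xi_2,\xi_1)$; $\arg(\xi)$ is the polar angle of $\xi\ne0$. The semiclassical Fourier transform is $\mathcal{F}_hf(\xi)=\hat f(\xi/h)=\int e^{-ix\cdot\xi/h}f(x)\,dx$. A family $f_h$ is semiclassically band limited if (i) it is supported in an $h$-independent compact set; (ii) it is tempered, i.e. $\|f_h\|_{H^\sigma}=O(h^{-N})$ for some $\sigma$ and $N$; (iii) there is a compact set $\mathbf{B}\subset\mathbb{R}^2$ such that for every open $U\supset\mathbf{B}$ and every $N$, $|\mathcal{F}_hf_h(\xi)|\le C_Nh^N\langle\xi\rangle^{-N}$ for $\xi\notin U$. Unitary means unitary on $L^2(\mathbb{R}^2)$. Convention for the canonical relation: $\mathcal{A}_k$ has Schwartz kernel $(2\pi h)^{-2}\int e^{i\Phi(x,y,\xi)/h}\,d\xi$ with phase $\Phi=(x-y)\cdot\xi+2\pi k\arg(\xi)/s$ ($y$ the variable of the input function, $x$ that of the output), and the canonical relation is identified with the map $(x,\Phi_x)\mapsto(y,-\Phi_y)$ on the set $\{\Phi_\xi=0\}$. The infinite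 sum is understood in the sense of tempered distributions. *)

theory Defs
  imports "HOL-Analysis.Analysis"
begin

type_synonym plane = "real ^ 2"

section \<open>Smooth functions\<close>

primrec iter_deriv ::
  "'a::euclidean_space list \<Rightarrow> ('a \<Rightarrow> 'b::real_normed_vector) \<Rightarrow> 'a \<Rightarrow> 'b" where
  "iter_deriv [] f = f"
| "iter_deriv (v # vs) f = (\<lambda>x. frechet_derivative (iter_deriv vs f) (at x) v)"

text \<open>All iterated partial derivatives are (totally) differentiable at every point of \<open>S\<close>.
  Only used for open \<open>S\<close>, where it is the usual \<open>C\<^sup>\<infinity>\<close>.\<close>

definition smooth_on :: "'a::euclidean_space set \<Rightarrow> ('a \<Rightarrow> 'b::real_normed_vector) \<Rightarrow> bool" where
  "smooth_on S f \<longleftrightarrow>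
     (\<forall>vs. set vs \<subseteq> Basis \<longrightarrow> (\<forall>x\<in>S. iter_deriv vs f differentiable (at x)))"

definition test_function :: "'a::euclidean_space set \<Rightarrow> ('a \<Rightarrow> complex) \<Rightarrow> bool" where
  "test_function S \<phi> \<longleftrightarrow>
     smooth_on UNIV \<phi> \<and> (\<exists>K. compact K \<and> K \<subseteq> S \<and> (\<forall>x. x \<notin> K \<longrightarrow> \<phi> x = 0))"

definition schwartz :: "(plane \<Rightarrow> complex) \<Rightarrow> bool" where
  "schwartz \<phi> \<longleftrightarrow> smooth_on UNIV \<phi> \<and>
     (\<forall>vs (N::nat). set vs \<subseteq> Basis \<longrightarrow>
        (\<exists>C. \<forall>x. (1 + norm x) ^ N * norm (iter_deriv vs \<phi> x) \<le> C))"

definition omega :: "real \<Rightarrow> plane" where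
  "omega t = vector [cos t, sin t]"

text \<open>\<open>\<psi> \<in> C\<^sup>\<infinity>(S\<^sup>1)\<close>; only the values of \<open>\<psi>\<close> on the unit circle matter.
  The angle is a local coordinate on the circle.\<close>

definition smooth_on_circle :: "(plane \<Rightarrow> complex) \<Rightarrow> bool" where
  "smooth_on_circle \<psi> \<longleftrightarrow> smooth_on UNIV (\<lambda>t. \<psi> (omega t))"

definition perp :: "plane \<Rightarrow> plane" where
  "perp \<xi> = vector [- (\<xi> $ 2), \<xi> $ 1]"

text \<open>The principal branch of the polar angle, with values in \<open>(-\<pi>, \<pi>]\<close>.\<close>

definition polar_angle :: "plane \<Rightarrow> real" where
  "polar_angle \<xi> = Arg (Complex (\<xi> $ 1) (\<xi> $ 2))"


section \<open>Square integrable functions and the semiclassical Fourier transform\<close>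

definition L2 :: "(plane \<Rightarrow> complex) set" where
  "L2 = {f. f \<in> borel_measurable borel \<and> integrable lborel (\<lambda>x. (norm (f x))\<^sup>2)}"

definition L2_inner :: "(plane \<Rightarrow> complex) \<Rightarrow> (plane \<Rightarrow> complex) \<Rightarrow> complex" where
  "L2_inner f g = (LINT x|lborel. f x * cnj (g x))"

text \<open>A unitary operator on \<open>L\<^sup>2(\<real>\<^sup>2)\<close>. Elements of \<open>L\<^sup>2\<close> are represented by functions,
  so the operator has to respect equality almost everywhere.\<close>

definition unitary_L2 :: "((plane \<Rightarrow> complex) \<Rightarrow> (plane \<Rightarrow> complex)) \<Rightarrow> bool" where
  "unitary_L2 T \<longleftrightarrow>
     (\<forall>f\<in>L2. T f \<in> L2) \<and>
     (\<forall>f\<in>L2. \<forall>g\<in>L2. (AE x in lborel. f x = g x) \<longrightarrow> (AE x in lborel. T f x = T g x)) \<and>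
     (\<forall>f\<in>L2. \<forall>g\<in>L2. \<forall>c d. AE x in lborel.
        T (\<lambda>y. c * f y + d * g y) x = c * T f x + d * T g x) \<and>
     (\<forall>f\<in>L2. \<forall>g\<in>L2. L2_inner (T f) (T g) = L2_inner f g) \<and>
     (\<forall>g\<in>L2. \<exists>f\<in>L2. AE x in lborel. T f x = g x)"

definition fourier_h :: "real \<Rightarrow> (plane \<Rightarrow> complex) \<Rightarrow> plane \<Rightarrow> complex" where
  "fourier_h h f \<xi> = (LINT x|lborel. exp (- \<i> * of_real ((x \<bullet> \<xi>) / h)) * f x)"

text \<open>\<open>F\<close> is the semiclassical Fourier transform of \<open>f \<in> L\<^sup>2\<close>, defined by duality with
  Schwartz functions (the integral \<^const>\<open>fourier_h\<close> need not converge on \<open>L\<^sup>2\<close>).\<close>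

definition L2_fourier_h ::
  "real \<Rightarrow> (plane \<Rightarrow> complex) \<Rightarrow> (plane \<Rightarrow> complex) \<Rightarrow> bool" where
  "L2_fourier_h h f F \<longleftrightarrow> f \<in> L2 \<and> F \<in> L2 \<and>
     (\<forall>\<phi>. schwartz \<phi> \<longrightarrow>
        (LINT \<xi>|lborel. F \<xi> * \<phi> \<xi>) = (LINT x|lborel. f x * fourier_h h \<phi> x))"

text \<open>The operator on \<open>L\<^sup>2\<close> which multiplies the semiclassical Fourier transform by a bounded
  function \<open>a\<close>. The result is determined up to a null set.\<close>

definition fourier_multiplier ::
  "real \<Rightarrow> (plane \<Rightarrow> complex) \<Rightarrow> (plane \<Rightarrow> complex) \<Rightarrow> plane \<Rightarrow> complex" where
  "fourier_multiplier h a f =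
     (SOME g. \<exists>F. L2_fourier_h h f F \<and> L2_fourier_h h g (\<lambda>\<xi>. a \<xi> * F \<xi>))"


section \<open>Infinite sums of tempered distributions\<close>

text \<open>A measurable function which is a tempered distribution by integration; continuity of
  \<open>\<phi> \<mapsto> \<integral> u \<phi>\<close> on the Schwartz space is then automatic (Banach-Steinhaus).\<close>

definition tempered_function :: "(plane \<Rightarrow> complex) \<Rightarrow> bool" where
  "tempered_function u \<longleftrightarrow> u \<in> borel_measurable borel \<and>
     (\<forall>\<phi>. schwartz \<phi> \<longrightarrow> integrable lborel (\<lambda>x. u x * \<phi> x))"

definition tempered_has_sum ::
  "('i \<Rightarrow> plane \<Rightarrow> complex) \<Rightarrow> 'i set \<Rightarrow> (plane \<Rightarrow> complex) \<Rightarrow> bool" where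
  "tempered_has_sum u I v \<longleftrightarrow>
     (\<forall>k\<in>I. tempered_function (u k)) \<and> tempered_function v \<and>
     (\<forall>\<phi>. schwartz \<phi> \<longrightarrow>
        ((\<lambda>k. LINT x|lborel. u k x * \<phi> x) has_sum (LINT x|lborel. v x * \<phi> x)) I)"


section \<open>Semiclassically band limited families\<close>

definition japanese_bracket :: "plane \<Rightarrow> real" where
  "japanese_bracket \<xi> = sqrt (1 + (norm \<xi>)\<^sup>2)"

definition sobolev_norm :: "real \<Rightarrow> (plane \<Rightarrow> complex) \<Rightarrow> real" where
  "sobolev_norm \<sigma> f = sqrt (1 / (2 * pi)\<^sup>2 *
     (LINT \<xi>|lborel. japanese_bracket \<xi> powr (2 * \<sigma>) * (norm (fourier_h 1 f \<xi>))\<^sup>2))"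

definition in_sobolev :: "real \<Rightarrow> (plane \<Rightarrow> complex) \<Rightarrow> bool" where
  "in_sobolev \<sigma> f \<longleftrightarrow>
     integrable lborel
       (\<lambda>\<xi>. japanese_bracket \<xi> powr (2 * \<sigma>) * (norm (fourier_h 1 f \<xi>))\<^sup>2)"

text \<open>\<open>H\<close> is the set of values of the semiclassical parameter. A distribution with the last three
  properties is, for each \<open>h\<close>, a smooth function, since its Fourier transform is rapidly
  decreasing; continuity merely selects this representative.\<close>

definition semiclassically_band_limited ::
  "real set \<Rightarrow> (real \<Rightarrow> plane \<Rightarrow> complex) \<Rightarrow> bool" where
  "semiclassically_band_limited H f \<longleftrightarrow>
     (\<forall>h\<in>H. continuous_on UNIV (f h)) \<and>
     (\<exists>K. compact K \<and> (\<forall>h\<in>H. \<forall>x. x \<notin> K \<longrightarrow> f h x = 0)) \<and>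
     (\<exists>\<sigma> N C. \<forall>h\<in>H. in_sobolev \<sigma> (f h) \<and> sobolev_norm \<sigma> (f h) \<le> C * h powr (- N)) \<and>
     (\<exists>B. compact B \<and>
        (\<forall>U. open U \<and> B \<subseteq> U \<longrightarrow>
           (\<forall>N::nat. \<exists>C. \<forall>h\<in>H. \<forall>\<xi>. \<xi> \<notin> U \<longrightarrow>
              norm (fourier_h h (f h) \<xi>) \<le> C * h ^ N * japanese_bracket \<xi> powr (- real N))))"


section \<open>The Radon transform and the discretized reconstruction\<close>

text \<open>For a unit vector \<open>\<omega>\<close>.\<close>

definition radon :: "(plane \<Rightarrow> complex) \<Rightarrow> plane \<Rightarrow> real \<Rightarrow> complex" where
  "radon f \<omega> p = (LINT t|lborel. f (p *\<^sub>R \<omega> + t *\<^sub>R perp \<omega>))"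

definition hilbert_transform :: "(real \<Rightarrow> complex) \<Rightarrow> real \<Rightarrow> complex" where
  "hilbert_transform g p = 1 / of_real pi *
     Lim (at_right 0) (\<lambda>\<epsilon>. LINT t:{t. \<epsilon> < \<bar>p - t\<bar>}|lborel. g t / of_real (p - t))"

definition calH :: "(real \<Rightarrow> complex) \<Rightarrow> real \<Rightarrow> complex" where
  "calH g p = 1 / of_real (4 * pi) *
     hilbert_transform (\<lambda>q. vector_derivative g (at q)) p"

definition h_values :: "real \<Rightarrow> real set" where
  "h_values s = {pi / (s * real m) | m. m \<ge> 1}"

text \<open>For \<open>h \<in> h_values s\<close> the number \<open>pi / (s * h)\<close> is a positive integer,
  so the floor only changes its type.\<close>

definition f_psi_delta ::
  "real \<Rightarrow> real \<Rightarrow> (plane \<Rightarrow> complex) \<Rightarrow> (plane \<Rightarrow> complex) \<Rightarrow> plane \<Rightarrow> complex" where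
  "f_psi_delta s h \<psi> f x = of_real (2 * s * h) *
     (\<Sum>j = 1..nat \<lfloor>pi / (s * h)\<rfloor>.
        \<psi> (omega (s * h * real j)) *
        calH (radon f (omega (s * h * real j))) (x \<bullet> omega (s * h * real j)))"

definition f_psi :: "(plane \<Rightarrow> complex) \<Rightarrow> (plane \<Rightarrow> complex) \<Rightarrow> plane \<Rightarrow> complex" where
  "f_psi \<psi> f = fourier_multiplier 1 (\<lambda>\<xi>. \<psi> (\<xi> /\<^sub>R norm \<xi>)) f"

text \<open>For \<open>h \<in> h_values s\<close> the multiplier does not depend on the branch of the angle.\<close>

definition calA :: "real \<Rightarrow> int \<Rightarrow> real \<Rightarrow> (plane \<Rightarrow> complex) \<Rightarrow> plane \<Rightarrow> complex" where
  "calA s k h =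
     fourier_multiplier h
       (\<lambda>\<xi>. exp (2 * of_real pi * \<i> * of_int k * of_real (polar_angle \<xi>) / of_real (s * h)))"


section \<open>Semiclassical Fourier integral operators away from the zero section\<close>

text \<open>The cotangent bundle of the plane without its zero section; points are pairs \<open>(x, \<xi>)\<close>.\<close>

definition cotangent0 :: "(plane \<times> plane) set" where
  "cotangent0 = {(x, \<xi>). \<xi> \<noteq> 0}"

definition symplectic_form :: "plane \<times> plane \<Rightarrow> plane \<times> plane \<Rightarrow> real" where
  "symplectic_form v w = snd v \<bullet> fst w - fst v \<bullet> snd w"

definition canonical_transformation :: "(plane \<times> plane \<Rightarrow> plane \<times> plane) \<Rightarrow> bool" where
  "canonical_transformation \<kappa> \<longleftrightarrow>
     smooth_on cotangent0 \<kappa> \<and> bij_betw \<kappa> cotangent0 cotangent0 \<and>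
     (\<forall>\<rho>\<in>cotangent0. \<forall>v w.
        symplectic_form (frechet_derivative \<kappa> (at \<rho>) v) (frechet_derivative \<kappa> (at \<rho>) w)
          = symplectic_form v w)"

text \<open>Phase functions \<open>\<Phi>(x, y, \<theta>)\<close>, where \<open>y\<close> is the variable of the input function, \<open>x\<close> that of
  the output, and \<open>\<theta>\<close> ranges over the plane. Two phase variables suffice for canonical
  relations that are graphs over the plane: there the minimal number of phase variables is at most
  two, and it can be raised to two by adding squares of new variables.\<close>

definition grad_x :: "(plane \<times> plane \<times> plane \<Rightarrow> real) \<Rightarrow> plane \<times> plane \<times> plane \<Rightarrow> plane" where
  "grad_x \<Phi> p = (\<chi> i. frechet_derivative \<Phi> (at p) (axis i 1, 0, 0))"

definition grad_y :: "(plane \<times> plane \<times> plane \<Rightarrow> real) \<Rightarrow> plane \<times> plane \<times> plane \<Rightarrow> plane" where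
  "grad_y \<Phi> p = (\<chi> i. frechet_derivative \<Phi> (at p) (0, axis i 1, 0))"

definition grad_theta :: "(plane \<times> plane \<times> plane \<Rightarrow> real) \<Rightarrow> plane \<times> plane \<times> plane \<Rightarrow> plane" where
  "grad_theta \<Phi> p = (\<chi> i. frechet_derivative \<Phi> (at p) (0, 0, axis i 1))"

definition critical_set ::
  "(plane \<times> plane \<times> plane) set \<Rightarrow> (plane \<times> plane \<times> plane \<Rightarrow> real) \<Rightarrow> (plane \<times> plane \<times> plane) set" where
  "critical_set \<Omega> \<Phi> = {p \<in> \<Omega>. grad_theta \<Phi> p = 0}"

definition phase_relation ::
  "(plane \<times> plane \<times> plane \<Rightarrow> real) \<Rightarrow> plane \<times> plane \<times> plane \<Rightarrow> (plane \<times> plane) \<times> (plane \<times> plane)" where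
  "phase_relation \<Phi> p =
     ((fst p, grad_x \<Phi> p), (fst (snd p), - grad_y \<Phi> p))"

text \<open>\<open>\<Phi>\<close> is a nondegenerate phase function on the open set \<open>\<Omega>\<close> (the differentials of the two
  components of \<open>\<Phi>\<^sub>\<theta>\<close> are linearly independent where \<open>\<Phi>\<^sub>\<theta> = 0\<close>) which parametrizes part of the
  graph of \<open>\<kappa>\<close>.\<close>

definition phase_for ::
  "(plane \<times> plane \<Rightarrow> plane \<times> plane) \<Rightarrow> (plane \<times> plane \<times> plane) set \<Rightarrow>
     (plane \<times> plane \<times> plane \<Rightarrow> real) \<Rightarrow> bool" where
  "phase_for \<kappa> \<Omega> \<Phi> \<longleftrightarrow> open \<Omega> \<and> smooth_on \<Omega> \<Phi> \<and>
     (\<forall>p\<in>critical_set \<Omega> \<Phi>. \<forall>c.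
        (\<forall>w. frechet_derivative (\<lambda>q. c \<bullet> grad_theta \<Phi> q) (at p) w = 0) \<longrightarrow> c = 0) \<and>
     inj_on (phase_relation \<Phi>) (critical_set \<Omega> \<Phi>) \<and>
     phase_relation \<Phi> ` critical_set \<Omega> \<Phi> \<subseteq> {(\<rho>, \<kappa> \<rho>) | \<rho>. \<rho> \<in> cotangent0}"

text \<open>Amplitudes of order zero: supported in a fixed compact subset of \<open>\<Omega>\<close>, with all derivatives
  bounded uniformly in \<open>h\<close>.\<close>

definition amplitude0 ::
  "real set \<Rightarrow> (plane \<times> plane \<times> plane) set \<Rightarrow> (real \<Rightarrow> plane \<times> plane \<times> plane \<Rightarrow> complex) \<Rightarrow> bool" where
  "amplitude0 H \<Omega> a \<longleftrightarrow>
     (\<forall>h\<in>H. smooth_on UNIV (a h)) \<and>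
     (\<exists>K. compact K \<and> K \<subseteq> \<Omega> \<and> (\<forall>h\<in>H. \<forall>p. p \<notin> K \<longrightarrow> a h p = 0)) \<and>
     (\<forall>vs. set vs \<subseteq> Basis \<longrightarrow> (\<exists>C. \<forall>h\<in>H. \<forall>p. norm (iter_deriv vs (a h) p) \<le> C))"

definition negligible_kernel ::
  "real set \<Rightarrow> (real \<Rightarrow> plane \<times> plane \<Rightarrow> complex) \<Rightarrow> bool" where
  "negligible_kernel H R \<longleftrightarrow>
     (\<forall>h\<in>H. smooth_on UNIV (R h)) \<and>
     (\<exists>K. compact K \<and> (\<forall>h\<in>H. \<forall>q. q \<notin> K \<longrightarrow> R h q = 0)) \<and>
     (\<forall>vs (N::nat). set vs \<subseteq> Basis \<longrightarrow>
        (\<exists>C. \<forall>h\<in>H. \<forall>q. norm (iter_deriv vs (R h) q) \<le> C * h ^ N))"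

text \<open>The exponent of \<open>2\<pi>h\<close> is \<open>-(n + N)/2\<close> with \<open>n = 2\<close> space and \<open>N = 2\<close> phase variables, which
  makes the operator with an amplitude of order zero an operator of order zero.\<close>

definition oscillatory_kernel ::
  "real \<Rightarrow> (plane \<times> plane \<times> plane \<Rightarrow> real) \<Rightarrow> (plane \<times> plane \<times> plane \<Rightarrow> complex) \<Rightarrow>
     plane \<times> plane \<Rightarrow> complex" where
  "oscillatory_kernel h \<Phi> a = (\<lambda>(x, y).
     1 / of_real ((2 * pi * h)\<^sup>2) *
     (LINT \<theta>|lborel. exp (\<i> * of_real (\<Phi> (x, y, \<theta>) / h)) * a (x, y, \<theta>)))"

definition has_kernel ::
  "((plane \<Rightarrow> complex) \<Rightarrow> (plane \<Rightarrow> complex)) \<Rightarrow> (plane \<times> plane \<Rightarrow> complex) \<Rightarrow> bool" where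
  "has_kernel T K \<longleftrightarrow>
     (\<forall>u\<in>L2. AE x in lborel. T u x = (LINT y|lborel. K (x, y) * u y))"

text \<open>\<open>\<chi>\<^sub>1 b\<^sub>1(hD) T b\<^sub>2(hD) \<chi>\<^sub>2\<close>: localization of \<open>T\<close> in phase space on both sides.\<close>

definition microlocalized ::
  "real \<Rightarrow> (plane \<Rightarrow> complex) \<Rightarrow> (plane \<Rightarrow> complex) \<Rightarrow> (plane \<Rightarrow> complex) \<Rightarrow> (plane \<Rightarrow> complex) \<Rightarrow>
     ((plane \<Rightarrow> complex) \<Rightarrow> (plane \<Rightarrow> complex)) \<Rightarrow> (plane \<Rightarrow> complex) \<Rightarrow> (plane \<Rightarrow> complex)" where
  "microlocalized h \<chi>1 b1 b2 \<chi>2 T u =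
     (\<lambda>x. \<chi>1 x * fourier_multiplier h b1
              (T (fourier_multiplier h b2 (\<lambda>y. \<chi>2 y * u y))) x)"

definition microlocal_cutoffs ::
  "(plane \<Rightarrow> complex) \<Rightarrow> (plane \<Rightarrow> complex) \<Rightarrow> (plane \<Rightarrow> complex) \<Rightarrow> (plane \<Rightarrow> complex) \<Rightarrow> bool" where
  "microlocal_cutoffs \<chi>1 b1 b2 \<chi>2 \<longleftrightarrow>
     test_function UNIV \<chi>1 \<and> test_function UNIV \<chi>2 \<and>
     test_function (- {0}) b1 \<and> test_function (- {0}) b2"

text \<open>The family \<open>T h\<close>, \<open>h \<in> H\<close>, is, away from the zero section, a semiclassical Fourier integral
  operator of order zero whose canonical relation is the graph of \<open>\<kappa>\<close>: every compact
  localization away from the zero section has as its kernel a finite sum of oscillatory integrals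
  with nondegenerate phases parametrizing the graph and amplitudes of order zero, up to a smooth
  kernel which is \<open>O(h\<^sup>\<infinity>)\<close>.\<close>

definition semiclassical_FIO0 ::
  "real set \<Rightarrow> (plane \<times> plane \<Rightarrow> plane \<times> plane) \<Rightarrow>
     (real \<Rightarrow> (plane \<Rightarrow> complex) \<Rightarrow> (plane \<Rightarrow> complex)) \<Rightarrow> bool" where
  "semiclassical_FIO0 H \<kappa> T \<longleftrightarrow> canonical_transformation \<kappa> \<and>
     (\<forall>\<chi>1 b1 b2 \<chi>2. microlocal_cutoffs \<chi>1 b1 b2 \<chi>2 \<longrightarrow>
        (\<exists>(n::nat) \<Omega> \<Phi> a R.
           (\<forall>i<n. phase_for \<kappa> (\<Omega> i) (\<Phi> i) \<and> amplitude0 H (\<Omega> i) (a i)) \<and>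
           negligible_kernel H R \<and>
           (\<forall>h\<in>H. has_kernel (microlocalized h \<chi>1 b1 b2 \<chi>2 (T h))
              (\<lambda>q. (\<Sum>i<n. oscillatory_kernel h (\<Phi> i) (a i h) q) + R h q))))"

text \<open>Ellipticity: at every point \<open>(\<rho>, \<kappa> \<rho>)\<close> of the canonical relation, some localization is given
  by one oscillatory integral whose amplitude is bounded away from zero, as \<open>h \<rightarrow> 0\<close>, at the
  critical point that corresponds to \<open>(\<rho>, \<kappa> \<rho>)\<close> (unique by injectivity in \<^const>\<open>phase_for\<close>).\<close>

definition elliptic_semiclassical_FIO0 ::
  "real set \<Rightarrow> (plane \<times> plane \<Rightarrow> plane \<times> plane) \<Rightarrow>
     (real \<Rightarrow> (plane \<Rightarrow> complex) \<Rightarrow> (plane \<Rightarrow> complex)) \<Rightarrow> bool" where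
  "elliptic_semiclassical_FIO0 H \<kappa> T \<longleftrightarrow> semiclassical_FIO0 H \<kappa> T \<and>
     (\<forall>\<rho>\<in>cotangent0. \<exists>\<chi>1 b1 b2 \<chi>2 \<Omega> \<Phi> a R p.
        microlocal_cutoffs \<chi>1 b1 b2 \<chi>2 \<and>
        phase_for \<kappa> \<Omega> \<Phi> \<and> amplitude0 H \<Omega> a \<and> negligible_kernel H R \<and>
        (\<forall>h\<in>H. has_kernel (microlocalized h \<chi>1 b1 b2 \<chi>2 (T h))
           (\<lambda>q. oscillatory_kernel h \<Phi> (a h) q + R h q)) \<and>
        p \<in> critical_set \<Omega> \<Phi> \<and> phase_relation \<Phi> p = (\<rho>, \<kappa> \<rho>) \<and>
        (\<exists>c>0. \<exists>h0>0. \<forall>h\<in>H. h < h0 \<longrightarrow> c \<le> norm (a h p)))"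

definition C_rel :: "real \<Rightarrow> int \<Rightarrow> plane \<times> plane \<Rightarrow> plane \<times> plane" where
  "C_rel s k = (\<lambda>(x, \<xi>).
     (x + (2 * pi * of_int k / (s * norm \<xi>)) *\<^sub>R (perp \<xi> /\<^sub>R norm \<xi>), \<xi>))"

end

theory Submission
  imports Defs "HOL-Probability.Probability"
begin

text \<open>Both sides are paired with a Schwartz function \<open>\<phi>\<close>. Let
  \<open>G t = \<psi>(\<omega>\<^sub>t) \<integral> (F f)(r \<omega>\<^sub>t) (F \<phi>)(- r \<omega>\<^sub>t) r dr\<close> with \<open>r\<close> from \<open>0\<close> to \<open>\<infinity>\<close> and \<open>\<omega>\<^sub>t\<close> the unit vector of angle \<open>t\<close>.
  By the Fourier slice theorem, and since \<open>H \<partial>\<^sub>p\<close> is the multiplier \<open>|\<sigma>|\<close>, direction \<open>j\<close> contributes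
  \<open>G (t\<^sub>j) + G (t\<^sub>j + \<pi>)\<close> to the pairing with the reconstruction, which is therefore a Riemann sum
  of the periodic function \<open>G\<close> with step \<open>s h = \<pi> / m\<close>. By polar coordinates the pairing with
  \<open>A\<^sub>k f\<^sub>\<psi>\<close> is the Fourier coefficient of \<open>G\<close> of index \<open>2 m k\<close>, up to the same constant. Hence the sum
  formula is the aliasing (Poisson summation) formula for \<open>G\<close>; it converges absolutely because \<open>G\<close>
  is \<open>C\<^sup>2\<close>.

  The \<open>A\<^sub>k\<close> are unimodular Fourier multipliers, so they are unitary by Plancherel. After localization
  their kernels are oscillatory integrals with phase \<open>(x - y) \<bullet> \<theta> + (2 \<pi> k / s) arg \<theta>\<close>, where a partition
  of unity in \<open>\<theta>\<close> selects one of two smooth branches of \<open>arg\<close>; the choice does not matter because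
  changing \<open>arg\<close> by \<open>2 \<pi>\<close> changes the phase divided by \<open>h\<close> by \<open>4 \<pi> k m\<close>.\<close>

section \<open>Calculus of smooth functions\<close>

text \<open>The summation formula is exact for every h, so h is fixed and f becomes one continuous
  function of compact support with rapidly decreasing transform. The delicate point is the
  regularity of G: the sum over k is unordered, so the Fourier coefficients of G must be absolutely
  summable. Each angular derivative brings out a factor r, hence the angular derivatives of the
  transform of f must decay as well, while the hypothesis bounds only the transform itself.
  Interpolating between a decaying function and its second derivative of polynomial growth closes
  this gap; for the transform of phi polynomial growth is then enough. The constants match because 2
  s h / (4 pi) times the 1 / (2 pi) of one-dimensional inversion is s h / (2 pi)^2, the step of the
  Riemann sum times the constant of Parseval in the plane. Evenness of psi gives omega and -omega
  the same weight, so that m directions produce 2 m samples on the full circle. A multiplier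
  localized by multipliers is again a multiplier, which makes the oscillatory representation of A_k
  exact.\<close>

text \<open>Differentiability to finite order, so that closure properties of smooth functions can be proved
  by induction on the order.\<close>

primrec Ck :: "nat \<Rightarrow> 'a::euclidean_space set \<Rightarrow> ('a \<Rightarrow> 'b::real_normed_vector) \<Rightarrow> bool" where
  "Ck 0 S f = True"
| "Ck (Suc n) S f \<longleftrightarrow> (\<forall>x\<in>S. f differentiable (at x)) \<and>
     (\<forall>v\<in>Basis. Ck n S (\<lambda>x. frechet_derivative f (at x) v))"

lemma iter_deriv_append: "iter_deriv (vs @ ws) f = iter_deriv vs (iter_deriv ws f)"
  by (induction vs) auto

text \<open>\<open>Ck\<close> differentiates first and recurses on the derivative, and
  \<open>iter_deriv\<close> applies the last list entry first. Hence the induction splits lists at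
  their end.\<close>

lemma Ck_iff:
  "Ck n S f \<longleftrightarrow>
    (\<forall>vs. set vs \<subseteq> Basis \<and> length vs < n \<longrightarrow> (\<forall>x\<in>S. iter_deriv vs f differentiable (at x)))"
proof (induction n arbitrary: f)
  case 0
  then show ?case by simp
next
  case (Suc n)
  show ?case
  proof
    assume L: "Ck (Suc n) S f"
    show "\<forall>vs. set vs \<subseteq> Basis \<and> length vs < Suc n \<longrightarrow> (\<forall>x\<in>S. iter_deriv vs f differentiable (at x))"
    proof (intro allI impI)
      fix vs :: "'a list" assume vs: "set vs \<subseteq> Basis \<and> length vs < Suc n"
      show "\<forall>x\<in>S. iter_deriv vs f differentiable (at x)"
      proof (cases vs rule: rev_cases)
        case Nil
        then show ?thesis using L by simp
      next
        case (snoc ws v)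
        then have "Ck n S (\<lambda>x. frechet_derivative f (at x) v)" "set ws \<subseteq> Basis \<and> length ws < n"
          using L vs by auto
        then show ?thesis
          unfolding Suc.IH using snoc by (simp add: iter_deriv_append)
      qed
    qed
  next
    assume R: "\<forall>vs. set vs \<subseteq> Basis \<and> length vs < Suc n \<longrightarrow> (\<forall>x\<in>S. iter_deriv vs f differentiable (at x))"
    have "f differentiable (at x)" if "x \<in> S" for x
      using R[rule_format, of "[]"] that by auto
    moreover have "Ck n S (\<lambda>x. frechet_derivative f (at x) v)" if "v \<in> Basis" for v
      unfolding Suc.IH
    proof (intro allI impI)
      fix vs :: "'a list" assume "set vs \<subseteq> Basis \<and> length vs < n"
      then show "\<forall>x\<in>S. iter_deriv vs (\<lambda>x. frechet_derivative f (at x) v) differentiable (at x)"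
        using R[rule_format, of "vs @ [v]"] that by (simp add: iter_deriv_append)
    qed
    ultimately show "Ck (Suc n) S f" by simp
  qed
qed

lemma smooth_on_iff_Ck: "smooth_on S f \<longleftrightarrow> (\<forall>n. Ck n S f)"
  unfolding smooth_on_def Ck_iff by (meson lessI)

lemma Ck_Suc_imp: "Ck (Suc n) S f \<Longrightarrow> Ck n S f"
  unfolding Ck_iff by (meson less_SucI)

lemma Ck_cong:
  assumes "open S" "\<And>x. x \<in> S \<Longrightarrow> f x = g x" "Ck n S f"
  shows "Ck n S g"
  using assms(2,3)
proof (induction n arbitrary: f g)
  case (Suc n)
  have D: "(g has_derivative frechet_derivative f (at x)) (at x)" if "x \<in> S" for x
  proof -
    have "(f has_derivative frechet_derivative f (at x)) (at x)"
      using Suc.prems that by (simp add: frechet_derivative_works)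
    then show ?thesis
      using has_derivative_transform_within_open[OF _ \<open>open S\<close> that] Suc.prems(1) by blast
  qed
  have E: "frechet_derivative g (at x) = frechet_derivative f (at x)" if "x \<in> S" for x
    using frechet_derivative_at[OF D[OF that]] by simp
  have "Ck n S (\<lambda>x. frechet_derivative g (at x) v)" if "v \<in> Basis" for v
    using Suc.IH[of "\<lambda>x. frechet_derivative f (at x) v" "\<lambda>x. frechet_derivative g (at x) v"]
      Suc.prems that E by simp
  then show ?case using D by (auto simp: differentiable_def)
qed simp

text \<open>Lets a proof exhibit derivatives instead of reasoning about the chosen
  \<open>frechet_derivative\<close>. Openness of \<open>S\<close> carries the agreement of the two
  on \<open>S\<close> over to all further derivatives.\<close>

lemma Ck_SucI:
  assumes "open S" and D: "\<And>x. x \<in> S \<Longrightarrow> (f has_derivative f' x) (at x)"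
    and "\<And>v. v \<in> Basis \<Longrightarrow> Ck n S (\<lambda>x. f' x v)"
  shows "Ck (Suc n) S f"
proof -
  have E: "frechet_derivative f (at x) = f' x" if "x \<in> S" for x
    using frechet_derivative_at[OF D[OF that]] by simp
  have "Ck n S (\<lambda>x. frechet_derivative f (at x) v)" if "v \<in> Basis" for v
    by (rule Ck_cong[OF assms(1) _ assms(3)[OF that]]) (simp add: E)
  then show ?thesis using D by (auto simp: differentiable_def)
qed

lemma Ck_SucD:
  assumes "Ck (Suc n) S f"
  shows "x \<in> S \<Longrightarrow> (f has_derivative frechet_derivative f (at x)) (at x)"
    and "v \<in> Basis \<Longrightarrow> Ck n S (\<lambda>x. frechet_derivative f (at x) v)"
  using assms by (auto simp: frechet_derivative_works)

text \<open>Smoothness for a whole family that is closed under partial derivatives. It serves for c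
  x^(-n), for p(1/x) exp(-1/x) and for polynomials times Gaussians, where only the shape of the
  derivatives matters.\<close>

lemma smooth_on_coinduct:
  assumes "open S" "P f"
    and "\<And>f. P f \<Longrightarrow> \<exists>f'. (\<forall>x\<in>S. (f has_derivative f' x) (at x)) \<and> (\<forall>v\<in>Basis. P (\<lambda>x. f' x v))"
  shows "smooth_on S f"
proof -
  have "P f \<Longrightarrow> Ck n S f" for n f
  proof (induction n arbitrary: f)
    case (Suc n)
    then obtain f' where "\<forall>x\<in>S. (f has_derivative f' x) (at x)" "\<forall>v\<in>Basis. P (\<lambda>x. f' x v)"
      using assms(3) by blast
    then show ?case
      using Suc.IH by (intro Ck_SucI[OF \<open>open S\<close>, of f f']) auto
  qed simp
  then show ?thesis using assms(2) by (simp add: smooth_on_iff_Ck)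
qed

lemma Ck_const: "open S \<Longrightarrow> Ck n S (\<lambda>x. c)"
proof (induction n arbitrary: c)
  case (Suc n)
  show ?case
    by (rule Ck_SucI[OF Suc.prems, of _ "\<lambda>x h. 0"]) (use Suc in auto)
qed simp

lemma Ck_add: "open S \<Longrightarrow> Ck n S f \<Longrightarrow> Ck n S g \<Longrightarrow> Ck n S (\<lambda>x. f x + g x)"
proof (induction n arbitrary: f g)
  case (Suc n)
  show ?case
    by (rule Ck_SucI[OF Suc.prems(1) has_derivative_add])
       (use Suc Ck_SucD in blast)+
qed simp

lemma Ck_sum:
  assumes "open S" "finite I" "\<And>i. i \<in> I \<Longrightarrow> Ck n S (f i)"
  shows "Ck n S (\<lambda>x. \<Sum>i\<in>I. f i x)"
  using assms(2,3)
  by (induction I rule: finite_induct) (auto intro: Ck_const Ck_add assms(1))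

lemma Ck_bounded_linear_comp:
  assumes "bounded_linear h" "open S"
  shows "Ck n S f \<Longrightarrow> Ck n S (\<lambda>x. h (f x))"
proof (induction n arbitrary: f)
  case (Suc n)
  show ?case
    by (rule Ck_SucI[OF assms(2) bounded_linear.has_derivative[OF assms(1)]])
       (use Suc Ck_SucD in blast)+
qed simp

lemma Ck_bilinear:
  assumes "bounded_bilinear B" "open S"
  shows "Ck n S f \<Longrightarrow> Ck n S g \<Longrightarrow> Ck n S (\<lambda>x. B (f x) (g x))"
proof (induction n arbitrary: f g)
  case (Suc n)
  \<comment> \<open>The product rule leaves one factor undifferentiated in each term, so both
    factors are also needed one order lower.\<close>
  have "Ck n S f" "Ck n S g" using Suc.prems Ck_Suc_imp by blast+
  then show ?case
    by (intro Ck_SucI[OF assms(2) bounded_bilinear.FDERIV[OF assms(1)]] Ck_add Ck_SucD(1) assms(2))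
       (use Suc Ck_SucD in blast)+
qed simp

lemma Ck_compose:
  fixes g :: "'a::euclidean_space \<Rightarrow> 'b::euclidean_space" and f :: "'b \<Rightarrow> 'c::real_normed_vector"
  assumes "open S" "g ` S \<subseteq> T"
  shows "Ck n T f \<Longrightarrow> Ck n S g \<Longrightarrow> Ck n S (\<lambda>x. f (g x))"
proof (induction n arbitrary: f)
  case (Suc n)
  let ?F = "\<lambda>x b. frechet_derivative f (at x) b" and ?G = "\<lambda>x v. frechet_derivative g (at x) v"
  have "Ck n S g" using Suc.prems Ck_Suc_imp by blast
  show ?case
  proof (rule Ck_SucI[OF assms(1)])
    fix x assume x: "x \<in> S"
    then have gx: "g x \<in> T" using assms by auto
    note f = Ck_SucD(1)[OF Suc.prems(1) gx] and g = Ck_SucD(1)[OF Suc.prems(2) x]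
    \<comment> \<open>Expanding the inner derivative in the basis evaluates the outer derivative
      only at basis vectors, where the induction hypothesis applies to it.\<close>
    have "(\<lambda>v. \<Sum>b\<in>Basis. (?G x v \<bullet> b) *\<^sub>R ?F (g x) b) = ?F (g x) \<circ> ?G x"
    proof
      fix v
      have lin: "linear (?F (g x))" using f has_derivative_linear by blast
      have "?F (g x) (?G x v) = ?F (g x) (\<Sum>b\<in>Basis. (?G x v \<bullet> b) *\<^sub>R b)"
        by (simp add: euclidean_representation)
      then show "(\<Sum>b\<in>Basis. (?G x v \<bullet> b) *\<^sub>R ?F (g x) b) = (?F (g x) \<circ> ?G x) v"
        by (simp add: linear_sum[OF lin] linear_cmul[OF lin])
    qed
    then show "((\<lambda>x. f (g x)) has_derivative (\<lambda>v. \<Sum>b\<in>Basis. (?G x v \<bullet> b) *\<^sub>R ?F (g x) b)) (at x)"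
      using diff_chain_at[OF g f] by (simp add: o_def)
  next
    fix v :: 'a assume v: "v \<in> Basis"
    show "Ck n S (\<lambda>x. \<Sum>b\<in>Basis. (?G x v \<bullet> b) *\<^sub>R ?F (g x) b)"
      using Ck_SucD(2)[OF Suc.prems(1)] Ck_SucD(2)[OF Suc.prems(2) v] Suc.IH \<open>Ck n S g\<close>
      by (intro Ck_sum assms(1) Ck_bilinear[OF bounded_bilinear_scaleR]
            Ck_bounded_linear_comp[OF bounded_linear_inner_left]) auto
  qed
qed simp

section \<open>Closure properties of smooth functions\<close>

lemma smooth_on_subset: "smooth_on T f \<Longrightarrow> S \<subseteq> T \<Longrightarrow> smooth_on S f"
  unfolding smooth_on_def by blast

lemma smooth_on_derivI:
  assumes "open S" "\<And>x. x \<in> S \<Longrightarrow> (f has_derivative f' x) (at x)"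
    and "\<And>v. v \<in> Basis \<Longrightarrow> smooth_on S (\<lambda>x. f' x v)"
  shows "smooth_on S f"
  unfolding smooth_on_iff_Ck
proof
  fix n show "Ck n S f"
    by (cases n) (use assms Ck_SucI[OF assms(1,2)] in \<open>auto simp: smooth_on_iff_Ck simp del: Ck.simps(2)\<close>)
qed

lemma smooth_on_const: "open S \<Longrightarrow> smooth_on S (\<lambda>x. c)"
  by (simp add: smooth_on_iff_Ck Ck_const)

lemma smooth_on_add: "open S \<Longrightarrow> smooth_on S f \<Longrightarrow> smooth_on S g \<Longrightarrow> smooth_on S (\<lambda>x. f x + g x)"
  by (simp add: smooth_on_iff_Ck Ck_add)

lemma smooth_on_bounded_linear_comp:
  "bounded_linear h \<Longrightarrow> open S \<Longrightarrow> smooth_on S f \<Longrightarrow> smooth_on S (\<lambda>x. h (f x))"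
  by (simp add: smooth_on_iff_Ck Ck_bounded_linear_comp)

lemma smooth_on_bilinear:
  "bounded_bilinear B \<Longrightarrow> open S \<Longrightarrow> smooth_on S f \<Longrightarrow> smooth_on S g \<Longrightarrow> smooth_on S (\<lambda>x. B (f x) (g x))"
  by (simp add: smooth_on_iff_Ck Ck_bilinear)

lemmas smooth_on_scaleR = smooth_on_bilinear[OF bounded_bilinear_scaleR]
lemmas smooth_on_mult = smooth_on_bilinear[OF bounded_bilinear_mult]
lemmas smooth_on_inner = smooth_on_bilinear[OF bounded_bilinear_inner]
lemmas smooth_on_of_real = smooth_on_bounded_linear_comp[OF bounded_linear_of_real]

lemma smooth_on_compose:
  fixes g :: "'a::euclidean_space \<Rightarrow> 'b::euclidean_space" and f :: "'b \<Rightarrow> 'c::real_normed_vector"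
  assumes "open S" "g ` S \<subseteq> T" "smooth_on T f" "smooth_on S g"
  shows "smooth_on S (\<lambda>x. f (g x))"
  using assms by (simp add: smooth_on_iff_Ck Ck_compose)

lemma smooth_on_id: "open S \<Longrightarrow> smooth_on S (\<lambda>x. x)"
  by (rule smooth_on_derivI[where f' = "\<lambda>x h. h"]) (auto intro: smooth_on_const)

lemma smooth_on_bounded_linear: "bounded_linear h \<Longrightarrow> open S \<Longrightarrow> smooth_on S h"
  using smooth_on_bounded_linear_comp[OF _ _ smooth_on_id] by blast

lemma smooth_on_diff: "open S \<Longrightarrow> smooth_on S f \<Longrightarrow> smooth_on S g \<Longrightarrow> smooth_on S (\<lambda>x. f x - g x)"
  using smooth_on_add[of S f "\<lambda>x. - g x"] smooth_on_bounded_linear_comp[OF bounded_linear_minus[OF bounded_linear_ident], of S g]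
  by simp

lemma smooth_on_inverse:
  fixes f :: "'a::euclidean_space \<Rightarrow> real"
  assumes "open S" "smooth_on S f" "\<And>x. x \<in> S \<Longrightarrow> f x \<noteq> 0"
  shows "smooth_on S (\<lambda>x. inverse (f x))"
proof (rule smooth_on_compose[OF assms(1) _ _ assms(2), of "- {0}"])
  show "smooth_on (- {0}) (inverse :: real \<Rightarrow> real)"
  \<comment> \<open>Constant multiples of negative powers form a family closed under
    differentiation.\<close>
  proof (rule smooth_on_coinduct[where P = "\<lambda>f. \<exists>c n. f = (\<lambda>x::real. c * inverse x ^ n)"])
    show "\<exists>c n. inverse = (\<lambda>x::real. c * inverse x ^ n)"
      by (rule exI[of _ 1], rule exI[of _ 1]) auto
  next
    fix f assume "\<exists>c n. f = (\<lambda>x::real. c * inverse x ^ n)"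
    then obtain c n where f: "f = (\<lambda>x::real. c * inverse x ^ n)" by blast
    have "(f has_real_derivative (- (real n * c)) * inverse x ^ Suc n) (at x)" if "x \<noteq> 0" for x
    proof -
      have "(f has_real_derivative c * (real n * (- (inverse x ^ 2) * inverse x ^ (n - Suc 0)))) (at x)"
        unfolding f using that DERIV_inverse[of x UNIV]
        by (intro DERIV_cmult DERIV_power) (simp_all add: numeral_2_eq_2)
      then show ?thesis
        by (cases n) (simp_all add: power2_eq_square algebra_simps)
    qed
    then show "\<exists>f'. (\<forall>x\<in>- {0}. (f has_derivative f' x) (at x)) \<and>
               (\<forall>v\<in>Basis. \<exists>c n. (\<lambda>x. f' x v) = (\<lambda>x. c * inverse x ^ n))"
    proof (intro exI[of _ "\<lambda>x v. ((- (real n * c)) * inverse x ^ Suc n) * v"] conjI ballI)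
      fix v :: real assume "v \<in> Basis"
      then have "v = 1" by simp
      then show "\<exists>c' n'. (\<lambda>x. ((- (real n * c)) * inverse x ^ Suc n) * v) = (\<lambda>x. c' * inverse x ^ n')"
        by (intro exI[of _ "- (real n * c)"] exI[of _ "Suc n"]) (simp only: mult_1_right)
    qed (simp only: has_field_derivative_def Compl_iff singleton_iff, blast)
  qed auto
qed (use assms in auto)

lemma smooth_on_imp_differentiable: "smooth_on S f \<Longrightarrow> x \<in> S \<Longrightarrow> f differentiable (at x)"
  unfolding smooth_on_def by (metis empty_set empty_subsetI iter_deriv.simps(1))

section \<open>Derivatives of compactly supported functions\<close>

lemma smooth_on_UNIV_continuous: "smooth_on UNIV f \<Longrightarrow> continuous_on UNIV f"
  by (meson UNIV_I continuous_at_imp_continuous_on differentiable_imp_continuous_within smooth_on_imp_differentiable)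

lemma iter_deriv_continuous:
  assumes "smooth_on UNIV f" "set vs \<subseteq> Basis"
  shows "continuous_on UNIV (iter_deriv vs f)"
  using assms unfolding smooth_on_def
  by (meson UNIV_I continuous_at_imp_continuous_on differentiable_imp_continuous_within)

lemma iter_deriv_zero_outside:
  assumes "closed K" "\<And>x. x \<notin> K \<Longrightarrow> f x = 0" "x \<notin> K"
  shows "iter_deriv vs f x = 0"
  using assms(3)
proof (induction vs arbitrary: x)
  case (Cons v vs)
  have "(iter_deriv vs f has_derivative (\<lambda>_. 0)) (at x)"
    by (rule has_derivative_transform_within_open[where f = "\<lambda>_. 0" and s = "- K"])
       (use assms Cons in auto)
  then have "frechet_derivative (iter_deriv vs f) (at x) = (\<lambda>_. 0)"
    using frechet_derivative_at by metis
  then show ?case by simp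
qed (use assms in auto)

lemma iter_deriv_bounded:
  assumes "smooth_on UNIV f" "compact K" "\<And>x. x \<notin> K \<Longrightarrow> f x = 0" "set vs \<subseteq> Basis"
  shows "\<exists>C. \<forall>x. norm (iter_deriv vs f x) \<le> C"
proof -
  have "compact (iter_deriv vs f ` K)"
    using iter_deriv_continuous[OF assms(1,4)] assms(2)
    by (intro compact_continuous_image) (auto intro: continuous_on_subset)
  then obtain C where C: "\<And>x. x \<in> K \<Longrightarrow> norm (iter_deriv vs f x) \<le> C"
    by (meson bounded_iff compact_imp_bounded imageI)
  have "norm (iter_deriv vs f x) \<le> max C 0" for x
    using C[of x] iter_deriv_zero_outside[OF compact_imp_closed[OF assms(2)], where f = f and x = x and vs = vs] assms(3)
    by (cases "x \<in> K") auto
  then show ?thesis by blast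
qed

lemma iter_deriv_zero: "iter_deriv vs (\<lambda>_. 0) = (\<lambda>_. 0)"
  using iter_deriv_zero_outside[of "{}" "\<lambda>_. 0"] by auto

section \<open>Cutoff functions\<close>

definition flat_exp :: "real \<Rightarrow> real" where
  "flat_exp x = (if x > 0 then exp (- (1 / x)) else 0)"

lemma poly_times_exp_minus_tendsto: "((\<lambda>y. poly p y * exp (- y)) \<longlongrightarrow> (0::real)) at_top"
proof (induction p)
  case (pCons a p)
  have 1: "((\<lambda>y. y ^ n * exp (- y)) \<longlongrightarrow> (0::real)) at_top" for n
    using tendsto_power_div_exp_0[of n] by (simp add: exp_minus divide_inverse)
  have "((\<lambda>y. \<Sum>i\<le>degree (pCons a p). coeff (pCons a p) i * (y ^ i * exp (- y))) \<longlongrightarrow>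
      (\<Sum>i\<le>degree (pCons a p). coeff (pCons a p) i * 0)) at_top"
    by (intro tendsto_intros 1)
  then show ?case
    unfolding poly_altdef by (simp add: sum_distrib_right mult.assoc del: coeff_pCons degree_pCons_eq_if)
qed simp

text \<open>All derivatives have the shape p(1/x) exp(-1/x) on the right and 0 on the left; the
  exponential decay in 1/x makes the two sides match at 0.\<close>

lemma smooth_on_flat_exp: "smooth_on UNIV flat_exp"
proof (rule smooth_on_coinduct[where
      P = "\<lambda>f. \<exists>p. f = (\<lambda>x::real. if x > 0 then poly p (1 / x) * exp (- (1 / x)) else (0::real))"])
  show "\<exists>p. flat_exp = (\<lambda>x::real. if x > 0 then poly p (1 / x) * exp (- (1 / x)) else (0::real))"
    by (rule exI[of _ 1]) (auto simp: flat_exp_def fun_eq_iff)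
next
  fix f assume "\<exists>p. f = (\<lambda>x::real. if x > 0 then poly p (1 / x) * exp (- (1 / x)) else (0::real))"
  then obtain p where f: "f = (\<lambda>x. if x > 0 then poly p (1 / x) * exp (- (1 / x)) else 0)" by blast
  \<comment> \<open>With y = 1/x, the derivative of p(y) exp(-y) with respect to x is y^2 (p(y) -
    p'(y)) exp(-y).\<close>
  define q where "q = [:0, 0, 1:] * (p - pderiv p)"
  define f' where "f' = (\<lambda>x::real. if x > 0 then poly q (1 / x) * exp (- (1 / x)) else 0)"
  have "(f has_real_derivative f' x) (at x)" for x
  proof -
    consider "x > 0" | "x < 0" | "x = 0" by linarith
    then show ?thesis
    proof cases
      case 1
      have "((\<lambda>x. poly p (1 / x) * exp (- (1 / x))) has_real_derivative poly q (1 / x) * exp (- (1 / x))) (at x)"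
      proof -
        have d: "((\<lambda>x. 1 / x) has_real_derivative - (1 / x\<^sup>2)) (at x)"
          using 1 by (auto intro!: derivative_eq_intros simp: power2_eq_square)
        show ?thesis
          by (rule DERIV_cong[OF DERIV_mult[OF DERIV_chain2[OF poly_DERIV d] DERIV_chain2[OF DERIV_exp DERIV_minus[OF d]]]])
             (simp add: q_def power2_eq_square algebra_simps)
      qed
      then show ?thesis
        unfolding has_field_derivative_def
        using 1 by (intro has_derivative_transform_within_open[of _ _ x UNIV "{0<..}" f])
                   (auto simp: f f'_def)
    next
      case 2
      have "((\<lambda>x::real. 0) has_real_derivative 0) (at x)" by simp
      then show ?thesis
        unfolding has_field_derivative_def
        using 2 by (intro has_derivative_transform_within_open[of _ _ x UNIV "{..<0}" f])
                   (auto simp: f f'_def)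
    next
      case 3
      have "((\<lambda>h. (f (0 + h) - f 0) / h) \<longlongrightarrow> 0) (at 0)"
      proof (rule filterlim_split_at)
        show "((\<lambda>h. (f (0 + h) - f 0) / h) \<longlongrightarrow> 0) (at_left 0)"
          by (rule tendsto_eventually, rule eventually_at_leftI[of "-1"]) (auto simp: f)
        \<comment> \<open>Dividing by h multiplies the polynomial in 1/h by its variable.\<close>
        have "((\<lambda>h::real. poly ([:0, 1:] * p) (inverse h) * exp (- (inverse h))) \<longlongrightarrow> 0) (at_right 0)"
          by (rule filterlim_compose[OF poly_times_exp_minus_tendsto filterlim_inverse_at_top_right])
        then show "((\<lambda>h. (f (0 + h) - f 0) / h) \<longlongrightarrow> 0) (at_right 0)"
          by (rule Lim_transform_eventually)
             (auto simp: f divide_inverse intro!: eventually_at_rightI[of 0 1])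
      qed
      then show ?thesis using 3 by (simp add: DERIV_def f'_def)
    qed
  qed
  then show "\<exists>f'. (\<forall>x\<in>UNIV. (f has_derivative f' x) (at x)) \<and>
      (\<forall>v\<in>Basis. \<exists>p. (\<lambda>x. f' x v) = (\<lambda>x. if x > 0 then poly p (1 / x) * exp (- (1 / x)) else 0))"
    by (intro exI[of _ "\<lambda>x v. f' x * v"]) (auto simp: has_field_derivative_def f'_def)
qed simp

text \<open>Rises from 0 at -d to 1 at d. For d > 0 the denominator never vanishes, since at least
  one of d + t and d - t is positive.\<close>

definition smooth_step :: "real \<Rightarrow> real \<Rightarrow> real" where
  "smooth_step d t = flat_exp (d + t) * inverse (flat_exp (d + t) + flat_exp (d - t))"

lemma flat_exp_nonneg: "flat_exp t \<ge> 0" and flat_exp_pos_iff: "flat_exp t > 0 \<longleftrightarrow> t > 0"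
  by (auto simp: flat_exp_def)

lemma smooth_on_smooth_step:
  assumes "d > 0" shows "smooth_on UNIV (smooth_step d)"
proof -
  have 1: "smooth_on UNIV (\<lambda>t. flat_exp (d + t))"
    by (rule smooth_on_compose[OF _ _ smooth_on_flat_exp, where g = "\<lambda>t. d + t"])
       (auto intro!: smooth_on_add smooth_on_const smooth_on_id)
  have 2: "smooth_on UNIV (\<lambda>t. flat_exp (d - t))"
    by (rule smooth_on_compose[OF _ _ smooth_on_flat_exp, where g = "\<lambda>t. d - t"])
       (auto intro!: smooth_on_diff smooth_on_const smooth_on_id)
  have "flat_exp (d + t) + flat_exp (d - t) \<noteq> 0" for t
    using assms flat_exp_pos_iff[of "d + t"] flat_exp_pos_iff[of "d - t"]
      flat_exp_nonneg[of "d + t"] flat_exp_nonneg[of "d - t"] by (cases "t > -d") auto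
  then show ?thesis
    unfolding smooth_step_def by (intro smooth_on_mult smooth_on_inverse smooth_on_add 1 2) auto
qed

lemma smooth_step_eq_0: "t \<le> - d \<Longrightarrow> smooth_step d t = 0"
  by (simp add: smooth_step_def flat_exp_def)

lemma smooth_step_eq_1: "d > 0 \<Longrightarrow> t \<ge> d \<Longrightarrow> smooth_step d t = 1"
  by (simp add: smooth_step_def flat_exp_def)

lemma bump_function:
  fixes x0 :: "'a::euclidean_space"
  assumes "r > 0"
  obtains \<beta> :: "'a \<Rightarrow> complex" where "smooth_on UNIV \<beta>" "\<beta> x0 \<noteq> 0" "\<And>x. x \<notin> cball x0 r \<Longrightarrow> \<beta> x = 0"
proof
  \<comment> \<open>The squared distance is used because, unlike the distance, it is smooth at
    \<open>x0\<close>.\<close>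
  let ?b = "\<lambda>x. complex_of_real (flat_exp (r\<^sup>2 - (x - x0) \<bullet> (x - x0)))"
  show "smooth_on UNIV ?b"
    by (intro smooth_on_of_real smooth_on_compose[OF _ _ smooth_on_flat_exp] smooth_on_diff
          smooth_on_inner smooth_on_const smooth_on_id) auto
  show "?b x0 \<noteq> 0" using assms by (simp add: flat_exp_def)
  show "?b x = 0" if "x \<notin> cball x0 r" for x
  proof -
    have "r < norm (x - x0)" using that by (simp add: dist_norm norm_minus_commute)
    then have "r\<^sup>2 \<le> (norm (x - x0))\<^sup>2" using assms by (intro power_mono) auto
    then show ?thesis by (simp add: flat_exp_def power2_norm_eq_inner)
  qed
qed

section \<open>Modulated Gaussians are Schwartz functions\<close>

text \<open>Polynomial functions of the coordinates. What matters is that they are closed under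
  derivatives and grow at most polynomially.\<close>

inductive_set cpoly :: "('a::euclidean_space \<Rightarrow> complex) set" where
  cpoly_const: "(\<lambda>_. c) \<in> cpoly"
| cpoly_coord: "(\<lambda>x. of_real (x \<bullet> b)) \<in> cpoly"
| cpoly_add: "p \<in> cpoly \<Longrightarrow> q \<in> cpoly \<Longrightarrow> (\<lambda>x. p x + q x) \<in> cpoly"
| cpoly_mult: "p \<in> cpoly \<Longrightarrow> q \<in> cpoly \<Longrightarrow> (\<lambda>x. p x * q x) \<in> cpoly"

lemma cpoly_deriv:
  "p \<in> cpoly \<Longrightarrow> \<exists>p'. (\<forall>x. (p has_derivative p' x) (at x)) \<and> (\<forall>v. (\<lambda>x. p' x v) \<in> cpoly)"
proof (induction rule: cpoly.induct)
  case (cpoly_const c)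
  show ?case by (rule exI[of _ "\<lambda>x h. 0"]) (auto intro: cpoly.intros)
next
  case (cpoly_coord b)
  show ?case
    by (rule exI[of _ "\<lambda>x h. of_real (h \<bullet> b)"])
       (auto intro!: derivative_eq_intros cpoly.cpoly_const)
next
  case (cpoly_add p q)
  then obtain p' q' where "\<forall>x. (p has_derivative p' x) (at x)" "\<forall>v. (\<lambda>x. p' x v) \<in> cpoly"
    "\<forall>x. (q has_derivative q' x) (at x)" "\<forall>v. (\<lambda>x. q' x v) \<in> cpoly" by blast
  then show ?case
    by (intro exI[of _ "\<lambda>x h. p' x h + q' x h"] conjI allI has_derivative_add cpoly.cpoly_add) blast+
next
  case (cpoly_mult p q)
  then obtain p' q' where "\<forall>x. (p has_derivative p' x) (at x)" "\<forall>v. (\<lambda>x. p' x v) \<in> cpoly"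
    "\<forall>x. (q has_derivative q' x) (at x)" "\<forall>v. (\<lambda>x. q' x v) \<in> cpoly" by blast
  then show ?case
    by (intro exI[of _ "\<lambda>x h. p x * q' x h + p' x h * q x"])
       (intro conjI allI has_derivative_mult cpoly.cpoly_add cpoly.cpoly_mult; use cpoly_mult.hyps in blast)
qed

lemma cpoly_bound:
  "p \<in> cpoly \<Longrightarrow> \<exists>C n. C \<ge> 0 \<and> (\<forall>x. norm (p x) \<le> C * (1 + norm x) ^ n)"
proof (induction rule: cpoly.induct)
  case (cpoly_const c)
  show ?case by (rule exI[of _ "norm c"], rule exI[of _ 0]) auto
next
  case (cpoly_coord b)
  have "norm (complex_of_real (x \<bullet> b)) \<le> norm b * (1 + norm x) ^ 1" for x :: 'a
  proof -
    have "\<bar>x \<bullet> b\<bar> \<le> norm b * norm x" using Cauchy_Schwarz_ineq2[of x b] by (simp add: mult.commute)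
    also have "\<dots> \<le> norm b * (1 + norm x)" by (intro mult_left_mono) auto
    finally show ?thesis by simp
  qed
  then show ?case using norm_ge_zero by blast
next
  case (cpoly_add p q)
  then obtain C n D m where b: "C \<ge> 0" "\<And>x. norm (p x) \<le> C * (1 + norm x) ^ n"
    "D \<ge> 0" "\<And>x. norm (q x) \<le> D * (1 + norm x) ^ m" by blast
  have "norm (p x + q x) \<le> (C + D) * (1 + norm x) ^ max n m" for x
  proof -
    have "C * (1 + norm x) ^ n \<le> C * (1 + norm x) ^ max n m"
         "D * (1 + norm x) ^ m \<le> D * (1 + norm x) ^ max n m"
      using b by (intro mult_left_mono power_increasing; simp)+
    then show ?thesis using b(2)[of x] b(4)[of x] norm_triangle_ineq[of "p x" "q x"]
      by (simp add: algebra_simps)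
  qed
  then show ?case using b by (meson add_nonneg_nonneg)
next
  case (cpoly_mult p q)
  then obtain C n D m where b: "C \<ge> 0" "\<And>x. norm (p x) \<le> C * (1 + norm x) ^ n"
    "D \<ge> 0" "\<And>x. norm (q x) \<le> D * (1 + norm x) ^ m" by blast
  have "norm (p x * q x) \<le> (C * D) * (1 + norm x) ^ (n + m)" for x
    using mult_mono[OF b(2)[of x] b(4)[of x]] b by (simp add: norm_mult power_add mult_ac)
  then show ?case using b by (meson mult_nonneg_nonneg)
qed

text \<open>The power is absorbed by exp(1 + t), and the resulting linear exponent by the quadratic
  one.\<close>

lemma poly_gaussian_bounded:
  fixes a u :: real
  assumes "a > 0"
  shows "\<exists>C. \<forall>t\<ge>0. (1 + t) ^ n * exp (- (a / 2) * t\<^sup>2 + u * t) \<le> C"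
proof (intro exI allI impI)
  fix t :: real assume t: "t \<ge> 0"
  \<comment> \<open>A single term of the exponential series.\<close>
  have "(\<Sum>i\<in>{n}. (1 + t) ^ i /\<^sub>R fact i) \<le> (\<Sum>i. (1 + t) ^ i /\<^sub>R fact i)"
    using t by (intro sum_le_suminf summable_exp_generic) auto
  then have "(1 + t) ^ n / fact n \<le> exp (1 + t)"
    by (simp add: exp_def divide_inverse mult.commute)
  then have 1: "(1 + t) ^ n \<le> fact n * exp (1 + t)" by (simp add: field_simps)
  \<comment> \<open>Centring the square at (u + 1) / a rather than u / a leaves a spare exp(-t),
    which cancels exp(1 + t) up to a constant.\<close>
  have "0 \<le> (a / 2) * (t - (u + 1) / a)\<^sup>2" using assms by simp
  also have "\<dots> = (a / 2) * t\<^sup>2 - (u + 1) * t + (u + 1)\<^sup>2 / (2 * a)"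
    using assms by (simp add: power2_eq_square field_simps)
  finally have 2: "- (a / 2) * t\<^sup>2 + u * t \<le> (u + 1)\<^sup>2 / (2 * a) - t" by (simp add: algebra_simps)
  have "(1 + t) ^ n * exp (- (a / 2) * t\<^sup>2 + u * t) \<le>
      (fact n * exp (1 + t)) * exp ((u + 1)\<^sup>2 / (2 * a) - t)"
    using 1 2 t by (intro mult_mono) auto
  also have "\<dots> = fact n * exp (1 + (u + 1)\<^sup>2 / (2 * a))"
    by (simp add: mult.assoc flip: exp_add)
  finally show "(1 + t) ^ n * exp (- (a / 2) * t\<^sup>2 + u * t) \<le> fact n * exp (1 + (u + 1)\<^sup>2 / (2 * a))" .
qed

text \<open>The real linear exponent is included because u = a y turns the function into a multiple
  of the Gaussian centred at y. In this way translated Gaussians become available as Schwartz test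
  functions.\<close>

definition gauss_mod :: "real \<Rightarrow> 'a::euclidean_space \<Rightarrow> 'a \<Rightarrow> 'a \<Rightarrow> complex" where
  "gauss_mod a u v x = exp (of_real (- (a / 2) * (x \<bullet> x) + x \<bullet> u) + \<i> * of_real (x \<bullet> v))"

lemma gauss_mod_deriv:
  "(gauss_mod a u v has_derivative
     (\<lambda>h. gauss_mod a u v x * (of_real (- a * (x \<bullet> h) + h \<bullet> u) + \<i> * of_real (h \<bullet> v)))) (at x)"
proof -
  have "((\<lambda>x. complex_of_real (- (a / 2) * (x \<bullet> x) + x \<bullet> u) + \<i> * of_real (x \<bullet> v)) has_derivative
      (\<lambda>h. of_real (- a * (x \<bullet> h) + h \<bullet> u) + \<i> * of_real (h \<bullet> v))) (at x)"
    by (auto intro!: derivative_eq_intros simp: fun_eq_iff inner_commute algebra_simps)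
  from has_derivative_compose[OF this DERIV_exp[THEN has_field_derivative_imp_has_derivative]]
  show ?thesis unfolding gauss_mod_def .
qed

lemma norm_gauss_mod: "norm (gauss_mod a u v x) = exp (- (a / 2) * (norm x)\<^sup>2 + x \<bullet> u)"
  by (simp add: gauss_mod_def power2_norm_eq_inner)

lemma gauss_mod_schwartz_bound:
  assumes "a > 0" "q \<in> cpoly"
  shows "\<exists>C. \<forall>x. (1 + norm x) ^ N * norm (q x * gauss_mod a u v x) \<le> C"
proof -
  obtain C n where C: "C \<ge> 0" "\<And>x. norm (q x) \<le> C * (1 + norm x) ^ n" using cpoly_bound[OF assms(2)] by blast
  obtain D where D: "\<And>t. t \<ge> 0 \<Longrightarrow> (1 + t) ^ (N + n) * exp (- (a / 2) * t\<^sup>2 + norm u * t) \<le> D"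
    using poly_gaussian_bounded[OF assms(1)] by blast
  have "(1 + norm x) ^ N * norm (q x * gauss_mod a u v x) \<le> C * D" for x
  proof -
    have 1: "norm (gauss_mod a u v x) \<le> exp (- (a / 2) * (norm x)\<^sup>2 + norm u * norm x)"
      using norm_cauchy_schwarz[of x u] by (simp add: norm_gauss_mod mult.commute)
    have "norm (q x * gauss_mod a u v x) \<le>
        (C * (1 + norm x) ^ n) * exp (- (a / 2) * (norm x)\<^sup>2 + norm u * norm x)"
      unfolding norm_mult using C 1 by (intro mult_mono) auto
    then have "(1 + norm x) ^ N * norm (q x * gauss_mod a u v x) \<le>
        (1 + norm x) ^ N * ((C * (1 + norm x) ^ n) * exp (- (a / 2) * (norm x)\<^sup>2 + norm u * norm x))"
      by (intro mult_left_mono) auto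
    also have "\<dots> = C * ((1 + norm x) ^ (N + n) * exp (- (a / 2) * (norm x)\<^sup>2 + norm u * norm x))"
      by (simp add: power_add mult_ac)
    also have "\<dots> \<le> C * D" using C D[of "norm x"] by (intro mult_left_mono) auto
    finally show ?thesis .
  qed
  then show ?thesis by blast
qed

lemma schwartz_gauss_mod:
  fixes u v :: plane
  assumes "a > 0"
  shows "schwartz (gauss_mod a u v)"
proof -
  let ?P = "\<lambda>f. \<exists>q\<in>cpoly. f = (\<lambda>x. q x * gauss_mod a u v x)"
  have D: "\<exists>f'. (\<forall>x\<in>UNIV. (f has_derivative f' x) (at x)) \<and> (\<forall>v\<in>Basis. ?P (\<lambda>x. f' x v))" if P: "?P f" for f
  proof -
    obtain q where q: "q \<in> cpoly" "f = (\<lambda>x. q x * gauss_mod a u v x)" using P by blast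
    obtain q' where q': "\<And>x. (q has_derivative q' x) (at x)" "\<And>v. (\<lambda>x. q' x v) \<in> cpoly"
      using cpoly_deriv[OF q(1)] by blast
    let ?e = "\<lambda>x h. complex_of_real (- a) * of_real (x \<bullet> h) + (of_real (h \<bullet> u) + \<i> * of_real (h \<bullet> v))"
    show ?thesis
    proof (intro exI[of _ "\<lambda>x h. (q x * ?e x h + q' x h) * gauss_mod a u v x"] conjI ballI)
      fix x show "(f has_derivative (\<lambda>h. (q x * ?e x h + q' x h) * gauss_mod a u v x)) (at x)"
        unfolding q(2)
        by (rule has_derivative_eq_rhs[OF has_derivative_mult[OF q'(1) gauss_mod_deriv]])
           (simp add: fun_eq_iff algebra_simps)
    next
      fix h :: plane
      show "?P (\<lambda>x. (q x * ?e x h + q' x h) * gauss_mod a u v x)"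
        by (rule bexI[of _ "\<lambda>x. q x * ?e x h + q' x h"])
           (auto intro!: cpoly.intros q(1) q'(2) simp del: of_real_minus)
    qed
  qed
  have P0: "?P (gauss_mod a u v)"
    by (rule bexI[of _ "\<lambda>_. 1"]) (auto intro: cpoly.intros)
  have It: "?P (iter_deriv vs (gauss_mod a u v))" if "set vs \<subseteq> Basis" for vs
    using that
  proof (induction vs)
    case (Cons w vs)
    then obtain f' where f': "\<forall>x\<in>UNIV. (iter_deriv vs (gauss_mod a u v) has_derivative f' x) (at x)"
      "\<forall>v\<in>Basis. ?P (\<lambda>x. f' x v)" using D[of "iter_deriv vs (gauss_mod a u v)"] by auto
    have "frechet_derivative (iter_deriv vs (gauss_mod a u v)) (at x) = f' x" for x
      using frechet_derivative_at[of _ "f' x" x] f'(1) by simp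
    then show ?case using f'(2) Cons.prems by simp
  qed (use P0 in simp)
  show ?thesis
    unfolding schwartz_def
  proof (intro conjI allI impI)
    show "smooth_on UNIV (gauss_mod a u v)"
      by (rule smooth_on_coinduct[where P = ?P]) (use P0 D in auto)
    fix vs :: "plane list" and N :: nat assume "set vs \<subseteq> Basis"
    then show "\<exists>C. \<forall>x. (1 + norm x) ^ N * norm (iter_deriv vs (gauss_mod a u v) x) \<le> C"
      using It[of vs] gauss_mod_schwartz_bound[OF assms] by fastforce
  qed
qed

section \<open>Gaussians and the Fourier integral\<close>

lemma integrable_pair_mult:
  fixes f :: "'a::euclidean_space \<Rightarrow> complex" and g :: "'b::euclidean_space \<Rightarrow> complex"
  assumes f: "integrable lborel f" and g: "integrable lborel g"
  shows "integrable (lborel \<Otimes>\<^sub>M lborel) (\<lambda>(x, y). f x * g y)"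
proof (rule lborel_pair.Fubini_integrable)
  have [measurable]: "f \<in> borel_measurable borel" "g \<in> borel_measurable borel"
    using f g borel_measurable_integrable by auto
  show "(\<lambda>(x, y). f x * g y) \<in> borel_measurable (lborel \<Otimes>\<^sub>M lborel)" by measurable
  show "integrable lborel (\<lambda>x. \<integral>y. norm (case (x, y) of (x, y) \<Rightarrow> f x * g y) \<partial>lborel)"
    using f g by (simp add: norm_mult)
  show "AE x in lborel. integrable lborel (\<lambda>y. case (x, y) of (x, y) \<Rightarrow> f x * g y)"
    using g by simp
qed

text \<open>Supplies the integrability that Fubini's theorem requires. The kernel k will be a wave
  of modulus 1, or a Gaussian divided by a majorant.\<close>

lemma integrable_pair_mult_bounded:
  fixes f :: "'a::euclidean_space \<Rightarrow> complex" and g :: "'b::euclidean_space \<Rightarrow> complex"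
  assumes f: "integrable lborel f" and g: "integrable lborel g"
    and k: "case_prod k \<in> borel_measurable (borel \<Otimes>\<^sub>M borel)" "\<And>x y. norm (k x y) \<le> 1"
  shows "integrable (lborel \<Otimes>\<^sub>M lborel) (\<lambda>(x, y). k x y * (f x * g y) :: complex)"
proof (rule Bochner_Integration.integrable_bound[OF integrable_pair_mult[OF f g]])
  have [measurable]: "f \<in> borel_measurable borel" "g \<in> borel_measurable borel"
    using f g borel_measurable_integrable by auto
  note k(1)[measurable]
  show "(\<lambda>(x, y). k x y * (f x * g y)) \<in> borel_measurable (lborel \<Otimes>\<^sub>M lborel)"
    by measurable
  show "AE x in lborel \<Otimes>\<^sub>M lborel. norm (case x of (x, y) \<Rightarrow> k x y * (f x * g y))
      \<le> norm (case x of (x, y) \<Rightarrow> f x * g y)"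
  proof (rule AE_I2)
    fix p :: "'a \<times> 'b"
    obtain x y where "p = (x, y)" by (cases p)
    then show "norm (case p of (x, y) \<Rightarrow> k x y * (f x * g y)) \<le> norm (case p of (x, y) \<Rightarrow> f x * g y)"
      using k(2)[of x y] mult_right_mono[OF k(2)[of x y], of "norm (f x * g y)"] by (simp add: norm_mult)
  qed
qed

text \<open>Each factor depends on one coordinate only, and Lebesgue measure is the image of the
  product measure over \<open>Basis\<close>.\<close>

lemma lborel_prod_integral:
  fixes f :: "'a::euclidean_space \<Rightarrow> real \<Rightarrow> complex"
  assumes f: "\<And>b. b \<in> Basis \<Longrightarrow> integrable lborel (f b)"
  shows "integrable lborel (\<lambda>x::'a. \<Prod>b\<in>Basis. f b (x \<bullet> b))"
    and "(LINT x|lborel. (\<Prod>b\<in>Basis. f b (x \<bullet> b))) = (\<Prod>b\<in>Basis. (LINT t|lborel. f b t))"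
proof -
  interpret product_sigma_finite "\<lambda>_::'a. lborel :: real measure" by standard
  have [measurable]: "f b \<in> borel_measurable borel" if "b \<in> Basis" for b
    using borel_measurable_integrable[OF f[OF that]] by simp
  let ?T = "\<lambda>g. \<Sum>b\<in>Basis. g b *\<^sub>R (b::'a)"
  have T[measurable]: "?T \<in> (\<Pi>\<^sub>M b\<in>Basis. lborel) \<rightarrow>\<^sub>M borel" by measurable
  have m[measurable]: "(\<lambda>x::'a. \<Prod>b\<in>Basis. f b (x \<bullet> b)) \<in> borel_measurable borel" by measurable
  have i: "(\<Prod>b\<in>Basis. f b (?T g \<bullet> b)) = (\<Prod>b\<in>Basis. f b (g b))" for g
    by (rule prod.cong) auto
  show "integrable lborel (\<lambda>x::'a. \<Prod>b\<in>Basis. f b (x \<bullet> b))"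
    by (subst lborel_eq, subst integrable_distr_eq[OF T m]) (simp add: i product_integrable_prod f)
  show "(LINT x|lborel. (\<Prod>b\<in>Basis. f b (x \<bullet> b))) = (\<Prod>b\<in>Basis. (LINT t|lborel. f b t))"
    by (subst lborel_eq, subst integral_distr[OF T m]) (simp add: i product_integral_prod f)
qed

text \<open>The factor 1/2 makes the transform of \<open>gauss a\<close> a multiple of
  \<open>gauss (1 / a)\<close>.\<close>

definition gauss :: "real \<Rightarrow> 'a::euclidean_space \<Rightarrow> real" where
  "gauss a x = exp (- (a / 2) * (norm x)\<^sup>2)"

lemma gauss_pos: "gauss a x > 0" and gauss_le_1: "a \<ge> 0 \<Longrightarrow> gauss a x \<le> 1"
  by (auto simp: gauss_def)

lemma abs_gauss [simp]: "\<bar>gauss a x\<bar> = gauss a x"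
  using gauss_pos[of a x] by simp

lemma gauss_minus [simp]: "gauss a (- x) = gauss a x"
  by (simp add: gauss_def)

lemma gauss_measurable [measurable]: "gauss a \<in> borel_measurable borel"
  unfolding gauss_def by measurable

text \<open>The substitution t = u / sqrt a leads to the characteristic function of the standard
  normal distribution.\<close>

lemma gauss_integral_real:
  fixes s :: real
  assumes "a > 0"
  shows "integrable lborel (\<lambda>t. exp (\<i> * of_real (s * t)) * of_real (gauss a t))"
    and "(LINT t|lborel. exp (\<i> * of_real (s * t)) * of_real (gauss a t)) =
      of_real (sqrt (2 * pi / a) * exp (- s\<^sup>2 / (2 * a)))"
proof -
  define c where "c = 1 / sqrt a"
  have c: "c > 0" "a * c\<^sup>2 = 1" "c \<noteq> 0" using assms by (auto simp: c_def power_divide)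
  define F where "F = (\<lambda>t. exp (\<i> * of_real (s * t)) * complex_of_real (gauss a t))"
  have sc: "F (0 + c * u) = of_real (sqrt (2 * pi)) * (std_normal_density u *\<^sub>R iexp ((s * c) * u))" for u
  proof -
    have "gauss a (c * u) = sqrt (2 * pi) * std_normal_density u"
      using c(2) by (simp add: gauss_def std_normal_density_def power_mult_distrib)
    then show ?thesis unfolding F_def scaleR_conv_of_real by (simp add: mult_ac)
  qed
  have int1: "integrable lborel (\<lambda>u. std_normal_density u *\<^sub>R iexp ((s * c) * u))"
    by (rule Bochner_Integration.integrable_bound[OF integrable_std_normal_moment[of 0]])
       (auto simp: norm_mult)
  have "(LINT u|lborel. std_normal_density u *\<^sub>R iexp ((s * c) * u)) = char std_normal_distribution (s * c)"
    unfolding char_def by (subst integral_density) auto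
  also have "\<dots> = of_real (exp (- s\<^sup>2 / (2 * a)))"
    using assms by (simp add: char_std_normal_distribution c_def power_mult_distrib power_divide)
  finally have val: "(LINT u|lborel. std_normal_density u *\<^sub>R iexp ((s * c) * u)) = of_real (exp (- s\<^sup>2 / (2 * a)))" .
  have "integrable lborel (\<lambda>u. F (0 + c * u))"
    unfolding sc by (intro integrable_mult_right int1)
  then have "integrable lborel F"
    using lborel_integrable_real_affine_iff[of c F 0] c by simp
  then show "integrable lborel (\<lambda>t. exp (\<i> * of_real (s * t)) * complex_of_real (gauss a t))"
    unfolding F_def .
  have "(LINT t|lborel. F t) = \<bar>c\<bar> *\<^sub>R (LINT u|lborel. F (0 + c * u))"
    using c by (intro lborel_integral_real_affine) auto
  also have "\<dots> = of_real (c * sqrt (2 * pi) * exp (- s\<^sup>2 / (2 * a)))"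
    unfolding sc Bochner_Integration.integral_mult_right_zero val using c(1) by (simp add: scaleR_conv_of_real)
  also have "c * sqrt (2 * pi) = sqrt (2 * pi / a)"
    by (simp add: c_def real_sqrt_divide)
  finally show "(LINT t|lborel. exp (\<i> * of_real (s * t)) * of_real (gauss a t)) =
      of_real (sqrt (2 * pi / a) * exp (- s\<^sup>2 / (2 * a)))" unfolding F_def .
qed

lemma gauss_fourier:
  fixes v :: "'a::euclidean_space"
  assumes "a > 0"
  shows "integrable lborel (\<lambda>x. exp (\<i> * of_real (x \<bullet> v)) * of_real (gauss a x))"
    and "(LINT x|lborel. exp (\<i> * of_real (x \<bullet> v)) * of_real (gauss a x)) =
      of_real (sqrt (2 * pi / a) ^ DIM('a) * gauss (1 / a) v)"
proof -
  have n: "(norm x)\<^sup>2 = (\<Sum>b\<in>Basis. (x \<bullet> b)\<^sup>2)" for x :: 'a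
    unfolding power2_norm_eq_inner by (subst euclidean_inner) (simp add: power2_eq_square)
  have e: "exp (\<i> * of_real (x \<bullet> v)) * of_real (gauss a x) =
      (\<Prod>b\<in>Basis. exp (\<i> * of_real ((v \<bullet> b) * (x \<bullet> b))) * complex_of_real (gauss a (x \<bullet> b)))" for x :: 'a
  proof -
    have 1: "exp (\<i> * of_real (x \<bullet> v)) = (\<Prod>b\<in>Basis. exp (\<i> * of_real ((v \<bullet> b) * (x \<bullet> b))))"
      by (subst euclidean_inner, subst exp_sum[symmetric], simp)
         (simp add: sum_distrib_left mult_ac)
    have 2: "gauss a x = (\<Prod>b\<in>Basis. gauss a (x \<bullet> b))"
      unfolding gauss_def n by (subst exp_sum[symmetric]) (simp_all add: sum_distrib_left)
    show ?thesis unfolding 1 2 by (simp add: prod.distrib)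
  qed
  note g = gauss_integral_real[OF assms]
  show "integrable lborel (\<lambda>x. exp (\<i> * of_real (x \<bullet> v)) * of_real (gauss a x))"
    unfolding e by (rule lborel_prod_integral(1)) (rule g)
  have "(LINT x|lborel. exp (\<i> * of_real (x \<bullet> v)) * of_real (gauss a x)) =
     (\<Prod>b\<in>(Basis :: 'a set). of_real (sqrt (2 * pi / a) * exp (- (v \<bullet> b)\<^sup>2 / (2 * a))))"
    unfolding e by (subst lborel_prod_integral(2)) (simp_all only: g)
  also have "\<dots> = of_real (sqrt (2 * pi / a) ^ DIM('a) * gauss (1 / a) v)"
    unfolding of_real_prod[symmetric] prod.distrib gauss_def n
    by (subst exp_sum[symmetric]) (simp_all add: sum_divide_distrib sum_negf mult.commute)
  finally show "(LINT x|lborel. exp (\<i> * of_real (x \<bullet> v)) * of_real (gauss a x)) =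
      of_real (sqrt (2 * pi / a) ^ DIM('a) * gauss (1 / a) v)" .
qed

lemma gauss_integrable:
  assumes "a > 0"
  shows "integrable lborel (gauss a :: 'a::euclidean_space \<Rightarrow> real)"
    and "(LINT x|lborel. gauss a (x :: 'a)) = sqrt (2 * pi / a) ^ DIM('a)"
proof -
  have i: "integrable lborel (\<lambda>x::'a. complex_of_real (gauss a x))"
    using gauss_fourier(1)[OF assms, of "0::'a"] by simp
  then show "integrable lborel (gauss a :: 'a \<Rightarrow> real)"
    by (simp add: complex_of_real_integrable_eq)
  have "complex_of_real (LINT x|lborel. gauss a (x :: 'a)) = of_real (sqrt (2 * pi / a) ^ DIM('a))"
    using gauss_fourier(2)[OF assms, of "0::'a"] by (simp add: gauss_def)
  then show "(LINT x|lborel. gauss a (x :: 'a)) = sqrt (2 * pi / a) ^ DIM('a)"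
    by (simp only: of_real_eq_iff)
qed

lemma gauss_scale: "gauss a (t *\<^sub>R x) = gauss (a * t\<^sup>2) x"
  by (simp add: gauss_def power_mult_distrib)

lemma lborel_integral_affine:
  fixes f :: "'a::euclidean_space \<Rightarrow> 'b::{banach, second_countable_topology}"
  assumes [measurable]: "f \<in> borel_measurable borel" and c: "c \<noteq> 0"
  shows "(LINT x|lborel. f x) = \<bar>c\<bar> ^ DIM('a) *\<^sub>R (LINT u|lborel. f (t + c *\<^sub>R u))"
    and "integrable lborel (\<lambda>u. f (t + c *\<^sub>R u)) \<longleftrightarrow> integrable lborel f"
proof -
  have e: "density (distr lborel borel (\<lambda>x. t + c *\<^sub>R x)) (\<lambda>_. ennreal (\<bar>c\<bar> ^ DIM('a))) = lborel"
    using lborel_affine[OF c, of t] by (simp add: ennreal_power)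
  let ?T = "\<lambda>x. t + c *\<^sub>R x" and ?C = "\<bar>c\<bar> ^ DIM('a)"
  have T: "?T \<in> lborel \<rightarrow>\<^sub>M borel" by measurable
  have "(LINT x|lborel. f x) = (LINT x|density (distr lborel borel ?T) (\<lambda>_. ennreal ?C). f x)"
    by (simp only: e)
  also have "\<dots> = (LINT x|distr lborel borel ?T. ?C *\<^sub>R f x)"
    by (rule integral_density) auto
  also have "\<dots> = (LINT u|lborel. ?C *\<^sub>R f (t + c *\<^sub>R u))"
    by (rule integral_distr[OF T]) simp
  finally show "(LINT x|lborel. f x) = ?C *\<^sub>R (LINT u|lborel. f (t + c *\<^sub>R u))" by simp
  have "integrable lborel f \<longleftrightarrow> integrable (density (distr lborel borel ?T) (\<lambda>_. ennreal ?C)) f"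
    by (simp only: e)
  also have "\<dots> \<longleftrightarrow> integrable (distr lborel borel ?T) (\<lambda>x. ?C *\<^sub>R f x)"
    by (rule integrable_density) auto
  also have "\<dots> \<longleftrightarrow> integrable lborel (\<lambda>u. ?C *\<^sub>R f (t + c *\<^sub>R u))"
    by (rule integrable_distr_eq[OF T]) simp
  finally show "integrable lborel (\<lambda>u. f (t + c *\<^sub>R u)) \<longleftrightarrow> integrable lborel f"
    using c integrable_scaleR_right[of "inverse ?C" lborel "\<lambda>u. ?C *\<^sub>R f (t + c *\<^sub>R u)"]
    by auto
qed

section \<open>The Fourier integral: duality, inversion and the Plancherel inequality\<close>

definition ft :: "real \<Rightarrow> ('a::euclidean_space \<Rightarrow> complex) \<Rightarrow> 'a \<Rightarrow> complex" where
  "ft c f \<xi> = (LINT x|lborel. exp (\<i> * of_real (c * (x \<bullet> \<xi>))) * f x)"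

text \<open>The free parameter c lets one kernel serve for the semiclassical transform, c = -1/h,
  and, up to a constant, for its inverse, c = 1/h. In one dimension the same kernel serves for the
  Radon variable.\<close>

lemma fourier_h_eq_ft: "fourier_h h f = ft (- 1 / h) f"
  by (simp add: fourier_h_def ft_def fun_eq_iff)

lemma ft_integrand:
  assumes "integrable lborel f"
  shows "integrable lborel (\<lambda>x. exp (\<i> * of_real (c * (x \<bullet> \<xi>))) * f x)"
proof (rule Bochner_Integration.integrable_bound[OF assms])
  have [measurable]: "f \<in> borel_measurable borel"
    using assms borel_measurable_integrable by auto
  show "(\<lambda>x. exp (\<i> * of_real (c * (x \<bullet> \<xi>))) * f x) \<in> borel_measurable lborel" by measurable
qed (auto simp: norm_mult)

lemma ft_measurable [measurable]:
  fixes f :: "'a::euclidean_space \<Rightarrow> complex"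
  assumes [measurable]: "f \<in> borel_measurable borel"
  shows "ft c f \<in> borel_measurable borel"
proof -
  have "(\<lambda>\<xi>. LINT x|lborel. exp (\<i> * of_real (c * (x \<bullet> \<xi>))) * f x) \<in> borel_measurable borel"
    by (rule lborel.borel_measurable_lebesgue_integral) measurable
  then show ?thesis by (simp add: ft_def[abs_def])
qed

lemma norm_ft_le:
  assumes "integrable lborel f"
  shows "norm (ft c f \<xi>) \<le> (LINT x|lborel. norm (f x))"
  unfolding ft_def
  by (rule order_trans[OF integral_norm_bound]) (simp add: norm_mult)

text \<open>The kernel is symmetric in its two variables, so exchanging the integrals moves the
  transform to the other factor.\<close>

lemma ft_duality:
  assumes f: "integrable lborel f" and g: "integrable lborel g"
  shows "(LINT \<xi>|lborel. ft c f \<xi> * g \<xi>) = (LINT x|lborel. f x * ft c g x)"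
proof -
  have k: "integrable (lborel \<Otimes>\<^sub>M lborel) (\<lambda>(x, \<xi>). exp (\<i> * of_real (c * (x \<bullet> \<xi>))) * (f x * g \<xi>))"
    by (rule integrable_pair_mult_bounded[OF f g]) auto
  have "(LINT \<xi>|lborel. ft c f \<xi> * g \<xi>) =
      (LINT \<xi>|lborel. LINT x|lborel. exp (\<i> * of_real (c * (x \<bullet> \<xi>))) * (f x * g \<xi>))"
    unfolding ft_def
    by (subst integral_mult_left_zero[symmetric]) (simp add: mult_ac)
  also have "\<dots> = (LINT x|lborel. LINT \<xi>|lborel. exp (\<i> * of_real (c * (x \<bullet> \<xi>))) * (f x * g \<xi>))"
    by (rule lborel_pair.Fubini_integral) (use k in simp)
  also have "\<dots> = (LINT x|lborel. f x * ft c g x)"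
    unfolding ft_def
    by (subst integral_mult_right_zero[symmetric]) (simp add: mult_ac inner_commute)
  finally show ?thesis .
qed

lemma ft_gauss_modulated:
  fixes v :: "'a::euclidean_space"
  assumes "a > 0"
  shows "integrable lborel (\<lambda>\<xi>. exp (\<i> * of_real (\<xi> \<bullet> v)) * of_real (gauss a \<xi>))"
    and "ft c (\<lambda>\<xi>. exp (\<i> * of_real (\<xi> \<bullet> v)) * of_real (gauss a \<xi>)) y =
      of_real (sqrt (2 * pi / a) ^ DIM('a) * gauss (1 / a) (c *\<^sub>R y + v))"
proof -
  show "integrable lborel (\<lambda>\<xi>. exp (\<i> * of_real (\<xi> \<bullet> v)) * of_real (gauss a \<xi>))"
    by (rule gauss_fourier[OF assms])
  have "exp (\<i> * of_real (c * (x \<bullet> y))) * (exp (\<i> * of_real (x \<bullet> v)) * of_real (gauss a x)) =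
      exp (\<i> * of_real (x \<bullet> (c *\<^sub>R y + v))) * complex_of_real (gauss a x)" for x
    by (simp add: inner_add_right exp_add[symmetric] distrib_left flip: mult.assoc)
  then show "ft c (\<lambda>\<xi>. exp (\<i> * of_real (\<xi> \<bullet> v)) * of_real (gauss a \<xi>)) y =
      of_real (sqrt (2 * pi / a) ^ DIM('a) * gauss (1 / a) (c *\<^sub>R y + v))"
    unfolding ft_def by (simp only: gauss_fourier[OF assms])
qed

text \<open>By duality the inverse transform of the damped transform is f paired with the transform
  of a modulated Gaussian, that is, a Gaussian average of f around x, which is narrow when a is
  small.\<close>

lemma ft_damped:
  fixes f :: "'a::euclidean_space \<Rightarrow> complex"
  assumes f: "integrable lborel f" and a: "a > 0"
  shows "ft (- c) (\<lambda>\<xi>. ft c f \<xi> * of_real (gauss a \<xi>)) x =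
    of_real (sqrt (2 * pi / a) ^ DIM('a)) * (LINT y|lborel. f y * of_real (gauss (c\<^sup>2 / a) (y - x)))"
proof -
  let ?e = "\<lambda>\<xi>. exp (\<i> * of_real (\<xi> \<bullet> (- c *\<^sub>R x))) * complex_of_real (gauss a \<xi>)"
  have "ft (- c) (\<lambda>\<xi>. ft c f \<xi> * of_real (gauss a \<xi>)) x = (LINT \<xi>|lborel. ft c f \<xi> * ?e \<xi>)"
    unfolding ft_def[of "- c"] by (rule Bochner_Integration.integral_cong) (auto simp: mult_ac)
  also have "\<dots> = (LINT y|lborel. f y * ft c ?e y)"
    by (rule ft_duality[OF f ft_gauss_modulated(1)[OF a]])
  also have "\<dots> = (LINT y|lborel. of_real (sqrt (2 * pi / a) ^ DIM('a)) * (f y * of_real (gauss (c\<^sup>2 / a) (y - x))))"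
  proof (rule Bochner_Integration.integral_cong)
    fix y
    have "c *\<^sub>R y + - c *\<^sub>R x = c *\<^sub>R (y - x)" by (simp add: algebra_simps)
    then show "f y * ft c ?e y = of_real (sqrt (2 * pi / a) ^ DIM('a)) * (f y * of_real (gauss (c\<^sup>2 / a) (y - x)))"
      unfolding ft_gauss_modulated(2)[OF a] by (simp only: gauss_scale) (simp add: mult_ac)
  qed simp
  finally show ?thesis by simp
qed

lemma gauss_convolution_rescale:
  fixes f :: "'a::euclidean_space \<Rightarrow> complex"
  assumes [measurable]: "f \<in> borel_measurable borel" and t: "t > 0"
  shows "(LINT y|lborel. f y * of_real (gauss (1 / t\<^sup>2) (y - x))) =
    of_real (t ^ DIM('a)) * (LINT u|lborel. f (x + t *\<^sub>R u) * of_real (gauss 1 u))"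
  using t by (subst lborel_integral_affine(1)[of _ t x])
    (auto simp: gauss_scale power_divide scaleR_conv_of_real)

lemma gauss_convolution_limit:
  fixes f :: "'a::euclidean_space \<Rightarrow> complex"
  assumes [measurable]: "f \<in> borel_measurable borel" and b: "\<And>x. norm (f x) \<le> B"
    and c: "isCont f x" and t: "t \<longlonglongrightarrow> 0"
  shows "(\<lambda>n. LINT u|lborel. f (x + t n *\<^sub>R u) * of_real (gauss 1 u)) \<longlonglongrightarrow>
     f x * of_real (sqrt (2 * pi) ^ DIM('a))"
proof -
  have "(\<lambda>n. LINT u|lborel. f (x + t n *\<^sub>R u) * of_real (gauss 1 u)) \<longlonglongrightarrow>
     (LINT u|lborel. f x * of_real (gauss 1 (u :: 'a)))"
  proof (rule integral_dominated_convergence[where w = "\<lambda>u. B * gauss 1 u"])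
    show "AE u in lborel. (\<lambda>n. f (x + t n *\<^sub>R u) * of_real (gauss 1 u)) \<longlonglongrightarrow> f x * of_real (gauss 1 u)"
    proof (intro AE_I2 tendsto_intros isCont_tendsto_compose[OF c])
      fix u :: 'a
      have "(\<lambda>n. x + t n *\<^sub>R u) \<longlonglongrightarrow> x + 0 *\<^sub>R u" by (intro tendsto_intros t)
      then show "(\<lambda>n. x + t n *\<^sub>R u) \<longlonglongrightarrow> x" by simp
    qed
    show "AE u in lborel. norm (f (x + t n *\<^sub>R u) * complex_of_real (gauss 1 u)) \<le> B * gauss 1 u" for n
      using b by (intro AE_I2) (simp add: norm_mult mult_right_mono less_imp_le[OF gauss_pos])
    show "integrable lborel (\<lambda>u::'a. B * gauss 1 u)" by (simp add: gauss_integrable)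
  qed measurable
  then show ?thesis
    by (simp add: gauss_integrable)
qed

text \<open>The limit of the damped inverse integral is computed twice: by dominated convergence as
  the damping vanishes, and as the limit of Gaussian averages of f that concentrate at x, where f is
  continuous.\<close>

theorem ft_inversion:
  fixes f :: "'a::euclidean_space \<Rightarrow> complex"
  assumes f: "integrable lborel f" and b: "\<And>x. norm (f x) \<le> B" and cont: "isCont f x"
    and F: "integrable lborel (ft c f)" and c: "c \<noteq> 0"
  shows "ft (- c) (ft c f) x = of_real ((2 * pi / \<bar>c\<bar>) ^ DIM('a)) * f x"
proof -
  have [measurable]: "f \<in> borel_measurable borel"
    using f borel_measurable_integrable by auto
  \<comment> \<open>Chosen so that the averaging Gaussian of \<open>ft_damped\<close> has width 1 /
    (n + 1) whatever c is.\<close>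
  define a where "a n = c\<^sup>2 * (1 / real (Suc n))\<^sup>2" for n
  have a: "a n > 0" for n using c by (simp add: a_def)
  define t where "t n = 1 / real (Suc n)" for n
  have t: "t \<longlonglongrightarrow> 0" unfolding t_def by (rule LIMSEQ_Suc[OF lim_1_over_n])
  have tp: "t n > 0" for n by (simp add: t_def)
  have ca: "c\<^sup>2 / a n = 1 / (1 / real (Suc n))\<^sup>2" for n using c by (simp add: a_def)
  have a0: "a \<longlonglongrightarrow> c\<^sup>2 * 0\<^sup>2"
    unfolding a_def by (intro tendsto_intros LIMSEQ_Suc[OF lim_1_over_n])
  have 1: "(\<lambda>n. ft (- c) (\<lambda>\<xi>. ft c f \<xi> * of_real (gauss (a n) \<xi>)) x) \<longlonglongrightarrow> ft (- c) (ft c f) x"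
    unfolding ft_def[of "- c"]
  proof (rule integral_dominated_convergence[where w = "\<lambda>\<xi>. norm (ft c f \<xi>)"])
    show "AE \<xi> in lborel. (\<lambda>n. exp (\<i> * of_real (- c * (\<xi> \<bullet> x))) * (ft c f \<xi> * of_real (gauss (a n) \<xi>)))
      \<longlonglongrightarrow> exp (\<i> * of_real (- c * (\<xi> \<bullet> x))) * ft c f \<xi>"
    proof (rule AE_I2)
      fix \<xi> :: 'a
      have "(\<lambda>n. gauss (a n) \<xi>) \<longlonglongrightarrow> exp (- (c\<^sup>2 * 0\<^sup>2 / 2) * (norm \<xi>)\<^sup>2)"
        unfolding gauss_def by (intro tendsto_intros a0) auto
      then have "(\<lambda>n. gauss (a n) \<xi>) \<longlonglongrightarrow> 1" by simp
      then have "(\<lambda>n. exp (\<i> * of_real (- c * (\<xi> \<bullet> x))) * (ft c f \<xi> * of_real (gauss (a n) \<xi>)))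
         \<longlonglongrightarrow> exp (\<i> * of_real (- c * (\<xi> \<bullet> x))) * (ft c f \<xi> * of_real 1)"
        by (intro tendsto_intros)
      then show "(\<lambda>n. exp (\<i> * of_real (- c * (\<xi> \<bullet> x))) * (ft c f \<xi> * of_real (gauss (a n) \<xi>)))
         \<longlonglongrightarrow> exp (\<i> * of_real (- c * (\<xi> \<bullet> x))) * ft c f \<xi>" by simp
    qed
    show "AE \<xi> in lborel. norm (exp (\<i> * of_real (- c * (\<xi> \<bullet> x))) * (ft c f \<xi> * of_real (gauss (a n) \<xi>)))
        \<le> norm (ft c f \<xi>)" for n
      by (intro AE_I2) (simp add: norm_mult mult_left_le less_imp_le[OF gauss_pos] gauss_le_1[OF less_imp_le[OF a]])
    show "integrable lborel (\<lambda>\<xi>. norm (ft c f \<xi>))" using F by simp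
  qed measurable
  have 2: "ft (- c) (\<lambda>\<xi>. ft c f \<xi> * of_real (gauss (a n) \<xi>)) x =
      of_real ((sqrt (2 * pi) / \<bar>c\<bar>) ^ DIM('a)) * (LINT u|lborel. f (x + t n *\<^sub>R u) * of_real (gauss 1 u))" for n
  proof -
    have "sqrt (2 * pi / a n) * t n = sqrt (2 * pi) / \<bar>c\<bar>"
      using c by (simp add: a_def t_def real_sqrt_divide real_sqrt_mult)
    then have "sqrt (2 * pi / a n) ^ DIM('a) * t n ^ DIM('a) = (sqrt (2 * pi) / \<bar>c\<bar>) ^ DIM('a)"
      by (simp only: power_mult_distrib[symmetric])
    then show ?thesis
      unfolding ft_damped[OF f a] ca t_def[symmetric]
      by (subst gauss_convolution_rescale[OF _ tp]) (simp_all only: mult.assoc[symmetric] of_real_mult[symmetric], simp)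
  qed
  have "(\<lambda>n. of_real ((sqrt (2 * pi) / \<bar>c\<bar>) ^ DIM('a)) * (LINT u|lborel. f (x + t n *\<^sub>R u) * of_real (gauss 1 u)))
     \<longlonglongrightarrow> of_real ((sqrt (2 * pi) / \<bar>c\<bar>) ^ DIM('a)) * (f x * of_real (sqrt (2 * pi) ^ DIM('a)))"
    by (intro tendsto_intros gauss_convolution_limit[OF _ b cont t]) auto
  then have "ft (- c) (ft c f) x =
      of_real ((sqrt (2 * pi) / \<bar>c\<bar>) ^ DIM('a)) * (f x * of_real (sqrt (2 * pi) ^ DIM('a)))"
    using 1 unfolding 2 by (blast intro: LIMSEQ_unique)
  also have "\<dots> = of_real ((sqrt (2 * pi) / \<bar>c\<bar> * sqrt (2 * pi)) ^ DIM('a)) * f x"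
    by (simp only: power_mult_distrib of_real_mult) (simp add: mult_ac)
  finally show ?thesis by simp
qed

text \<open>Only an inequality at this stage; Parseval's identity is deduced later from inversion.
  By duality the damped square integral is a double integral of f against a Gaussian in y - x, and 2
  |f x| |f y| <= |f x|^2 + |f y|^2 bounds it by the L2 norm, uniformly in the damping. Fatou's lemma
  then removes the damping.\<close>

lemma nn_integral_ft_le:
  fixes f :: "'a::euclidean_space \<Rightarrow> complex"
  assumes f: "integrable lborel f" and f2: "integrable lborel (\<lambda>x. (norm (f x))\<^sup>2)" and c: "c \<noteq> 0"
  shows "(\<integral>\<^sup>+\<xi>. ennreal ((norm (ft c f \<xi>))\<^sup>2) \<partial>lborel) \<le>
    ennreal ((2 * pi / \<bar>c\<bar>) ^ DIM('a) * (LINT x|lborel. (norm (f x))\<^sup>2))"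
proof -
  let ?C = "(2 * pi / \<bar>c\<bar>) ^ DIM('a)"
  have [measurable]: "f \<in> borel_measurable borel"
    using f borel_measurable_integrable by auto
  have damped: "(\<integral>\<^sup>+\<xi>. ennreal ((norm (ft c f \<xi>))\<^sup>2 * gauss a \<xi>) \<partial>lborel) \<le>
      ennreal (?C * (LINT x|lborel. (norm (f x))\<^sup>2))" if a: "a > 0" for a
  proof -
    define b where "b = c\<^sup>2 / a"
    have b: "b > 0" using a c by (simp add: b_def)
    let ?Z = "sqrt (2 * pi / a) ^ DIM('a)"
    let ?G = "\<lambda>y x. gauss b (y - x :: 'a)"
    have Gint: "integrable lborel (\<lambda>y. ?G y x)" "(LINT y|lborel. ?G y x) = sqrt (2 * pi / b) ^ DIM('a)" for x
      using lborel_integral_affine[of "gauss b :: 'a \<Rightarrow> real" 1 "- x"] gauss_integrable[OF b, where 'a='a]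
      by (simp_all add: algebra_simps)
    have G': "?G y x = ?G x y" for x y by (metis gauss_minus minus_diff_eq)
    have cf: "integrable lborel (\<lambda>x. cnj (f x))" using f by simp
    have bd: "norm (ft c f \<xi>) \<le> (LINT x|lborel. norm (f x))" for \<xi> by (rule norm_ft_le[OF f])
    have dint: "integrable lborel (\<lambda>\<xi>. ft c f \<xi> * of_real (gauss a \<xi>))"
      by (rule Bochner_Integration.integrable_bound[where f = "\<lambda>\<xi>. (LINT x|lborel. norm (f x)) * gauss a \<xi>"])
         (use bd in \<open>auto simp: norm_mult gauss_integrable[OF a] less_imp_le[OF gauss_pos] intro!: AE_I2 mult_right_mono order_trans[OF bd]\<close>)
    have int: "integrable lborel (\<lambda>\<xi>. (norm (ft c f \<xi>))\<^sup>2 * gauss a \<xi>)"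
      by (rule Bochner_Integration.integrable_bound[where f = "\<lambda>\<xi>. (LINT x|lborel. norm (f x))\<^sup>2 * gauss a \<xi>"])
         (use bd in \<open>auto simp: gauss_integrable[OF a] abs_mult less_imp_le[OF gauss_pos] intro!: AE_I2 mult_right_mono power_mono\<close>)
    have "complex_of_real (LINT \<xi>|lborel. (norm (ft c f \<xi>))\<^sup>2 * gauss a \<xi>) =
        (LINT \<xi>|lborel. (ft c f \<xi> * of_real (gauss a \<xi>)) * ft (- c) (\<lambda>x. cnj (f x)) \<xi>)"
    proof (subst integral_complex_of_real[symmetric], rule Bochner_Integration.integral_cong)
      fix \<xi> :: 'a
      have "ft (- c) (\<lambda>x. cnj (f x)) \<xi> = cnj (ft c f \<xi>)"
        unfolding ft_def Bochner_Integration.integral_cnj[symmetric] by (simp add: exp_cnj)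
      then show "complex_of_real ((norm (ft c f \<xi>))\<^sup>2 * gauss a \<xi>) =
          (ft c f \<xi> * of_real (gauss a \<xi>)) * ft (- c) (\<lambda>x. cnj (f x)) \<xi>"
        by (simp add: complex_norm_square[symmetric] mult_ac)
    qed simp
    also have "\<dots> = (LINT x|lborel. ft (- c) (\<lambda>\<xi>. ft c f \<xi> * of_real (gauss a \<xi>)) x * cnj (f x))"
      by (rule ft_duality[symmetric, OF dint cf])
    also have "\<dots> = of_real ?Z * (LINT x|lborel. (LINT y|lborel. f y * of_real (?G y x)) * cnj (f x))"
      unfolding ft_damped[OF f a] b_def[symmetric]
      by (subst Bochner_Integration.integral_mult_right_zero[symmetric]) (simp add: mult.assoc)
    finally have eq: "complex_of_real (LINT \<xi>|lborel. (norm (ft c f \<xi>))\<^sup>2 * gauss a \<xi>) =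
        of_real ?Z * (LINT x|lborel. (LINT y|lborel. f y * of_real (?G y x)) * cnj (f x))" .
    let ?h = "\<lambda>x y. ((norm (f x))\<^sup>2 + (norm (f y))\<^sup>2) / 2 * ?G y x"
    have inner: "ennreal (norm ((LINT y|lborel. f y * of_real (?G y x)) * cnj (f x))) \<le>
        (\<integral>\<^sup>+y. ennreal (?h x y) \<partial>lborel)" for x
    proof -
      have "ennreal (norm ((LINT y|lborel. f y * of_real (?G y x)) * cnj (f x))) =
          ennreal (norm (LINT y|lborel. f y * of_real (?G y x) * cnj (f x)))"
        by simp
      also have "\<dots> \<le> (\<integral>\<^sup>+y. ennreal (norm (f y * of_real (?G y x) * cnj (f x))) \<partial>lborel)"
        by (rule integral_norm_bound_ennreal, intro integrable_mult_left,
            rule Bochner_Integration.integrable_bound[OF f])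
           (auto simp: norm_mult less_imp_le[OF b] gauss_le_1 less_imp_le[OF gauss_pos] intro!: AE_I2 mult_left_le)
      also have "\<dots> \<le> (\<integral>\<^sup>+y. ennreal (?h x y) \<partial>lborel)"
      proof (intro nn_integral_mono ennreal_leI)
        fix y
        have "2 * (norm (f y) * norm (f x)) \<le> (norm (f x))\<^sup>2 + (norm (f y))\<^sup>2"
          using sum_squares_bound[of "norm (f x)" "norm (f y)"] by (simp add: mult_ac)
        then have "norm (f y) * norm (f x) \<le> ((norm (f x))\<^sup>2 + (norm (f y))\<^sup>2) / 2" by simp
        then have "norm (f y) * norm (f x) * ?G y x \<le> ?h x y"
          by (rule mult_right_mono) (rule less_imp_le[OF gauss_pos])
        then show "norm (f y * of_real (?G y x) * cnj (f x)) \<le> ?h x y"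
          by (simp add: norm_mult mult_ac)
      qed
      finally show ?thesis .
    qed
    have half: "(\<integral>\<^sup>+x. \<integral>\<^sup>+y. ennreal ((norm (f x))\<^sup>2 / 2 * ?G y x) \<partial>lborel \<partial>lborel) =
       ennreal (sqrt (2 * pi / b) ^ DIM('a) * (LINT x|lborel. (norm (f x))\<^sup>2) / 2)" (is "?L = _")
    proof -
      have "?L = (\<integral>\<^sup>+x. ennreal ((norm (f x))\<^sup>2 * (sqrt (2 * pi / b) ^ DIM('a) / 2)) \<partial>lborel)"
      proof (rule nn_integral_cong)
        fix x
        have "(\<integral>\<^sup>+y. ennreal ((norm (f x))\<^sup>2 / 2 * ?G y x) \<partial>lborel) =
            ennreal (LINT y|lborel. (norm (f x))\<^sup>2 / 2 * ?G y x)"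
          by (rule nn_integral_eq_integral) (auto simp: Gint less_imp_le[OF gauss_pos])
        then show "(\<integral>\<^sup>+y. ennreal ((norm (f x))\<^sup>2 / 2 * ?G y x) \<partial>lborel) =
            ennreal ((norm (f x))\<^sup>2 * (sqrt (2 * pi / b) ^ DIM('a) / 2))"
          by (simp add: Gint)
      qed
      also have "\<dots> = ennreal (LINT x|lborel. (norm (f x))\<^sup>2 * (sqrt (2 * pi / b) ^ DIM('a) / 2))"
        by (rule nn_integral_eq_integral) (use f2 b in \<open>auto intro!: AE_I2 mult_nonneg_nonneg\<close>)
      finally show ?thesis by (simp add: mult_ac)
    qed
    have half': "(\<integral>\<^sup>+x. \<integral>\<^sup>+y. ennreal ((norm (f y))\<^sup>2 / 2 * ?G y x) \<partial>lborel \<partial>lborel) =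
       (\<integral>\<^sup>+x. \<integral>\<^sup>+y. ennreal ((norm (f x))\<^sup>2 / 2 * ?G y x) \<partial>lborel \<partial>lborel)"
      by (subst lborel_pair.Fubini') (auto simp: G')
    have "ennreal (norm (LINT x|lborel. (LINT y|lborel. f y * of_real (?G y x)) * cnj (f x))) \<le>
        (\<integral>\<^sup>+x. ennreal (norm ((LINT y|lborel. f y * of_real (?G y x)) * cnj (f x))) \<partial>lborel)"
    \<comment> \<open>In the other case the integral is 0 by convention.\<close>
    proof (cases "integrable lborel (\<lambda>x. (LINT y|lborel. f y * of_real (?G y x)) * cnj (f x))")
      case True
      then show ?thesis by (rule integral_norm_bound_ennreal)
    qed (simp add: not_integrable_integral_eq)
    also have "\<dots> \<le> (\<integral>\<^sup>+x. \<integral>\<^sup>+y. ennreal (?h x y) \<partial>lborel \<partial>lborel)"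
      by (intro nn_integral_mono inner)
    also have "\<dots> = (\<integral>\<^sup>+x. \<integral>\<^sup>+y. (ennreal ((norm (f x))\<^sup>2 / 2 * ?G y x) + ennreal ((norm (f y))\<^sup>2 / 2 * ?G y x)) \<partial>lborel \<partial>lborel)"
      by (intro nn_integral_cong)
         (simp add: ennreal_plus[symmetric] less_imp_le[OF gauss_pos] add_divide_distrib distrib_right del: ennreal_plus)
    also have "\<dots> = ennreal (sqrt (2 * pi / b) ^ DIM('a) * (LINT x|lborel. (norm (f x))\<^sup>2) / 2) +
        ennreal (sqrt (2 * pi / b) ^ DIM('a) * (LINT x|lborel. (norm (f x))\<^sup>2) / 2)"
    proof -
      have "(\<integral>\<^sup>+x. \<integral>\<^sup>+y. (ennreal ((norm (f x))\<^sup>2 / 2 * ?G y x) + ennreal ((norm (f y))\<^sup>2 / 2 * ?G y x)) \<partial>lborel \<partial>lborel) =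
          (\<integral>\<^sup>+x. (\<integral>\<^sup>+y. ennreal ((norm (f x))\<^sup>2 / 2 * ?G y x) \<partial>lborel) + (\<integral>\<^sup>+y. ennreal ((norm (f y))\<^sup>2 / 2 * ?G y x) \<partial>lborel) \<partial>lborel)"
        by (intro nn_integral_cong nn_integral_add) measurable
      also have "\<dots> = (\<integral>\<^sup>+x. (\<integral>\<^sup>+y. ennreal ((norm (f x))\<^sup>2 / 2 * ?G y x) \<partial>lborel) \<partial>lborel) +
          (\<integral>\<^sup>+x. (\<integral>\<^sup>+y. ennreal ((norm (f y))\<^sup>2 / 2 * ?G y x) \<partial>lborel) \<partial>lborel)"
        by (rule nn_integral_add) measurable
      finally show ?thesis by (simp only: half half')
    qed
    also have "\<dots> = ennreal (sqrt (2 * pi / b) ^ DIM('a) * (LINT x|lborel. (norm (f x))\<^sup>2))"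
      using b by (subst ennreal_plus[symmetric]) auto
    finally have le: "norm (LINT x|lborel. (LINT y|lborel. f y * of_real (?G y x)) * cnj (f x)) \<le>
        sqrt (2 * pi / b) ^ DIM('a) * (LINT x|lborel. (norm (f x))\<^sup>2)"
      using b by (subst (asm) ennreal_le_iff) auto
    \<comment> \<open>The two normalizing constants multiply to a value independent of a; this is
      what makes the bound uniform in the damping.\<close>
    have "sqrt (2 * pi / a) * sqrt (2 * pi / b) = 2 * pi / \<bar>c\<bar>"
      using a c unfolding b_def by (subst real_sqrt_mult[symmetric]) (simp add: real_sqrt_divide real_sqrt_mult)
    then have C: "?Z * sqrt (2 * pi / b) ^ DIM('a) = ?C"
      by (simp only: power_mult_distrib[symmetric])
    have "(LINT \<xi>|lborel. (norm (ft c f \<xi>))\<^sup>2 * gauss a \<xi>) \<le>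
        norm (complex_of_real (LINT \<xi>|lborel. (norm (ft c f \<xi>))\<^sup>2 * gauss a \<xi>))"
      by simp
    also have "\<dots> \<le> ?Z * (sqrt (2 * pi / b) ^ DIM('a) * (LINT x|lborel. (norm (f x))\<^sup>2))"
      unfolding eq norm_mult using le a by (intro mult_mono) (auto simp: norm_power)
    also have "\<dots> = ?C * (LINT x|lborel. (norm (f x))\<^sup>2)"
      by (simp only: mult.assoc[symmetric] C)
    finally show ?thesis
      by (subst nn_integral_eq_integral[OF int]) (auto simp: less_imp_le[OF gauss_pos])
  qed
  have "(\<integral>\<^sup>+\<xi>. ennreal ((norm (ft c f \<xi>))\<^sup>2) \<partial>lborel) =
      (\<integral>\<^sup>+\<xi>. liminf (\<lambda>n. ennreal ((norm (ft c f \<xi>))\<^sup>2 * gauss (1 / real (Suc n)) \<xi>)) \<partial>lborel)"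
  proof (rule nn_integral_cong)
    fix \<xi> :: 'a
    have "(\<lambda>n. (norm (ft c f \<xi>))\<^sup>2 * gauss (1 / real (Suc n)) \<xi>) \<longlonglongrightarrow> (norm (ft c f \<xi>))\<^sup>2 * exp (- (0 / 2) * (norm \<xi>)\<^sup>2)"
      unfolding gauss_def by (intro tendsto_intros LIMSEQ_Suc[OF lim_1_over_n]) auto
    then have "(\<lambda>n. ennreal ((norm (ft c f \<xi>))\<^sup>2 * gauss (1 / real (Suc n)) \<xi>)) \<longlonglongrightarrow> ennreal ((norm (ft c f \<xi>))\<^sup>2)"
      by (intro tendsto_ennrealI) simp
    then show "ennreal ((norm (ft c f \<xi>))\<^sup>2) = liminf (\<lambda>n. ennreal ((norm (ft c f \<xi>))\<^sup>2 * gauss (1 / real (Suc n)) \<xi>))"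
      by (simp add: lim_imp_Liminf)
  qed
  also have "\<dots> \<le> liminf (\<lambda>n. \<integral>\<^sup>+\<xi>. ennreal ((norm (ft c f \<xi>))\<^sup>2 * gauss (1 / real (Suc n)) \<xi>) \<partial>lborel)"
    by (rule nn_integral_liminf) measurable
  also have "\<dots> \<le> liminf (\<lambda>n::nat. ennreal (?C * (LINT x|lborel. (norm (f x))\<^sup>2)))"
    by (intro Liminf_mono always_eventually allI damped) simp
  finally show ?thesis by (simp add: Liminf_const)
qed

section \<open>Uniqueness from Gaussian averages\<close>

text \<open>The positive and the negative part of r are densities of two measures that agree on
  boxes, and boxes are stable under intersection and generate the Borel sets.\<close>

lemma AE_zero_if_box_integrals_zero_real:
  fixes r :: "'a::euclidean_space \<Rightarrow> real"
  assumes [measurable]: "r \<in> borel_measurable borel"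
    and int: "\<And>l u. integrable lborel (\<lambda>x. indicator (box l u) x * r x)"
    and zero: "\<And>l u. (LINT x|lborel. indicator (box l u) x * r x) = 0"
  shows "AE x in lborel. r x = 0"
proof -
  have emeasure_box: "emeasure (density lborel (\<lambda>x. ennreal (f x))) (box l u) =
      ennreal (LINT x|lborel. indicator (box l u) x * max 0 (f x))"
    if [measurable]: "f \<in> borel_measurable borel"
      and i: "integrable lborel (\<lambda>x. indicator (box l u) x * max 0 (f x))" for f :: "'a \<Rightarrow> real" and l u
  proof -
    have "emeasure (density lborel (\<lambda>x. ennreal (f x))) (box l u) =
        (\<integral>\<^sup>+x. ennreal (indicator (box l u) x * max 0 (f x)) \<partial>lborel)"
      by (subst emeasure_density) (auto intro!: nn_integral_cong simp: indicator_def ennreal_max_0)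
    also have "\<dots> = ennreal (LINT x|lborel. indicator (box l u) x * max 0 (f x))"
      using i by (rule nn_integral_eq_integral) auto
    finally show ?thesis .
  qed
  have ip: "integrable lborel (\<lambda>x. indicator (box l u) x * max 0 (r x))" for l u
    by (rule Bochner_Integration.integrable_bound[OF int[of l u]]) (auto simp: indicator_def)
  have im: "integrable lborel (\<lambda>x. indicator (box l u) x * max 0 (- r x))" for l u
    by (rule Bochner_Integration.integrable_bound[OF int[of l u]]) (auto simp: indicator_def)
  have eq: "(LINT x|lborel. indicator (box l u) x * max 0 (r x)) =
      (LINT x|lborel. indicator (box l u) x * max 0 (- r x))" for l u
  proof -
    have "(LINT x|lborel. indicator (box l u) x * r x) =
        (LINT x|lborel. indicator (box l u) x * max 0 (r x) - indicator (box l u) x * max 0 (- r x))"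
      by (rule Bochner_Integration.integral_cong) (auto simp: indicator_def max_def)
    then show ?thesis using zero[of l u] by (simp add: Bochner_Integration.integral_diff[OF ip im])
  qed
  let ?E = "range (\<lambda>(a, b). box a b :: 'a set)"
  \<comment> \<open>\<open>ennreal\<close> sends negative numbers to 0, so these are the measures of
    the positive and the negative part.\<close>
  have "density lborel (\<lambda>x. ennreal (r x)) = density lborel (\<lambda>x. ennreal (- r x))"
  proof (rule measure_eqI_generator_eq)
    show "Int_stable ?E"
      by (auto simp: Int_stable_def box_Int_box)
    show "?E \<subseteq> Pow UNIV" by auto
    show "sets (density lborel (\<lambda>x. ennreal (r x))) = sigma_sets UNIV ?E"
         "sets (density lborel (\<lambda>x. ennreal (- r x))) = sigma_sets UNIV ?E"
      by (simp_all add: borel_eq_box)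
    let ?A = "\<lambda>n::nat. box (- (real n *\<^sub>R One)) (real n *\<^sub>R One) :: 'a set"
    show "range ?A \<subseteq> ?E" by auto
    show "(\<Union>i. ?A i) = UNIV" by (rule UN_box_eq_UNIV)
    show "emeasure (density lborel (\<lambda>x. ennreal (r x))) (?A i) \<noteq> \<infinity>" for i
      by (subst emeasure_box) (use ip in auto)
    fix X assume "X \<in> ?E"
    then obtain l u where X: "X = box l u" by auto
    show "emeasure (density lborel (\<lambda>x. ennreal (r x))) X = emeasure (density lborel (\<lambda>x. ennreal (- r x))) X"
      unfolding X by (simp only: emeasure_box[OF _ ip] emeasure_box[OF _ im] eq assms borel_measurable_uminus)
  qed
  then have "AE x in lborel. ennreal (r x) = ennreal (- r x)"
    by (intro sigma_finite_measure.density_unique[OF sigma_finite_lborel]) auto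
  then show ?thesis
  proof eventually_elim
    case (elim x)
    then show ?case
      by (metis ennreal_eq_0_iff ennreal_neg le_cases neg_0_le_iff_le neg_le_0_iff_le order_antisym)
  qed
qed

lemma AE_zero_if_box_integrals_zero:
  fixes g :: "'a::euclidean_space \<Rightarrow> complex"
  assumes [measurable]: "g \<in> borel_measurable borel"
    and int: "\<And>l u. integrable lborel (\<lambda>x. indicator (box l u) x * g x)"
    and zero: "\<And>l u. (LINT x|lborel. indicator (box l u) x * g x) = 0"
  shows "AE x in lborel. g x = 0"
proof -
  have i: "indicator A x * Re (g x) = Re (indicator A x * g x)"
    "indicator A x * Im (g x) = Im (indicator A x * g x)" for A x by (auto simp: indicator_def)
  have "AE x in lborel. Re (g x) = 0"
  proof (rule AE_zero_if_box_integrals_zero_real)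
    fix l u :: 'a
    show "integrable lborel (\<lambda>x. indicator (box l u) x * Re (g x))"
      unfolding i by (intro integrable_Re int)
    show "(LINT x|lborel. indicator (box l u) x * Re (g x)) = 0"
      unfolding i integral_Re[OF int] by (simp add: zero)
  qed measurable
  moreover have "AE x in lborel. Im (g x) = 0"
  proof (rule AE_zero_if_box_integrals_zero_real)
    fix l u :: 'a
    show "integrable lborel (\<lambda>x. indicator (box l u) x * Im (g x))"
      unfolding i by (intro integrable_Im int)
    show "(LINT x|lborel. indicator (box l u) x * Im (g x)) = 0"
      unfolding i integral_Im[OF int] by (simp add: zero)
  qed measurable
  ultimately show ?thesis by eventually_elim (simp add: complex_eq_iff)
qed

lemma square_integrable_mult:
  fixes f g :: "'a \<Rightarrow> complex"
  assumes [measurable]: "f \<in> borel_measurable M" "g \<in> borel_measurable M"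
    and "integrable M (\<lambda>x. (norm (f x))\<^sup>2)" "integrable M (\<lambda>x. (norm (g x))\<^sup>2)"
  shows "integrable M (\<lambda>x. f x * g x)"
proof (rule Bochner_Integration.integrable_bound[OF Bochner_Integration.integrable_add[OF assms(3,4)]])
  show "AE x in M. norm (f x * g x) \<le> norm ((norm (f x))\<^sup>2 + (norm (g x))\<^sup>2)"
  proof (rule AE_I2)
    fix x
    have "2 * (norm (f x) * norm (g x)) \<le> (norm (f x))\<^sup>2 + (norm (g x))\<^sup>2"
      using sum_squares_bound[of "norm (f x)" "norm (g x)"] by (simp add: mult_ac)
    then show "norm (f x * g x) \<le> norm ((norm (f x))\<^sup>2 + (norm (g x))\<^sup>2)"
      using mult_nonneg_nonneg[of "norm (f x)" "norm (g x)"] by (simp add: norm_mult del: mult_nonneg_nonneg)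
  qed
qed measurable

lemma norm_sum_square_le: "(norm (x + y))\<^sup>2 \<le> 2 * (norm x)\<^sup>2 + 2 * (norm (y :: 'a::real_normed_vector))\<^sup>2"
proof -
  have "(norm (x + y))\<^sup>2 \<le> (norm x + norm y)\<^sup>2" by (intro power_mono norm_triangle_ineq) simp
  also have "\<dots> \<le> 2 * (norm x)\<^sup>2 + 2 * (norm y)\<^sup>2"
    using sum_squares_bound[of "norm x" "norm y"] by (simp add: power2_sum)
  finally show ?thesis .
qed

text \<open>The indicator of a box is smoothed by a Gaussian. By Fubini the pairing of g with the
  smoothed indicator is a superposition of Gaussian averages of g, hence 0. As the width shrinks,
  the smoothed indicator tends to the indicator off the frontier of the box, a null set, so g has
  integral 0 over every box.\<close>

lemma gauss_averages_zero_imp_AE_zero: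
  fixes g :: "'a::euclidean_space \<Rightarrow> complex"
  assumes [measurable]: "g \<in> borel_measurable borel"
    and g2: "integrable lborel (\<lambda>x. (norm (g x))\<^sup>2)"
    and zero: "\<And>a y. a > 0 \<Longrightarrow> (LINT x|lborel. g x * of_real (gauss a (x - y))) = 0"
  shows "AE x in lborel. g x = 0"
proof -
  have gg: "integrable lborel (\<lambda>x. g x * of_real (gauss a x))" if "a > 0" for a
  proof (rule square_integrable_mult)
    have "(norm (complex_of_real (gauss a x)))\<^sup>2 = gauss (2 * a) x" for x :: 'a
      by (simp add: gauss_def power2_eq_square exp_add[symmetric])
    then show "integrable lborel (\<lambda>x::'a. (norm (complex_of_real (gauss a x)))\<^sup>2)"
      using gauss_integrable(1)[of "2 * a"] that by simp
  qed (use g2 in auto)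
  have box: "integrable lborel (\<lambda>x. indicator (box l u) x * g x) \<and>
      (LINT x|lborel. indicator (box l u) x * g x) = 0" for l u
  proof -
    let ?B = "box l u"
    obtain R where R0: "\<forall>x\<in>?B. norm x \<le> R"
      using bounded_box[of l u] unfolding bounded_iff by (rule exE)
    have R: "norm x \<le> R" if "x \<in> ?B" for x using R0 that by (rule bspec)
    define bx where "bx = (\<lambda>x. indicator ?B x :: complex)"
    have [measurable]: "bx \<in> borel_measurable borel" unfolding bx_def by measurable
    have chi_le: "norm (bx x) \<le> 1" for x by (simp add: bx_def indicator_def)
    have chi_int: "integrable lborel bx"
      using integrable_of_real[OF integrable_real_indicator[of ?B lborel], where 'a = complex]
      using emeasure_lborel_box_finite[of l u] by (simp add: bx_def of_real_indicator infinity_ennreal_def less_top)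
    \<comment> \<open>g is only square integrable, but g times a Gaussian is integrable, and on the
      bounded box 1 <= exp(R^2) \<open>gauss 1\<close>.\<close>
    have int: "integrable lborel (\<lambda>x. bx x * g x)"
    proof (rule Bochner_Integration.integrable_bound)
      show "integrable lborel (\<lambda>x. exp (R\<^sup>2) * norm (g x * of_real (gauss 1 x)))"
        using gg[of 1] by simp
      show "AE x in lborel. norm (bx x * g x) \<le> norm (exp (R\<^sup>2) * norm (g x * of_real (gauss 1 x)))"
      proof (rule AE_I2)
        fix x :: 'a
        have "1 \<le> exp (R\<^sup>2) * gauss 1 x" if "x \<in> ?B"
        proof -
          have "(norm x)\<^sup>2 \<le> R\<^sup>2" using R[OF that] by (intro power_mono) auto
          then have "0 \<le> R\<^sup>2 - (norm x)\<^sup>2 / 2" using zero_le_power2[of "norm x"] by linarith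
          then show ?thesis by (simp add: gauss_def exp_add[symmetric])
        qed
        then show "norm (bx x * g x) \<le> norm (exp (R\<^sup>2) * norm (g x * of_real (gauss 1 x)))"
          using mult_right_mono[of 1 "exp (R\<^sup>2) * gauss 1 x" "norm (g x)"]
          by (auto simp: bx_def indicator_def norm_mult abs_mult mult_ac
              intro!: mult_nonneg_nonneg less_imp_le[OF gauss_pos])
      qed
    qed measurable
    have h0: "(LINT x|lborel. g x * (LINT u|lborel. bx (x + t *\<^sub>R u) * of_real (gauss 1 u))) = 0" if t: "t > 0" for t
    proof -
      define a where "a = 1 / t\<^sup>2"
      have a: "a > 0" using t by (simp add: a_def)
      define C where "C = exp (a * R\<^sup>2 / 2)"
      have C: "C > 0" by (simp add: C_def)
      \<comment> \<open>For Fubini the Gaussian in x - y is divided by C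
        \<open>gauss (a / 2) x\<close>, which majorizes it for y in the box because |x|^2 <= 2 |x -
        y|^2 + 2 R^2. The indicator may occur twice since it is idempotent.\<close>
      let ?k = "\<lambda>x y. bx y * of_real (gauss a (x - y) / (C * gauss (a / 2) x))"
      have "integrable (lborel \<Otimes>\<^sub>M lborel) (\<lambda>(x, y). ?k x y * ((g x * of_real (C * gauss (a / 2) x)) * bx y))"
      proof (rule integrable_pair_mult_bounded)
        have "integrable lborel (\<lambda>x. of_real C * (g x * of_real (gauss (a / 2) x)))"
          using gg[of "a / 2"] a by simp
        then show "integrable lborel (\<lambda>x. g x * of_real (C * gauss (a / 2) x))"
          by (simp add: mult_ac)
        show "norm (?k x y) \<le> 1" for x y
        proof (cases "y \<in> ?B")
          case True
          have "(norm x)\<^sup>2 \<le> 2 * (norm (x - y))\<^sup>2 + 2 * (norm y)\<^sup>2"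
            using norm_sum_square_le[of "x - y" y] by simp
          moreover have "(norm y)\<^sup>2 \<le> R\<^sup>2" using R[OF True] by (intro power_mono) auto
          ultimately have "(norm x)\<^sup>2 / 2 \<le> (norm (x - y))\<^sup>2 + R\<^sup>2" by simp
          then have "a / 2 * ((norm x)\<^sup>2 / 2) \<le> a / 2 * ((norm (x - y))\<^sup>2 + R\<^sup>2)"
            using a by (intro mult_left_mono) auto
          then have "gauss a (x - y) \<le> C * gauss (a / 2) x"
            unfolding gauss_def C_def exp_add[symmetric] by (subst exp_le_cancel_iff) (simp add: algebra_simps)
          then show ?thesis
            using C gauss_pos[of "a / 2" x]
            by (simp add: bx_def True norm_divide norm_mult)
        qed (simp add: bx_def)
      qed (use chi_int in auto)
      moreover have "?k x y * ((g x * of_real (C * gauss (a / 2) x)) * bx y) = g x * (bx y * of_real (gauss a (x - y)))" for x y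
      proof -
        have "C * gauss (a / 2) x \<noteq> 0" using C gauss_pos[of "a / 2" x] by simp
        moreover have "bx y * bx y = bx y" by (simp add: bx_def indicator_def)
        ultimately show ?thesis by (simp add: field_simps del: mult_eq_0_iff) (metis mult.assoc mult.commute)
      qed
      ultimately have F: "integrable (lborel \<Otimes>\<^sub>M lborel) (\<lambda>(x, y). g x * (bx y * of_real (gauss a (x - y))))"
        by simp
      have "(LINT x|lborel. g x * (of_real (t ^ DIM('a)) * (LINT u|lborel. bx (x + t *\<^sub>R u) * of_real (gauss 1 u)))) =
          (LINT x|lborel. LINT y|lborel. g x * (bx y * of_real (gauss a (x - y))))"
      proof (rule Bochner_Integration.integral_cong[OF refl])
        fix x :: 'a
        have "gauss a (y - x) = gauss a (x - y)" for y by (metis gauss_minus minus_diff_eq)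
        then show "g x * (of_real (t ^ DIM('a)) * (LINT u|lborel. bx (x + t *\<^sub>R u) * of_real (gauss 1 u))) =
          (LINT y|lborel. g x * (bx y * of_real (gauss a (x - y))))"
          using gauss_convolution_rescale[of bx t x] t by (simp add: a_def)
      qed
      also have "\<dots> = (LINT y|lborel. LINT x|lborel. g x * (bx y * of_real (gauss a (x - y))))"
        by (rule lborel_pair.Fubini_integral[symmetric]) (use F in simp)
      also have "\<dots> = (LINT y|lborel. bx y * (LINT x|lborel. g x * of_real (gauss a (x - y))))"
        by (subst Bochner_Integration.integral_mult_right_zero[symmetric]) (simp add: mult_ac)
      also have "\<dots> = 0" using zero[OF a] by simp
      finally have z: "(LINT x|lborel. g x * (of_real (t ^ DIM('a)) * (LINT u|lborel. bx (x + t *\<^sub>R u) * of_real (gauss 1 u)))) = 0" .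
      have "of_real (t ^ DIM('a)) * (LINT x|lborel. g x * (LINT u|lborel. bx (x + t *\<^sub>R u) * of_real (gauss 1 u))) = 0"
        unfolding Bochner_Integration.integral_mult_right_zero[symmetric] z[symmetric]
        by (rule Bochner_Integration.integral_cong) (simp_all only: mult.left_commute)
      then show ?thesis using t by simp
    qed
    let ?t = "\<lambda>n. 1 / real (Suc n)"
    have "(\<lambda>n. LINT x|lborel. g x * (LINT u|lborel. bx (x + ?t n *\<^sub>R u) * of_real (gauss 1 u))) \<longlonglongrightarrow>
        (LINT x|lborel. g x * (bx x * of_real (sqrt (2 * pi) ^ DIM('a))))"
    \<comment> \<open>Origin of the majorant: if x + t u lies in the box and 0 < t <= 1, then |x|^2
      <= 2 R^2 + 2 |u|^2. One sixteenth of this is traded against the exponent |u|^2 / 2, which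
      leaves 3/8 of |u|^2 for the integral over u.\<close>
    proof (rule integral_dominated_convergence[where
          w = "\<lambda>x. exp (R\<^sup>2 / 8) * (LINT u|lborel. gauss (3 / 4) (u :: 'a)) * norm (g x * of_real (gauss (1 / 8) x))"])
      show "integrable lborel (\<lambda>x. exp (R\<^sup>2 / 8) * (LINT u|lborel. gauss (3 / 4) (u :: 'a)) * norm (g x * of_real (gauss (1 / 8) x)))"
        using gg[of "1 / 8"] by simp
      have "frontier ?B \<in> null_sets lebesgue"
        using negligible_convex_frontier[OF convex_box(2)] negligible_iff_null_sets by blast
      then have "frontier ?B \<in> null_sets lborel"
        by (simp add: null_sets_def)
      then have "AE x in lborel. x \<notin> frontier ?B" by (rule AE_not_in)
      then show "AE x in lborel. (\<lambda>n. g x * (LINT u|lborel. bx (x + ?t n *\<^sub>R u) * of_real (gauss 1 u))) \<longlonglongrightarrow>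
          g x * (bx x * of_real (sqrt (2 * pi) ^ DIM('a)))"
      proof eventually_elim
        case (elim x)
        have "isCont (\<lambda>x. of_real (indicator ?B x :: real) :: complex) x"
          by (intro isCont_of_real) (simp add: isCont_indicator elim)
        then have "isCont bx x" by (simp add: bx_def of_real_indicator)
        then have "(\<lambda>n. LINT u|lborel. bx (x + ?t n *\<^sub>R u) * of_real (gauss 1 u)) \<longlonglongrightarrow> bx x * of_real (sqrt (2 * pi) ^ DIM('a))"
          by (intro gauss_convolution_limit[where B = 1] LIMSEQ_Suc[OF lim_1_over_n] chi_le) auto
        then show ?case by (rule tendsto_mult_left)
      qed
      show "AE x in lborel. norm (g x * (LINT u|lborel. bx (x + ?t n *\<^sub>R u) * of_real (gauss 1 u))) \<le>
          exp (R\<^sup>2 / 8) * (LINT u|lborel. gauss (3 / 4) (u :: 'a)) * norm (g x * of_real (gauss (1 / 8) x))" for n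
      proof (rule AE_I2)
        fix x :: 'a
        have "norm (LINT u|lborel. bx (x + ?t n *\<^sub>R u) * of_real (gauss 1 u)) \<le>
            (LINT u|lborel. exp (R\<^sup>2 / 8) * gauss (1 / 8) x * gauss (3 / 4) (u :: 'a))"
        proof (rule order_trans[OF Bochner_Integration.integral_norm_bound], rule Bochner_Integration.integral_mono)
          show "integrable lborel (\<lambda>u. norm (bx (x + ?t n *\<^sub>R u) * complex_of_real (gauss 1 u)))"
            by (rule integrable_norm, rule Bochner_Integration.integrable_bound[OF gauss_integrable(1)[of 1]])
               (auto simp: norm_mult intro!: AE_I2 mult_left_le_one_le chi_le less_imp_le[OF gauss_pos])
          show "integrable lborel (\<lambda>u::'a. exp (R\<^sup>2 / 8) * gauss (1 / 8) x * gauss (3 / 4) u)"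
            by (simp add: gauss_integrable)
          fix u :: 'a
          show "norm (bx (x + ?t n *\<^sub>R u) * complex_of_real (gauss 1 u)) \<le> exp (R\<^sup>2 / 8) * gauss (1 / 8) x * gauss (3 / 4) u"
          proof (cases "x + ?t n *\<^sub>R u \<in> ?B")
            case True
            have "norm (?t n *\<^sub>R u) \<le> norm u"
              by (simp add: divide_le_eq mult_le_cancel_left1)
            then have "norm x \<le> R + norm u"
              using R[OF True] norm_triangle_ineq4[of "x + ?t n *\<^sub>R u" "?t n *\<^sub>R u"] by simp
            then have "(norm x)\<^sup>2 \<le> (R + norm u)\<^sup>2" by (intro power_mono) auto
            also have "\<dots> \<le> 2 * R\<^sup>2 + 2 * (norm u)\<^sup>2"
              using sum_squares_bound[of R "norm u"] by (simp add: power2_sum)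
            finally have "gauss 1 u \<le> exp (R\<^sup>2 / 8) * gauss (1 / 8) x * gauss (3 / 4) u"
              unfolding gauss_def exp_add[symmetric] by (subst exp_le_cancel_iff) (simp add: algebra_simps)
            moreover have "bx (x + ?t n *\<^sub>R u) = 1" using True by (simp only: bx_def indicator_simps)
            ultimately show ?thesis by (simp only: mult_1 norm_of_real abs_gauss)
          next
            case False
            then have "bx (x + ?t n *\<^sub>R u) = 0" by (simp only: bx_def indicator_simps not_False_eq_True)
            then show ?thesis using less_imp_le[OF gauss_pos] by (simp only: mult_zero_left norm_zero) (simp add: less_imp_le[OF gauss_pos])
          qed
        qed
        then have "norm (LINT u|lborel. bx (x + ?t n *\<^sub>R u) * of_real (gauss 1 u)) \<le>
            exp (R\<^sup>2 / 8) * gauss (1 / 8) x * (LINT u|lborel. gauss (3 / 4) (u::'a))" by simp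
        from mult_left_mono[OF this norm_ge_zero[of "g x"]]
        show "norm (g x * (LINT u|lborel. bx (x + ?t n *\<^sub>R u) * of_real (gauss 1 u))) \<le>
          exp (R\<^sup>2 / 8) * (LINT u|lborel. gauss (3 / 4) (u :: 'a)) * norm (g x * of_real (gauss (1 / 8) x))"
          by (simp add: norm_mult mult_ac)
      qed
    qed measurable
    then have "(LINT x|lborel. g x * (bx x * of_real (sqrt (2 * pi) ^ DIM('a)))) = 0"
      by (subst (asm) h0) (auto simp: LIMSEQ_const_iff)
    then have "(LINT x|lborel. of_real (sqrt (2 * pi) ^ DIM('a)) * (bx x * g x)) = 0"
      by (simp add: mult_ac)
    then have "(LINT x|lborel. bx x * g x) = 0" by simp
    then show ?thesis using int by (simp add: bx_def)
  qed
  then show ?thesis by (intro AE_zero_if_box_integrals_zero) auto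
qed

section \<open>The Fourier transform on \<open>L\<^sup>2\<close>\<close>

lemma inverse_1_plus_square_integrable: "integrable lborel (\<lambda>t::real. inverse (1 + t\<^sup>2))"
  using integrable_inverse_1_plus_square by (simp add: set_integrable_def)

text \<open>(1 + |x|)^2 dominates 1 + x_b^2 for each coordinate x_b, so the weight lies below a
  product of integrable functions of one variable.\<close>

lemma integrable_weight:
  "integrable lborel (\<lambda>x::'a::euclidean_space. 1 / (1 + norm x) ^ (2 * DIM('a)))"
proof (rule Bochner_Integration.integrable_bound)
  have "integrable lborel (\<lambda>t. complex_of_real (inverse (1 + t\<^sup>2)))"
    by (rule integrable_of_real[OF inverse_1_plus_square_integrable])
  then show "integrable lborel (\<lambda>x::'a. \<Prod>b\<in>Basis. complex_of_real (inverse (1 + (x \<bullet> b)\<^sup>2)))"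
    by (rule lborel_prod_integral(1))
  show "AE x in lborel. norm (1 / (1 + norm x) ^ (2 * DIM('a))) \<le>
      norm (\<Prod>b\<in>(Basis :: 'a set). complex_of_real (inverse (1 + (x \<bullet> b)\<^sup>2)))"
  proof (rule AE_I2)
    fix x :: 'a
    have "(\<Prod>b\<in>(Basis :: 'a set). 1 + (x \<bullet> b)\<^sup>2) \<le> (\<Prod>b\<in>(Basis :: 'a set). (1 + norm x)\<^sup>2)"
    proof (rule prod_mono, intro conjI)
      fix b :: 'a assume "b \<in> Basis"
      then have "(x \<bullet> b)\<^sup>2 \<le> (norm x)\<^sup>2"
        using Basis_le_norm[of b x] by (simp add: abs_le_square_iff[symmetric])
      then show "1 + (x \<bullet> b)\<^sup>2 \<le> (1 + norm x)\<^sup>2" using norm_ge_zero[of x] by (simp add: power2_sum add_increasing2)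
    qed (simp add: add_nonneg_nonneg)
    also have "\<dots> = (1 + norm x) ^ (2 * DIM('a))" by (simp add: power_mult)
    finally have "(\<Prod>b\<in>(Basis :: 'a set). 1 + (x \<bullet> b)\<^sup>2) \<le> (1 + norm x) ^ (2 * DIM('a))" .
    moreover have "(\<Prod>b\<in>(Basis :: 'a set). 1 + (x \<bullet> b)\<^sup>2) > 0"
      by (rule prod_pos) (simp add: add_pos_nonneg)
    ultimately have "inverse ((1 + norm x) ^ (2 * DIM('a))) \<le> inverse (\<Prod>b\<in>(Basis :: 'a set). 1 + (x \<bullet> b)\<^sup>2)"
      by (rule le_imp_inverse_le)
    also have "\<dots> = norm (\<Prod>b\<in>(Basis :: 'a set). complex_of_real (inverse (1 + (x \<bullet> b)\<^sup>2)))"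
    proof -
      have "inverse (\<Prod>b\<in>(Basis :: 'a set). 1 + (x \<bullet> b)\<^sup>2) = (\<Prod>b\<in>(Basis :: 'a set). inverse (1 + (x \<bullet> b)\<^sup>2))"
        using prod_inversef[of "\<lambda>b. 1 + (x \<bullet> b)\<^sup>2" "Basis :: 'a set"] by (simp only: o_def)
      moreover have "(\<Prod>b\<in>(Basis :: 'a set). inverse (1 + (x \<bullet> b)\<^sup>2)) \<ge> 0"
        by (rule prod_nonneg) (simp add: add_nonneg_nonneg)
      ultimately show ?thesis by (simp only: of_real_prod[symmetric] norm_of_real abs_of_nonneg)
    qed
    finally show "norm (1 / (1 + norm x) ^ (2 * DIM('a))) \<le>
      norm (\<Prod>b\<in>(Basis :: 'a set). complex_of_real (inverse (1 + (x \<bullet> b)\<^sup>2)))"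
      by (simp add: divide_inverse abs_of_nonneg)
  qed
qed measurable

section \<open>Norms, pairings, completeness and density in L2\<close>

definition nrm2 :: "(plane \<Rightarrow> complex) \<Rightarrow> real" where
  "nrm2 f = (LINT x|lborel. (norm (f x))\<^sup>2)"

definition L12 :: "(plane \<Rightarrow> complex) set" where
  "L12 = {f \<in> L2. integrable lborel f}"

lemma L2_D: "f \<in> L2 \<Longrightarrow> f \<in> borel_measurable borel" "f \<in> L2 \<Longrightarrow> integrable lborel (\<lambda>x. (norm (f x))\<^sup>2)"
  by (auto simp: L2_def)

lemma L12_D: "f \<in> L12 \<Longrightarrow> f \<in> L2" "f \<in> L12 \<Longrightarrow> integrable lborel f"
  by (auto simp: L12_def)

lemma L2_add: "f \<in> L2 \<Longrightarrow> g \<in> L2 \<Longrightarrow> (\<lambda>x. f x + g x) \<in> L2"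
  unfolding L2_def
proof (safe, goal_cases)
  case 2
  have [measurable]: "f \<in> borel_measurable borel" "g \<in> borel_measurable borel" by fact+
  show ?case
    by (rule Bochner_Integration.integrable_bound[where f = "\<lambda>x. 2 * (norm (f x))\<^sup>2 + 2 * (norm (g x))\<^sup>2"])
       (use 2 norm_sum_square_le in auto)
qed auto

lemma L2_mult_bounded:
  assumes f: "f \<in> L2" and [measurable]: "a \<in> borel_measurable borel" and a: "\<And>x. norm (a x) \<le> M"
  shows "(\<lambda>x. a x * f x) \<in> L2"
proof -
  note [measurable] = L2_D(1)[OF f]
  have "integrable lborel (\<lambda>x. (norm (a x * f x))\<^sup>2)"
  proof (rule Bochner_Integration.integrable_bound[where f = "\<lambda>x. M\<^sup>2 * (norm (f x))\<^sup>2"])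
    show "AE x in lborel. norm ((norm (a x * f x))\<^sup>2) \<le> norm (M\<^sup>2 * (norm (f x))\<^sup>2)"
      using a by (intro AE_I2) (auto simp: norm_mult power_mult_distrib intro!: mult_right_mono power_mono)
  qed (use L2_D(2)[OF f] in auto)
  then show ?thesis by (simp add: L2_def)
qed

lemma L2_scale: "f \<in> L2 \<Longrightarrow> (\<lambda>x. c * f x) \<in> L2"
  by (rule L2_mult_bounded[where M = "norm c"]) auto

lemma L2_diff: "f \<in> L2 \<Longrightarrow> g \<in> L2 \<Longrightarrow> (\<lambda>x. f x - g x) \<in> L2"
  using L2_add[of f "\<lambda>x. (-1) * g x"] L2_scale[of g "-1"] by simp

lemma L2_cnj: "f \<in> L2 \<Longrightarrow> (\<lambda>x. cnj (f x)) \<in> L2"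
  using measurable_compose[OF L2_D(1) borel_measurable_continuous_onI[OF continuous_on_cnj[OF continuous_on_id]]]
  by (simp add: L2_def)

lemma L2_mult_integrable: "f \<in> L2 \<Longrightarrow> g \<in> L2 \<Longrightarrow> integrable lborel (\<lambda>x. f x * g x)"
  by (rule square_integrable_mult) (auto simp: L2_def)

lemma L12_diff: "f \<in> L12 \<Longrightarrow> g \<in> L12 \<Longrightarrow> (\<lambda>x. f x - g x) \<in> L12"
  by (auto simp: L12_def L2_diff)

lemma nrm2_nonneg: "nrm2 f \<ge> 0"
  by (simp add: nrm2_def)

text \<open>Squared norms avoid square roots at the price of factors 2, which the geometric rates
  used below absorb.\<close>

lemma nrm2_add: "f \<in> L2 \<Longrightarrow> g \<in> L2 \<Longrightarrow> nrm2 (\<lambda>x. f x + g x) \<le> 2 * nrm2 f + 2 * nrm2 g"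
proof -
  assume fg: "f \<in> L2" "g \<in> L2"
  have "nrm2 (\<lambda>x. f x + g x) \<le> (LINT x|lborel. 2 * (norm (f x))\<^sup>2 + 2 * (norm (g x))\<^sup>2)"
    unfolding nrm2_def
    using L2_D(2)[OF L2_add[OF fg]] L2_D(2)[OF fg(1)] L2_D(2)[OF fg(2)]
    by (intro integral_mono) (auto intro: norm_sum_square_le)
  then show ?thesis using L2_D(2)[OF fg(1)] L2_D(2)[OF fg(2)] by (simp add: nrm2_def)
qed

lemma nrm2_minus: "nrm2 (\<lambda>x. f x - g x) = nrm2 (\<lambda>x. g x - f x)"
  by (simp add: nrm2_def norm_minus_commute)

lemma nrm2_triangle:
  assumes "f \<in> L2" "g \<in> L2" "k \<in> L2"
  shows "nrm2 (\<lambda>x. f x - k x) \<le> 2 * nrm2 (\<lambda>x. f x - g x) + 2 * nrm2 (\<lambda>x. g x - k x)"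
  using nrm2_add[OF L2_diff[OF assms(1,2)] L2_diff[OF assms(2,3)]] by simp

lemma nn_integral_nrm2: "f \<in> L2 \<Longrightarrow> (\<integral>\<^sup>+x. ennreal ((norm (f x))\<^sup>2) \<partial>lborel) = ennreal (nrm2 f)"
  unfolding nrm2_def by (rule nn_integral_eq_integral) (auto simp: L2_def)

lemma pairing_bound:
  assumes f: "f \<in> L2" and g: "g \<in> L2"
  shows "(norm (LINT x|lborel. f x * g x))\<^sup>2 \<le> nrm2 f * nrm2 g"
proof -
  note [measurable] = L2_D(1)[OF f] L2_D(1)[OF g]
  have "ennreal (norm (LINT x|lborel. f x * g x)) \<le> (\<integral>\<^sup>+x. ennreal (norm (f x)) * ennreal (norm (g x)) \<partial>lborel)"
    using integral_norm_bound_ennreal[OF L2_mult_integrable[OF f g]]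
    by (simp add: norm_mult ennreal_mult)
  then have "(ennreal (norm (LINT x|lborel. f x * g x)))\<^sup>2 \<le> (\<integral>\<^sup>+x. ennreal (norm (f x)) * ennreal (norm (g x)) \<partial>lborel)\<^sup>2"
    by (rule power_mono) simp
  also have "\<dots> \<le> (\<integral>\<^sup>+x. (ennreal (norm (f x)))\<^sup>2 \<partial>lborel) * (\<integral>\<^sup>+x. (ennreal (norm (g x)))\<^sup>2 \<partial>lborel)"
    by (rule Cauchy_Schwarz_nn_integral) auto
  also have "\<dots> = ennreal (nrm2 f * nrm2 g)"
    by (simp add: ennreal_power nn_integral_nrm2[OF f] nn_integral_nrm2[OF g] ennreal_mult nrm2_nonneg)
  finally show ?thesis
    by (simp add: ennreal_power nrm2_nonneg)
qed

lemma pairing_limit: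
  assumes F: "\<And>n. F n \<in> L2" "G \<in> L2" and lim: "(\<lambda>n. nrm2 (\<lambda>x. F n x - G x)) \<longlonglongrightarrow> 0" and g: "g \<in> L2"
  shows "(\<lambda>n. LINT x|lborel. F n x * g x) \<longlonglongrightarrow> (LINT x|lborel. G x * g x)"
proof -
  have "(\<lambda>n. sqrt (nrm2 (\<lambda>x. F n x - G x) * nrm2 g)) \<longlonglongrightarrow> sqrt (0 * nrm2 g)"
    by (intro tendsto_intros lim)
  then have "(\<lambda>n. (LINT x|lborel. F n x * g x) - (LINT x|lborel. G x * g x)) \<longlonglongrightarrow> 0"
  proof (rule Lim_null_comparison[rotated, OF tendsto_eq_rhs])
    show "\<forall>\<^sub>F n in sequentially. norm ((LINT x|lborel. F n x * g x) - (LINT x|lborel. G x * g x)) \<le> sqrt (nrm2 (\<lambda>x. F n x - G x) * nrm2 g)"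
    proof (intro always_eventually allI)
      fix n
      have "(LINT x|lborel. F n x * g x) - (LINT x|lborel. G x * g x) = (LINT x|lborel. (F n x - G x) * g x)"
        by (subst Bochner_Integration.integral_diff[symmetric]) (auto simp: L2_mult_integrable F g left_diff_distrib)
      then show "norm ((LINT x|lborel. F n x * g x) - (LINT x|lborel. G x * g x)) \<le> sqrt (nrm2 (\<lambda>x. F n x - G x) * nrm2 g)"
        using pairing_bound[OF L2_diff[OF F(1)[of n] F(2)] g] by (simp add: real_le_rsqrt)
    qed
  qed simp
  then show ?thesis by (rule LIM_zero_cancel)
qed

text \<open>The rate 4^(-n) for squared norms leaves room for a weight 2^n: the weighted series of
  squared increments is integrable, hence finite almost everywhere, so the increments are
  O(2^(-n/2)) and the sequence converges pointwise. Fatou's lemma turns this into convergence in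
  L2.\<close>

lemma L2_complete:
  assumes F: "\<And>n. F n \<in> L2" and r: "\<And>n. nrm2 (\<lambda>x. F (Suc n) x - F n x) \<le> (1 / 4) ^ n"
  obtains G where "G \<in> L2" "(\<lambda>n. nrm2 (\<lambda>x. F n x - G x)) \<longlonglongrightarrow> 0"
proof -
  note [measurable] = L2_D(1)[OF F]
  let ?D = "\<lambda>n x. F (Suc n) x - F n x"
  have "(\<integral>\<^sup>+x. (\<Sum>n. ennreal (2 ^ n * (norm (?D n x))\<^sup>2)) \<partial>lborel) =
      (\<Sum>n. \<integral>\<^sup>+x. ennreal (2 ^ n * (norm (?D n x))\<^sup>2) \<partial>lborel)"
    by (rule nn_integral_suminf) measurable
  also have "\<dots> = (\<Sum>n. ennreal (2 ^ n * nrm2 (?D n)))"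
    by (simp add: ennreal_mult nn_integral_cmult nn_integral_nrm2 L2_diff F nrm2_nonneg)
  also have "\<dots> \<le> (\<Sum>n. ennreal ((1 / 2) ^ n))"
  proof (intro suminf_le ennreal_leI)
    fix n
    have "2 ^ n * nrm2 (?D n) \<le> 2 ^ n * (1 / 4) ^ n" by (intro mult_left_mono r) simp
    also have "\<dots> = (1 / 2) ^ n" by (simp only: power_mult_distrib[symmetric]) simp
    finally show "2 ^ n * nrm2 (?D n) \<le> (1 / 2) ^ n" .
  qed auto
  also have "\<dots> = ennreal 2"
    by (subst suminf_ennreal2) (auto simp: suminf_geometric)
  finally have "(\<integral>\<^sup>+x. (\<Sum>n. ennreal (2 ^ n * (norm (?D n x))\<^sup>2)) \<partial>lborel) \<noteq> \<infinity>"
    by (auto simp: top_unique)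
  then have "AE x in lborel. (\<Sum>n. ennreal (2 ^ n * (norm (?D n x))\<^sup>2)) \<noteq> \<infinity>"
    by (rule nn_integral_noteq_infinite[rotated]) measurable
  then have conv: "AE x in lborel. convergent (\<lambda>n. F n x)"
  proof eventually_elim
    case (elim x)
    then have s: "summable (\<lambda>n. 2 ^ n * (norm (?D n x))\<^sup>2)"
      by (intro summable_suminf_not_top) auto
    obtain M where M: "\<And>n. norm (2 ^ n * (norm (?D n x))\<^sup>2) \<le> M"
      using summable_imp_bounded[OF s] unfolding bounded_iff by auto
    have le: "norm (?D n x) \<le> sqrt M * (1 / sqrt 2) ^ n" for n
    proof (rule power2_le_imp_le)
      have "(norm (?D n x))\<^sup>2 \<le> M / 2 ^ n" using M[of n] by (simp add: field_simps)
      also have "\<dots> = (sqrt M * (1 / sqrt 2) ^ n)\<^sup>2"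
        using order_trans[OF norm_ge_zero M] by (simp add: power_mult_distrib power_divide flip: power_mult)
           (simp add: power_mult mult.commute[of n])
      finally show "(norm (?D n x))\<^sup>2 \<le> (sqrt M * (1 / sqrt 2) ^ n)\<^sup>2" .
      show "0 \<le> sqrt M * (1 / sqrt 2) ^ n" using order_trans[OF norm_ge_zero M] by simp
    qed
    have "summable (\<lambda>n. sqrt M * (1 / sqrt 2) ^ n)"
      by (intro summable_mult summable_geometric) (simp add: real_less_lsqrt)
    then have "summable (\<lambda>n. ?D n x)"
      by (rule summable_comparison_test'[where N = 0]) (rule le)
    then have "convergent (\<lambda>n. \<Sum>k<n. ?D k x)" by (simp add: summable_iff_convergent)
    then have "convergent (\<lambda>n. (F n x - F 0 x) + F 0 x)"
      by (intro convergent_add convergent_const) (simp add: sum_lessThan_telescope[of "\<lambda>k. F k x"])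
    then show ?case by simp
  qed
  define G where "G x = lim (\<lambda>n. F n x)" for x
  have [measurable]: "G \<in> borel_measurable borel" unfolding G_def by measurable
  have lim: "AE x in lborel. (\<lambda>n. F n x) \<longlonglongrightarrow> G x"
    using conv by eventually_elim (simp add: G_def convergent_LIMSEQ_iff)
  \<comment> \<open>The constant 4 is the fixed point of the recursion C = 2 C / 4 + 2.\<close>
  have step: "nrm2 (\<lambda>x. F (n + m) x - F n x) \<le> 4 * (1 / 4) ^ n" for n m
  proof (induction m arbitrary: n)
    case (Suc m)
    have "nrm2 (\<lambda>x. F (n + Suc m) x - F n x) \<le>
        2 * nrm2 (\<lambda>x. F (Suc n + m) x - F (Suc n) x) + 2 * nrm2 (\<lambda>x. F (Suc n) x - F n x)"
      using nrm2_triangle[OF F F F, of "n + Suc m" n "Suc n"] by simp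
    also have "\<dots> \<le> 2 * (4 * (1 / 4) ^ Suc n) + 2 * (1 / 4) ^ n"
      by (intro add_mono mult_left_mono Suc.IH r) auto
    finally show ?case by simp
  qed (simp add: nrm2_def)
  have fatou: "(\<integral>\<^sup>+x. ennreal ((norm (F n x - G x))\<^sup>2) \<partial>lborel) \<le> ennreal (4 * (1 / 4) ^ n)" for n
  proof -
    have "(\<integral>\<^sup>+x. ennreal ((norm (F n x - G x))\<^sup>2) \<partial>lborel) =
        (\<integral>\<^sup>+x. liminf (\<lambda>m. ennreal ((norm (F (n + m) x - F n x))\<^sup>2)) \<partial>lborel)"
    proof (rule nn_integral_cong_AE, use lim in eventually_elim)
      case (elim x)
      have "(\<lambda>m. F (n + m) x) \<longlonglongrightarrow> G x" using LIMSEQ_ignore_initial_segment[OF elim, of n] by (simp add: add.commute)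
      then have "(\<lambda>m. ennreal ((norm (F (n + m) x - F n x))\<^sup>2)) \<longlonglongrightarrow> ennreal ((norm (G x - F n x))\<^sup>2)"
        by (intro tendsto_ennrealI tendsto_intros)
      from lim_imp_Liminf[OF trivial_limit_sequentially this]
      show ?case by (simp only: norm_minus_commute[of "F n x" "G x"])
    qed
    also have "\<dots> \<le> liminf (\<lambda>m. \<integral>\<^sup>+x. ennreal ((norm (F (n + m) x - F n x))\<^sup>2) \<partial>lborel)"
      by (rule nn_integral_liminf) measurable
    also have "\<dots> \<le> liminf (\<lambda>m::nat. ennreal (4 * (1 / 4) ^ n))"
      using step by (intro Liminf_mono always_eventually allI) (simp add: nn_integral_nrm2 L2_diff F)
    finally show ?thesis by (simp add: Liminf_const)
  qed
  have FG: "(\<lambda>x. F n x - G x) \<in> L2" for n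
  proof -
    have "(\<integral>\<^sup>+x. ennreal ((norm (F n x - G x))\<^sup>2) \<partial>lborel) < \<infinity>"
      using le_less_trans[OF fatou[of n]] by auto
    then show ?thesis by (auto simp: L2_def integrable_iff_bounded)
  qed
  have GL2: "G \<in> L2" using L2_diff[OF F[of 0] FG[of 0]] by simp
  have "nrm2 (\<lambda>x. F n x - G x) \<le> 4 * (1 / 4) ^ n" for n
    using fatou[of n] by (simp add: nn_integral_nrm2 FG)
  moreover have "(\<lambda>n. 4 * (1 / 4 :: real) ^ n) \<longlonglongrightarrow> 4 * 0"
    by (intro tendsto_intros LIMSEQ_power_zero) auto
  ultimately have "(\<lambda>n. nrm2 (\<lambda>x. F n x - G x)) \<longlonglongrightarrow> 0"
    by - (rule Lim_null_comparison[where g = "\<lambda>n. 4 * (1 / 4) ^ n"], simp_all add: nrm2_nonneg)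
  then show ?thesis by (rule that[OF GL2])
qed

text \<open>Truncation to balls. The geometric rate is the one that \<open>L2_complete\<close>
  consumes.\<close>

lemma L12_dense:
  assumes f: "f \<in> L2" and e: "e > 0"
  obtains g where "\<And>n. g n \<in> L12" "\<And>n. nrm2 (\<lambda>x. f x - g n x) \<le> e * (1 / 4) ^ n" "\<And>n. nrm2 (g n) \<le> nrm2 f"
proof -
  note [measurable] = L2_D(1)[OF f]
  let ?t = "\<lambda>N x. indicator (ball 0 (real N)) x * f x"
  have [measurable]: "(indicator (ball 0 (real N)) :: plane \<Rightarrow> complex) \<in> borel_measurable borel" for N
    by (rule borel_measurable_indicator) simp
  have tL: "?t N \<in> L12" for N
  proof -
    have i: "(\<lambda>x. indicator (ball 0 (real N)) x :: complex) \<in> L2"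
    proof -
      have "(\<lambda>x::plane. (norm (indicator (ball 0 (real N)) x :: complex))\<^sup>2) = (\<lambda>x. indicator (ball 0 (real N)) x)"
        by (auto simp: indicator_def)
      then show ?thesis
        by (auto simp: L2_def intro!: integrable_real_indicator emeasure_bounded_finite)
    qed
    have "?t N \<in> L2" by (rule L2_mult_bounded[OF f, where M = 1]) (auto simp: indicator_def)
    then show ?thesis using L2_mult_integrable[OF i f] by (simp add: L12_def)
  qed
  have lim: "(\<lambda>N. nrm2 (\<lambda>x. f x - ?t N x)) \<longlonglongrightarrow> (LINT x|(lborel :: plane measure). 0)"
    unfolding nrm2_def
  proof (rule integral_dominated_convergence[where w = "\<lambda>x. (norm (f x))\<^sup>2"])
    show "AE x in lborel. (\<lambda>N. (norm (f x - ?t N x))\<^sup>2) \<longlonglongrightarrow> 0"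
    proof (rule AE_I2)
      fix x :: plane
      obtain N0 where N0: "norm x < real N0" using reals_Archimedean2 by blast
      have "\<forall>\<^sub>F N in sequentially. (norm (f x - ?t N x))\<^sup>2 = 0"
        using eventually_ge_at_top[of N0]
      proof eventually_elim
        case (elim N)
        then have "norm x < real N" using N0 by linarith
        then show ?case by (simp add: indicator_def)
      qed
      then show "(\<lambda>N. (norm (f x - ?t N x))\<^sup>2) \<longlonglongrightarrow> 0" by (rule tendsto_eventually)
    qed
    show "AE x in lborel. norm ((norm (f x - ?t N x))\<^sup>2) \<le> (norm (f x))\<^sup>2" for N
      by (auto simp: indicator_def)
  qed (use L2_D(2)[OF f] in auto)
  have "\<exists>N. nrm2 (\<lambda>x. f x - ?t N x) \<le> e * (1 / 4) ^ n" for n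
  proof -
    have "\<forall>\<^sub>F N in sequentially. nrm2 (\<lambda>x. f x - ?t N x) < e * (1 / 4) ^ n"
      using lim e by (intro order_tendstoD(2)) auto
    then show ?thesis by (auto simp: eventually_sequentially intro: less_imp_le)
  qed
  from choice[OF allI, OF this]
  obtain N where N0: "\<forall>n. nrm2 (\<lambda>x. f x - ?t (N n) x) \<le> e * (1 / 4) ^ n" by (rule exE)
  have N: "nrm2 (\<lambda>x. f x - ?t (N n) x) \<le> e * (1 / 4) ^ n" for n using N0 by (rule spec)
  have "nrm2 (?t N) \<le> nrm2 f" for N
    unfolding nrm2_def using L2_D(2)[OF f] L2_D(2)[OF L12_D(1)[OF tL]]
    by (intro integral_mono) (auto simp: indicator_def)
  then show ?thesis by (intro that[of "\<lambda>n. ?t (N n)"] tL N)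
qed

text \<open>\<open>F\<close> is the Fourier transform of \<open>f \<in> L\<^sup>2\<close> with kernel \<open>exp (i c x \<bullet> \<xi>)\<close>. Testing against
  \<open>L\<^sup>1 \<inter> L\<^sup>2\<close> instead of Schwartz functions avoids showing that the latter are preserved by the
  transform.\<close>

definition fourier_pair :: "real \<Rightarrow> (plane \<Rightarrow> complex) \<Rightarrow> (plane \<Rightarrow> complex) \<Rightarrow> bool" where
  "fourier_pair c f F \<longleftrightarrow> f \<in> L2 \<and> F \<in> L2 \<and>
     (\<forall>g\<in>L12. (LINT x|lborel. F x * g x) = (LINT x|lborel. f x * ft c g x))"

lemma fourier_pair_D: "fourier_pair c f F \<Longrightarrow> f \<in> L2" "fourier_pair c f F \<Longrightarrow> F \<in> L2"
  "fourier_pair c f F \<Longrightarrow> g \<in> L12 \<Longrightarrow> (LINT x|lborel. F x * g x) = (LINT x|lborel. f x * ft c g x)"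
  by (auto simp: fourier_pair_def)

abbreviation planch :: "real \<Rightarrow> real" where
  "planch c \<equiv> (2 * pi / \<bar>c\<bar>)\<^sup>2"

section \<open>Existence, uniqueness and inversion of transform pairs\<close>

lemma ft_L2:
  assumes f: "f \<in> L12" and c: "c \<noteq> 0"
  shows "ft c f \<in> L2" "nrm2 (ft c f) \<le> planch c * nrm2 f"
proof -
  note [measurable] = L2_D(1)[OF L12_D(1)[OF f]]
  have le: "(\<integral>\<^sup>+\<xi>. ennreal ((norm (ft c f \<xi>))\<^sup>2) \<partial>lborel) \<le> ennreal (planch c * nrm2 f)"
    using nn_integral_ft_le[OF L12_D(2)[OF f] L2_D(2)[OF L12_D(1)[OF f]] c]
    by (simp add: nrm2_def)
  then have "(\<integral>\<^sup>+\<xi>. ennreal ((norm (ft c f \<xi>))\<^sup>2) \<partial>lborel) < \<infinity>"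
    using le_less_trans[OF le ennreal_less_top] by simp
  then show L: "ft c f \<in> L2" by (auto simp: L2_def integrable_iff_bounded)
  show "nrm2 (ft c f) \<le> planch c * nrm2 f"
    using le by (simp add: nn_integral_nrm2[OF L] nrm2_nonneg)
qed

lemma ft_diff:
  "integrable lborel f \<Longrightarrow> integrable lborel g \<Longrightarrow> ft c (\<lambda>x. f x - g x) \<xi> = ft c f \<xi> - ft c g \<xi>"
  unfolding ft_def using ft_integrand[of f c \<xi>] ft_integrand[of g c \<xi>]
  by (simp add: right_diff_distrib)

lemma fourier_pair_ft: "f \<in> L12 \<Longrightarrow> c \<noteq> 0 \<Longrightarrow> fourier_pair c f (ft c f)"
  unfolding fourier_pair_def by (auto intro: ft_L2 L12_D ft_duality)

lemma nrm2_eq_pairing: "f \<in> L2 \<Longrightarrow> of_real (nrm2 f) = (LINT x|lborel. f x * cnj (f x))"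
  unfolding nrm2_def integral_complex_of_real[symmetric] by (simp only: complex_norm_square)

text \<open>By the Plancherel inequality the transforms of truncations of f form a Cauchy sequence,
  and both sides of the defining identity pass to the limit.\<close>

lemma fourier_pair_exists:
  assumes f: "f \<in> L2" and c: "c \<noteq> 0"
  shows "\<exists>F. fourier_pair c f F \<and> nrm2 F \<le> planch c * nrm2 f"
proof -
  have C: "planch c > 0" using c by simp
  \<comment> \<open>Consecutive transforms then differ by at most (1/4) (5/2) 4^(-n) in squared
    norm, which is within the rate required by \<open>L2_complete\<close>.\<close>
  define e where "e = 1 / (4 * planch c)"
  have e: "e > 0" using C by (simp add: e_def)
  obtain g where g: "\<And>n. g n \<in> L12" "\<And>n. nrm2 (\<lambda>x. f x - g n x) \<le> e * (1 / 4) ^ n" "\<And>n. nrm2 (g n) \<le> nrm2 f"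
    using L12_dense[OF f e] by blast
  note gL = L12_D(1)[OF g(1)]
  let ?G = "\<lambda>n. ft c (g n)"
  have "nrm2 (\<lambda>x. ?G (Suc n) x - ?G n x) \<le> (1 / 4) ^ n" for n
  proof -
    have "nrm2 (\<lambda>x. ?G (Suc n) x - ?G n x) = nrm2 (ft c (\<lambda>x. g (Suc n) x - g n x))"
      by (simp add: ft_diff[OF L12_D(2)[OF g(1)] L12_D(2)[OF g(1)], abs_def])
    also have "\<dots> \<le> planch c * nrm2 (\<lambda>x. g (Suc n) x - g n x)"
      by (intro ft_L2 L12_diff g c)
    also have "\<dots> \<le> planch c * (2 * nrm2 (\<lambda>x. g (Suc n) x - f x) + 2 * nrm2 (\<lambda>x. f x - g n x))"
      using C by (intro mult_left_mono nrm2_triangle gL f) auto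
    also have "\<dots> \<le> planch c * (2 * (e * (1 / 4) ^ Suc n) + 2 * (e * (1 / 4) ^ n))"
    proof (intro mult_left_mono add_mono)
      show "nrm2 (\<lambda>x. g (Suc n) x - f x) \<le> e * (1 / 4) ^ Suc n"
        using g(2)[of "Suc n"] by (simp only: nrm2_minus[of "g (Suc n)" f])
    qed (use C g(2) in auto)
    also have "\<dots> = (planch c * e) * (5 / 2) * (1 / 4) ^ n" by (simp add: algebra_simps)
    also have "planch c * e = 1 / 4" using C by (simp add: e_def)
    also have "1 / 4 * (5 / 2) * (1 / 4) ^ n \<le> (1 / 4 :: real) ^ n" by simp
    finally show ?thesis .
  qed
  then obtain F where F: "F \<in> L2" "(\<lambda>n. nrm2 (\<lambda>x. ?G n x - F x)) \<longlonglongrightarrow> 0"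
    using L2_complete[of ?G] ft_L2(1)[OF g(1) c] by blast
  have gf: "(\<lambda>n. nrm2 (\<lambda>x. g n x - f x)) \<longlonglongrightarrow> 0"
  proof (rule Lim_null_comparison)
    show "(\<lambda>n. e * (1 / 4) ^ n) \<longlonglongrightarrow> 0"
      using tendsto_mult_left[OF LIMSEQ_power_zero[of "1 / 4 :: real"], of e] by simp
    show "\<forall>\<^sub>F n in sequentially. norm (nrm2 (\<lambda>x. g n x - f x)) \<le> e * (1 / 4) ^ n"
      using g(2) by (simp add: nrm2_minus[of _ f] nrm2_nonneg)
  qed
  have "fourier_pair c f F"
    unfolding fourier_pair_def
  proof (intro conjI ballI f F)
    fix u assume u: "u \<in> L12"
    have "(\<lambda>n. LINT x|lborel. ?G n x * u x) \<longlonglongrightarrow> (LINT x|lborel. F x * u x)"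
      by (rule pairing_limit[OF ft_L2(1)[OF g(1) c] F L12_D(1)[OF u]])
    moreover have "(LINT x|lborel. ?G n x * u x) = (LINT x|lborel. g n x * ft c u x)" for n
      by (intro ft_duality L12_D g u)
    moreover have "(\<lambda>n. LINT x|lborel. g n x * ft c u x) \<longlonglongrightarrow> (LINT x|lborel. f x * ft c u x)"
      by (rule pairing_limit[OF gL f gf ft_L2(1)[OF u c]])
    ultimately show "(LINT x|lborel. F x * u x) = (LINT x|lborel. f x * ft c u x)"
      using LIMSEQ_unique by simp
  qed
  moreover have "nrm2 F \<le> planch c * nrm2 f"
  proof -
    \<comment> \<open>The bound for F is the limit of the Cauchy-Schwarz bounds for the pairings of
      the approximations with the conjugate of F; one factor \<open>nrm2 F\<close> is cancelled at
      the end.\<close>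
    have lim: "(\<lambda>n. (norm (LINT x|lborel. ?G n x * cnj (F x)))\<^sup>2) \<longlonglongrightarrow> (norm (LINT x|lborel. F x * cnj (F x)))\<^sup>2"
      by (intro tendsto_intros pairing_limit[OF ft_L2(1)[OF g(1) c] F L2_cnj[OF F(1)]])
    have cn: "nrm2 (\<lambda>x. cnj (F x)) = nrm2 F" by (simp add: nrm2_def)
    have "(norm (LINT x|lborel. ?G n x * cnj (F x)))\<^sup>2 \<le> (planch c * nrm2 f) * nrm2 F" for n
    proof -
      have "(norm (LINT x|lborel. ?G n x * cnj (F x)))\<^sup>2 \<le> nrm2 (?G n) * nrm2 F"
        using pairing_bound[OF ft_L2(1)[OF g(1) c] L2_cnj[OF F(1)], of n] by (simp add: cn)
      also have "nrm2 (?G n) \<le> planch c * nrm2 f"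
        using ft_L2(2)[OF g(1)[of n] c] mult_left_mono[OF g(3)[of n] less_imp_le[OF C]] by linarith
      finally show ?thesis using mult_right_mono[OF _ nrm2_nonneg[of F]] by simp
    qed
    then have "(norm (LINT x|lborel. F x * cnj (F x)))\<^sup>2 \<le> (planch c * nrm2 f) * nrm2 F"
      using LIMSEQ_le_const2[OF lim] by blast
    then have "(nrm2 F)\<^sup>2 \<le> (planch c * nrm2 f) * nrm2 F"
      by (simp add: nrm2_eq_pairing[OF F(1), symmetric])
    then have sq: "nrm2 F * nrm2 F \<le> (planch c * nrm2 f) * nrm2 F"
      by (simp only: power2_eq_square)
    show ?thesis
    proof (cases "nrm2 F = 0")
      case True
      then show ?thesis using nrm2_nonneg[of f] by simp
    next
      case False
      then have "nrm2 F > 0" using nrm2_nonneg[of F] by simp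
      then show ?thesis using mult_right_le_imp_le[OF sq] by blast
    qed
  qed
  ultimately show ?thesis by blast
qed

lemma gauss_translate_L12:
  assumes a: "a > 0"
  shows "(\<lambda>x::plane. complex_of_real (gauss a (x - y))) \<in> L12"
proof -
  have i: "integrable lborel (\<lambda>x::plane. gauss b (x - y))" if "b > 0" for b
    using lborel_integral_affine(2)[of "gauss b :: plane \<Rightarrow> real" 1 "- y"] gauss_integrable(1)[OF that, where 'a=plane]
    by simp
  have "(gauss a x)\<^sup>2 = gauss (2 * a) x" for x :: plane
    by (simp add: gauss_def power2_eq_square exp_add[symmetric])
  then show ?thesis using i[OF a] i[of "2 * a"] a by (auto simp: L12_def L2_def)
qed

text \<open>Translated Gaussians separate the elements of L2. The uniqueness statements below rest
  on this.\<close>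

lemma AE_eq_if_gauss_pairings_eq:
  assumes "F \<in> L2" "G \<in> L2"
    and "\<And>a y. a > 0 \<Longrightarrow> (LINT x|lborel. F x * of_real (gauss a (x - y))) = (LINT x|lborel. G x * of_real (gauss a (x - y)))"
  shows "AE x in lborel. F x = G x"
proof -
  have "AE x in lborel. F x - G x = 0"
  proof (rule gauss_averages_zero_imp_AE_zero)
    fix a :: real and y :: plane assume a: "a > 0"
    show "(LINT x|lborel. (F x - G x) * of_real (gauss a (x - y))) = 0"
      unfolding left_diff_distrib
      using assms(3)[OF a] L2_mult_integrable[OF assms(1) L12_D(1)[OF gauss_translate_L12[OF a]]]
        L2_mult_integrable[OF assms(2) L12_D(1)[OF gauss_translate_L12[OF a]]]
      by simp
  qed (use L2_diff[OF assms(1,2)] in \<open>auto simp: L2_def\<close>)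
  then show ?thesis by simp
qed

lemma fourier_pair_unique: "fourier_pair c f F \<Longrightarrow> fourier_pair c f G \<Longrightarrow> AE x in lborel. F x = G x"
  by (rule AE_eq_if_gauss_pairings_eq) (auto simp: fourier_pair_D gauss_translate_L12)

lemma nrm2_cong_AE: "f \<in> L2 \<Longrightarrow> g \<in> L2 \<Longrightarrow> AE x in lborel. f x = g x \<Longrightarrow> nrm2 f = nrm2 g"
  unfolding nrm2_def by (rule integral_cong_AE) (auto simp: L2_def)

lemma L2_pairing_cong_AE:
  assumes "f \<in> L2" "g \<in> L2" "k \<in> borel_measurable borel" "AE x in lborel. f x = g x"
  shows "(LINT x|lborel. f x * k x) = (LINT x|lborel. g x * k x)"
  by (rule integral_cong_AE) (use assms in \<open>auto simp: L2_def\<close>)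

lemma fourier_pair_cong_AE:
  assumes W: "fourier_pair c f F" and "f' \<in> L2" "F' \<in> L2" "AE x in lborel. f x = f' x" "AE x in lborel. F x = F' x"
  shows "fourier_pair c f' F'"
  unfolding fourier_pair_def
proof (intro conjI ballI assms)
  fix g assume g: "g \<in> L12"
  then have [measurable]: "g \<in> borel_measurable borel" by (auto simp: L12_def L2_def)
  show "(LINT x|lborel. F' x * g x) = (LINT x|lborel. f' x * ft c g x)"
    using fourier_pair_D(3)[OF W g] L2_pairing_cong_AE[OF fourier_pair_D(2)[OF W] assms(3) _ assms(5), of g]
      L2_pairing_cong_AE[OF fourier_pair_D(1)[OF W] assms(2) _ assms(4), of "ft c g"] by simp
qed

lemma fourier_pair_lincomb:
  assumes f: "fourier_pair c f F" and g: "fourier_pair c g G" and c: "c \<noteq> 0"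
  shows "fourier_pair c (\<lambda>x. a * f x + b * g x) (\<lambda>x. a * F x + b * G x)"
  unfolding fourier_pair_def
proof (intro conjI ballI L2_add L2_scale fourier_pair_D(1)[OF f] fourier_pair_D(1)[OF g] fourier_pair_D(2)[OF f] fourier_pair_D(2)[OF g])
  fix u assume u: "u \<in> L12"
  have "(LINT x|lborel. p * r x * w x + q * t x * w x) = p * (LINT x|lborel. r x * w x) + q * (LINT x|lborel. t x * w x)"
    if "r \<in> L2" "t \<in> L2" "w \<in> L2" for p q and r t w :: "plane \<Rightarrow> complex"
    using L2_mult_integrable[OF that(1,3)] L2_mult_integrable[OF that(2,3)] by (simp add: mult.assoc)
  note l = this[OF fourier_pair_D(2)[OF f] fourier_pair_D(2)[OF g] L12_D(1)[OF u]]
  show "(LINT x|lborel. (a * F x + b * G x) * u x) = (LINT x|lborel. (a * f x + b * g x) * ft c u x)"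
    unfolding distrib_right l
    using fourier_pair_D(3)[OF f u] fourier_pair_D(3)[OF g u] L2_mult_integrable[OF fourier_pair_D(1)[OF f] ft_L2(1)[OF u c]]
      L2_mult_integrable[OF fourier_pair_D(1)[OF g] ft_L2(1)[OF u c]]
    by (simp add: mult.assoc)
qed

text \<open>Existence produces one partner of f that satisfies the bound, and uniqueness transfers
  it to every partner.\<close>

lemma fourier_pair_bound: "fourier_pair c f F \<Longrightarrow> c \<noteq> 0 \<Longrightarrow> nrm2 F \<le> planch c * nrm2 f"
  using fourier_pair_exists[of f c] fourier_pair_unique[of c f F] nrm2_cong_AE fourier_pair_D by metis

text \<open>Extends the test functions to all of L2: g is approximated by truncations, whose
  transforms converge to G by \<open>fourier_pair_bound\<close>.\<close>

lemma fourier_pair_duality: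
  assumes f: "fourier_pair c f F" and g: "fourier_pair c g G" and c: "c \<noteq> 0"
  shows "(LINT x|lborel. F x * g x) = (LINT x|lborel. f x * G x)"
proof -
  obtain u where u: "\<And>n. u n \<in> L12" "\<And>n. nrm2 (\<lambda>x. g x - u n x) \<le> 1 * (1 / 4) ^ n"
    "\<And>n. nrm2 (u n) \<le> nrm2 g"
    using L12_dense[OF fourier_pair_D(1)[OF g] zero_less_one] by blast
  have z: "(\<lambda>n. K * (1 / 4 :: real) ^ n) \<longlonglongrightarrow> 0" for K
    using tendsto_mult_left[OF LIMSEQ_power_zero[of "1 / 4 :: real"], of K] by simp
  have l1: "(\<lambda>n. nrm2 (\<lambda>x. u n x - g x)) \<longlonglongrightarrow> 0"
    by (rule Lim_null_comparison[OF _ z[of 1]])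
       (use u(2) in \<open>simp add: nrm2_minus[of _ g] nrm2_nonneg\<close>)
  have l2: "(\<lambda>n. nrm2 (\<lambda>x. ft c (u n) x - G x)) \<longlonglongrightarrow> 0"
  proof (rule Lim_null_comparison[OF _ z[of "planch c"]], intro always_eventually allI)
    fix n
    have "fourier_pair c (\<lambda>x. 1 * g x + (-1) * u n x) (\<lambda>x. 1 * G x + (-1) * ft c (u n) x)"
      by (intro fourier_pair_lincomb g fourier_pair_ft u c)
    then have "nrm2 (\<lambda>x. G x - ft c (u n) x) \<le> planch c * nrm2 (\<lambda>x. g x - u n x)"
      using fourier_pair_bound[OF _ c] by simp
    also have "\<dots> \<le> planch c * (1 * (1 / 4) ^ n)" by (intro mult_left_mono u) simp
    finally show "norm (nrm2 (\<lambda>x. ft c (u n) x - G x)) \<le> planch c * (1 / 4) ^ n"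
      by (simp add: nrm2_nonneg nrm2_minus[of _ G])
  qed
  have "(\<lambda>n. LINT x|lborel. u n x * F x) \<longlonglongrightarrow> (LINT x|lborel. g x * F x)"
    by (rule pairing_limit[OF L12_D(1)[OF u(1)] fourier_pair_D(1)[OF g] l1 fourier_pair_D(2)[OF f]])
  moreover have "(LINT x|lborel. u n x * F x) = (LINT x|lborel. ft c (u n) x * f x)" for n
    using fourier_pair_D(3)[OF f u(1)] by (simp add: mult.commute)
  moreover have "(\<lambda>n. LINT x|lborel. ft c (u n) x * f x) \<longlonglongrightarrow> (LINT x|lborel. G x * f x)"
    by (rule pairing_limit[OF ft_L2(1)[OF u(1) c] fourier_pair_D(2)[OF g] l2 fourier_pair_D(1)[OF f]])
  ultimately have "(LINT x|lborel. g x * F x) = (LINT x|lborel. G x * f x)"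
    using LIMSEQ_unique by simp
  then show ?thesis by (simp add: mult.commute)
qed

text \<open>The transform is a wave times a Gaussian, hence again integrable, as inversion for
  Gaussians requires.\<close>

lemma ft_translated_gauss:
  fixes y :: plane
  assumes a: "a > 0"
  shows "ft c (\<lambda>x. of_real (gauss a (x - y))) \<xi> =
    exp (\<i> * of_real (c * (y \<bullet> \<xi>))) * of_real ((2 * pi / a) * gauss (c\<^sup>2 / a) \<xi>)"
proof -
  have "ft c (\<lambda>x. of_real (gauss a (x - y))) \<xi> =
      (LINT x|lborel. exp (\<i> * of_real (c * ((y + x) \<bullet> \<xi>))) * of_real (gauss a x))"
    unfolding ft_def using lborel_integral_affine(1)[of "\<lambda>x. exp (\<i> * of_real (c * (x \<bullet> \<xi>))) * of_real (gauss a (x - y))" 1 y]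
    by simp
  also have "\<dots> = (LINT x|lborel. exp (\<i> * of_real (c * (y \<bullet> \<xi>))) * (exp (\<i> * of_real (x \<bullet> (c *\<^sub>R \<xi>))) * of_real (gauss a x)))"
    by (intro Bochner_Integration.integral_cong) (simp_all add: inner_add_left distrib_left exp_add)
  also have "\<dots> = exp (\<i> * of_real (c * (y \<bullet> \<xi>))) * of_real (sqrt (2 * pi / a) ^ 2 * gauss (1 / a) (c *\<^sub>R \<xi>))"
    by (simp only: Bochner_Integration.integral_mult_right_zero gauss_fourier(2)[OF a]) simp
  finally show ?thesis using a by (simp add: gauss_scale)
qed

lemma ft_gauss_inversion:
  fixes y :: plane
  assumes a: "a > 0" and c: "c \<noteq> 0"
  defines "\<phi> \<equiv> (\<lambda>x. complex_of_real (gauss a (x - y)))"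
  shows "ft c \<phi> \<in> L12" "ft (- c) (ft c \<phi>) x = of_real (planch c) * \<phi> x"
proof -
  have ca: "c\<^sup>2 / a > 0" using a c by simp
  have phi: "\<phi> \<in> L12" unfolding \<phi>_def by (rule gauss_translate_L12[OF a])
  have i: "integrable lborel (ft c \<phi>)"
  proof (rule Bochner_Integration.integrable_bound)
    show "integrable lborel (\<lambda>\<xi>::plane. (2 * pi / a) * gauss (c\<^sup>2 / a) \<xi>)"
      by (simp add: gauss_integrable[OF ca])
    show "ft c \<phi> \<in> borel_measurable lborel" using ft_L2(1)[OF phi c] by (simp add: L2_def)
    show "AE \<xi> in lborel. norm (ft c \<phi> \<xi>) \<le> norm ((2 * pi / a) * gauss (c\<^sup>2 / a) \<xi>)"
      unfolding \<phi>_def ft_translated_gauss[OF a]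
      by (simp only: norm_mult norm_exp_i_times norm_of_real) (simp add: abs_mult)
  qed
  then show "ft c \<phi> \<in> L12" using ft_L2(1)[OF phi c] by (simp add: L12_def)
  have "ft (- c) (ft c \<phi>) x = of_real ((2 * pi / \<bar>c\<bar>) ^ DIM(plane)) * \<phi> x"
  proof (rule ft_inversion[OF L12_D(2)[OF phi] _ _ i c])
    show "norm (\<phi> x) \<le> 1" for x using a by (simp add: \<phi>_def gauss_le_1)
    show "isCont \<phi> x" unfolding \<phi>_def gauss_def by (intro continuous_intros)
  qed
  then show "ft (- c) (ft c \<phi>) x = of_real (planch c) * \<phi> x" by simp
qed

text \<open>Both sides are tested against translated Gaussians. Their transforms are again
  admissible test functions, so the defining identity can be used twice, and pointwise inversion
  applies to the Gaussian instead of f.\<close>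

lemma fourier_pair_inverse:
  assumes f: "fourier_pair c f F" and c: "c \<noteq> 0"
  shows "fourier_pair (- c) F (\<lambda>x. of_real (planch c) * f x)"
proof -
  obtain H where H: "fourier_pair (- c) F H" using fourier_pair_exists[OF fourier_pair_D(2)[OF f], of "- c"] c by auto
  have "AE x in lborel. H x = of_real (planch c) * f x"
  proof (rule AE_eq_if_gauss_pairings_eq[OF fourier_pair_D(2)[OF H] L2_scale[OF fourier_pair_D(1)[OF f]]])
    fix a :: real and y :: plane assume a: "a > 0"
    let ?g = "\<lambda>x. complex_of_real (gauss a (x - y))"
    note inv = ft_gauss_inversion[OF a, of "- c" y]
    have "(LINT x|lborel. H x * ?g x) = (LINT x|lborel. F x * ft (- c) ?g x)"
      by (rule fourier_pair_D(3)[OF H gauss_translate_L12[OF a]])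
    also have "\<dots> = (LINT x|lborel. f x * ft c (ft (- c) ?g) x)"
      by (rule fourier_pair_D(3)[OF f]) (use inv c in auto)
    also have "\<dots> = (LINT x|lborel. of_real (planch c) * f x * ?g x)"
      using inv(2) c by (intro Bochner_Integration.integral_cong) (simp_all add: mult_ac)
    finally show "(LINT x|lborel. H x * ?g x) = (LINT x|lborel. of_real (planch c) * f x * ?g x)" .
  qed
  then show ?thesis
    by (intro fourier_pair_cong_AE[OF H fourier_pair_D(2)[OF f] L2_scale[OF fourier_pair_D(1)[OF f]]]) auto
qed

text \<open>Transforming F with the opposite sign and then back gives a multiple of F.\<close>

lemma fourier_pair_surj:
  assumes F: "F \<in> L2" and c: "c \<noteq> 0"
  obtains f where "fourier_pair c f F"
proof -
  obtain H where H: "fourier_pair (- c) F H" using fourier_pair_exists[OF F, of "- c"] c by auto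
  have "fourier_pair c H (\<lambda>x. of_real (planch c) * F x)" using fourier_pair_inverse[OF H] c by simp
  from fourier_pair_lincomb[OF this this c, of "1 / of_real (planch c)" 0]
  have "fourier_pair c (\<lambda>x. H x / of_real (planch c)) F" using c by simp
  then show ?thesis by (rule that)
qed

lemma fourier_pair_unique_left:
  assumes "fourier_pair c f F" "fourier_pair c g F" and c: "c \<noteq> 0"
  shows "AE x in lborel. f x = g x"
  using fourier_pair_unique[OF fourier_pair_inverse[OF assms(1) c] fourier_pair_inverse[OF assms(2) c]] c by simp

lemma fourier_pair_cnj:
  assumes f: "fourier_pair c f F" and c: "c \<noteq> 0"
  shows "fourier_pair (- c) (\<lambda>x. cnj (f x)) (\<lambda>x. cnj (F x))"
  unfolding fourier_pair_def
proof (intro conjI ballI L2_cnj fourier_pair_D(1)[OF f] fourier_pair_D(2)[OF f])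
  fix g assume g: "g \<in> L12"
  have [measurable]: "g \<in> borel_measurable borel" using g by (auto simp: L12_def L2_def)
  have g': "(\<lambda>x. cnj (g x)) \<in> L12" using g by (auto simp: L12_def L2_cnj)
  have "ft c (\<lambda>x. cnj (g x)) \<xi> = cnj (ft (- c) g \<xi>)" for \<xi>
    unfolding ft_def Bochner_Integration.integral_cnj[symmetric] by (simp add: exp_cnj)
  then have "cnj (LINT x|lborel. F x * cnj (g x)) = cnj (LINT x|lborel. f x * cnj (ft (- c) g x))"
    using fourier_pair_D(3)[OF f g'] by simp
  then show "(LINT x|lborel. cnj (F x) * g x) = (LINT x|lborel. cnj (f x) * ft (- c) g x)"
    by (simp flip: Bochner_Integration.integral_cnj)
qed

text \<open>Duality is applied to the conjugate of G, whose own transform is a multiple of the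
  conjugate of g by inversion. This improves the earlier inequality to Parseval's identity.\<close>

lemma fourier_pair_inner:
  assumes f: "fourier_pair c f F" and g: "fourier_pair c g G" and c: "c \<noteq> 0"
  shows "L2_inner F G = of_real (planch c) * L2_inner f g"
proof -
  have "fourier_pair c (\<lambda>x. cnj (G x)) (\<lambda>x. of_real (planch c) * cnj (g x))"
    using fourier_pair_inverse[OF fourier_pair_cnj[OF g c]] c by simp
  from fourier_pair_duality[OF f this c] show ?thesis
    unfolding L2_inner_def Bochner_Integration.integral_mult_right_zero[symmetric]
    by (simp only: mult.left_commute)
qed

section \<open>Schwartz functions as test functions\<close>

lemma schwartz_decay:
  assumes "schwartz \<phi>"
  obtains C where "C \<ge> 0" "\<And>x. norm (\<phi> x) \<le> C / (1 + norm x) ^ N"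
proof -
  obtain C where C: "\<And>x. (1 + norm x) ^ N * norm (\<phi> x) \<le> C"
    using assms unfolding schwartz_def by (metis empty_set empty_subsetI iter_deriv.simps(1))
  have "C \<ge> 0" by (rule order_trans[OF _ C[of 0]]) simp
  moreover have "norm (\<phi> x) \<le> C / (1 + norm x) ^ N" for x
    using C[of x] by (subst pos_le_divide_eq) (auto simp: mult.commute add_pos_nonneg)
  ultimately show ?thesis by (rule that)
qed

lemma schwartz_weighted_integrable:
  assumes "schwartz \<phi>"
  shows "integrable lborel (\<lambda>x. (1 + norm x) ^ N * norm (\<phi> x))"
proof -
  have [measurable]: "\<phi> \<in> borel_measurable borel"
    using assms by (intro borel_measurable_continuous_onI smooth_on_UNIV_continuous) (simp add: schwartz_def)
  \<comment> \<open>The extra exponent 4 is twice the dimension, the power in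
    \<open>integrable_weight\<close>.\<close>
  obtain C where C: "C \<ge> 0" "\<And>x. norm (\<phi> x) \<le> C / (1 + norm x) ^ (N + 4)" using schwartz_decay[OF assms] by blast
  show ?thesis
  proof (rule Bochner_Integration.integrable_bound)
    show "integrable lborel (\<lambda>x::plane. C * (1 / (1 + norm x) ^ (2 * DIM(plane))))"
      by (intro integrable_mult_right integrable_weight)
    show "AE x in lborel. norm ((1 + norm x) ^ N * norm (\<phi> x)) \<le> norm (C * (1 / (1 + norm x) ^ (2 * DIM(plane))))"
    proof (rule AE_I2)
      fix x :: plane
      have p: "(1 + norm x) ^ N > 0" by (simp add: add_pos_nonneg)
      have "(1 + norm x) ^ N * norm (\<phi> x) \<le> (1 + norm x) ^ N * (C / (1 + norm x) ^ (N + 4))"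
        using p C by (intro mult_left_mono) auto
      also have "\<dots> = C / (1 + norm x) ^ 4" using p by (simp add: power_add)
      finally show "norm ((1 + norm x) ^ N * norm (\<phi> x)) \<le> norm (C * (1 / (1 + norm x) ^ (2 * DIM(plane))))"
        using C(1) p by (simp add: abs_mult)
    qed
  qed measurable
qed

lemma schwartz_L12:
  assumes "schwartz \<phi>"
  shows "\<phi> \<in> L12"
proof -
  have [measurable]: "\<phi> \<in> borel_measurable borel"
    using assms by (intro borel_measurable_continuous_onI smooth_on_UNIV_continuous) (simp add: schwartz_def)
  have i: "integrable lborel (\<lambda>x. norm (\<phi> x))" using schwartz_weighted_integrable[OF assms, of 0] by simp
  obtain C where C: "C \<ge> 0" "\<And>x. norm (\<phi> x) \<le> C / (1 + norm x) ^ 0" using schwartz_decay[OF assms] by blast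
  have "integrable lborel (\<lambda>x. (norm (\<phi> x))\<^sup>2)"
    by (rule Bochner_Integration.integrable_bound[OF integrable_mult_right[OF i, of C]])
       (use C in \<open>auto simp: power2_eq_square intro!: AE_I2 mult_right_mono\<close>)
  then show ?thesis using i by (simp add: L12_def L2_def integrable_norm_iff)
qed

lemma gauss_mod_translate:
  "gauss_mod a (a *\<^sub>R y) 0 x = of_real (exp (a / 2 * (norm y)\<^sup>2)) * of_real (gauss a (x - y))"
proof -
  have "- (a / 2) * (x \<bullet> x) + x \<bullet> (a *\<^sub>R y) = a / 2 * (norm y)\<^sup>2 + - (a / 2) * (norm (x - y))\<^sup>2"
    by (simp add: power2_norm_eq_inner inner_diff_left inner_diff_right inner_commute algebra_simps)
  then show ?thesis
    by (simp only: gauss_mod_def gauss_def inner_zero_right of_real_0 mult_zero_right add_0_right exp_of_real exp_add of_real_mult)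
qed

text \<open>Schwartz functions are among the test functions of \<open>fourier_pair\<close>;
  conversely the translated Gaussians among them already determine the transform almost
  everywhere.\<close>

lemma L2_fourier_h_iff_W:
  assumes h: "h > 0"
  shows "L2_fourier_h h f F \<longleftrightarrow> fourier_pair (- 1 / h) f F"
proof
  assume "fourier_pair (- 1 / h) f F"
  then show "L2_fourier_h h f F"
    by (auto simp: L2_fourier_h_def fourier_pair_def fourier_h_eq_ft schwartz_L12)
next
  assume L: "L2_fourier_h h f F"
  then have f: "f \<in> L2" and F: "F \<in> L2" by (auto simp: L2_fourier_h_def)
  obtain G where G: "fourier_pair (- 1 / h) f G" using fourier_pair_exists[OF f, of "- 1 / h"] h by auto
  have "AE x in lborel. G x = F x"
  proof (rule AE_eq_if_gauss_pairings_eq[OF fourier_pair_D(2)[OF G] F])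
    fix a :: real and y :: plane assume a: "a > 0"
    let ?p = "gauss_mod a (a *\<^sub>R y) 0"
    let ?E = "complex_of_real (exp (a / 2 * (norm y)\<^sup>2))"
    have s: "schwartz ?p" by (rule schwartz_gauss_mod[OF a])
    have "(LINT x|lborel. G x * ?p x) = (LINT x|lborel. F x * ?p x)"
      using fourier_pair_D(3)[OF G schwartz_L12[OF s]] L s by (simp add: L2_fourier_h_def fourier_h_eq_ft)
    then have "?E * (LINT x|lborel. G x * of_real (gauss a (x - y))) = ?E * (LINT x|lborel. F x * of_real (gauss a (x - y)))"
      unfolding gauss_mod_translate Bochner_Integration.integral_mult_right_zero[symmetric]
      by (simp only: mult.left_commute)
    then show "(LINT x|lborel. G x * of_real (gauss a (x - y))) = (LINT x|lborel. F x * of_real (gauss a (x - y)))"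
      by simp
  qed
  then show "fourier_pair (- 1 / h) f F" by (intro fourier_pair_cong_AE[OF G f F]) auto
qed

section \<open>Fourier multipliers\<close>

text \<open>Surjectivity of the transform shows that the choice in \<open>fourier_multiplier\<close>
  picks an actual solution; uniqueness replaces the transform hidden in that choice by the given
  one.\<close>

lemma fourier_pair_fourier_multiplier:
  assumes h: "h > 0" and a[measurable]: "a \<in> borel_measurable borel" and b: "\<And>\<xi>. norm (a \<xi>) \<le> M"
    and f: "fourier_pair (- 1 / h) f F"
  shows "fourier_pair (- 1 / h) (fourier_multiplier h a f) (\<lambda>\<xi>. a \<xi> * F \<xi>)"
proof -
  have c: "- 1 / h \<noteq> 0" using h by simp
  obtain g where "fourier_pair (- 1 / h) g (\<lambda>\<xi>. a \<xi> * F \<xi>)"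
    using fourier_pair_surj[OF L2_mult_bounded[OF fourier_pair_D(2)[OF f] a b] c] .
  then have "\<exists>F. L2_fourier_h h f F \<and> L2_fourier_h h g (\<lambda>\<xi>. a \<xi> * F \<xi>)"
    using f by (auto simp: L2_fourier_h_iff_W[OF h])
  from someI[where P = "\<lambda>g. \<exists>F. L2_fourier_h h f F \<and> L2_fourier_h h g (\<lambda>\<xi>. a \<xi> * F \<xi>)", OF this]
  obtain F' where F': "fourier_pair (- 1 / h) f F'" "fourier_pair (- 1 / h) (fourier_multiplier h a f) (\<lambda>\<xi>. a \<xi> * F' \<xi>)"
    by (auto simp: L2_fourier_h_iff_W[OF h] fourier_multiplier_def)
  from fourier_pair_unique[OF F'(1) f] show ?thesis
    by (intro fourier_pair_cong_AE[OF F'(2) fourier_pair_D(1)[OF F'(2)] L2_mult_bounded[OF fourier_pair_D(2)[OF f] a b]]) auto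
qed

lemma fourier_pair_exists': "f \<in> L2 \<Longrightarrow> c \<noteq> 0 \<Longrightarrow> \<exists>F. fourier_pair c f F"
  using fourier_pair_exists by blast

theorem unitary_fourier_multiplier:
  assumes h: "h > 0" and [measurable]: "a \<in> borel_measurable borel" and one: "\<And>\<xi>. norm (a \<xi>) = 1"
  shows "unitary_L2 (fourier_multiplier h a)"
proof -
  let ?c = "- 1 / h" and ?T = "fourier_multiplier h a"
  have c: "?c \<noteq> 0" using h by simp
  note m = fourier_pair_fourier_multiplier[OF h assms(2), of 1]
  have m: "fourier_pair ?c (?T f) (\<lambda>\<xi>. a \<xi> * F \<xi>)" if "fourier_pair ?c f F" for f F
    using m[OF _ that] one by simp
  note ex = fourier_pair_exists'[OF _ c]
  show ?thesis
    unfolding unitary_L2_def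
  proof (intro conjI ballI allI impI)
    fix f assume "f \<in> L2"
    then show "?T f \<in> L2" using ex m fourier_pair_D(1) by blast
  next
    fix f g assume fg: "f \<in> L2" "g \<in> L2" and eq: "AE x in lborel. f x = g x"
    obtain F where F: "fourier_pair ?c f F" using ex[OF fg(1)] by blast
    have "fourier_pair ?c g F" by (rule fourier_pair_cong_AE[OF F fg(2) fourier_pair_D(2)[OF F] eq]) simp
    from fourier_pair_unique_left[OF m[OF F] m[OF this] c]
    show "AE x in lborel. ?T f x = ?T g x" .
  next
    fix f g c' d assume fg: "f \<in> L2" "g \<in> L2"
    obtain F G where F: "fourier_pair ?c f F" and G: "fourier_pair ?c g G" using ex[OF fg(1)] ex[OF fg(2)] by blast
    have "fourier_pair ?c (\<lambda>x. c' * ?T f x + d * ?T g x) (\<lambda>\<xi>. a \<xi> * (c' * F \<xi> + d * G \<xi>))"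
      using fourier_pair_lincomb[OF m[OF F] m[OF G] c, of c' d] by (simp add: algebra_simps)
    from fourier_pair_unique_left[OF m[OF fourier_pair_lincomb[OF F G c, of c' d]] this c]
    show "AE x in lborel. ?T (\<lambda>y. c' * f y + d * g y) x = c' * ?T f x + d * ?T g x" .
  next
    fix f g assume fg: "f \<in> L2" "g \<in> L2"
    obtain F G where F: "fourier_pair ?c f F" and G: "fourier_pair ?c g G" using ex[OF fg(1)] ex[OF fg(2)] by blast
    have "a x * F x * cnj (a x * G x) = F x * cnj (G x)" for x
      using complex_norm_square[of "a x"] one[of x] by (simp add: mult_ac)
    then have "L2_inner (\<lambda>\<xi>. a \<xi> * F \<xi>) (\<lambda>\<xi>. a \<xi> * G \<xi>) = L2_inner F G"
      by (simp only: L2_inner_def)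
    then show "L2_inner (?T f) (?T g) = L2_inner f g"
      using fourier_pair_inner[OF m[OF F] m[OF G] c] fourier_pair_inner[OF F G c] h by simp
  next
    fix g assume g: "g \<in> L2"
    obtain G where G: "fourier_pair ?c g G" using ex[OF g] by blast
    have "(\<lambda>\<xi>. inverse (a \<xi>) * G \<xi>) \<in> L2"
      by (rule L2_mult_bounded[OF fourier_pair_D(2)[OF G], where M = 1]) (auto simp: norm_inverse one)
    then obtain f where f: "fourier_pair ?c f (\<lambda>\<xi>. inverse (a \<xi>) * G \<xi>)" using fourier_pair_surj[OF _ c] by blast
    have "a \<xi> \<noteq> 0" for \<xi> using one[of \<xi>] by auto
    then have "fourier_pair ?c (?T f) G" using m[OF f] by (simp add: mult.assoc[symmetric])
    from fourier_pair_unique_left[OF this G c] fourier_pair_D(1)[OF f]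
    show "\<exists>f\<in>L2. AE x in lborel. ?T f x = g x" by blast
  qed
qed

text \<open>If the product on the Fourier side is integrable, the output is an ordinary inverse
  Fourier integral. The kernel of a localized multiplier is read off from it.\<close>

lemma fourier_multiplier_integral:
  assumes h: "h > 0" and v: "v \<in> L12" and g: "fourier_pair (- 1 / h) g (\<lambda>\<xi>. m \<xi> * ft (- 1 / h) v \<xi>)"
    and i: "integrable lborel (\<lambda>\<xi>. m \<xi> * ft (- 1 / h) v \<xi>)"
  shows "AE x in lborel. g x = ft (1 / h) (\<lambda>\<xi>. m \<xi> * ft (- 1 / h) v \<xi>) x / of_real ((2 * pi * h)\<^sup>2)"
proof -
  let ?c = "- 1 / h" and ?P = "\<lambda>\<xi>. m \<xi> * ft (- 1 / h) v \<xi>"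
  have c: "?c \<noteq> 0" using h by simp
  have "?P \<in> L12" using i fourier_pair_D(2)[OF g] by (simp add: L12_def)
  then have "fourier_pair (1 / h) ?P (ft (1 / h) ?P)" using h by (intro fourier_pair_ft) auto
  from fourier_pair_inverse[OF this] h have P: "fourier_pair ?c (ft (1 / h) ?P) (\<lambda>x. of_real ((2 * pi * h)\<^sup>2) * ?P x)" by simp
  have "fourier_pair ?c (\<lambda>x. ft (1 / h) ?P x / of_real ((2 * pi * h)\<^sup>2)) ?P"
    using fourier_pair_lincomb[OF P P c, of "1 / of_real ((2 * pi * h)\<^sup>2)" 0] h by simp
  from fourier_pair_unique_left[OF g this c] show ?thesis .
qed

section \<open>The polar angle and the canonical relation\<close>

text \<open>The gradient of the polar angle and, below, its derivative.\<close>

definition angrad :: "plane \<Rightarrow> plane" where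
  "angrad \<xi> = perp \<xi> /\<^sub>R (norm \<xi>)\<^sup>2"

definition angrad' :: "plane \<Rightarrow> plane \<Rightarrow> plane" where
  "angrad' \<xi> v = perp v /\<^sub>R (norm \<xi>)\<^sup>2 - (2 * (\<xi> \<bullet> v) / (norm \<xi>)^4) *\<^sub>R perp \<xi>"

lemma perp_nth [simp]: "perp \<xi> $ 1 = - (\<xi> $ 2)" "perp \<xi> $ 2 = \<xi> $ 1"
  by (simp_all add: perp_def)

lemma plane_eq_iff: "x = y \<longleftrightarrow> x $ 1 = y $ 1 \<and> x $ 2 = (y :: plane) $ 2"
  by (simp add: vec_eq_iff forall_2)

lemma inner_plane: "x \<bullet> y = x $ 1 * y $ 1 + x $ 2 * (y :: plane) $ 2"
  by (simp add: inner_vec_def sum_2)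

lemma norm_plane: "(norm x)\<^sup>2 = (x $ 1)\<^sup>2 + (x $ 2 :: real)\<^sup>2" for x :: plane
  unfolding power2_norm_eq_inner inner_plane by (simp add: power2_eq_square)

lemma bounded_linear_perp: "bounded_linear perp"
  unfolding linear_conv_bounded_linear[symmetric] by (rule linearI) (simp_all add: plane_eq_iff)

lemma smooth_on_angrad: "smooth_on (- {0}) angrad"
  unfolding angrad_def power2_norm_eq_inner
  by (intro smooth_on_scaleR smooth_on_inverse smooth_on_inner smooth_on_id
        smooth_on_bounded_linear bounded_linear_perp) auto

lemma angrad_has_derivative:
  assumes "\<xi> \<noteq> 0"
  shows "(angrad has_derivative angrad' \<xi>) (at \<xi>)"
proof -
  have 1: "((\<lambda>\<xi>::plane. \<xi> \<bullet> \<xi>) has_derivative (\<lambda>v. 2 * (\<xi> \<bullet> v))) (at \<xi>)"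
    by (auto intro!: derivative_eq_intros simp: inner_commute)
  have 2: "((\<lambda>\<xi>::plane. inverse (\<xi> \<bullet> \<xi>)) has_derivative (\<lambda>v. - (inverse (\<xi> \<bullet> \<xi>) * (2 * (\<xi> \<bullet> v)) * inverse (\<xi> \<bullet> \<xi>)))) (at \<xi>)"
    by (rule Deriv.has_derivative_inverse[OF _ 1]) (use assms in simp)
  have 3: "(perp has_derivative perp) (at \<xi>)"
    by (rule bounded_linear_imp_has_derivative[OF bounded_linear_perp])
  have "((\<lambda>\<xi>. inverse (\<xi> \<bullet> \<xi>) *\<^sub>R perp \<xi>) has_derivative angrad' \<xi>) (at \<xi>)"
    by (rule has_derivative_eq_rhs[OF has_derivative_scaleR[OF 2 3]])
       (use assms in \<open>simp add: fun_eq_iff angrad'_def power2_norm_eq_inner[symmetric] divide_inverse power4_eq_xxxx power2_eq_square\<close>)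
  then show ?thesis by (simp add: angrad_def[abs_def] power2_norm_eq_inner)
qed

text \<open>\<open>angrad'\<close> is the Hessian of the polar angle, hence symmetric. This is what
  makes \<open>C_rel\<close> symplectic.\<close>

lemma angrad'_symmetric: "angrad' \<xi> v \<bullet> w = v \<bullet> angrad' \<xi> w"
proof (cases "\<xi> = 0")
  case False
  define n where "n = (norm \<xi>)\<^sup>2"
  have n1: "n \<noteq> 0" using False by (simp add: n_def)
  have n2: "n = \<xi> $ 1 * \<xi> $ 1 + \<xi> $ 2 * \<xi> $ 2"
    unfolding n_def norm_plane by (simp add: power2_eq_square)
  note n = n1 n2
  have n4: "(norm \<xi>) ^ 4 = n * n" by (simp add: n_def power4_eq_xxxx power2_eq_square)
  have e: "angrad' \<xi> v \<bullet> w = (n * (perp v \<bullet> w) - 2 * (\<xi> \<bullet> v) * (perp \<xi> \<bullet> w)) / (n * n)" for v w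
    using n(1) unfolding angrad'_def n4 n_def[symmetric]
    by (simp add: inner_diff_left field_simps)
  have "n * (perp v \<bullet> w) - 2 * (\<xi> \<bullet> v) * (perp \<xi> \<bullet> w) = n * (perp w \<bullet> v) - 2 * (\<xi> \<bullet> w) * (perp \<xi> \<bullet> v)"
    unfolding n(2) inner_plane by (simp add: algebra_simps)
  then show ?thesis by (simp only: e inner_commute[of v])
qed (simp add: angrad'_def)

definition shift :: "real \<Rightarrow> int \<Rightarrow> real" where
  "shift s k = 2 * pi * of_int k / s"

lemma C_rel_eq: "C_rel s k (x, \<xi>) = (x + shift s k *\<^sub>R angrad \<xi>, \<xi>)"
  by (simp add: C_rel_def shift_def angrad_def divide_inverse power2_eq_square mult_ac)

lemma open_cotangent0: "open cotangent0"
proof -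
  have eq: "cotangent0 = UNIV \<times> (- {0})" by (auto simp: cotangent0_def)
  show ?thesis unfolding eq by (intro open_Times open_UNIV open_Compl closed_singleton)
qed

text \<open>x is translated by a gradient in xi while xi stays fixed; the extra terms in the
  symplectic form cancel because the derivative of a gradient is symmetric.\<close>

lemma canonical_C_rel: "canonical_transformation (C_rel s k)"
  unfolding canonical_transformation_def
proof (intro conjI ballI allI)
  have C: "C_rel s k = (\<lambda>p. p + (shift s k *\<^sub>R angrad (snd p), 0))"
    by (auto simp: C_rel_eq)
  have bl: "bounded_linear (\<lambda>u::plane. (shift s k *\<^sub>R u, 0 :: plane))"
    by (intro bounded_linear_Pair bounded_linear_scaleR_right bounded_linear_zero)
  have sm: "smooth_on cotangent0 (\<lambda>p. angrad (snd p))"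
    by (rule smooth_on_compose[OF open_cotangent0 _ smooth_on_angrad])
       (auto simp: cotangent0_def intro!: smooth_on_bounded_linear bounded_linear_snd open_cotangent0[unfolded cotangent0_def])
  show "smooth_on cotangent0 (C_rel s k)"
    unfolding C
    by (intro smooth_on_add smooth_on_id open_cotangent0 smooth_on_bounded_linear_comp[OF bl _ sm])
  show "bij_betw (C_rel s k) cotangent0 cotangent0"
    by (rule bij_betw_byWitness[where f' = "\<lambda>(x, \<xi>). (x - shift s k *\<^sub>R angrad \<xi>, \<xi>)"])
       (auto simp: C_rel_eq cotangent0_def)
  fix \<rho> v w assume "\<rho> \<in> cotangent0"
  then have nz: "snd \<rho> \<noteq> 0" by (auto simp: cotangent0_def)
  have D: "((\<lambda>p. angrad (snd p)) has_derivative (\<lambda>v. angrad' (snd \<rho>) (snd v))) (at \<rho>)"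
    using has_derivative_compose[where f = snd and g = angrad,
        OF bounded_linear_imp_has_derivative[OF bounded_linear_snd] angrad_has_derivative[OF nz]] .
  have "((\<lambda>p. p + (shift s k *\<^sub>R angrad (snd p), 0)) has_derivative
      (\<lambda>v. v + (shift s k *\<^sub>R angrad' (snd \<rho>) (snd v), 0))) (at \<rho>)"
    by (intro has_derivative_add has_derivative_ident bounded_linear.has_derivative[OF bl D])
  from frechet_derivative_at[OF this, symmetric]
  show "symplectic_form (frechet_derivative (C_rel s k) (at \<rho>) v) (frechet_derivative (C_rel s k) (at \<rho>) w) =
      symplectic_form v w"
    unfolding C
    by (simp add: symplectic_form_def inner_add_left inner_add_right angrad'_symmetric)
qed

text \<open>The slit planes for \<open>e = 1\<close> and \<open>e = -1\<close> cover the punctured plane, and the angle has a smooth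
  branch on each.\<close>

definition slit :: "real \<Rightarrow> plane set" where
  "slit e = {\<xi>. \<xi> $ 2 \<noteq> 0 \<or> e * \<xi> $ 1 > 0}"

text \<open>For e = -1 the cut lies on the positive axis. The added pi undoes the half turn, so that
  the branch differs from the principal angle by 0 or 2 pi.\<close>

definition angle_branch :: "real \<Rightarrow> plane \<Rightarrow> real" where
  "angle_branch e \<xi> = polar_angle (e *\<^sub>R \<xi>) + (if e = 1 then 0 else pi)"

lemma open_slit: "open (slit e)"
  unfolding slit_def
  by (intro open_Collect_disj open_Collect_neq open_Collect_less continuous_intros)

lemma zero_notin_slit: "0 \<notin> slit e"
  by (simp add: slit_def)

lemma slit_scale: "e = 1 \<or> e = -1 \<Longrightarrow> \<xi> \<in> slit e \<longleftrightarrow> e *\<^sub>R \<xi> \<in> slit 1"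
  by (auto simp: slit_def)

text \<open>Off the cut the angle is the imaginary part of the complex logarithm.\<close>

lemma polar_angle_has_derivative:
  assumes "\<xi> \<in> slit 1"
  shows "(polar_angle has_derivative (\<lambda>v. angrad \<xi> \<bullet> v)) (at \<xi>)"
proof -
  let ?L = "\<lambda>\<xi>::plane. Complex (\<xi> $ 1) (\<xi> $ 2)"
  have bl: "bounded_linear ?L"
    unfolding linear_conv_bounded_linear[symmetric] by (rule linearI) (simp_all add: complex_eq_iff)
  have nn: "?L \<xi> \<notin> \<real>\<^sub>\<le>\<^sub>0" if "\<xi> \<in> slit 1" for \<xi>
    using that by (auto simp: slit_def complex_nonpos_Reals_iff)
  have D: "((\<lambda>\<xi>. Im (Ln (?L \<xi>))) has_derivative (\<lambda>v. Im (inverse (?L \<xi>) * ?L v))) (at \<xi>)"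
    using bounded_linear.has_derivative[OF bounded_linear_Im has_derivative_compose[OF
       bounded_linear_imp_has_derivative[OF bl]
       has_field_derivative_imp_has_derivative[OF has_field_derivative_Ln[OF nn[OF assms]]]]] .
  have "(\<lambda>v. Im (inverse (?L \<xi>) * ?L v)) = (\<lambda>v. angrad \<xi> \<bullet> v)"
  proof
    fix v
    have "Im (inverse (?L \<xi>) * ?L v) = (\<xi> $ 1 * v $ 2 - \<xi> $ 2 * v $ 1) / (norm \<xi>)\<^sup>2"
      by (simp add: norm_plane diff_divide_distrib)
    then show "Im (inverse (?L \<xi>) * ?L v) = angrad \<xi> \<bullet> v"
      by (simp add: angrad_def inner_plane divide_inverse algebra_simps)
  qed
  with D have "((\<lambda>\<xi>. Im (Ln (?L \<xi>))) has_derivative (\<lambda>v. angrad \<xi> \<bullet> v)) (at \<xi>)" by simp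
  moreover have "Im (Ln (?L \<xi>)) = polar_angle \<xi>" if "\<xi> \<in> slit 1" for \<xi>
  proof -
    have "?L \<xi> \<noteq> 0" using that by (auto simp: slit_def complex_eq_iff)
    then show ?thesis by (simp add: polar_angle_def Arg_eq_Im_Ln)
  qed
  ultimately show ?thesis
    using has_derivative_transform_within_open[OF _ open_slit assms] by blast
qed

lemma angle_branch_has_derivative:
  assumes e: "e = 1 \<or> e = -1" and "\<xi> \<in> slit e"
  shows "(angle_branch e has_derivative (\<lambda>v. angrad \<xi> \<bullet> v)) (at \<xi>)"
proof -
  have s: "e *\<^sub>R \<xi> \<in> slit 1" using assms slit_scale by blast
  have "((\<lambda>\<xi>. polar_angle (e *\<^sub>R \<xi>)) has_derivative (\<lambda>v. angrad (e *\<^sub>R \<xi>) \<bullet> (e *\<^sub>R v))) (at \<xi>)"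
    by (rule has_derivative_compose[where f = "\<lambda>\<xi>. e *\<^sub>R \<xi>" and f' = "\<lambda>v. e *\<^sub>R v" and g = polar_angle, OF _ polar_angle_has_derivative[OF s]])
       (auto intro!: derivative_eq_intros)
  then have "((\<lambda>\<xi>. polar_angle (e *\<^sub>R \<xi>) + (if e = 1 then 0 else pi)) has_derivative (\<lambda>v. angrad (e *\<^sub>R \<xi>) \<bullet> (e *\<^sub>R v) + 0)) (at \<xi>)"
    by (intro has_derivative_add has_derivative_const)
  moreover have "angrad (e *\<^sub>R \<xi>) \<bullet> (e *\<^sub>R v) = angrad \<xi> \<bullet> v" for v
    using e by (auto simp: angrad_def inner_plane)
  ultimately show ?thesis by (simp add: angle_branch_def[abs_def])
qed

lemma smooth_on_angle_branch:
  assumes e: "e = 1 \<or> e = -1"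
  shows "smooth_on (slit e) (angle_branch e)"
proof (rule smooth_on_derivI[OF open_slit angle_branch_has_derivative[OF e]])
  show "smooth_on (slit e) (\<lambda>x. angrad x \<bullet> v)" for v
    by (intro smooth_on_inner smooth_on_const open_slit smooth_on_subset[OF smooth_on_angrad])
       (use zero_notin_slit in auto)
qed

lemma exp_angle_branch:
  assumes e: "e = 1 \<or> e = -1" and \<xi>: "\<xi> \<in> slit e" and s: "s > 0" and h: "h \<in> h_values s"
  shows "exp (\<i> * of_real (shift s k * angle_branch e \<xi> / h)) =
    exp (2 * of_real pi * \<i> * of_int k * of_real (polar_angle \<xi>) / of_real (s * h))"
proof -
  obtain m where m: "h = pi / (s * real m)" "m \<ge> 1" using h by (auto simp: h_values_def)
  have kh: "shift s k / h = 2 * of_int k * real m"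
    using s m(2) unfolding shift_def m(1) by (simp add: field_simps)
  have rhs: "2 * of_real pi * \<i> * of_int k * of_real (polar_angle \<xi>) / of_real (s * h) =
      \<i> * of_real ((shift s k / h) * polar_angle \<xi>)"
    using s m(2) unfolding shift_def m(1) by (simp add: field_simps)
  have "\<exists>j::int. angle_branch e \<xi> = polar_angle \<xi> + of_int j * (2 * pi)"
  proof (cases "e = 1")
    case True
    then show ?thesis by (intro exI[of _ 0]) (simp add: angle_branch_def)
  next
    case False
    then have e: "e = -1" using e by simp
    let ?z = "Complex (\<xi> $ 1) (\<xi> $ 2)"
    have z: "?z \<noteq> 0" using \<xi> by (auto simp: slit_def complex_eq_iff)
    have mz: "Complex (- (\<xi> $ 1)) (- (\<xi> $ 2)) = - ?z" by (simp add: complex_eq_iff)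
    \<comment> \<open>The second branch has values in (0, 2 pi], so it exceeds the principal angle
      by 2 pi exactly when the latter is not positive.\<close>
    show ?thesis
      by (rule exI[of _ "if Arg ?z \<le> 0 then 1 else 0"])
         (simp add: angle_branch_def polar_angle_def e mz Arg_minus[OF z])
  qed
  then obtain j where j: "angle_branch e \<xi> = polar_angle \<xi> + of_int j * (2 * pi)" by blast
  define N where "N = 2 * k * int m * j"
  have "shift s k * angle_branch e \<xi> / h = (shift s k / h) * angle_branch e \<xi>" by simp
  also have "\<dots> = (shift s k / h) * polar_angle \<xi> + of_int N * (pi * 2)"
    unfolding j kh N_def by (simp add: algebra_simps)
  finally have r: "shift s k * angle_branch e \<xi> / h = (shift s k / h) * polar_angle \<xi> + of_int N * (pi * 2)" .
  have "\<i> * complex_of_real ((shift s k / h) * polar_angle \<xi> + of_int N * (pi * 2)) =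
      \<i> * of_real ((shift s k / h) * polar_angle \<xi>) + \<i> * (of_int N * (of_real pi * 2))"
    by (simp add: distrib_left)
  then show ?thesis unfolding rhs r by (simp only: exp_plus_2pin)
qed

section \<open>Phases and amplitudes\<close>

definition phase :: "real \<Rightarrow> real \<Rightarrow> plane \<times> plane \<times> plane \<Rightarrow> real" where
  "phase \<kappa> e = (\<lambda>(x, y, \<theta>). (x - y) \<bullet> \<theta> + \<kappa> * angle_branch e \<theta>)"

definition slit3 :: "real \<Rightarrow> (plane \<times> plane \<times> plane) set" where
  "slit3 e = UNIV \<times> UNIV \<times> slit e"

lemma open_slit3: "open (slit3 e)"
  unfolding slit3_def by (intro open_Times open_slit open_UNIV)

lemmas bl3 = bounded_linear_fst bounded_linear_compose[OF bounded_linear_fst bounded_linear_snd]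
  bounded_linear_compose[OF bounded_linear_snd bounded_linear_snd]

lemma phase_has_derivative:
  assumes e: "e = 1 \<or> e = -1" and p: "p \<in> slit3 e"
  shows "(phase \<kappa> e has_derivative (\<lambda>(u, v, w). (u - v) \<bullet> snd (snd p) +
     (fst p - fst (snd p) + \<kappa> *\<^sub>R angrad (snd (snd p))) \<bullet> w)) (at p)"
proof -
  have t: "snd (snd p) \<in> slit e" using p by (auto simp: slit3_def)
  have P: "phase \<kappa> e = (\<lambda>p. (fst p - fst (snd p)) \<bullet> snd (snd p) + \<kappa> * angle_branch e (snd (snd p)))"
    by (auto simp: phase_def)
  have 1: "((\<lambda>p::plane \<times> plane \<times> plane. fst p - fst (snd p)) has_derivative (\<lambda>q. fst q - fst (snd q))) (at p)"
    by (intro bounded_linear_imp_has_derivative bounded_linear_sub bl3)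
  have 2: "((\<lambda>p::plane \<times> plane \<times> plane. snd (snd p)) has_derivative (\<lambda>q. snd (snd q))) (at p)"
    by (intro bounded_linear_imp_has_derivative bl3)
  note 3 = has_derivative_mult_right[OF has_derivative_compose[OF 2 angle_branch_has_derivative[OF e t]], of \<kappa>]
  show ?thesis
    unfolding P
    by (rule has_derivative_eq_rhs[OF has_derivative_add[OF has_derivative_inner[OF 1 2] 3]])
       (auto simp: fun_eq_iff inner_add_left)
qed

lemma phase_gradients:
  assumes e: "e = 1 \<or> e = -1" and p: "p \<in> slit3 e"
  shows "grad_x (phase \<kappa> e) p = snd (snd p)" "grad_y (phase \<kappa> e) p = - snd (snd p)"
    "grad_theta (phase \<kappa> e) p = fst p - fst (snd p) + \<kappa> *\<^sub>R angrad (snd (snd p))"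
  using frechet_derivative_at[OF phase_has_derivative[OF assms], symmetric]
  by (simp_all add: grad_x_def grad_y_def grad_theta_def vec_eq_iff inner_axis inner_axis')

lemma phase_for_phase:
  assumes e: "e = 1 \<or> e = -1"
  shows "phase_for (C_rel s k) (slit3 e) (phase (shift s k) e)"
  unfolding phase_for_def
proof (intro conjI ballI allI impI)
  let ?\<Phi> = "phase (shift s k) e"
  show "open (slit3 e)" by (rule open_slit3)
  have P: "?\<Phi> = (\<lambda>p. (fst p - fst (snd p)) \<bullet> snd (snd p) + shift s k * angle_branch e (snd (snd p)))"
    by (auto simp: phase_def)
  have "smooth_on (slit3 e) (\<lambda>p. angle_branch e (snd (snd p)))"
    by (rule smooth_on_compose[OF open_slit3 _ smooth_on_angle_branch[OF e]])
       (auto simp: slit3_def intro!: smooth_on_bounded_linear bl3 open_slit3[unfolded slit3_def])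
  note sm = this
  show "smooth_on (slit3 e) ?\<Phi>"
    unfolding P
    by (rule smooth_on_add[OF open_slit3
          smooth_on_inner[OF open_slit3 smooth_on_bounded_linear[OF bounded_linear_sub[OF bl3(1,2)] open_slit3]
            smooth_on_bounded_linear[OF bl3(3) open_slit3]]
          smooth_on_mult[OF open_slit3 smooth_on_const[OF open_slit3] sm]])
  \<comment> \<open>x and y are components of the relation, and theta is recovered as the gradient
    in x.\<close>
  show "inj_on (phase_relation ?\<Phi>) (critical_set (slit3 e) ?\<Phi>)"
    by (rule inj_onI)
       (auto simp: phase_relation_def critical_set_def phase_gradients[OF e] prod_eq_iff)
  show "phase_relation ?\<Phi> ` critical_set (slit3 e) ?\<Phi> \<subseteq> {(\<rho>, C_rel s k \<rho>) |\<rho>. \<rho> \<in> cotangent0}"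
  proof
    fix q assume "q \<in> phase_relation ?\<Phi> ` critical_set (slit3 e) ?\<Phi>"
    then obtain p where p: "p \<in> slit3 e" "grad_theta ?\<Phi> p = 0" "q = phase_relation ?\<Phi> p"
      by (auto simp: critical_set_def)
    obtain x y \<theta> where xy: "p = (x, y, \<theta>)" by (cases p) auto
    have "x - y + shift s k *\<^sub>R angrad \<theta> = 0" using p(2) phase_gradients(3)[OF e p(1)] xy by simp
    then have "y = x + shift s k *\<^sub>R angrad \<theta>" by (simp add: algebra_simps)
    moreover have "\<theta> \<noteq> 0" using p(1) xy zero_notin_slit by (auto simp: slit3_def)
    moreover have "q = ((x, \<theta>), (y, \<theta>))"
      using p(3) phase_gradients[OF e p(1)] xy by (simp add: phase_relation_def)
    ultimately show "q \<in> {(\<rho>, C_rel s k \<rho>) |\<rho>. \<rho> \<in> cotangent0}"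
      by (auto simp: C_rel_eq cotangent0_def)
  qed
  fix p c assume p: "p \<in> critical_set (slit3 e) ?\<Phi>"
    and z: "\<forall>w. frechet_derivative (\<lambda>q. c \<bullet> grad_theta ?\<Phi> q) (at p) w = 0"
  have ps: "p \<in> slit3 e" using p by (auto simp: critical_set_def)
  then have nz: "snd (snd p) \<noteq> 0" using zero_notin_slit by (auto simp: slit3_def)
  have 1: "((\<lambda>p::plane \<times> plane \<times> plane. fst p - fst (snd p)) has_derivative (\<lambda>q. fst q - fst (snd q))) (at p)"
    by (intro bounded_linear_imp_has_derivative bounded_linear_sub bl3)
  have 2: "((\<lambda>p::plane \<times> plane \<times> plane. snd (snd p)) has_derivative (\<lambda>q. snd (snd q))) (at p)"
    by (intro bounded_linear_imp_has_derivative bl3)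
  have "((\<lambda>q. c \<bullet> (fst q - fst (snd q) + shift s k *\<^sub>R angrad (snd (snd q)))) has_derivative
      (\<lambda>q. c \<bullet> (fst q - fst (snd q) + shift s k *\<^sub>R angrad' (snd (snd p)) (snd (snd q))))) (at p)"
    by (intro has_derivative_inner_right has_derivative_add 1 has_derivative_scaleR_right
          has_derivative_compose[OF 2 angrad_has_derivative[OF nz]])
  then have "((\<lambda>q. c \<bullet> grad_theta ?\<Phi> q) has_derivative
      (\<lambda>q. c \<bullet> (fst q - fst (snd q) + shift s k *\<^sub>R angrad' (snd (snd p)) (snd (snd q))))) (at p)"
    by (rule has_derivative_transform_within_open[OF _ open_slit3 ps]) (simp add: phase_gradients[OF e])
  \<comment> \<open>Testing with the direction that moves x by c alone: the derivative of the
    theta-gradient in x is the identity, so c is orthogonal to itself.\<close>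
  from frechet_derivative_at[OF this, symmetric] z[rule_format, of "(c, 0, 0)"]
  have "c \<bullet> (c + shift s k *\<^sub>R angrad' (snd (snd p)) 0) = 0" by simp
  then show "c = 0" by (simp add: angrad'_def plane_eq_iff inner_plane)
qed

definition amp :: "(plane \<Rightarrow> complex) \<Rightarrow> (plane \<Rightarrow> complex) \<Rightarrow> (plane \<Rightarrow> complex) \<Rightarrow> plane \<times> plane \<times> plane \<Rightarrow> complex" where
  "amp \<chi>1 b \<chi>2 = (\<lambda>(x, y, \<theta>). \<chi>1 x * b \<theta> * \<chi>2 y)"

text \<open>The amplitude does not depend on h, so the uniform bounds are those of a single function
  of compact support.\<close>

lemma amplitude0_amp:
  assumes "test_function UNIV \<chi>1" "test_function (slit e) b" "test_function UNIV \<chi>2"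
  shows "amplitude0 H (slit3 e) (\<lambda>h. amp \<chi>1 b \<chi>2)"
proof -
  obtain K1 K2 K where K: "compact K1" "\<And>x. x \<notin> K1 \<Longrightarrow> \<chi>1 x = 0" "compact K2" "\<And>x. x \<notin> K2 \<Longrightarrow> \<chi>2 x = 0"
    "compact K" "K \<subseteq> slit e" "\<And>x. x \<notin> K \<Longrightarrow> b x = 0"
    using assms by (auto simp: test_function_def)
  have A: "amp \<chi>1 b \<chi>2 = (\<lambda>p. \<chi>1 (fst p) * b (snd (snd p)) * \<chi>2 (fst (snd p)))" by (auto simp: amp_def)
  have sm: "smooth_on UNIV (amp \<chi>1 b \<chi>2)"
  proof -
    have "smooth_on UNIV \<chi>1" "smooth_on UNIV b" "smooth_on UNIV \<chi>2"
      using assms by (auto simp: test_function_def)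
    note c = this[THEN smooth_on_compose[OF open_UNIV subset_UNIV]]
    show ?thesis
      unfolding A
      by (rule smooth_on_mult[OF open_UNIV smooth_on_mult[OF open_UNIV]], (rule c, rule smooth_on_bounded_linear[OF _ open_UNIV], rule bl3)+)
  qed
  have cK: "compact (K1 \<times> K2 \<times> K)" using K by (intro compact_Times)
  have z: "amp \<chi>1 b \<chi>2 p = 0" if "p \<notin> K1 \<times> K2 \<times> K" for p
    using that K by (cases p) (auto simp: amp_def)
  show ?thesis
    unfolding amplitude0_def
  proof (intro conjI allI impI ballI sm)
    show "\<exists>K. compact K \<and> K \<subseteq> slit3 e \<and> (\<forall>h\<in>H. \<forall>p. p \<notin> K \<longrightarrow> amp \<chi>1 b \<chi>2 p = 0)"
      using cK z K by (intro exI[of _ "K1 \<times> K2 \<times> K"]) (auto simp: slit3_def)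
    show "\<exists>C. \<forall>h\<in>H. \<forall>p. norm (iter_deriv vs (amp \<chi>1 b \<chi>2) p) \<le> C" if "set vs \<subseteq> Basis" for vs
      using iter_deriv_bounded[OF sm cK z that] by blast
  qed
qed

lemma negligible_zero: "negligible_kernel H (\<lambda>_ _. 0)"
  unfolding negligible_kernel_def
  by (auto simp: iter_deriv_zero intro: smooth_on_const exI[of _ "{}"] exI[of _ 0])

lemma test_function_L12:
  fixes b :: "plane \<Rightarrow> complex"
  assumes "test_function S b"
  shows "b \<in> L12" "\<exists>M. \<forall>x. norm (b x) \<le> M" "b \<in> borel_measurable borel"
proof -
  obtain K where K: "compact K" "\<And>x. x \<notin> K \<Longrightarrow> b x = 0" and sm: "smooth_on UNIV b"
    using assms by (auto simp: test_function_def)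
  obtain M where M: "\<And>x. norm (b x) \<le> M"
    using iter_deriv_bounded[OF sm K, of "[]"] by auto
  then show "\<exists>M. \<forall>x. norm (b x) \<le> M" by blast
  show bm[measurable]: "b \<in> borel_measurable borel"
    by (intro borel_measurable_continuous_onI smooth_on_UNIV_continuous sm)
  have Kb: "K \<in> sets borel" "emeasure lborel K < \<infinity>"
    using K(1) emeasure_bounded_finite[OF compact_imp_bounded[OF K(1)]] by (auto intro: borel_compact)
  have 1: "integrable lborel (\<lambda>x. indicator K x * C :: real)" for C
    using Kb by (intro integrable_mult_left integrable_real_indicator) auto
  have "integrable lborel b"
    by (rule Bochner_Integration.integrable_bound[OF 1[of M]])
       (use K M order_trans[OF norm_ge_zero M] in \<open>auto simp: indicator_def intro!: AE_I2\<close>)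
  moreover have "integrable lborel (\<lambda>x. (norm (b x))\<^sup>2)"
    by (rule Bochner_Integration.integrable_bound[OF 1[of "M\<^sup>2"]])
       (use K M in \<open>auto simp: indicator_def intro!: AE_I2 power_mono\<close>)
  ultimately show "b \<in> L12" by (simp add: L12_def L2_def)
qed

text \<open>The three multipliers compose to the single compactly supported symbol b1 a b2, so the
  output is an absolutely convergent inverse Fourier integral. Duality then exchanges the frequency
  integral with the integral over the input variable.\<close>

lemma microlocalized_multiplier_kernel:
  assumes cut: "microlocal_cutoffs \<chi>1 b1 b2 \<chi>2" and h: "h > 0"
    and a[measurable]: "a \<in> borel_measurable borel" and a1: "\<And>\<xi>. norm (a \<xi>) \<le> 1"
  shows "has_kernel (microlocalized h \<chi>1 b1 b2 \<chi>2 (fourier_multiplier h a))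
    (\<lambda>(x, y). 1 / of_real ((2 * pi * h)\<^sup>2) * (\<chi>1 x * \<chi>2 y) *
       (LINT \<theta>|lborel. exp (\<i> * of_real (((x - y) \<bullet> \<theta>) / h)) * (b1 \<theta> * (a \<theta> * b2 \<theta>))))"
  unfolding has_kernel_def
proof
  fix u assume u: "u \<in> L2"
  have t: "test_function UNIV \<chi>1" "test_function UNIV \<chi>2" "test_function (- {0}) b1" "test_function (- {0}) b2"
    using cut by (auto simp: microlocal_cutoffs_def)
  note [measurable] = test_function_L12(3)[OF t(1)] test_function_L12(3)[OF t(2)]
    test_function_L12(3)[OF t(3)] test_function_L12(3)[OF t(4)]
  obtain M1 M2 M3 where M: "\<And>x. norm (b1 x) \<le> M1" "\<And>x. norm (b2 x) \<le> M2" "\<And>x. norm (\<chi>2 x) \<le> M3"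
    using test_function_L12(2)[OF t(3)] test_function_L12(2)[OF t(4)] test_function_L12(2)[OF t(2)] by blast
  let ?c = "- 1 / h"
  define v where "v = (\<lambda>y. \<chi>2 y * u y)"
  have v: "v \<in> L12"
    unfolding v_def L12_def
    using L2_mult_bounded[OF u _ M(3)] L2_mult_integrable[OF L12_D(1)[OF test_function_L12(1)[OF t(2)]] u] by simp
  define m where "m = (\<lambda>\<theta>. b1 \<theta> * (a \<theta> * b2 \<theta>))"
  have m_L12: "m \<in> L12"
  proof -
    have "norm (b1 x * a x) \<le> M1" for x
      using mult_mono[OF M(1)[of x] a1[of x]] order_trans[OF norm_ge_zero M(1)] by (simp add: norm_mult)
    then have "(\<lambda>x. (b1 x * a x) * b2 x) \<in> L2"
      by (intro L2_mult_bounded L12_D(1)[OF test_function_L12(1)[OF t(4)]]) auto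
    moreover have "(\<lambda>x. a x * b2 x) \<in> L2"
      by (intro L2_mult_bounded[OF _ a a1] L12_D(1)[OF test_function_L12(1)[OF t(4)]])
    then have "integrable lborel (\<lambda>x. b1 x * (a x * b2 x))"
      by (intro L2_mult_integrable L12_D(1)[OF test_function_L12(1)[OF t(3)]])
    ultimately show ?thesis by (simp add: L12_def m_def mult.assoc)
  qed
  let ?g = "fourier_multiplier h b1 (fourier_multiplier h a (fourier_multiplier h b2 v))"
  have "fourier_pair ?c v (ft ?c v)" using h by (intro fourier_pair_ft v) auto
  then have g: "fourier_pair ?c ?g (\<lambda>\<xi>. m \<xi> * ft ?c v \<xi>)"
    using fourier_pair_fourier_multiplier[OF h _ M(1) fourier_pair_fourier_multiplier[OF h a a1 fourier_pair_fourier_multiplier[OF h _ M(2)]]]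
    by (simp add: m_def mult.assoc)
  have vc: "ft ?c v \<in> L2" using h by (intro ft_L2 v) auto
  have i: "integrable lborel (\<lambda>\<xi>. m \<xi> * ft ?c v \<xi>)"
    by (rule L2_mult_integrable[OF L12_D(1)[OF m_L12] vc])
  have "AE x in lborel. ?g x = ft (1 / h) (\<lambda>\<xi>. m \<xi> * ft ?c v \<xi>) x / of_real ((2 * pi * h)\<^sup>2)"
    by (rule fourier_multiplier_integral[OF h v g i])
  then show "AE x in lborel. microlocalized h \<chi>1 b1 b2 \<chi>2 (fourier_multiplier h a) u x =
      (LINT y|lborel. (case (x, y) of (x, y) \<Rightarrow> 1 / of_real ((2 * pi * h)\<^sup>2) * (\<chi>1 x * \<chi>2 y) *
       (LINT \<theta>|lborel. exp (\<i> * of_real (((x - y) \<bullet> \<theta>) / h)) * (b1 \<theta> * (a \<theta> * b2 \<theta>)))) * u y)"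
  proof eventually_elim
    case (elim x)
    \<comment> \<open>The symbol times the outgoing wave at x. Its transform in y is the kernel up
      to the cutoffs and the constant.\<close>
    define e where "e = (\<lambda>\<theta>. exp (\<i> * of_real ((1 / h) * (\<theta> \<bullet> x))) * m \<theta>)"
    have e: "integrable lborel e" unfolding e_def by (rule ft_integrand[OF L12_D(2)[OF m_L12]])
    have "ft (1 / h) (\<lambda>\<xi>. m \<xi> * ft ?c v \<xi>) x = (LINT \<theta>|lborel. ft ?c v \<theta> * e \<theta>)"
      unfolding ft_def[of "1 / h"] e_def by (intro Bochner_Integration.integral_cong) (simp_all only: mult_ac)
    also have "\<dots> = (LINT y|lborel. v y * ft ?c e y)"
      by (rule ft_duality[OF L12_D(2)[OF v] e])
    finally have 1: "ft (1 / h) (\<lambda>\<xi>. m \<xi> * ft ?c v \<xi>) x = (LINT y|lborel. v y * ft ?c e y)" .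
    have 2: "ft ?c e y = (LINT \<theta>|lborel. exp (\<i> * of_real (((x - y) \<bullet> \<theta>) / h)) * m \<theta>)" for y
      unfolding ft_def
    proof (rule Bochner_Integration.integral_cong)
      fix \<theta>
      have "\<i> * of_real (((x - y) \<bullet> \<theta>) / h) = \<i> * of_real (?c * (\<theta> \<bullet> y)) + \<i> * complex_of_real ((1 / h) * (\<theta> \<bullet> x))"
      proof -
        have "((x - y) \<bullet> \<theta>) / h = ?c * (\<theta> \<bullet> y) + (1 / h) * (\<theta> \<bullet> x)"
          by (simp add: inner_diff_left diff_divide_distrib inner_commute[of \<theta>])
        then show ?thesis by (simp only: distrib_left of_real_add)
      qed
      then show "exp (\<i> * of_real (?c * (\<theta> \<bullet> y))) * e \<theta> = exp (\<i> * of_real (((x - y) \<bullet> \<theta>) / h)) * m \<theta>"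
        by (simp only: e_def exp_add mult.assoc)
    qed simp
    have "microlocalized h \<chi>1 b1 b2 \<chi>2 (fourier_multiplier h a) u x =
        (1 / of_real ((2 * pi * h)\<^sup>2) * \<chi>1 x) * (LINT y|lborel. v y * ft ?c e y)"
      unfolding microlocalized_def v_def[symmetric] elim 1 by simp
    also have "\<dots> = (LINT y|lborel. (1 / of_real ((2 * pi * h)\<^sup>2) * \<chi>1 x) * (v y * ft ?c e y))"
      by (rule Bochner_Integration.integral_mult_right_zero[symmetric])
    finally show ?case
      unfolding 2 v_def m_def by (simp add: mult_ac)
  qed
qed

section \<open>The multipliers as Fourier integral operators\<close>

lemma slit_sgn_minus: "\<xi> \<notin> slit 1 \<longleftrightarrow> \<xi> $ 2 = 0 \<and> \<xi> $ 1 \<le> 0"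
  by (auto simp: slit_def)

lemma polar_angle_measurable [measurable]: "polar_angle \<in> borel_measurable borel"
proof -
  have "continuous_on (slit 1) polar_angle"
    by (meson continuous_at_imp_continuous_on has_derivative_continuous polar_angle_has_derivative)
  then have [measurable]: "(\<lambda>\<xi>. indicator (slit 1) \<xi> *\<^sub>R polar_angle \<xi>) \<in> borel_measurable borel"
    by (intro borel_measurable_continuous_on_indicator borel_open open_slit)
  have [measurable]: "slit 1 \<in> sets borel" by (intro borel_open open_slit)
  \<comment> \<open>Continuous off the cut; on the cut the angle is the constant pi, except that
    \<open>Arg\<close> is 0 at the origin.\<close>
  have "polar_angle = (\<lambda>\<xi>. indicator (slit 1) \<xi> *\<^sub>R polar_angle \<xi> + pi * indicator (- slit 1 - {0}) \<xi>)"
  proof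
    fix \<xi> :: plane
    have "polar_angle \<xi> = pi" if "\<xi> \<notin> slit 1" "\<xi> \<noteq> 0"
    proof -
      have "\<xi> $ 2 = 0" "\<xi> $ 1 \<le> 0" using that(1) unfolding slit_sgn_minus by simp_all
      moreover have "\<xi> $ 1 \<noteq> 0" using that(2) calculation(1) by (auto simp: plane_eq_iff)
      ultimately have "Complex (\<xi> $ 1) (\<xi> $ 2) = of_real (\<xi> $ 1)" "\<xi> $ 1 < 0" by (auto simp: complex_eq_iff)
      then show ?thesis unfolding polar_angle_def by (simp add: Arg_of_real)
    qed
    moreover have "polar_angle 0 = 0" by (simp add: polar_angle_def Complex_eq Arg_zero)
    ultimately show "polar_angle \<xi> = indicator (slit 1) \<xi> *\<^sub>R polar_angle \<xi> + pi * indicator (- slit 1 - {0}) \<xi>"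
      using zero_notin_slit by (auto simp: indicator_def)
  qed
  moreover have "(\<lambda>\<xi>. indicator (slit 1) \<xi> *\<^sub>R polar_angle \<xi> + pi * indicator (- slit 1 - {0}) \<xi>) \<in> borel_measurable borel"
    by measurable
  ultimately show ?thesis by simp
qed

definition angle_mult :: "real \<Rightarrow> int \<Rightarrow> real \<Rightarrow> plane \<Rightarrow> complex" where
  "angle_mult s k h \<xi> = exp (2 * of_real pi * \<i> * of_int k * of_real (polar_angle \<xi>) / of_real (s * h))"

lemma calA_eq: "calA s k h = fourier_multiplier h (angle_mult s k h)"
  by (simp add: calA_def angle_mult_def[abs_def])

lemma angle_mult_measurable [measurable]: "angle_mult s k h \<in> borel_measurable borel"
  unfolding angle_mult_def by measurable

lemma angle_mult_eq: "angle_mult s k h \<xi> = exp (\<i> * of_real (2 * pi * of_int k * polar_angle \<xi> / (s * h)))"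
  by (simp add: angle_mult_def mult_ac)

lemma norm_angle_mult: "norm (angle_mult s k h \<xi>) = 1"
  unfolding angle_mult_eq by (rule norm_exp_i_times)

lemma h_values_pos: "s > 0 \<Longrightarrow> h \<in> h_values s \<Longrightarrow> h > 0"
  by (auto simp: h_values_def)

lemma unitary_calA: "s > 0 \<Longrightarrow> h \<in> h_values s \<Longrightarrow> unitary_L2 (calA s k h)"
  unfolding calA_eq by (rule unitary_fourier_multiplier[OF h_values_pos angle_mult_measurable norm_angle_mult])

lemma test_function_mult:
  assumes "test_function S b" "smooth_on UNIV g" "closed C" "\<And>x. x \<notin> C \<Longrightarrow> g x = 0"
    and "\<And>K. K \<subseteq> S \<Longrightarrow> (\<And>x. x \<notin> K \<Longrightarrow> b x = 0) \<Longrightarrow> compact K \<Longrightarrow> K \<inter> C \<subseteq> T"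
  shows "test_function T (\<lambda>x. b x * g x)"
proof -
  obtain K where K: "compact K" "K \<subseteq> S" "\<And>x. x \<notin> K \<Longrightarrow> b x = 0" and b: "smooth_on UNIV b"
    using assms(1) by (auto simp: test_function_def)
  show ?thesis
    unfolding test_function_def
  proof (intro conjI exI[of _ "K \<inter> C"] allI impI)
    show "smooth_on UNIV (\<lambda>x. b x * g x)" by (intro smooth_on_mult b assms open_UNIV)
    show "compact (K \<inter> C)" by (intro compact_Int_closed K assms)
    show "K \<inter> C \<subseteq> T" by (rule assms(5)) (use K in auto)
    show "b x * g x = 0" if "x \<notin> K \<inter> C" for x using that K(3) assms(4) by auto
  qed
qed

text \<open>A smooth step in the first coordinate splits b. A point of the support on the horizontal
  axis has |xi_1| = |xi| >= r > d, so the step is already constant there, and each piece avoids the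
  cut of its branch.\<close>

lemma test_function_slit_split:
  assumes b: "test_function (- {0}) b"
  obtains b1 b2 where "test_function (slit 1) b1" "test_function (slit (- 1)) b2" "\<And>x. b x = b1 x + b2 x"
proof -
  obtain K where K: "compact K" "K \<subseteq> - {0}" "\<And>x. x \<notin> K \<Longrightarrow> b x = 0" and sm: "smooth_on UNIV b"
    using b by (auto simp: test_function_def)
  obtain r where r: "r > 0" "\<And>x. x \<in> K \<Longrightarrow> r \<le> norm x"
  proof (cases "K = {}")
    case True
    then show ?thesis using that[of 1] by simp
  next
    case False
    obtain x where x: "x \<in> K" "\<And>y. y \<in> K \<Longrightarrow> norm x \<le> norm y"
      using continuous_attains_inf[OF K(1) False, of norm] by (auto intro: continuous_intros)
    then show ?thesis using that[of "norm x"] K(2) by auto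
  qed
  define d where "d = r / 2"
  have d: "d > 0" "d < r" using r by (auto simp: d_def)
  let ?e = "\<lambda>\<xi>::plane. complex_of_real (smooth_step d (\<xi> $ 1))"
  have e: "smooth_on UNIV ?e"
    by (intro smooth_on_of_real open_UNIV smooth_on_compose[OF open_UNIV subset_UNIV smooth_on_smooth_step[OF d(1)]]
          smooth_on_bounded_linear bounded_linear_vec_nth)
  have K': "b x = 0" if "x \<notin> K" for x using that K by blast
  have nr: "norm x = \<bar>x $ 1\<bar>" if "x $ 2 = 0" for x :: plane
  proof -
    have "(norm x)\<^sup>2 = \<bar>x $ 1\<bar>\<^sup>2" using that norm_plane[of x] by simp
    then show ?thesis by (rule power2_eq_imp_eq) auto
  qed
  \<comment> \<open>b is regarded as a test function on its own support, so that the compact sets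
    considered in \<open>test_function_mult\<close> keep the distance r from the origin.\<close>
  have bK: "test_function K b" unfolding test_function_def using K sm by blast
  have "test_function (slit 1) (\<lambda>x. b x * ?e x)"
  proof (rule test_function_mult[OF bK e, of "{\<xi>. \<xi> $ 1 \<ge> - d}"])
    show "closed {\<xi>::plane. \<xi> $ 1 \<ge> - d}" by (intro closed_Collect_le continuous_intros)
    show "?e x = 0" if "x \<notin> {\<xi>. \<xi> $ 1 \<ge> - d}" for x using that by (simp add: smooth_step_eq_0)
    show "K' \<inter> {\<xi>. \<xi> $ 1 \<ge> - d} \<subseteq> slit 1" if "K' \<subseteq> K" for K'
    proof
      fix x assume x: "x \<in> K' \<inter> {\<xi>. \<xi> $ 1 \<ge> - d}"
      then have "r \<le> norm x" using that r by auto
      then show "x \<in> slit 1" using x d nr[of x] by (cases "x $ 2 = 0") (auto simp: slit_def)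
    qed
  qed
  moreover have "test_function (slit (- 1)) (\<lambda>x. b x * (1 - ?e x))"
  proof (rule test_function_mult[OF bK, of _ "{\<xi>. \<xi> $ 1 \<le> d}"])
    show "smooth_on UNIV (\<lambda>x. 1 - ?e x)" by (intro smooth_on_diff smooth_on_const e open_UNIV)
    show "closed {\<xi>::plane. \<xi> $ 1 \<le> d}" by (intro closed_Collect_le continuous_intros)
    show "1 - ?e x = 0" if "x \<notin> {\<xi>. \<xi> $ 1 \<le> d}" for x using that d by (simp add: smooth_step_eq_1)
    show "K' \<inter> {\<xi>. \<xi> $ 1 \<le> d} \<subseteq> slit (- 1)" if "K' \<subseteq> K" for K'
    proof
      fix x assume x: "x \<in> K' \<inter> {\<xi>. \<xi> $ 1 \<le> d}"
      then have "r \<le> norm x" using that r by auto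
      then show "x \<in> slit (- 1)" using x d nr[of x] by (cases "x $ 2 = 0") (auto simp: slit_def)
    qed
  qed
  ultimately show ?thesis by (rule that) (simp add: algebra_simps)
qed

lemma test_function_product:
  assumes "test_function S b1" "test_function S b2"
  shows "test_function S (\<lambda>x. b1 x * b2 x)"
proof -
  obtain K where K: "compact K" "K \<subseteq> S" "\<And>x. x \<notin> K \<Longrightarrow> b2 x = 0"
    using assms(2) by (auto simp: test_function_def)
  show ?thesis
    by (rule test_function_mult[OF assms(1) _ compact_imp_closed[OF K(1)] K(3)])
       (use assms K in \<open>auto simp: test_function_def\<close>)
qed

text \<open>On the slit plane the exponential of the angular part of the phase equals the
  multiplier, whichever branch is used; elsewhere the amplitude vanishes.\<close>

lemma oscillatory_kernel_amp:
  assumes e: "e = 1 \<or> e = -1" and s: "s > 0" and h: "h \<in> h_values s" and b: "test_function (slit e) b"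
  shows "oscillatory_kernel h (phase (shift s k) e) (amp \<chi>1 b \<chi>2) (x, y) =
    1 / of_real ((2 * pi * h)\<^sup>2) * (\<chi>1 x * \<chi>2 y) *
       (LINT \<theta>|lborel. exp (\<i> * of_real (((x - y) \<bullet> \<theta>) / h)) * (angle_mult s k h \<theta> * b \<theta>))"
    "integrable lborel (\<lambda>\<theta>. exp (\<i> * of_real (((x - y) \<bullet> \<theta>) / h)) * (angle_mult s k h \<theta> * b \<theta>))"
proof -
  have "exp (\<i> * of_real (phase (shift s k) e (x, y, \<theta>) / h)) * amp \<chi>1 b \<chi>2 (x, y, \<theta>) =
      (\<chi>1 x * \<chi>2 y) * (exp (\<i> * of_real (((x - y) \<bullet> \<theta>) / h)) * (angle_mult s k h \<theta> * b \<theta>))" for \<theta>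
  proof (cases "\<theta> \<in> slit e")
    case True
    have "\<i> * complex_of_real (phase (shift s k) e (x, y, \<theta>) / h) =
        \<i> * of_real (((x - y) \<bullet> \<theta>) / h) + \<i> * of_real (shift s k * angle_branch e \<theta> / h)"
      by (simp add: phase_def add_divide_distrib distrib_left)
    then show ?thesis
      by (simp only: exp_add exp_angle_branch[OF e True s h] angle_mult_def[symmetric]) (simp add: amp_def)
  next
    case False
    then have "b \<theta> = 0" using b by (auto simp: test_function_def)
    then show ?thesis by (simp add: amp_def)
  qed
  then show "oscillatory_kernel h (phase (shift s k) e) (amp \<chi>1 b \<chi>2) (x, y) =
    1 / of_real ((2 * pi * h)\<^sup>2) * (\<chi>1 x * \<chi>2 y) *
       (LINT \<theta>|lborel. exp (\<i> * of_real (((x - y) \<bullet> \<theta>) / h)) * (angle_mult s k h \<theta> * b \<theta>))"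
    by (simp add: oscillatory_kernel_def)
  note [measurable] = test_function_L12(3)[OF b]
  show "integrable lborel (\<lambda>\<theta>. exp (\<i> * of_real (((x - y) \<bullet> \<theta>) / h)) * (angle_mult s k h \<theta> * b \<theta>))"
  proof (rule Bochner_Integration.integrable_bound[OF L12_D(2)[OF test_function_L12(1)[OF b]]])
    show "AE \<theta> in lborel. norm (exp (\<i> * of_real (((x - y) \<bullet> \<theta>) / h)) * (angle_mult s k h \<theta> * b \<theta>)) \<le> norm (b \<theta>)"
      unfolding norm_mult norm_exp_i_times norm_angle_mult by simp
  qed measurable
qed

theorem elliptic_FIO_calA:
  assumes s: "s > 0"
  shows "elliptic_semiclassical_FIO0 (h_values s) (C_rel s k) (calA s k)"
  unfolding elliptic_semiclassical_FIO0_def semiclassical_FIO0_def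
proof (intro conjI canonical_C_rel allI impI ballI)
  fix \<chi>1 b1 b2 \<chi>2 assume cut: "microlocal_cutoffs \<chi>1 b1 b2 \<chi>2"
  then have t: "test_function UNIV \<chi>1" "test_function UNIV \<chi>2" "test_function (- {0}) (\<lambda>\<theta>. b1 \<theta> * b2 \<theta>)"
    by (auto simp: microlocal_cutoffs_def intro: test_function_product)
  obtain B1 B2 where B: "test_function (slit 1) B1" "test_function (slit (- 1)) B2" "\<And>x. b1 x * b2 x = B1 x + B2 x"
    using test_function_slit_split[OF t(3)] by blast
  let ?e = "\<lambda>i::nat. if i = 0 then 1 else - 1 :: real" and ?B = "\<lambda>i::nat. if i = 0 then B1 else B2"
  have tB: "test_function (slit (?e i)) (?B i)" and e: "?e i = 1 \<or> ?e i = - 1" for i using B by auto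
  show "\<exists>(n::nat) \<Omega> \<Phi> a R. (\<forall>i<n. phase_for (C_rel s k) (\<Omega> i) (\<Phi> i) \<and> amplitude0 (h_values s) (\<Omega> i) (a i)) \<and>
      negligible_kernel (h_values s) R \<and>
      (\<forall>h\<in>h_values s. has_kernel (microlocalized h \<chi>1 b1 b2 \<chi>2 (calA s k h))
        (\<lambda>q. (\<Sum>i<n. oscillatory_kernel h (\<Phi> i) (a i h) q) + R h q))"
  \<comment> \<open>One oscillatory integral for each branch of the angle, and remainder 0.\<close>
  proof (rule exI[of _ "2::nat"], rule exI[of _ "\<lambda>i. slit3 (?e i)"], rule exI[of _ "\<lambda>i. phase (shift s k) (?e i)"],
      rule exI[of _ "\<lambda>i (h::real). amp \<chi>1 (?B i) \<chi>2"], rule exI[of _ "\<lambda>(_::real) (_ :: plane \<times> plane). 0::complex"],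
      intro conjI allI impI ballI negligible_zero)
    fix i show "phase_for (C_rel s k) (slit3 (?e i)) (phase (shift s k) (?e i))"
      by (rule phase_for_phase[OF e])
    show "amplitude0 (h_values s) (slit3 (?e i)) (\<lambda>h. amp \<chi>1 (?B i) \<chi>2)"
      by (rule amplitude0_amp[OF t(1) tB t(2)])
  next
    fix h assume h: "h \<in> h_values s"
    have "(\<lambda>(x, y). 1 / of_real ((2 * pi * h)\<^sup>2) * (\<chi>1 x * \<chi>2 y) *
       (LINT \<theta>|lborel. exp (\<i> * of_real (((x - y) \<bullet> \<theta>) / h)) * (b1 \<theta> * (angle_mult s k h \<theta> * b2 \<theta>)))) =
      (\<lambda>q. (\<Sum>i<2. oscillatory_kernel h (phase (shift s k) (?e i)) (amp \<chi>1 (?B i) \<chi>2) q) + 0)"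
    proof (rule ext, clarify)
      fix x y :: plane
      let ?E = "\<lambda>\<theta>. exp (\<i> * of_real (((x - y) \<bullet> \<theta>) / h))"
      note i1 = oscillatory_kernel_amp(2)[OF _ s h B(1), where k = k and x = x and y = y] and i2 = oscillatory_kernel_amp(2)[OF _ s h B(2), where k = k and x = x and y = y]
      have "(LINT \<theta>|lborel. ?E \<theta> * (b1 \<theta> * (angle_mult s k h \<theta> * b2 \<theta>))) =
          (LINT \<theta>|lborel. ?E \<theta> * (angle_mult s k h \<theta> * B1 \<theta>) + ?E \<theta> * (angle_mult s k h \<theta> * B2 \<theta>))"
      proof (rule Bochner_Integration.integral_cong[OF refl])
        fix \<theta>
        have "b1 \<theta> * (angle_mult s k h \<theta> * b2 \<theta>) = angle_mult s k h \<theta> * (b1 \<theta> * b2 \<theta>)" by simp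
        then show "?E \<theta> * (b1 \<theta> * (angle_mult s k h \<theta> * b2 \<theta>)) = ?E \<theta> * (angle_mult s k h \<theta> * B1 \<theta>) + ?E \<theta> * (angle_mult s k h \<theta> * B2 \<theta>)"
          by (simp only: B(3) distrib_left)
      qed
      also have "\<dots> = (LINT \<theta>|lborel. ?E \<theta> * (angle_mult s k h \<theta> * B1 \<theta>)) + (LINT \<theta>|lborel. ?E \<theta> * (angle_mult s k h \<theta> * B2 \<theta>))"
        by (rule Bochner_Integration.integral_add) (use i1 i2 in auto)
      finally have L: "(LINT \<theta>|lborel. ?E \<theta> * (b1 \<theta> * (angle_mult s k h \<theta> * b2 \<theta>))) =
         (LINT \<theta>|lborel. ?E \<theta> * (angle_mult s k h \<theta> * B1 \<theta>)) + (LINT \<theta>|lborel. ?E \<theta> * (angle_mult s k h \<theta> * B2 \<theta>))" .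
      have S: "(\<Sum>i<2. g i) = g 0 + g (1::nat)" for g :: "nat \<Rightarrow> complex" by (simp add: numeral_2_eq_2)
      have "oscillatory_kernel h (phase (shift s k) 1) (amp \<chi>1 B1 \<chi>2) (x, y) + oscillatory_kernel h (phase (shift s k) (- 1)) (amp \<chi>1 B2 \<chi>2) (x, y) =
         1 / of_real ((2 * pi * h)\<^sup>2) * (\<chi>1 x * \<chi>2 y) * (LINT \<theta>|lborel. ?E \<theta> * (b1 \<theta> * (angle_mult s k h \<theta> * b2 \<theta>)))"
        unfolding L distrib_left
        by (intro arg_cong2[of _ _ _ _ "(+)"] oscillatory_kernel_amp(1) s h B) auto
      then show "1 / of_real ((2 * pi * h)\<^sup>2) * (\<chi>1 x * \<chi>2 y) *
          (LINT \<theta>|lborel. ?E \<theta> * (b1 \<theta> * (angle_mult s k h \<theta> * b2 \<theta>))) =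
          (\<Sum>i<2. oscillatory_kernel h (phase (shift s k) (?e i)) (amp \<chi>1 (?B i) \<chi>2) (x, y)) + 0"
        unfolding S by simp
    qed
    moreover have "has_kernel (microlocalized h \<chi>1 b1 b2 \<chi>2 (calA s k h))
       (\<lambda>(x, y). 1 / of_real ((2 * pi * h)\<^sup>2) * (\<chi>1 x * \<chi>2 y) *
       (LINT \<theta>|lborel. exp (\<i> * of_real (((x - y) \<bullet> \<theta>) / h)) * (b1 \<theta> * (angle_mult s k h \<theta> * b2 \<theta>))))"
      unfolding calA_eq
      by (rule microlocalized_multiplier_kernel[OF cut h_values_pos[OF s h]]) (auto simp: norm_angle_mult)
    ultimately show "has_kernel (microlocalized h \<chi>1 b1 b2 \<chi>2 (calA s k h))
        (\<lambda>q. (\<Sum>i<2. oscillatory_kernel h (phase (shift s k) (?e i)) (amp \<chi>1 (?B i) \<chi>2) q) + 0)"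
      by (simp only:)
  qed
next
  fix \<rho> :: "plane \<times> plane" assume "\<rho> \<in> cotangent0"
  then obtain x \<xi> where \<rho>: "\<rho> = (x, \<xi>)" and nz: "\<xi> \<noteq> 0" by (auto simp: cotangent0_def)
  \<comment> \<open>The unique y for which (x, y, xi) is a critical point.\<close>
  define y where "y = x + shift s k *\<^sub>R angrad \<xi>"
  define e :: real where "e = (if \<xi> \<in> slit 1 then 1 else - 1)"
  have e: "e = 1 \<or> e = - 1" by (simp add: e_def)
  have \<xi>e: "\<xi> \<in> slit e" using nz by (auto simp: e_def slit_def plane_eq_iff)
  obtain r where r: "r > 0" "cball \<xi> r \<subseteq> slit e" using open_slit \<xi>e open_contains_cball by blast
  have bump: "\<exists>\<beta>. smooth_on UNIV \<beta> \<and> \<beta> z \<noteq> 0 \<and> (\<forall>x. x \<notin> cball z q \<longrightarrow> \<beta> x = (0 :: complex))" if "q > 0" for z :: plane and q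
    by (rule bump_function[OF that, of z]) (intro exI conjI allI impI; assumption | simp)
  obtain \<chi>1 :: "plane \<Rightarrow> complex" where b1: "smooth_on UNIV \<chi>1" "\<chi>1 x \<noteq> 0" "\<forall>z. z \<notin> cball x 1 \<longrightarrow> \<chi>1 z = 0"
    using bump[OF zero_less_one, of x] by (elim exE conjE)
  obtain \<chi>2 :: "plane \<Rightarrow> complex" where b2: "smooth_on UNIV \<chi>2" "\<chi>2 y \<noteq> 0" "\<forall>z. z \<notin> cball y 1 \<longrightarrow> \<chi>2 z = 0"
    using bump[OF zero_less_one, of y] by (elim exE conjE)
  obtain b :: "plane \<Rightarrow> complex" where b3: "smooth_on UNIV b" "b \<xi> \<noteq> 0" "\<forall>z. z \<notin> cball \<xi> r \<longrightarrow> b z = 0"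
    using bump[OF r(1), of \<xi>] by (elim exE conjE)
  note bumps = b1 b2 b3
  have t: "test_function UNIV \<chi>1" "test_function UNIV \<chi>2" "test_function (slit e) b"
    using bumps r(2) unfolding test_function_def by (blast intro: compact_cball)+
  have t0: "test_function (- {0}) b" using t(3) zero_notin_slit[of e] unfolding test_function_def by blast
  let ?\<Phi> = "phase (shift s k) e" and ?bb = "\<lambda>\<theta>. b \<theta> * b \<theta>"
  have tb: "test_function (slit e) ?bb" by (rule test_function_product[OF t(3) t(3)])
  have cut: "microlocal_cutoffs \<chi>1 b b \<chi>2" using t t0 by (simp add: microlocal_cutoffs_def)
  have p: "(x, y, \<xi>) \<in> slit3 e" using \<xi>e by (simp add: slit3_def)
  show "\<exists>\<chi>1 b1 b2 \<chi>2 \<Omega> \<Phi> a R p. microlocal_cutoffs \<chi>1 b1 b2 \<chi>2 \<and>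
        phase_for (C_rel s k) \<Omega> \<Phi> \<and> amplitude0 (h_values s) \<Omega> a \<and> negligible_kernel (h_values s) R \<and>
        (\<forall>h\<in>h_values s. has_kernel (microlocalized h \<chi>1 b1 b2 \<chi>2 (calA s k h))
           (\<lambda>q. oscillatory_kernel h \<Phi> (a h) q + R h q)) \<and>
        p \<in> critical_set \<Omega> \<Phi> \<and> phase_relation \<Phi> p = (\<rho>, C_rel s k \<rho>) \<and>
        (\<exists>c>0. \<exists>h0>0. \<forall>h\<in>h_values s. h < h0 \<longrightarrow> c \<le> norm (a h p))"
  \<comment> \<open>The same frequency cutoff on both sides, supported in one slit plane, leaves a
    single oscillatory integral. Its amplitude at the critical point is a product of nonzero cutoff
    values, the same for every h.\<close>
  proof (rule exI[of _ \<chi>1], rule exI[of _ b], rule exI[of _ b], rule exI[of _ \<chi>2], rule exI[of _ "slit3 e"],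
      rule exI[of _ ?\<Phi>], rule exI[of _ "\<lambda>h::real. amp \<chi>1 ?bb \<chi>2"],
      rule exI[of _ "\<lambda>(_::real) (_ :: plane \<times> plane). 0::complex"], rule exI[of _ "(x, y, \<xi>)"],
      intro conjI ballI cut phase_for_phase[OF e] amplitude0_amp[OF t(1) tb t(2)] negligible_zero)
    show "(x, y, \<xi>) \<in> critical_set (slit3 e) ?\<Phi>"
    proof -
      have "x - y + shift s k *\<^sub>R angrad \<xi> = 0" by (simp add: y_def)
      then show ?thesis using p by (simp add: critical_set_def phase_gradients[OF e p])
    qed
    show "phase_relation ?\<Phi> (x, y, \<xi>) = (\<rho>, C_rel s k \<rho>)"
      by (simp add: phase_relation_def phase_gradients[OF e p] \<rho> C_rel_eq) (simp add: y_def)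
    show "\<exists>c>0. \<exists>h0>0. \<forall>h\<in>h_values s. h < h0 \<longrightarrow> c \<le> norm (amp \<chi>1 ?bb \<chi>2 (x, y, \<xi>))"
      using bumps by (intro exI[of _ "norm (amp \<chi>1 ?bb \<chi>2 (x, y, \<xi>))"] conjI exI[of _ 1]) (auto simp: amp_def)
    fix h assume h: "h \<in> h_values s"
    have "(\<lambda>(x, y). 1 / of_real ((2 * pi * h)\<^sup>2) * (\<chi>1 x * \<chi>2 y) *
       (LINT \<theta>|lborel. exp (\<i> * of_real (((x - y) \<bullet> \<theta>) / h)) * (b \<theta> * (angle_mult s k h \<theta> * b \<theta>)))) =
      (\<lambda>q. oscillatory_kernel h ?\<Phi> (amp \<chi>1 ?bb \<chi>2) q + 0)"
    proof (rule ext, clarify)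
      fix x y :: plane
      have "b \<theta> * (angle_mult s k h \<theta> * b \<theta>) = angle_mult s k h \<theta> * (b \<theta> * b \<theta>)" for \<theta> by simp
      then show "1 / of_real ((2 * pi * h)\<^sup>2) * (\<chi>1 x * \<chi>2 y) *
       (LINT \<theta>|lborel. exp (\<i> * of_real (((x - y) \<bullet> \<theta>) / h)) * (b \<theta> * (angle_mult s k h \<theta> * b \<theta>))) =
        oscillatory_kernel h ?\<Phi> (amp \<chi>1 ?bb \<chi>2) (x, y) + 0"
        by (simp only: oscillatory_kernel_amp(1)[OF e s h tb] add_0_right)
    qed
    moreover have "has_kernel (microlocalized h \<chi>1 b b \<chi>2 (calA s k h))
       (\<lambda>(x, y). 1 / of_real ((2 * pi * h)\<^sup>2) * (\<chi>1 x * \<chi>2 y) *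
       (LINT \<theta>|lborel. exp (\<i> * of_real (((x - y) \<bullet> \<theta>) / h)) * (b \<theta> * (angle_mult s k h \<theta> * b \<theta>))))"
      unfolding calA_eq
      by (rule microlocalized_multiplier_kernel[OF cut h_values_pos[OF s h]]) (auto simp: norm_angle_mult)
    ultimately show "has_kernel (microlocalized h \<chi>1 b b \<chi>2 (calA s k h))
        (\<lambda>q. oscillatory_kernel h ?\<Phi> (amp \<chi>1 ?bb \<chi>2) q + 0)"
      by (simp only:)
  qed
qed

section \<open>Sampling a periodic function\<close>

text \<open>Unnormalized, and with the sign of the exponent in the multiplier of
  \<open>calA\<close>.\<close>

definition fc :: "int \<Rightarrow> (real \<Rightarrow> complex) \<Rightarrow> complex" where
  "fc n G = integral {-pi..pi} (\<lambda>t. G t * cis (of_int n * t))"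

lemma cis_has_vector_derivative:
  "((\<lambda>t. cis (a * t)) has_vector_derivative \<i> * of_real a * cis (a * t)) (at t within S)"
  unfolding cis_conv_exp
  by (rule has_vector_derivative_eq_rhs[OF vector_derivative_diff_chain_within[unfolded o_def,
        where f = "\<lambda>t. \<i> * of_real (a * t)" and g = exp and f' = "\<i> * of_real a"]])
     (auto intro!: derivative_eq_intros DERIV_exp[THEN has_field_derivative_at_within]
       simp: has_vector_derivative_def scaleR_conv_of_real)

lemma vector_derivative_quotient:
  assumes "(f has_vector_derivative d) (at x)"
  shows "((\<lambda>t. (f t - f x) /\<^sub>R (t - x)) \<longlongrightarrow> d) (at x)"
proof -
  have "((\<lambda>t. norm (f t - f x - (t - x) *\<^sub>R d) / norm (t - x)) \<longlongrightarrow> 0) (at x)"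
    using assms by (simp add: has_vector_derivative_def has_derivative_iff_norm)
  then have "((\<lambda>t. norm ((f t - f x) /\<^sub>R (t - x) - d)) \<longlongrightarrow> 0) (at x)"
  proof (rule Lim_transform_eventually)
    have "norm (f t - f x - (t - x) *\<^sub>R d) / norm (t - x) = norm ((f t - f x) /\<^sub>R (t - x) - d)" if "t \<noteq> x" for t
    proof -
      have "(f t - f x) /\<^sub>R (t - x) - d = (f t - f x - (t - x) *\<^sub>R d) /\<^sub>R (t - x)"
        using that by (simp add: scaleR_diff_right)
      then show ?thesis by (simp add: divide_inverse mult.commute)
    qed
    then show "\<forall>\<^sub>F t in at x. norm (f t - f x - (t - x) *\<^sub>R d) / norm (t - x) = norm ((f t - f x) /\<^sub>R (t - x) - d)"
      by (simp add: eventually_at_filter)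
  qed
  then show ?thesis by (rule LIM_zero_cancel[OF tendsto_norm_zero_cancel])
qed

lemma fc_integrable: "continuous_on {-pi..pi} G \<Longrightarrow> (\<lambda>t. G t * cis (of_int n * t)) integrable_on {-pi..pi}"
  by (intro integrable_continuous_real continuous_intros) (auto intro!: continuous_intros simp: cis_conv_exp)

lemma fc_diff:
  "continuous_on {-pi..pi} F \<Longrightarrow> continuous_on {-pi..pi} G \<Longrightarrow> fc n (\<lambda>t. F t - G t) = fc n F - fc n G"
  unfolding fc_def left_diff_distrib by (intro integral_diff fc_integrable)

lemma fc_sum:
  "finite I \<Longrightarrow> (\<And>i. i \<in> I \<Longrightarrow> continuous_on {-pi..pi} (F i)) \<Longrightarrow> fc n (\<lambda>t. \<Sum>i\<in>I. F i t) = (\<Sum>i\<in>I. fc n (F i))"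
  unfolding fc_def sum_distrib_right by (intro integral_sum fc_integrable)

lemma fc_cong: "(\<And>t. t \<in> {-pi..pi} \<Longrightarrow> F t = G t) \<Longrightarrow> fc n F = fc n G"
  unfolding fc_def by (intro integral_cong) auto

lemma fc_bound:
  assumes "continuous_on {-pi..pi} G" "\<And>t. t \<in> {-pi..pi} \<Longrightarrow> norm (G t) \<le> B"
  shows "norm (fc n G) \<le> 2 * pi * B"
proof -
  have B: "B \<ge> 0" using assms(2)[of 0] order_trans[OF norm_ge_zero] by fastforce
  have "norm (fc n G) \<le> B * measure lborel (cbox (-pi) pi)"
    unfolding fc_def
    by (rule has_integral_bound[OF B]) (use fc_integrable[OF assms(1), of n] assms(2) in \<open>auto simp: norm_mult integrable_integral\<close>)
  then show ?thesis by (simp add: mult.commute)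
qed

text \<open>Integration by parts with the boundary terms kept, because the Riemann-Lebesgue lemma
  applies it to polynomials, which are not periodic.\<close>

lemma fc_deriv:
  assumes D: "\<And>t. t \<in> {-pi..pi} \<Longrightarrow> (G has_vector_derivative G' t) (at t within {-pi..pi})"
  shows "((\<lambda>t. G' t * cis (of_int n * t)) has_integral
    (G pi * cis (of_int n * pi) - G (- pi) * cis (of_int n * (- pi)) - \<i> * of_int n * fc n G)) {-pi..pi}"
proof -
  have c: "continuous_on {-pi..pi} G"
    using D has_vector_derivative_continuous continuous_on_eq_continuous_within by blast
  have "((\<lambda>t. G t * cis (of_int n * t)) has_vector_derivative
      (G t * (\<i> * of_real (of_int n) * cis (of_int n * t)) + G' t * cis (of_int n * t))) (at t within {-pi..pi})"
    if "t \<in> {-pi..pi}" for t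
    by (rule has_vector_derivative_mult[OF D[OF that] cis_has_vector_derivative])
  then have "((\<lambda>t. G t * (\<i> * of_real (of_int n) * cis (of_int n * t)) + G' t * cis (of_int n * t)) has_integral
      (G pi * cis (of_int n * pi) - G (- pi) * cis (of_int n * (- pi)))) {-pi..pi}"
    by (intro fundamental_theorem_of_calculus) auto
  moreover have "((\<lambda>t. \<i> * of_int n * (G t * cis (of_int n * t))) has_integral (\<i> * of_int n * fc n G)) {-pi..pi}"
    unfolding fc_def by (intro has_integral_mult_right integrable_integral fc_integrable c)
  ultimately have "((\<lambda>t. (G t * (\<i> * of_real (of_int n) * cis (of_int n * t)) + G' t * cis (of_int n * t)) -
      \<i> * of_int n * (G t * cis (of_int n * t))) has_integral
      (G pi * cis (of_int n * pi) - G (- pi) * cis (of_int n * (- pi)) - \<i> * of_int n * fc n G)) {-pi..pi}"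
    by (rule has_integral_diff)
  then show ?thesis by (simp add: mult_ac)
qed

lemma cis_pi_eq: "cis (of_int n * (- pi)) = cis (of_int n * pi)"
proof -
  have "cis (of_int n * pi) = cis (of_int n * (- pi) + 2 * pi * of_int n)" by (simp add: algebra_simps)
  also have "\<dots> = cis (of_int n * (- pi)) * cis (2 * pi * of_int n)" by (simp only: cis_mult)
  also have "cis (2 * pi * of_int n) = 1" by (rule cis_multiple_2pi) auto
  finally show ?thesis by simp
qed

text \<open>Approximation by a polynomial, whose coefficients are O(1/n) after one integration by
  parts.\<close>

lemma fc_riemann_lebesgue:
  assumes c: "continuous_on {-pi..pi} g" and e: "e > 0"
  shows "\<exists>N. \<forall>n. \<bar>n\<bar> \<ge> N \<longrightarrow> norm (fc n g) < e"
proof -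
  \<comment> \<open>A uniform error d changes every coefficient by at most 2 pi d = e / 2.\<close>
  define d where "d = e / (4 * pi)"
  have d: "d > 0" using e by (simp add: d_def)
  obtain p :: "real \<Rightarrow> complex" where p: "polynomial_function p" "\<And>t. t \<in> {-pi..pi} \<Longrightarrow> norm (g t - p t) < d"
    using Stone_Weierstrass_polynomial_function[OF compact_Icc c d] by blast
  obtain p' where p': "polynomial_function p'" "\<And>t. (p has_vector_derivative p' t) (at t)"
    using has_vector_derivative_polynomial_function[OF p(1)] by blast
  have cp: "continuous_on {-pi..pi} p" "continuous_on {-pi..pi} p'"
    using p(1) p'(1) by (auto intro: continuous_on_polymonial_function)
  obtain M where M: "\<And>t. t \<in> {-pi..pi} \<Longrightarrow> norm (p' t) \<le> M"
    using compact_imp_bounded[OF compact_continuous_image[OF cp(2) compact_Icc]] unfolding bounded_iff by blast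
  define K where "K = norm (p pi) + norm (p (- pi)) + 2 * pi * M"
  have pn: "\<bar>real_of_int n\<bar> * norm (fc n p) \<le> K" for n
  proof -
    have "\<i> * of_int n * fc n p = p pi * cis (of_int n * pi) - p (- pi) * cis (of_int n * (- pi)) - fc n p'"
      using integral_unique[OF fc_deriv[of p p' n]] has_vector_derivative_at_within[OF p'(2)]
      by (simp add: fc_def)
    then have "norm (\<i> * of_int n * fc n p) \<le> norm (p pi * cis (of_int n * pi)) + norm (p (- pi) * cis (of_int n * (- pi))) + norm (fc n p')"
      by (metis (no_types, opaque_lifting) add_right_mono norm_triangle_ineq4 order_trans)
    also have "norm (fc n p') \<le> 2 * pi * M" by (rule fc_bound[OF cp(2) M])
    finally show ?thesis by (simp add: norm_mult K_def)
  qed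
  have K0: "K \<ge> 0" using pn[of 0] by simp
  obtain N :: nat where N: "2 * K / e < real N" using reals_Archimedean2 by blast
  have "norm (fc n g) < e" if n: "\<bar>n\<bar> \<ge> int N + 1" for n
  proof -
    have nr: "real N < \<bar>real_of_int n\<bar>" using n by linarith
    have "2 * K < e * \<bar>real_of_int n\<bar>"
      using N nr e by (simp add: divide_less_eq) (smt (verit) mult.commute mult_less_cancel_left_pos)
    then have "2 * (\<bar>real_of_int n\<bar> * norm (fc n p)) < e * \<bar>real_of_int n\<bar>" using pn[of n] by linarith
    then have "\<bar>real_of_int n\<bar> * (2 * norm (fc n p)) < \<bar>real_of_int n\<bar> * e" by (simp only: mult.left_commute mult.commute)
    moreover have "0 < \<bar>real_of_int n\<bar>" using nr by linarith
    ultimately have 1: "2 * norm (fc n p) < e" by (simp only: mult_less_cancel_left_pos)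
    have "norm (fc n (\<lambda>t. g t - p t)) \<le> 2 * pi * d"
      by (rule fc_bound) (use p(2) c cp in \<open>auto intro!: continuous_intros less_imp_le\<close>)
    then have "2 * norm (fc n g - fc n p) \<le> e"
      unfolding fc_diff[OF c cp(1)] by (simp add: d_def)
    then show ?thesis using 1 norm_triangle_ineq[of "fc n g - fc n p" "fc n p"] by simp
  qed
  then show ?thesis by blast
qed

lemma fc_const: fixes c :: complex shows "fc n (\<lambda>_. c) = (if n = 0 then 2 * pi * c else 0)"
proof (cases "n = 0")
  case False
  have "((\<lambda>t. 0 * cis (of_int n * t)) has_integral
    (c * cis (of_int n * pi) - c * cis (of_int n * (- pi)) - \<i> * of_int n * fc n (\<lambda>_. c))) {-pi..pi}"
    by (rule fc_deriv) (rule has_vector_derivative_const)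
  then have "\<i> * of_int n * fc n (\<lambda>_. c) = 0"
    by (simp add: cis_pi_eq[of n, simplified])
  then show ?thesis using False by simp
qed (simp add: fc_def scaleR_conv_of_real)

text \<open>The term at n = 0 is 0 by the convention 1 / 0 = 0.\<close>

lemma int_inverse_square_summable: "(\<lambda>n::int. 1 / (of_int n)\<^sup>2 :: real) summable_on UNIV"
proof -
  let ?f = "\<lambda>n::int. 1 / (of_int n)\<^sup>2 :: real"
  have s: "summable (\<lambda>n. 1 / (real (Suc n))\<^sup>2)"
    using inverse_power_summable[of 2, where 'a = real] summable_Suc_iff[of "\<lambda>n. 1 / (real n)\<^sup>2"]
    by (simp add: divide_inverse)
  then have 1: "(\<lambda>n. 1 / (real (Suc n))\<^sup>2) summable_on UNIV"
    by (intro norm_summable_imp_summable_on) simp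
  have p: "?f summable_on range (\<lambda>n. int (Suc n))"
    by (subst summable_on_reindex) (use 1 in \<open>auto simp: inj_def o_def\<close>)
  have m: "?f summable_on range (\<lambda>n. - int (Suc n))"
  proof (subst summable_on_reindex)
    show "inj (\<lambda>n. - int (Suc n))" by (auto simp: inj_def)
    have "(\<lambda>n. 1 / (real (Suc n))\<^sup>2) = ?f \<circ> (\<lambda>n. - int (Suc n))" by (auto simp: o_def fun_eq_iff power2_eq_square algebra_simps)
    then show "?f \<circ> (\<lambda>n. - int (Suc n)) summable_on UNIV" using 1 by simp
  qed
  have U: "UNIV = {0} \<union> (range (\<lambda>n. int (Suc n)) \<union> range (\<lambda>n. - int (Suc n)))"
  proof -
    have "n \<in> {0} \<union> (range (\<lambda>n. int (Suc n)) \<union> range (\<lambda>n. - int (Suc n)))" for n :: int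
    proof (cases n rule: int_cases3)
      case (pos k)
      then have "n = int (Suc (k - 1))" by simp
      then show ?thesis by blast
    next
      case (neg k)
      then have "n = - int (Suc (k - 1))" by simp
      then show ?thesis by blast
    qed simp
    then show ?thesis by blast
  qed
  show ?thesis
    unfolding U by (intro summable_on_union p m) simp
qed

section \<open>Fourier series of periodic functions with bounded second derivative\<close>

locale periodic_C2 =
  fixes G G' G'' :: "real \<Rightarrow> complex" and B :: real
  assumes per: "\<And>t. G (t + 2 * pi) = G t"
    and D1: "\<And>t. (G has_vector_derivative G' t) (at t)"
    and D2: "\<And>t. (G' has_vector_derivative G'' t) (at t)"
    and B: "\<And>t. norm (G'' t) \<le> B"
begin

lemma per': "G' (t + 2 * pi) = G' t"
proof -
  have "((\<lambda>t. G (t + 2 * pi)) has_vector_derivative 1 *\<^sub>R G' (t + 2 * pi)) (at t)"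
    by (rule vector_diff_chain_at[of "\<lambda>t. t + 2 * pi" 1 t G "G' (t + 2 * pi)", unfolded o_def])
       (auto intro!: derivative_eq_intros D1)
  then have "(G has_vector_derivative G' (t + 2 * pi)) (at t)" by (simp add: per)
  then show ?thesis using D1 vector_derivative_unique_at by blast
qed

lemma continuous_G: "continuous_on S G" "continuous_on S G'"
  by (auto intro!: continuous_at_imp_continuous_on has_vector_derivative_continuous[OF D1] has_vector_derivative_continuous[OF D2])

text \<open>Two integrations by parts, whose boundary terms cancel by periodicity. The fundamental
  theorem gives the last integral in gauge form, where the bound on G'' applies directly.\<close>

lemma fc_decay: "(of_int n)\<^sup>2 * norm (fc n G) \<le> 2 * pi * B"
proof -
  have b: "G pi = G (- pi)" "G' pi = G' (- pi)" using per[of "- pi"] per'[of "- pi"] by simp_all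
  have "fc n G' = - \<i> * of_int n * fc n G"
    using integral_unique[OF fc_deriv[of G G' n]] has_vector_derivative_at_within[OF D1]
    by (simp add: fc_def b cis_pi_eq[simplified])
  moreover have "((\<lambda>t. G'' t * cis (of_int n * t)) has_integral (- \<i> * of_int n * fc n G')) {-pi..pi}"
    using fc_deriv[of G' G'' n] has_vector_derivative_at_within[OF D2]
    by (simp add: b cis_pi_eq[simplified])
  ultimately have i: "((\<lambda>t. G'' t * cis (of_int n * t)) has_integral (- \<i> * of_int n * (- \<i> * of_int n * fc n G))) (cbox (-pi) pi)"
    by simp
  have "norm (- \<i> * of_int n * (- \<i> * of_int n * fc n G)) \<le> B * measure lborel (cbox (- pi) pi)"
    by (rule has_integral_bound[OF _ i]) (use B order_trans[OF norm_ge_zero B] in \<open>auto simp: norm_mult\<close>)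
  then show ?thesis by (simp add: norm_mult power2_eq_square mult_ac)
qed

lemma fc_summable: "(\<lambda>n. fc n G) summable_on UNIV"
proof -
  have "(\<lambda>n. norm (fc n G)) summable_on (UNIV - {0})"
  proof (rule summable_on_comparison_test)
    show "(\<lambda>n::int. (2 * pi * B) * (1 / (of_int n)\<^sup>2)) summable_on (UNIV - {0})"
      by (intro summable_on_cmult_right summable_on_subset_banach[OF int_inverse_square_summable]) simp
    show "norm (fc n G) \<le> (2 * pi * B) * (1 / (of_int n)\<^sup>2)" if "n \<in> UNIV - {0}" for n
      using fc_decay[of n] that by (simp add: field_simps)
  qed simp
  then have "(\<lambda>n. fc n G) summable_on (UNIV - {0})" by (rule abs_summable_summable)
  then have "(\<lambda>n. fc n G) summable_on insert 0 (UNIV - {0})"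
    by (subst summable_on_insert_iff)
  then show ?thesis by (simp add: insert_UNIV)
qed

text \<open>Dividing G - G 0 by cis t - 1 gives a continuous g. Multiplication by cis t shifts
  coefficients, so the symmetric partial sums telescope to two far coefficients of g, which tend to
  0 by Riemann-Lebesgue. Summability allows the unordered sum to be evaluated along these partial
  sums.\<close>

lemma fc_has_sum: "((\<lambda>n. fc n G) has_sum (2 * pi * G 0)) UNIV"
proof -
  obtain S where S: "((\<lambda>n. fc n G) has_sum S) UNIV"
    using fc_summable by (auto simp: summable_on_def)
  \<comment> \<open>At 0 the quotient is completed by its limit, since G and cis have derivatives G'
    0 and i there.\<close>
  define g where "g t = (if t = 0 then G' 0 / \<i> else (G t - G 0) / (cis t - 1))" for t
  have cis1: "cis t \<noteq> 1" if "t \<in> {-pi..pi}" "t \<noteq> 0" for t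
  proof
    assume "cis t = 1"
    then have "cos t = 1" by (metis cis.sel(1) one_complex.sel(1))
    then have "cos \<bar>t\<bar> = cos 0" by simp
    moreover have "\<bar>t\<bar> \<in> {0..pi}" using that by auto
    ultimately show False using cos_inj_pi[of "\<bar>t\<bar>" 0] that by auto
  qed
  have cg: "continuous_on {-pi..pi} g"
    unfolding continuous_on_eq_continuous_within
  proof
    fix t assume t: "t \<in> {-pi..pi}"
    show "continuous (at t within {-pi..pi}) g"
    proof (cases "t = 0")
      case False
      have "continuous (at t within {-pi..pi}) (\<lambda>t. (G t - G 0) / (cis t - 1))"
        using cis1[OF t False] has_vector_derivative_continuous[OF has_vector_derivative_at_within[OF D1]]
        by (intro continuous_intros) (auto simp: cis_conv_exp intro!: continuous_intros)
      then show ?thesis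
        by (rule continuous_transform_within[of _ _ _ "\<bar>t\<bar>"])
           (use False t in \<open>auto simp: g_def dist_real_def\<close>)
    next
      case True
      have l1: "((\<lambda>t. (G t - G 0) /\<^sub>R (t - 0)) \<longlongrightarrow> G' 0) (at 0)"
        by (rule vector_derivative_quotient[OF D1])
      have l2: "((\<lambda>t. (cis t - 1) /\<^sub>R (t - 0)) \<longlongrightarrow> \<i>) (at 0)"
        using vector_derivative_quotient[OF cis_has_vector_derivative[of 1 0 UNIV]] by simp
      have "((\<lambda>t. ((G t - G 0) /\<^sub>R (t - 0)) / ((cis t - 1) /\<^sub>R (t - 0))) \<longlongrightarrow> G' 0 / \<i>) (at 0)"
        by (intro tendsto_divide l1 l2) simp
      then have "(g \<longlongrightarrow> G' 0 / \<i>) (at 0)"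
        by (rule Lim_transform_eventually)
           (auto simp: g_def eventually_at_filter divide_inverse scaleR_conv_of_real)
      then have "(g \<longlongrightarrow> g 0) (at 0)" by (simp add: g_def)
      then show ?thesis using True by (simp add: continuous_within Lim_at_imp_Lim_at_within)
    qed
  qed
  \<comment> \<open>The constant \<open>G 0\<close> has a nonzero coefficient at most at index 0, so
    removing it from G lowers each partial sum by 2 pi \<open>G 0\<close>.\<close>
  have tele: "(\<Sum>n=-int N..int N. fc n G) - 2 * pi * G 0 = fc (int N + 1) g - fc (- int N) g" for N
  proof -
    have e: "fc n (\<lambda>t. G t - G 0) = fc (n + 1) g - fc n g" for n
    proof -
      have "fc n (\<lambda>t. G t - G 0) = fc n (\<lambda>t. g t * cis t - g t)"
        by (rule fc_cong) (use cis1 in \<open>auto simp: g_def field_simps\<close>)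
      also have "\<dots> = fc n (\<lambda>t. g t * cis t) - fc n g"
        by (intro fc_diff cg continuous_intros)
      also have "fc n (\<lambda>t. g t * cis t) = fc (n + 1) g"
        unfolding fc_def by (intro integral_cong) (simp add: mult.assoc cis_mult algebra_simps)
      finally show ?thesis .
    qed
    have "(\<Sum>n=-int N..int N. fc (n + 1) g - fc n g) = fc (int N + 1) g - fc (- int N) g"
    proof (induction N)
      case (Suc N)
      have "{- int (Suc N)..int (Suc N)} = insert (- int (Suc N)) (insert (int (Suc N)) {-int N..int N})" by auto
      then have "(\<Sum>n=- int (Suc N)..int (Suc N). fc (n + 1) g - fc n g) =
          (fc (- int (Suc N) + 1) g - fc (- int (Suc N)) g) + ((fc (int (Suc N) + 1) g - fc (int (Suc N)) g) +
          (fc (int N + 1) g - fc (- int N) g))"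
        by (simp only: Suc.IH[symmetric]) simp
      moreover have "- int (Suc N) + 1 = - int N" "int (Suc N) = int N + 1" by simp_all
      ultimately show ?case by (simp add: add.commute)
    qed simp
    then have "(\<Sum>n=-int N..int N. fc n (\<lambda>t. G t - G 0)) = fc (int N + 1) g - fc (- int N) g"
      by (simp only: e)
    moreover have "(\<Sum>n=-int N..int N. fc n (\<lambda>t. G t - G 0)) = (\<Sum>n=-int N..int N. fc n G) - (\<Sum>n=-int N..int N. fc n (\<lambda>_. G 0))"
      by (subst sum_subtractf[symmetric]) (intro sum.cong refl fc_diff continuous_G continuous_on_const)
    moreover have "(\<Sum>n=-int N..int N. fc n (\<lambda>_. G 0)) = 2 * pi * G 0"
      by (simp only: fc_const) simp
    ultimately show ?thesis by simp
  qed
  have lim0: "(\<lambda>N. (\<Sum>n=-int N..int N. fc n G) - 2 * pi * G 0) \<longlonglongrightarrow> 0"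
  proof (rule LIMSEQ_I)
    fix r :: real assume "r > 0"
    then obtain N where N: "\<And>n. \<bar>n\<bar> \<ge> N \<Longrightarrow> norm (fc n g) < r / 2"
      using fc_riemann_lebesgue[OF cg, of "r / 2"] by auto
    have "norm ((\<Sum>n=-int k..int k. fc n G) - 2 * pi * G 0) < r" if "k \<ge> nat \<bar>N\<bar>" for k
      unfolding tele using N[of "int k + 1"] N[of "- int k"] that norm_triangle_ineq4[of "fc (int k + 1) g" "fc (- int k) g"] by linarith
    then show "\<exists>n0. \<forall>n\<ge>n0. norm ((\<Sum>n=-int n..int n. fc n G) - 2 * pi * G 0 - 0) < r" by auto
  qed
  have "(\<lambda>N. \<Sum>n=-int N..int N. fc n G) \<longlonglongrightarrow> S"
  proof -
    have "filterlim (\<lambda>N. {-int N..int N}) (finite_subsets_at_top UNIV) sequentially"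
      unfolding filterlim_finite_subsets_at_top
    proof (intro allI impI)
      fix X :: "int set" assume X: "finite X \<and> X \<subseteq> UNIV"
      then obtain M where M: "\<And>x. x \<in> X \<Longrightarrow> \<bar>x\<bar> \<le> M"
        using bdd_above.E[of "abs ` X"] finite_imageI[of X abs] bdd_above_finite by (metis imageI)
      have "\<forall>N\<ge>nat M. finite {-int N..int N} \<and> X \<subseteq> {-int N..int N} \<and> {-int N..int N} \<subseteq> UNIV"
        using M by (force simp: abs_le_iff)
      then show "\<forall>\<^sub>F N in sequentially. finite {-int N..int N} \<and> X \<subseteq> {-int N..int N} \<and> {-int N..int N} \<subseteq> UNIV"
        by (auto simp: eventually_sequentially)
    qed
    from filterlim_compose[OF S[unfolded has_sum_def] this] show ?thesis by simp
  qed
  moreover have "(\<lambda>N. \<Sum>n=-int N..int N. fc n G) \<longlonglongrightarrow> 2 * pi * G 0"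
    using lim0 by (rule LIM_zero_cancel)
  ultimately show ?thesis using S LIMSEQ_unique by blast
qed

text \<open>The part of the shifted interval that lies beyond pi is moved back by a full
  period.\<close>

lemma fc_shift:
  assumes \<tau>: "0 \<le> \<tau>" "\<tau> \<le> 2 * pi"
  shows "fc n (\<lambda>t. G (t + \<tau>)) = cis (- of_int n * \<tau>) * fc n G"
proof -
  define f where "f t = G t * cis (of_int n * t)" for t
  have fc: "continuous_on S f" for S
    unfolding f_def cis_conv_exp by (intro continuous_intros continuous_G)
  have fper: "f (t + 2 * pi) = f t" for t
  proof -
    have "cis (of_int n * (t + 2 * pi)) = cis (of_int n * t) * cis (2 * pi * of_int n)"
      by (simp add: cis_mult algebra_simps)
    also have "cis (2 * pi * of_int n) = 1" by (rule cis_multiple_2pi) auto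
    finally show ?thesis by (simp add: f_def per)
  qed
  have "fc n (\<lambda>t. G (t + \<tau>)) = integral {-pi..pi} (\<lambda>t. cis (- of_int n * \<tau>) * f (t + \<tau>))"
    unfolding fc_def
  proof (rule integral_cong)
    fix t
    have "cis (of_int n * t) = cis (- of_int n * \<tau>) * cis (of_int n * (t + \<tau>))"
      by (simp add: cis_mult algebra_simps)
    then show "G (t + \<tau>) * cis (of_int n * t) = cis (- of_int n * \<tau>) * f (t + \<tau>)" by (simp add: f_def)
  qed
  also have "\<dots> = cis (- of_int n * \<tau>) * integral {-pi..pi} (\<lambda>t. f (t + \<tau>))" by simp
  also have "integral {-pi..pi} (\<lambda>t. f (t + \<tau>)) = integral {-pi + \<tau>..pi + \<tau>} f"
    using integral_shift[OF fc, where a = "- pi" and b = pi and c = \<tau>] by (simp add: o_def)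
  also have "\<dots> = integral {-pi + \<tau>..pi} f + integral {pi..pi + \<tau>} f"
    by (rule Henstock_Kurzweil_Integration.integral_combine[symmetric]) (use \<tau> fc in \<open>auto intro: integrable_continuous_real\<close>)
  also have "integral {pi..pi + \<tau>} f = integral {-pi..-pi + \<tau>} (\<lambda>t. f (t + 2 * pi))"
    using integral_shift[OF fc, where a = "- pi" and b = "- pi + \<tau>" and c = "2 * pi"] by (simp add: o_def algebra_simps)
  also have "integral {-pi + \<tau>..pi} f + integral {-pi..-pi + \<tau>} (\<lambda>t. f (t + 2 * pi)) = integral {-pi..pi} f"
    unfolding fper
    by (subst add.commute, rule Henstock_Kurzweil_Integration.integral_combine) (use \<tau> fc in \<open>auto intro: integrable_continuous_real\<close>)
  finally show ?thesis by (simp add: fc_def f_def[abs_def])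
qed

text \<open>This is the Fourier series at 0 of the sum of 2 m equally spaced translates of G.
  Because the powers of a root of unity cancel, its coefficients vanish unless 2 m divides the
  index, and then they are 2 m times those of G.\<close>

theorem sampling_has_sum:
  assumes m: "m \<ge> (1::nat)"
  shows "((\<lambda>l. fc (2 * int m * l) G) has_sum (of_real (pi / real m) * (\<Sum>j=1..2*m. G (pi * real j / real m)))) UNIV"
proof -
  let ?\<tau> = "\<lambda>j::nat. pi * real j / real m"
  have D: "((\<lambda>t. F (t + c)) has_vector_derivative F' (t + c)) (at t)"
    if "\<And>t. (F has_vector_derivative F' t) (at t)" for F F' :: "real \<Rightarrow> complex" and c t
  proof -
    have "((\<lambda>t. t + c) has_vector_derivative 1) (at t)" by (auto intro!: derivative_eq_intros)
    from vector_diff_chain_at[OF this that] show ?thesis by (simp add: o_def)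
  qed
  interpret S: periodic_C2 "\<lambda>t. \<Sum>j=1..2*m. G (t + ?\<tau> j)" "\<lambda>t. \<Sum>j=1..2*m. G' (t + ?\<tau> j)"
    "\<lambda>t. \<Sum>j=1..2*m. G'' (t + ?\<tau> j)" "real (2 * m) * B"
  proof
    fix t
    have "t + 2 * pi + ?\<tau> j = (t + ?\<tau> j) + 2 * pi" for j by simp
    then show "(\<Sum>j=1..2*m. G (t + 2 * pi + ?\<tau> j)) = (\<Sum>j=1..2*m. G (t + ?\<tau> j))" by (simp only: per)
    show "((\<lambda>t. \<Sum>j=1..2*m. G (t + ?\<tau> j)) has_vector_derivative (\<Sum>j=1..2*m. G' (t + ?\<tau> j))) (at t)"
      by (intro has_vector_derivative_sum D D1)
    show "((\<lambda>t. \<Sum>j=1..2*m. G' (t + ?\<tau> j)) has_vector_derivative (\<Sum>j=1..2*m. G'' (t + ?\<tau> j))) (at t)"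
      by (intro has_vector_derivative_sum D D2)
    have "norm (\<Sum>j=1..2*m. G'' (t + ?\<tau> j)) \<le> (\<Sum>j=1..2*m. B)" by (intro sum_norm_le B)
    then show "norm (\<Sum>j=1..2*m. G'' (t + ?\<tau> j)) \<le> real (2 * m) * B" by simp
  qed
  have roots: "(\<Sum>j=1..2*m. cis (- of_int n * ?\<tau> j)) = (if 2 * int m dvd n then of_nat (2 * m) else 0)" for n
  proof -
    let ?z = "cis (- of_int n * pi / real m)"
    have zj: "cis (- of_int n * ?\<tau> j) = ?z ^ j" for j
      unfolding Complex.DeMoivre by (rule arg_cong[where f = cis]) simp
    have z1: "?z = 1 \<longleftrightarrow> 2 * int m dvd n"
    proof
      assume "?z = 1"
      then obtain q :: int where q: "- of_int n * pi / real m = of_int (2 * q) * pi"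
        unfolding cis_conv_exp exp_eq_1 by auto
      then have "(- of_int n / real m) * pi = of_int (2 * q) * pi" by simp
      then have "- of_int n / real m = of_int (2 * q)" by (simp only: mult_cancel_right pi_neq_zero simp_thms)
      then have "- real_of_int n = of_int (2 * q) * real m" using m by (simp add: field_simps)
      then have "- n = 2 * q * int m" by (metis (mono_tags, opaque_lifting) of_int_eq_iff of_int_minus of_int_mult of_int_of_nat_eq)
      then have "n = - (2 * q * int m)" by linarith
      then have "n = 2 * int m * (- q)" by (simp add: mult_ac)
      then show "2 * int m dvd n" by (rule dvdI)
    next
      assume "2 * int m dvd n"
      then obtain q where q: "n = 2 * int m * q" by (elim dvdE)
      have "- of_int n * pi / real m = 2 * pi * of_int (- q)" using m by (simp add: q)
      then show "?z = 1" using cis_multiple_2pi[of "of_int (- q)"] by simp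
    qed
    have zm: "?z ^ (2 * m) = 1"
    proof -
      have "real (2 * m) * (- of_int n * pi / real m) = 2 * pi * of_int (- n)" using m by simp
      then show ?thesis unfolding Complex.DeMoivre using cis_multiple_2pi[of "of_int (- n)"] by simp
    qed
    show ?thesis
    proof (cases "2 * int m dvd n")
      case True
      then show ?thesis unfolding zj using z1 by simp
    next
      case False
      have "(\<Sum>j=1..2*m. ?z ^ j) = ?z * (\<Sum>j<2*m. ?z ^ j)"
        unfolding sum_distrib_left power_Suc[symmetric]
        by (rule sum.reindex_bij_witness[of _ Suc "\<lambda>j. j - 1"]) auto
      also have "(\<Sum>j<2*m. ?z ^ j) = 0"
        using geometric_sum[of ?z "2 * m"] z1 False zm by simp
      finally show ?thesis unfolding zj using False by simp
    qed
  qed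
  have fcS: "fc n (\<lambda>t. \<Sum>j=1..2*m. G (t + ?\<tau> j)) = (if 2 * int m dvd n then of_nat (2 * m) * fc n G else 0)" for n
  proof -
    have "fc n (\<lambda>t. \<Sum>j=1..2*m. G (t + ?\<tau> j)) = (\<Sum>j=1..2*m. fc n (\<lambda>t. G (t + ?\<tau> j)))"
      by (rule fc_sum) (auto intro!: continuous_on_compose2[OF continuous_G(1)] continuous_intros)
    also have "\<dots> = (\<Sum>j=1..2*m. cis (- of_int n * ?\<tau> j) * fc n G)"
    proof (intro sum.cong refl fc_shift)
      fix j assume "j \<in> {1..2*m}"
      then have "real j \<le> 2 * real m" by (metis atLeastAtMost_iff of_nat_le_iff of_nat_mult of_nat_numeral)
      then show "?\<tau> j \<le> 2 * pi" using m by (simp add: field_simps)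
    qed auto
    finally show ?thesis unfolding sum_distrib_right[symmetric] roots by simp
  qed
  have "((\<lambda>n. fc n (\<lambda>t. \<Sum>j=1..2*m. G (t + ?\<tau> j))) has_sum (2 * pi * (\<Sum>j=1..2*m. G (?\<tau> j)))) UNIV"
    using S.fc_has_sum by simp
  then have "((\<lambda>n. of_nat (2 * m) * fc n G) has_sum (2 * pi * (\<Sum>j=1..2*m. G (?\<tau> j)))) (range (\<lambda>l. 2 * int m * l))"
    unfolding fcS
    by (rule has_sum_cong_neutral[THEN iffD1, rotated -1]) (auto simp: dvd_def)
  then have "((\<lambda>l. of_nat (2 * m) * fc (2 * int m * l) G) has_sum (2 * pi * (\<Sum>j=1..2*m. G (?\<tau> j)))) UNIV"
    using m by (subst (asm) has_sum_reindex) (auto simp: inj_def o_def)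
  then have "((\<lambda>l. (1 / of_nat (2 * m)) * (of_nat (2 * m) * fc (2 * int m * l) G)) has_sum
      ((1 / of_nat (2 * m)) * (2 * pi * (\<Sum>j=1..2*m. G (?\<tau> j))))) UNIV"
    by (rule has_sum_cmult_right)
  then show ?thesis using m by (simp add: mult.assoc[symmetric])
qed

end

section \<open>Integration in the plane\<close>

lemma vector_2_eq: "(vector [a, b] :: plane) = a *\<^sub>R axis 1 1 + b *\<^sub>R axis 2 1"
  by (simp add: plane_eq_iff axis_def)

lemma Basis_plane: "(Basis :: plane set) = {axis 1 1, axis 2 1}"
proof -
  have "(Basis :: plane set) = range (\<lambda>i. axis i 1)" by (auto simp: Basis_vec_def)
  also have "\<dots> = {axis 1 1, axis 2 1}" by (simp add: UNIV_2)
  finally show ?thesis .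
qed

lemma prod_Basis_plane: "(\<Prod>b\<in>(Basis :: plane set). x \<bullet> b) = x $ 1 * x $ 2"
  unfolding Basis_plane by (subst prod.insert) (auto simp: axis_eq_axis inner_axis)

lemma box_plane: "x \<in> box l u \<longleftrightarrow> l $ 1 < x $ 1 \<and> x $ 1 < u $ 1 \<and> l $ 2 < x $ 2 \<and> x $ 2 < (u :: plane) $ 2"
  by (auto simp: mem_box_cart forall_2)

lemma vector_pair_measurable [measurable]:
  "(\<lambda>p. vector [fst p, snd p] :: plane) \<in> borel_measurable (lborel \<Otimes>\<^sub>M lborel)"
  unfolding vector_2_eq by measurable

text \<open>Identifies planar integrals with integrals over a product, so that Fubini applies; boxes
  determine Lebesgue measure.\<close>

lemma lborel_plane: "(lborel :: plane measure) = distr (lborel \<Otimes>\<^sub>M lborel) borel (\<lambda>p. vector [fst p, snd p])"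
proof (rule lborel_eqI)
  fix l u :: plane assume le: "\<And>b. b \<in> Basis \<Longrightarrow> l \<bullet> b \<le> u \<bullet> b"
  have lu: "l $ 1 \<le> u $ 1" "l $ 2 \<le> u $ 2"
    using le[of "axis 1 1"] le[of "axis 2 1"] by (simp_all add: Basis_plane inner_axis)
  have "(\<lambda>p. vector [fst p, snd p] :: plane) -` box l u = {l $ 1<..<u $ 1} \<times> {l $ 2<..<u $ 2}"
    by (auto simp: box_plane)
  then have "emeasure (distr (lborel \<Otimes>\<^sub>M lborel) borel (\<lambda>p. vector [fst p, snd p])) (box l u) =
      emeasure (lborel \<Otimes>\<^sub>M lborel) ({l $ 1<..<u $ 1} \<times> {l $ 2<..<u $ 2})"
    by (subst emeasure_distr) (auto simp: space_pair_measure)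
  also have "\<dots> = ennreal (u $ 1 - l $ 1) * ennreal (u $ 2 - l $ 2)"
    using lu by (subst lborel.emeasure_pair_measure_Times) auto
  also have "\<dots> = ennreal ((u $ 1 - l $ 1) * (u $ 2 - l $ 2))"
    using lu by (simp add: ennreal_mult)
  finally show "emeasure (distr (lborel \<Otimes>\<^sub>M lborel) borel (\<lambda>p. vector [fst p, snd p])) (box l u) =
      ennreal (\<Prod>b\<in>Basis. (u - l) \<bullet> b)"
    by (simp add: prod_Basis_plane)
qed simp

lemma integral_plane:
  fixes H :: "plane \<Rightarrow> complex"
  assumes H: "integrable lborel H"
  shows "integrable (lborel \<Otimes>\<^sub>M lborel) (\<lambda>(a, b). H (vector [a, b]))"
    and "(LINT x|lborel. H x) = (\<integral>p. H (vector [fst p, snd p]) \<partial>(lborel \<Otimes>\<^sub>M lborel))"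
proof -
  have [measurable]: "H \<in> borel_measurable borel" using borel_measurable_integrable[OF H] by simp
  have "integrable (distr (lborel \<Otimes>\<^sub>M lborel) borel (\<lambda>p. vector [fst p, snd p])) H"
    using H by (simp only: lborel_plane[symmetric])
  then show "integrable (lborel \<Otimes>\<^sub>M lborel) (\<lambda>(a, b). H (vector [a, b]))"
    by (subst (asm) integrable_distr_eq) (auto simp: case_prod_beta')
  show "(LINT x|lborel. H x) = (\<integral>p. H (vector [fst p, snd p]) \<partial>(lborel \<Otimes>\<^sub>M lborel))"
    by (subst lborel_plane, subst integral_distr) auto
qed

lemma omega_nth [simp]: "omega t $ 1 = cos t" "omega t $ 2 = sin t"
  by (simp_all add: omega_def)

lemma norm_omega [simp]: "norm (omega t) = 1"
proof -
  have "(norm (omega t))\<^sup>2 = 1\<^sup>2" by (simp add: norm_plane)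
  then show ?thesis by (rule power2_eq_imp_eq) auto
qed

text \<open>The map is orthogonal, so the preimage of a box has the measure of the box, and boxes
  determine the measure.\<close>

lemma lborel_rotate:
  assumes w: "norm \<omega> = 1"
  shows "(lborel :: plane measure) = distr lborel borel (\<lambda>x::plane. (x $ 1) *\<^sub>R \<omega> + (x $ 2) *\<^sub>R perp \<omega>)"
proof (rule lborel_eqI)
  let ?R = "\<lambda>x::plane. (x $ 1) *\<^sub>R \<omega> + (x $ 2) *\<^sub>R perp \<omega>"
  have w1: "\<omega> $ 1 * \<omega> $ 1 + \<omega> $ 2 * \<omega> $ 2 = 1"
    using norm_plane[of \<omega>] w by (simp add: power2_eq_square)
  have lin: "linear ?R" by (rule linearI) (simp_all add: algebra_simps)
  have ip: "?R v \<bullet> ?R w = v \<bullet> w" for v w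
  proof -
    have "?R v \<bullet> ?R w = (v \<bullet> w) * (\<omega> $ 1 * \<omega> $ 1 + \<omega> $ 2 * \<omega> $ 2)"
      unfolding inner_plane by (simp add: algebra_simps)
    then show ?thesis by (simp only: w1 mult_1_right)
  qed
  have orth: "orthogonal_transformation ?R"
    unfolding orthogonal_transformation_def using lin ip by blast
  fix l u :: plane assume le: "\<And>b. b \<in> Basis \<Longrightarrow> l \<bullet> b \<le> u \<bullet> b"
  let ?S = "?R -` box l u"
  have op: "open ?S"
    by (intro continuous_open_vimage open_box) (intro continuous_intros)
  have "norm (?R x) = norm x" for x using orthogonal_transformation_norm[OF orth] .
  note nR = this
  obtain R0 where R0: "\<forall>x\<in>box l u. norm x \<le> R0" using bounded_box[of l u] unfolding bounded_iff by (rule exE)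
  have bS: "bounded ?S"
  proof (rule boundedI)
    fix x assume "x \<in> ?S"
    then have "norm (?R x) \<le> R0" using R0 by simp
    then show "norm x \<le> R0" by (simp only: nR)
  qed
  have S: "?S \<in> lmeasurable" by (rule bounded_set_imp_lmeasurable[OF bS]) (simp add: op)
  have "surj ?R" by (rule orthogonal_transformation_surj[OF orth])
  then have im: "?R ` ?S = box l u" by (rule surj_image_vimage_eq)
  have "emeasure (distr lborel borel ?R) (box l u) = emeasure lborel ?S"
    by (subst emeasure_distr) auto
  also have "\<dots> = ennreal (measure lborel ?S)"
    by (rule emeasure_eq_ennreal_measure) (use emeasure_bounded_finite[OF bS] in auto)
  also have "measure lborel ?S = measure lebesgue ?S"
    by (rule measure_completion[symmetric]) (simp add: op)
  also have "\<dots> = measure lebesgue (box l u)"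
    using measure_orthogonal_image[OF orth S] im by simp
  also have "\<dots> = measure lborel (box l u)" by (rule measure_completion) simp
  also have "\<dots> = (\<Prod>b\<in>Basis. (u - l) \<bullet> b)"
    using le by (simp add: measure_lborel_box_eq)
  finally show "emeasure (distr lborel borel ?R) (box l u) = ennreal (\<Prod>b\<in>Basis. (u - l) \<bullet> b)" .
qed simp

text \<open>The inner integral runs over the line x . omega = p, as in the Radon transform.\<close>

lemma integral_rotate:
  fixes F :: "plane \<Rightarrow> complex"
  assumes F: "integrable lborel F" and w: "norm \<omega> = 1"
  shows "(LINT x|lborel. F x) = (LINT p|lborel. LINT t|lborel. F (p *\<^sub>R \<omega> + t *\<^sub>R perp \<omega>))"
    "integrable lborel (\<lambda>p. LINT t|lborel. F (p *\<^sub>R \<omega> + t *\<^sub>R perp \<omega>))"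
proof -
  let ?R = "\<lambda>x::plane. (x $ 1) *\<^sub>R \<omega> + (x $ 2) *\<^sub>R perp \<omega>"
  have [measurable]: "F \<in> borel_measurable borel" using borel_measurable_integrable[OF F] by simp
  have "continuous_on UNIV ?R" by (intro continuous_intros)
  then have [measurable]: "?R \<in> borel_measurable borel" by (rule borel_measurable_continuous_onI)
  have "integrable (distr lborel borel ?R) F" using F by (simp only: lborel_rotate[OF w, symmetric])
  then have i: "integrable lborel (\<lambda>x. F (?R x))"
    by (subst (asm) integrable_distr_eq) auto
  note i2 = integral_plane(1)[OF i, simplified]
  have "(LINT x|lborel. F x) = (LINT x|lborel. F (?R x))"
    by (subst lborel_rotate[OF w], subst integral_distr) auto
  also have "\<dots> = (\<integral>q. (case q of (p, t) \<Rightarrow> F (p *\<^sub>R \<omega> + t *\<^sub>R perp \<omega>)) \<partial>(lborel \<Otimes>\<^sub>M lborel))"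
    unfolding integral_plane(2)[OF i] by (simp add: case_prod_beta')
  also have "\<dots> = (LINT p|lborel. LINT t|lborel. F (p *\<^sub>R \<omega> + t *\<^sub>R perp \<omega>))"
    by (rule lborel_pair.integral_fst[symmetric]) (rule i2)
  finally show "(LINT x|lborel. F x) = (LINT p|lborel. LINT t|lborel. F (p *\<^sub>R \<omega> + t *\<^sub>R perp \<omega>))" .
  show "integrable lborel (\<lambda>p. LINT t|lborel. F (p *\<^sub>R \<omega> + t *\<^sub>R perp \<omega>))"
    by (rule lborel_pair.integrable_fst) (rule i2)
qed

section \<open>Polar coordinates\<close>

definition polar_dom :: "plane set" where
  "polar_dom = {x. x $ 1 > 0 \<and> - pi < x $ 2 \<and> x $ 2 < pi}"

lemma open_polar_dom: "open polar_dom"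
  unfolding polar_dom_def by (intro open_Collect_conj open_Collect_less continuous_intros)

lemma polar_angle_polar:
  assumes "r > 0" "- pi < t" "t \<le> pi"
  shows "polar_angle (r *\<^sub>R omega t) = t"
  unfolding polar_angle_def
  by (rule Arg_unique[of r]) (use assms in \<open>auto simp: complex_eq_iff exp_Euler cos_of_real sin_of_real\<close>)

lemma polar_image: "(\<lambda>x. (x $ 1) *\<^sub>R omega (x $ 2)) ` polar_dom = slit 1"
proof (intro equalityI subsetI)
  fix z assume "z \<in> (\<lambda>x. (x $ 1) *\<^sub>R omega (x $ 2)) ` polar_dom"
  then obtain x where x: "z = (x $ 1) *\<^sub>R omega (x $ 2)" "x \<in> polar_dom" by blast
  have "cos (x $ 2) > 0 \<or> sin (x $ 2) \<noteq> 0"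
  proof (rule ccontr)
    assume "\<not> ?thesis"
    then have s: "sin (x $ 2) = 0" "cos (x $ 2) \<le> 0" by auto
    have "x $ 2 = 0"
      using x(2) s(1) sin_eq_0_pi[of "x $ 2"] by (auto simp: polar_dom_def)
    then show False using s(2) by simp
  qed
  then show "z \<in> slit 1" using x by (auto simp: slit_def polar_dom_def)
next
  fix z assume z: "z \<in> slit 1"
  then have nz: "Complex (z $ 1) (z $ 2) \<noteq> 0" by (auto simp: slit_def complex_eq_iff)
  let ?c = "Complex (z $ 1) (z $ 2)"
  have "?c = of_real (norm ?c) * exp (\<i> * Arg ?c)" by (rule Arg_eq[OF nz])
  then have c: "z $ 1 = norm ?c * cos (Arg ?c)" "z $ 2 = norm ?c * sin (Arg ?c)"
    by (auto simp: complex_eq_iff exp_Euler cos_of_real sin_of_real)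
  have "Arg ?c \<noteq> pi"
  proof
    assume "Arg ?c = pi"
    then have "z $ 2 = 0" "z $ 1 = - norm ?c" using c by simp_all
    then have "z $ 2 = 0" "z $ 1 \<le> 0" using norm_ge_zero[of ?c] by linarith+
    then show False using z by (auto simp: slit_def)
  qed
  then have "- pi < Arg ?c" "Arg ?c < pi" using mpi_less_Arg[of ?c] Arg_le_pi[of ?c] by auto
  then have "(vector [norm ?c, Arg ?c] :: plane) \<in> polar_dom" using nz by (simp add: polar_dom_def)
  moreover have "z = (vector [norm ?c, Arg ?c] $ 1) *\<^sub>R omega ((vector [norm ?c, Arg ?c] :: plane) $ 2)"
    using c by (simp add: plane_eq_iff)
  ultimately show "z \<in> (\<lambda>x. (x $ 1) *\<^sub>R omega (x $ 2)) ` polar_dom" by blast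
qed

lemma polar_inj: "inj_on (\<lambda>x. (x $ 1) *\<^sub>R omega (x $ 2)) polar_dom"
proof (rule inj_onI)
  fix x y assume x: "x \<in> polar_dom" and y: "y \<in> polar_dom"
    and eq: "(x $ 1) *\<^sub>R omega (x $ 2) = (y $ 1) *\<^sub>R omega (y $ 2)"
  have "norm ((x $ 1) *\<^sub>R omega (x $ 2)) = norm ((y $ 1) *\<^sub>R omega (y $ 2))" by (simp only: eq)
  then have 1: "x $ 1 = y $ 1" using x y by (simp add: polar_dom_def)
  have "polar_angle ((x $ 1) *\<^sub>R omega (x $ 2)) = x $ 2" "polar_angle ((y $ 1) *\<^sub>R omega (y $ 2)) = y $ 2"
    using x y by (auto simp: polar_dom_def intro!: polar_angle_polar)
  then have "x $ 2 = y $ 2" unfolding eq by simp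
  then show "x = y" using 1 by (simp add: plane_eq_iff)
qed

lemma polar_has_derivative:
  "((\<lambda>x::plane. (x $ 1) *\<^sub>R omega (x $ 2)) has_derivative
     (\<lambda>v. (v $ 1) *\<^sub>R omega (x $ 2) + (x $ 1 * v $ 2) *\<^sub>R perp (omega (x $ 2)))) (at x within S)"
proof -
  have bl: "((\<lambda>x::plane. x $ i) has_derivative (\<lambda>v. v $ i)) (at x within S)" for i
    by (rule bounded_linear_imp_has_derivative[OF bounded_linear_vec_nth])
  have "((\<lambda>x::plane. (x $ 1 * cos (x $ 2)) *\<^sub>R axis 1 1 + (x $ 1 * sin (x $ 2)) *\<^sub>R (axis 2 1 :: plane)) has_derivative
     (\<lambda>v. (v $ 1) *\<^sub>R omega (x $ 2) + (x $ 1 * v $ 2) *\<^sub>R perp (omega (x $ 2)))) (at x within S)"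
    by (auto intro!: derivative_eq_intros bl simp: fun_eq_iff plane_eq_iff axis_def)
  moreover have "(\<lambda>x::plane. (x $ 1 * cos (x $ 2)) *\<^sub>R axis 1 1 + (x $ 1 * sin (x $ 2)) *\<^sub>R (axis 2 1 :: plane)) = (\<lambda>x. (x $ 1) *\<^sub>R omega (x $ 2))"
    by (auto simp: fun_eq_iff plane_eq_iff axis_def)
  ultimately show ?thesis by simp
qed

lemma polar_det: "det (matrix (\<lambda>v. (v $ 1) *\<^sub>R omega (x $ 2) + (x $ 1 * v $ 2) *\<^sub>R perp (omega (x $ 2)))) = (x :: plane) $ 1"
proof -
  have "det (matrix (\<lambda>v. (v $ 1) *\<^sub>R omega (x $ 2) + (x $ 1 * v $ 2) *\<^sub>R perp (omega (x $ 2)))) =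
      x $ 1 * (cos (x $ 2) * cos (x $ 2)) + x $ 1 * (sin (x $ 2) * sin (x $ 2))"
    by (simp add: det_2 matrix_def axis_def algebra_simps)
  then show ?thesis by (simp only: distrib_left[symmetric] sin_cos_squared_add3 mult_1_right)
qed

lemma slit_AE: "AE x in lborel. x \<in> slit 1"
proof -
  have "negligible {x::plane. x \<bullet> axis 2 1 = 0}"
    by (rule negligible_standard_hyperplane) (simp add: Basis_plane)
  then have "{x::plane. x \<bullet> axis 2 1 = 0} \<in> null_sets lebesgue" by (simp add: negligible_iff_null_sets)
  moreover have "{x::plane. x \<bullet> axis 2 1 = 0} \<in> sets borel"
    by (intro borel_closed closed_Collect_eq continuous_intros)
  ultimately have "{x::plane. x \<bullet> axis 2 1 = 0} \<in> null_sets lborel" by (simp add: null_sets_def)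
  from AE_not_in[OF this] show ?thesis
    by eventually_elim (simp add: slit_def inner_axis)
qed

text \<open>As an identity of measures it has to be checked on boxes only, where it is the Jacobian
  formula for the measure of the image of a bounded open set. The image misses the cut, which is a
  null set.\<close>

lemma lborel_polar:
  "(lborel :: plane measure) = distr (density lborel (\<lambda>x. indicator polar_dom x * ennreal (x $ 1))) borel
     (\<lambda>x. (x $ 1) *\<^sub>R omega (x $ 2))"
proof (rule lborel_eqI)
  let ?g = "\<lambda>x::plane. (x $ 1) *\<^sub>R omega (x $ 2)"
  have cg: "continuous_on UNIV ?g"
    unfolding continuous_on_eq_continuous_within
    by (intro ballI has_derivative_continuous[OF polar_has_derivative])
  then have [measurable]: "?g \<in> borel_measurable borel" by (rule borel_measurable_continuous_onI)
  have [measurable]: "polar_dom \<in> sets borel" by (rule borel_open[OF open_polar_dom])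
  fix l u :: plane assume le: "\<And>b. b \<in> Basis \<Longrightarrow> l \<bullet> b \<le> u \<bullet> b"
  let ?B = "box l u"
  define S where "S = polar_dom \<inter> ?g -` ?B"
  have opS: "open S" unfolding S_def
    by (intro open_Int open_polar_dom continuous_open_vimage open_box has_derivative_continuous[OF polar_has_derivative])
  obtain R0 where R0: "\<forall>x\<in>?B. norm x \<le> R0" using bounded_box[of l u] unfolding bounded_iff by (rule exE)
  have R: "0 < x $ 1" "x $ 1 \<le> R0" "\<bar>x $ 2\<bar> \<le> pi" if "x \<in> S" for x
  proof -
    have "norm (?g x) \<le> R0" using that R0 unfolding S_def by blast
    then show "0 < x $ 1" "x $ 1 \<le> R0" "\<bar>x $ 2\<bar> \<le> pi" using that by (auto simp: S_def polar_dom_def)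
  qed
  have bS: "bounded S"
  proof (rule boundedI)
    fix x assume "x \<in> S"
    then have "norm x \<le> \<bar>x $ 1\<bar> + \<bar>x $ 2\<bar>" "\<bar>x $ 1\<bar> \<le> R0" "\<bar>x $ 2\<bar> \<le> pi"
      using R[of x] norm_le_l1_cart[of x] by (auto simp: sum_2)
    then show "norm x \<le> R0 + pi" by linarith
  qed
  have S: "S \<in> lmeasurable" by (intro bounded_set_imp_lmeasurable bS) (simp add: opS)
  let ?J = "\<lambda>x. \<bar>det (matrix (\<lambda>v. (v $ 1) *\<^sub>R omega (x $ 2) + (x $ 1 * v $ 2) *\<^sub>R perp (omega (x $ 2))))\<bar>"
  have J: "?J x = \<bar>x $ 1\<bar>" for x :: plane unfolding polar_det ..
  have Jint: "(\<lambda>x. \<bar>x $ 1\<bar>) integrable_on S"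
  proof (rule measurable_bounded_by_integrable_imp_integrable)
    show "(\<lambda>x. R0) integrable_on S" by (rule integrable_on_const[OF S])
    show "(\<lambda>x. \<bar>x $ 1\<bar>) \<in> borel_measurable (lebesgue_on S)"
      by (intro continuous_imp_measurable_on_sets_lebesgue continuous_intros) (use S in auto)
    show "norm \<bar>x $ 1\<bar> \<le> R0" if "x \<in> S" for x using R[OF that] by simp
    show "S \<in> sets lebesgue" using S by auto
  qed
  have meas: "measure lebesgue (?g ` S) = integral S (\<lambda>x. \<bar>x $ 1\<bar>)"
    using measure_differentiable_image_eq[of S ?g "\<lambda>x v. (v $ 1) *\<^sub>R omega (x $ 2) + (x $ 1 * v $ 2) *\<^sub>R perp (omega (x $ 2))"]
      polar_has_derivative inj_on_subset[OF polar_inj, of S] Jint S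
    unfolding J by (auto simp: S_def)
  have im: "?g ` S = slit 1 \<inter> ?B"
    unfolding S_def polar_image[symmetric] by auto
  have vB: "?g -` ?B \<in> sets borel"
    by (intro borel_open continuous_open_vimage open_box has_derivative_continuous[OF polar_has_derivative])
  have "emeasure (distr (density lborel (\<lambda>x. indicator polar_dom x * ennreal (x $ 1))) borel ?g) ?B =
      (\<integral>\<^sup>+x. indicator S x * ennreal (\<bar>x $ 1\<bar>) \<partial>lborel)"
    by (subst emeasure_distr, simp, simp, subst emeasure_density)
       (auto intro!: nn_integral_cong simp: vB S_def indicator_def polar_dom_def)
  also have "\<dots> = (\<integral>\<^sup>+x. ennreal (indicator S x * \<bar>x $ 1\<bar>) \<partial>lborel)"
    by (intro nn_integral_cong) (simp add: indicator_def)
  also have "\<dots> = ennreal (integral S (\<lambda>x. \<bar>x $ 1\<bar>))"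
    by (rule nn_integral_has_integral_lebesgue[OF _ integrable_integral[OF Jint]]) simp
  also have "integral S (\<lambda>x. \<bar>x $ 1\<bar>) = measure lebesgue (slit 1 \<inter> ?B)"
    using meas im by simp
  also have "\<dots> = measure lborel (slit 1 \<inter> ?B)"
    by (rule measure_completion) (simp add: open_slit)
  also have "\<dots> = measure lborel ?B"
    by (rule measure_eq_AE) (use slit_AE in \<open>auto simp: open_slit\<close>)
  also have "\<dots> = (\<Prod>b\<in>Basis. (u - l) \<bullet> b)"
    using le by (simp add: measure_lborel_box_eq)
  finally show "emeasure (distr (density lborel (\<lambda>x. indicator polar_dom x * ennreal (x $ 1))) borel ?g) ?B =
      ennreal (\<Prod>b\<in>Basis. (u - l) \<bullet> b)" .
qed simp

theorem integral_polar:
  fixes H :: "plane \<Rightarrow> complex"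
  assumes H: "integrable lborel H"
  shows "(LINT x|lborel. H x) = (LINT t|lborel. LINT r|lborel.
     indicator {-pi<..<pi} t *\<^sub>R (indicator {0<..} r *\<^sub>R (r *\<^sub>R H (r *\<^sub>R omega t))))"
proof -
  let ?g = "\<lambda>x::plane. (x $ 1) *\<^sub>R omega (x $ 2)" and ?d = "\<lambda>x::plane. indicator polar_dom x * x $ 1"
  have [measurable]: "H \<in> borel_measurable borel" using borel_measurable_integrable[OF H] by simp
  have "continuous_on UNIV ?g"
    unfolding continuous_on_eq_continuous_within
    by (intro ballI has_derivative_continuous[OF polar_has_derivative])
  then have [measurable]: "?g \<in> borel_measurable borel" by (rule borel_measurable_continuous_onI)
  have [measurable]: "polar_dom \<in> sets borel" by (rule borel_open[OF open_polar_dom])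
  have dn: "?d x \<ge> 0" for x by (simp add: indicator_def polar_dom_def)
  have L: "(lborel :: plane measure) = distr (density lborel (\<lambda>x. ennreal (?d x))) borel ?g"
  proof -
    have "(\<lambda>x. indicator polar_dom x * ennreal (x $ 1)) = (\<lambda>x::plane. ennreal (?d x))"
      by (auto simp: indicator_def)
    then show ?thesis using lborel_polar by simp
  qed
  have "integrable (distr (density lborel (\<lambda>x. ennreal (?d x))) borel ?g) H"
    using H by (simp only: L[symmetric])
  then have "integrable (density lborel (\<lambda>x. ennreal (?d x))) (\<lambda>x. H (?g x))"
    by (subst (asm) integrable_distr_eq) auto
  then have i: "integrable lborel (\<lambda>x. ?d x *\<^sub>R H (?g x))"
    by (subst (asm) integrable_density) (auto simp: dn)
  have "(LINT x|lborel. H x) = (\<integral>x. H (?g x) \<partial>(density lborel (\<lambda>x. ennreal (?d x))))"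
    by (subst L, subst integral_distr) auto
  also have "\<dots> = (LINT x|lborel. ?d x *\<^sub>R H (?g x))"
    by (subst integral_density) (auto simp: dn)
  also have "\<dots> = (\<integral>q. (case q of (r, t) \<Rightarrow> ?d (vector [r, t]) *\<^sub>R H (r *\<^sub>R omega t)) \<partial>(lborel \<Otimes>\<^sub>M lborel))"
    unfolding integral_plane(2)[OF i] by (simp add: case_prod_beta')
  also have "\<dots> = (LINT t|lborel. LINT r|lborel. ?d (vector [r, t]) *\<^sub>R H (r *\<^sub>R omega t))"
    by (rule lborel_pair.integral_snd[symmetric]) (use integral_plane(1)[OF i] in simp)
  also have "(\<lambda>t r. ?d (vector [r, t]) *\<^sub>R H (r *\<^sub>R omega t)) =
     (\<lambda>t r. indicator {-pi<..<pi} t *\<^sub>R (indicator {0<..} r *\<^sub>R (r *\<^sub>R H (r *\<^sub>R omega t))))"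
    by (auto simp: fun_eq_iff indicator_def polar_dom_def)
  finally show ?thesis .
qed

section \<open>Differentiation under the integral sign\<close>

lemma has_vector_derivative_quotientI:
  fixes f :: "real \<Rightarrow> 'a::real_normed_vector"
  assumes "((\<lambda>t. (f t - f x) /\<^sub>R (t - x)) \<longlongrightarrow> d) (at x)"
  shows "(f has_vector_derivative d) (at x)"
proof -
  have "((\<lambda>t. norm ((f t - f x) /\<^sub>R (t - x) - d)) \<longlongrightarrow> 0) (at x)"
    using tendsto_norm_zero[OF LIM_zero[OF assms]] .
  then have "((\<lambda>t. norm (f t - f x - (t - x) *\<^sub>R d) / norm (t - x)) \<longlongrightarrow> 0) (at x)"
  proof (rule Lim_transform_eventually)
    have "norm (f t - f x - (t - x) *\<^sub>R d) / norm (t - x) = norm ((f t - f x) /\<^sub>R (t - x) - d)" if "t \<noteq> x" for t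
    proof -
      have "(f t - f x) /\<^sub>R (t - x) - d = (f t - f x - (t - x) *\<^sub>R d) /\<^sub>R (t - x)"
        using that by (simp add: scaleR_diff_right)
      then show ?thesis by (simp add: divide_inverse mult.commute)
    qed
    then show "\<forall>\<^sub>F t in at x. norm ((f t - f x) /\<^sub>R (t - x) - d) = norm (f t - f x - (t - x) *\<^sub>R d) / norm (t - x)"
      by (simp add: eventually_at_filter)
  qed
  then show ?thesis
    by (simp add: has_vector_derivative_def has_derivative_iff_norm bounded_linear_scaleR_left)
qed

lemma vector_mean_value_bound:
  fixes f :: "real \<Rightarrow> complex"
  assumes "\<And>t. (f has_vector_derivative f' t) (at t)" "\<And>t. norm (f' t) \<le> B"
  shows "norm (f a - f b) \<le> B * \<bar>a - b\<bar>"
proof -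
  have "norm (f a - f b) \<le> B * norm (a - b)"
  proof (rule differentiable_bound[of UNIV f "\<lambda>t h. h *\<^sub>R f' t"])
    show "onorm (\<lambda>h. h *\<^sub>R f' t) \<le> B" for t
      by (rule onorm_le) (use mult_right_mono[OF assms(2) abs_ge_zero] in \<open>simp add: mult.commute\<close>)
  qed (use assms(1) in \<open>auto simp: has_vector_derivative_def\<close>)
  then show ?thesis by simp
qed

text \<open>By the mean value inequality the majorant of f' also bounds the difference quotients, so
  dominated convergence applies to them.\<close>

theorem has_vector_derivative_integral:
  fixes f :: "real \<Rightarrow> 'a \<Rightarrow> complex"
  assumes f: "\<And>t. integrable M (f t)"
    and D: "\<And>t x. x \<in> space M \<Longrightarrow> ((\<lambda>t. f t x) has_vector_derivative f' t x) (at t)"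
    and b: "\<And>t x. x \<in> space M \<Longrightarrow> norm (f' t x) \<le> w x" and w: "integrable M w"
  shows "integrable M (f' t)"
    and "((\<lambda>t. LINT x|M. f t x) has_vector_derivative (LINT x|M. f' t x)) (at t)"
proof -
  have m[measurable]: "f t \<in> borel_measurable M" for t using f borel_measurable_integrable by auto
  have q: "(\<lambda>n. (f (t + X n) x - f t x) /\<^sub>R X n) \<longlonglongrightarrow> f' t x"
    if X: "\<And>n. X n \<noteq> 0" "X \<longlonglongrightarrow> 0" and x: "x \<in> space M" for X t x
  proof -
    have "(\<lambda>n. t + X n) \<longlonglongrightarrow> t" using tendsto_add[OF tendsto_const X(2), of t] by simp
    then have "filterlim (\<lambda>n. t + X n) (at t) sequentially"
      using X(1) by (auto simp: filterlim_at)
    from filterlim_compose[OF vector_derivative_quotient[OF D[OF x]] this]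
    show ?thesis by simp
  qed
  have f'm[measurable]: "f' t \<in> borel_measurable M" for t
  \<comment> \<open>f' is measurable as a pointwise limit of difference quotients with increment 1 /
    (n + 1).\<close>
  proof (rule borel_measurable_LIMSEQ_metric[where f = "\<lambda>n x. (f (t + 1 / real (Suc n)) x - f t x) /\<^sub>R (1 / real (Suc n))"])
    show "(\<lambda>n. (f (t + 1 / real (Suc n)) x - f t x) /\<^sub>R (1 / real (Suc n))) \<longlonglongrightarrow> f' t x" if "x \<in> space M" for x
      by (rule q[OF _ LIMSEQ_Suc[OF lim_1_over_n] that]) simp
  qed measurable
  show f'i: "integrable M (f' t)"
    by (rule Bochner_Integration.integrable_bound[OF w]) (use b order_trans[OF norm_ge_zero b] in \<open>auto intro!: AE_I2 order_trans[OF b]\<close>)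
  show "((\<lambda>t. LINT x|M. f t x) has_vector_derivative (LINT x|M. f' t x)) (at t)"
  proof (rule has_vector_derivative_quotientI, unfold tendsto_at_iff_sequentially, intro allI impI)
    fix X :: "nat \<Rightarrow> real" assume X: "\<forall>i. X i \<in> UNIV - {t}" "X \<longlonglongrightarrow> t"
    define Y where "Y n = X n - t" for n
    have Y: "Y n \<noteq> 0" "X n = t + Y n" for n using X(1) by (auto simp: Y_def)
    have Y0: "Y \<longlonglongrightarrow> 0" using tendsto_diff[OF X(2) tendsto_const, of t] by (simp add: Y_def[abs_def])
    have "(\<lambda>n. LINT x|M. (f (t + Y n) x - f t x) /\<^sub>R Y n) \<longlonglongrightarrow> (LINT x|M. f' t x)"
    proof (rule integral_dominated_convergence[where w = w])
      show "AE x in M. (\<lambda>n. (f (t + Y n) x - f t x) /\<^sub>R Y n) \<longlonglongrightarrow> f' t x"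
        by (intro AE_I2 q Y Y0)
      show "AE x in M. norm ((f (t + Y n) x - f t x) /\<^sub>R Y n) \<le> w x" for n
      proof (rule AE_I2)
        fix x assume x: "x \<in> space M"
        have "norm (f (t + Y n) x - f t x) \<le> w x * \<bar>t + Y n - t\<bar>"
          by (rule vector_mean_value_bound[OF D[OF x] b[OF x]])
        then show "norm ((f (t + Y n) x - f t x) /\<^sub>R Y n) \<le> w x"
          using Y(1)[of n] by (simp add: divide_inverse[symmetric] pos_divide_le_eq mult.commute[of "inverse _"])
      qed
    qed (use w in measurable)
    moreover have "(LINT x|M. (f (t + Y n) x - f t x) /\<^sub>R Y n) =
        ((LINT x|M. f (X n) x) - (LINT x|M. f t x)) /\<^sub>R (X n - t)" for n
      using f by (simp add: Y(2)[symmetric] Y_def)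
    ultimately show "((\<lambda>s. ((LINT x|M. f s x) - (LINT x|M. f t x)) /\<^sub>R (s - t)) \<circ> X) \<longlonglongrightarrow> (LINT x|M. f' t x)"
      by (simp add: o_def)
  qed
qed

section \<open>Fourier transforms along circles\<close>

lemma perp_perp [simp]: "perp (perp x) = - x"
  by (simp add: plane_eq_iff)

lemma norm_perp [simp]: "norm (perp x) = norm x"
proof -
  have "(norm (perp x))\<^sup>2 = (norm x)\<^sup>2" by (simp add: norm_plane)
  then show ?thesis by (rule power2_eq_imp_eq) auto
qed

lemma omega_has_vector_derivative: "(omega has_vector_derivative perp (omega t)) (at t)"
proof -
  have "((\<lambda>t. cos t *\<^sub>R axis 1 1 + sin t *\<^sub>R (axis 2 1 :: plane)) has_vector_derivative
      (- sin t) *\<^sub>R axis 1 1 + cos t *\<^sub>R axis 2 1) (at t)"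
    by (auto intro!: derivative_eq_intros simp: has_vector_derivative_def fun_eq_iff algebra_simps)
  moreover have "(\<lambda>t. cos t *\<^sub>R axis 1 1 + sin t *\<^sub>R (axis 2 1 :: plane)) = omega"
    "(- sin t) *\<^sub>R axis 1 1 + cos t *\<^sub>R axis 2 1 = perp (omega t)"
    by (auto simp: fun_eq_iff plane_eq_iff axis_def)
  ultimately show ?thesis by simp
qed

lemma inner_omega_deriv:
  "((\<lambda>t. x \<bullet> omega t) has_vector_derivative (x \<bullet> perp (omega t))) (at t)"
  "((\<lambda>t. x \<bullet> perp (omega t)) has_vector_derivative (- (x \<bullet> omega t))) (at t)"
proof -
  note b = bounded_linear.has_vector_derivative[OF bounded_linear_inner_right omega_has_vector_derivative]
  show "((\<lambda>t. x \<bullet> omega t) has_vector_derivative (x \<bullet> perp (omega t))) (at t)" by (rule b)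
  have "((\<lambda>t. x \<bullet> perp (omega t)) has_vector_derivative (x \<bullet> perp (perp (omega t)))) (at t)"
    by (rule bounded_linear.has_vector_derivative[OF
          bounded_linear_compose[OF bounded_linear_inner_right bounded_linear_perp] omega_has_vector_derivative])
  then show "((\<lambda>t. x \<bullet> perp (omega t)) has_vector_derivative (- (x \<bullet> omega t))) (at t)" by simp
qed

text \<open>Along the circle a' = b and b' = -a, so every derivative of the wave is a polynomial in
  a and b times the wave.\<close>

lemma circle_wave_derivs:
  fixes r :: real and x :: plane
  defines "E \<equiv> \<lambda>t. exp (\<i> * of_real (r * (x \<bullet> omega t)))"
    and "a \<equiv> \<lambda>t. complex_of_real (r * (x \<bullet> omega t))" and "b \<equiv> \<lambda>t. complex_of_real (r * (x \<bullet> perp (omega t)))"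
  shows "(E has_vector_derivative (\<i> * b t) * E t) (at t)"
    "((\<lambda>t. (\<i> * b t) * E t) has_vector_derivative (- \<i> * a t - b t * b t) * E t) (at t)"
    "((\<lambda>t. (- \<i> * a t - b t * b t) * E t) has_vector_derivative
       (- \<i> * b t + 3 * (a t * b t) - \<i> * (b t * b t * b t)) * E t) (at t)"
proof -
  have a: "(a has_vector_derivative b t) (at t)" and b: "(b has_vector_derivative - a t) (at t)" for t
    unfolding a_def b_def
    using bounded_linear.has_vector_derivative[OF bounded_linear_compose[OF bounded_linear_of_real bounded_linear_mult_right[of r]] inner_omega_deriv(1), of x t]
      bounded_linear.has_vector_derivative[OF bounded_linear_compose[OF bounded_linear_of_real bounded_linear_mult_right[of r]] inner_omega_deriv(2), of x t]
    by simp_all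
  have E: "(E has_vector_derivative (\<i> * b t) * E t) (at t)" for t
  proof -
    have "((\<lambda>t. \<i> * a t) has_vector_derivative \<i> * b t) (at t)"
      by (rule bounded_linear.has_vector_derivative[OF bounded_linear_mult_right a])
    from field_vector_diff_chain_at[OF this DERIV_exp]
    show ?thesis by (simp add: E_def a_def o_def)
  qed
  show "(E has_vector_derivative (\<i> * b t) * E t) (at t)" by (rule E)
  have ib: "((\<lambda>t. \<i> * b t) has_vector_derivative \<i> * (- a t)) (at t)"
    by (rule bounded_linear.has_vector_derivative[OF bounded_linear_mult_right b])
  show "((\<lambda>t. (\<i> * b t) * E t) has_vector_derivative (- \<i> * a t - b t * b t) * E t) (at t)"
    by (rule has_vector_derivative_eq_rhs[OF has_vector_derivative_mult[OF ib E]]) (simp add: algebra_simps)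
  have c: "((\<lambda>t. - \<i> * a t - b t * b t) has_vector_derivative (- \<i> * b t - (b t * (- a t) + (- a t) * b t))) (at t)"
    by (intro has_vector_derivative_diff has_vector_derivative_mult b bounded_linear.has_vector_derivative[OF bounded_linear_mult_right a])
  show "((\<lambda>t. (- \<i> * a t - b t * b t) * E t) has_vector_derivative
       (- \<i> * b t + 3 * (a t * b t) - \<i> * (b t * b t * b t)) * E t) (at t)"
    by (rule has_vector_derivative_eq_rhs[OF has_vector_derivative_mult[OF c E]]) (simp add: algebra_simps)
qed

text \<open>Three derivatives are taken because decay of the second is interpolated from growth of
  the third. Each derivative costs at most one factor |r| |x|, whence the power 3 of the weight and
  of the growth.\<close>

lemma ft_circle_derivs:
  fixes w :: "plane \<Rightarrow> complex"
  assumes [measurable]: "w \<in> borel_measurable borel" and w3: "integrable lborel (\<lambda>x. (1 + norm x) ^ 3 * norm (w x))"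
  obtains U1 U2 U3 C where
    "\<And>r t. ((\<lambda>t. ft 1 w (r *\<^sub>R omega t)) has_vector_derivative U1 r t) (at t)"
    "\<And>r t. (U1 r has_vector_derivative U2 r t) (at t)"
    "\<And>r t. (U2 r has_vector_derivative U3 r t) (at t)"
    "\<And>r t. norm (ft 1 w (r *\<^sub>R omega t)) \<le> C * (1 + \<bar>r\<bar>) ^ 3"
    "\<And>r t. norm (U1 r t) \<le> C * (1 + \<bar>r\<bar>) ^ 3"
    "\<And>r t. norm (U2 r t) \<le> C * (1 + \<bar>r\<bar>) ^ 3"
    "\<And>r t. norm (U3 r t) \<le> C * (1 + \<bar>r\<bar>) ^ 3"
proof -
  define a where "a r x t = complex_of_real (r * (x \<bullet> omega t))" for r and x :: plane and t
  define b where "b r x t = complex_of_real (r * (x \<bullet> perp (omega t)))" for r and x :: plane and t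
  define E where "E r x t = exp (\<i> * of_real (r * (x \<bullet> omega t)))" for r and x :: plane and t
  define E1 where "E1 r x t = (\<i> * b r x t) * E r x t" for r x t
  define E2 where "E2 r x t = (- \<i> * a r x t - b r x t * b r x t) * E r x t" for r x t
  define E3 where "E3 r x t = (- \<i> * b r x t + 3 * (a r x t * b r x t) - \<i> * (b r x t * b r x t * b r x t)) * E r x t" for r x t
  note cw = circle_wave_derivs[of r x t for r x t, folded a_def b_def E_def, folded E1_def E2_def E3_def]
  \<comment> \<open>5 = 1 + 3 + 1 is the sum of the absolute coefficients in the third derivative,
    the largest of the four bounds.\<close>
  define K where "K r x = 5 * (1 + \<bar>r\<bar>) ^ 3 * ((1 + norm x) ^ 3)" for r and x :: plane
  have ab: "norm (a r x t) \<le> \<bar>r\<bar> * norm x" "norm (b r x t) \<le> \<bar>r\<bar> * norm x" "norm (E r x t) = 1" for r x t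
    using Cauchy_Schwarz_ineq2[of x "omega t"] Cauchy_Schwarz_ineq2[of x "perp (omega t)"]
    by (auto simp: a_def b_def E_def abs_mult norm_mult intro!: mult_left_mono)
  have KE: "norm (E r x t) \<le> K r x" "norm (E1 r x t) \<le> K r x" "norm (E2 r x t) \<le> K r x" "norm (E3 r x t) \<le> K r x" for r x t
  proof -
    define z where "z = \<bar>r\<bar> * norm x"
    define y where "y = (1 + \<bar>r\<bar>) * (1 + norm x)"
    have z: "0 \<le> z" by (simp add: z_def)
    have "y = 1 + \<bar>r\<bar> + norm x + z" by (simp add: y_def z_def algebra_simps)
    then have y: "1 \<le> y" "z \<le> y" by (simp_all add: z_def)
    have K: "K r x = 5 * y ^ 3" by (simp add: K_def y_def power_mult_distrib)
    have y3: "1 \<le> y ^ 3" "z \<le> y ^ 3" "z * z \<le> y ^ 3" "z * z * z \<le> y ^ 3"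
    proof -
      show "1 \<le> y ^ 3" using y by simp
      have "y ^ 1 \<le> y ^ 3" "y ^ 2 \<le> y ^ 3" by (intro power_increasing y; simp)+
      moreover have "z * z \<le> y ^ 2" "z * z * z \<le> y ^ 3"
        unfolding power2_eq_square power3_eq_cube using z y by (intro mult_mono; simp)+
      ultimately show "z \<le> y ^ 3" "z * z \<le> y ^ 3" "z * z * z \<le> y ^ 3" using y by auto
    qed
    note A = ab(1)[of r x t, folded z_def] and B = ab(2)[of r x t, folded z_def]
    have m: "norm (b r x t * b r x t) \<le> z * z" "norm (a r x t * b r x t) \<le> z * z" "norm (b r x t * b r x t * b r x t) \<le> z * z * z"
      unfolding norm_mult using A B z by (intro mult_mono; simp)+
    show "norm (E r x t) \<le> K r x" using y3 by (simp add: ab K)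
    show "norm (E1 r x t) \<le> K r x" using y3 B by (simp add: E1_def norm_mult ab K)
    have "norm (- \<i> * a r x t - b r x t * b r x t) \<le> norm (- \<i> * a r x t) + norm (b r x t * b r x t)" by (rule norm_triangle_ineq4)
    also have "norm (- \<i> * a r x t) = norm (a r x t)" by (simp add: norm_mult)
    finally show "norm (E2 r x t) \<le> K r x" using y3 A m unfolding E2_def norm_mult[of _ "E r x t"] ab(3) K by linarith
    have "norm (- \<i> * b r x t + 3 * (a r x t * b r x t) - \<i> * (b r x t * b r x t * b r x t)) \<le>
        norm (- \<i> * b r x t) + norm (3 * (a r x t * b r x t)) + norm (\<i> * (b r x t * b r x t * b r x t))"
      by (rule order_trans[OF norm_triangle_ineq4]) (intro add_right_mono norm_triangle_ineq)
    also have "\<dots> = norm (b r x t) + 3 * norm (a r x t * b r x t) + norm (b r x t * b r x t * b r x t)"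
      by (simp add: norm_mult)
    finally show "norm (E3 r x t) \<le> K r x" using y3 B m unfolding E3_def norm_mult[of _ "E r x t"] ab(3) K by linarith
  qed
  have Ki: "integrable lborel (\<lambda>x. K r x * norm (w x))" for r
    using integrable_mult_right[OF w3, of "5 * (1 + \<bar>r\<bar>) ^ 3"] by (simp add: K_def mult.assoc)
  have contE: "continuous_on UNIV (\<lambda>x. E r x t)" "continuous_on UNIV (\<lambda>x. E1 r x t)" "continuous_on UNIV (\<lambda>x. E2 r x t)" for r t
    unfolding E2_def E1_def E_def a_def b_def by (intro continuous_intros)+
  note [measurable] = contE[THEN borel_measurable_continuous_onI]
  have int: "integrable lborel (\<lambda>x. F x * w x)" if "F \<in> borel_measurable borel" "\<And>x. norm (F x) \<le> K r x" for F r
  proof (rule Bochner_Integration.integrable_bound[OF Ki[of r]])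
    show "AE x in lborel. norm (F x * w x) \<le> norm (K r x * norm (w x))"
      using that(2) by (intro AE_I2) (simp add: norm_mult K_def abs_mult mult_right_mono)
  qed (use that in measurable)
  define U1 where "U1 r t = (LINT x|lborel. E1 r x t * w x)" for r t
  define U2 where "U2 r t = (LINT x|lborel. E2 r x t * w x)" for r t
  define U3 where "U3 r t = (LINT x|lborel. E3 r x t * w x)" for r t
  have U0: "ft 1 w (r *\<^sub>R omega t) = (LINT x|lborel. E r x t * w x)" for r t
    by (simp add: ft_def E_def)
  have d: "((\<lambda>t. LINT x|lborel. F t x * w x) has_vector_derivative (LINT x|lborel. F' t x * w x)) (at t)"
    if "\<And>t. (\<lambda>x. F t x) \<in> borel_measurable borel" "\<And>t x. norm (F t x) \<le> K r x"
      "\<And>t x. ((\<lambda>t. F t x) has_vector_derivative F' t x) (at t)" "\<And>t x. norm (F' t x) \<le> K r x" for F F' r t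
  proof (rule has_vector_derivative_integral(2)[OF int[OF that(1,2)] _ _ Ki[of r]])
    show "((\<lambda>t. F t x * w x) has_vector_derivative F' t x * w x) (at t)" for t x
      by (rule bounded_linear.has_vector_derivative[OF bounded_linear_mult_left that(3)])
    show "norm (F' t x * w x) \<le> K r x * norm (w x)" for t x
      unfolding norm_mult by (intro mult_right_mono that(4)) simp
  qed
  define C where "C = 5 * (LINT x|lborel. (1 + norm x) ^ 3 * norm (w x))"
  have bd: "norm (LINT x|lborel. F x * w x) \<le> C * (1 + \<bar>r\<bar>) ^ 3" if "\<And>x. norm (F x) \<le> K r x" for F r
  proof -
    have "norm (LINT x|lborel. F x * w x) \<le> (LINT x|lborel. K r x * norm (w x))"
    proof (cases "integrable lborel (\<lambda>x. F x * w x)")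
      case True
      have "norm (LINT x|lborel. F x * w x) \<le> (LINT x|lborel. norm (F x * w x))" by (rule integral_norm_bound)
      also have "\<dots> \<le> (LINT x|lborel. K r x * norm (w x))"
        by (rule Bochner_Integration.integral_mono[OF integrable_norm[OF True] Ki]) (use that in \<open>auto simp: norm_mult mult_right_mono\<close>)
      finally show ?thesis .
    next
      case False
      then show ?thesis by (simp add: not_integrable_integral_eq K_def)
    qed
    also have "\<dots> = C * (1 + \<bar>r\<bar>) ^ 3" by (simp add: K_def C_def mult.assoc)
    finally show ?thesis .
  qed
  show ?thesis
  proof (rule that[of U1 U2 U3 C])
    fix r t
    show "((\<lambda>t. ft 1 w (r *\<^sub>R omega t)) has_vector_derivative U1 r t) (at t)"
      unfolding U0 U1_def by (rule d) (use cw(1) KE in auto)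
    show "(U1 r has_vector_derivative U2 r t) (at t)"
      unfolding U1_def[abs_def] U2_def by (rule d) (use cw(2) KE in auto)
    show "(U2 r has_vector_derivative U3 r t) (at t)"
      unfolding U2_def[abs_def] U3_def by (rule d) (use cw(3) KE in auto)
    show "norm (ft 1 w (r *\<^sub>R omega t)) \<le> C * (1 + \<bar>r\<bar>) ^ 3" unfolding U0 by (rule bd[OF KE(1)])
    show "norm (U1 r t) \<le> C * (1 + \<bar>r\<bar>) ^ 3" unfolding U1_def by (rule bd[OF KE(2)])
    show "norm (U2 r t) \<le> C * (1 + \<bar>r\<bar>) ^ 3" unfolding U2_def by (rule bd[OF KE(3)])
    show "norm (U3 r t) \<le> C * (1 + \<bar>r\<bar>) ^ 3" unfolding U3_def by (rule bd[OF KE(4)])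
  qed
qed

text \<open>Landau--Kolmogorov interpolation. Only the Fourier transform itself is assumed to decay rapidly;
  its derivatives are at first merely known to grow polynomially.\<close>

lemma derivative_interpolation:
  fixes u :: "real \<Rightarrow> complex"
  assumes u: "\<And>t. (u has_vector_derivative u' t) (at t)" and u': "\<And>t. (u' has_vector_derivative u'' t) (at t)"
    and A: "\<And>t. norm (u t) \<le> A" and B: "\<And>t. norm (u'' t) \<le> B" and d: "d > 0"
  shows "norm (u' t) \<le> 2 * A / d + B * d"
proof -
  define v where "v s = u s - s *\<^sub>R u' t" for s
  have B0: "B \<ge> 0" using order_trans[OF norm_ge_zero B] .
  \<comment> \<open>First-order Taylor estimate: u' varies by at most B d on an interval of length
    d.\<close>
  have "norm (u (t + d) - u t - (t + d - t) *\<^sub>R u' t) \<le> norm (t + d - t) * (B * d)"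
  proof (rule vector_differentiable_bound_linearization[of "{t..t + d}"])
    show "(u has_vector_derivative u' x) (at x within {t..t + d})" for x
      by (rule has_vector_derivative_at_within[OF u])
    show "closed_segment t (t + d) \<subseteq> {t..t + d}" using d by (simp add: closed_segment_eq_real_ivl)
    show "norm (u' x - u' t) \<le> B * d" if "x \<in> {t..t + d}" for x
    proof -
      have "norm (u' x - u' t) \<le> B * \<bar>x - t\<bar>" by (rule vector_mean_value_bound[OF u' B])
      also have "\<dots> \<le> B * d" using that B0 by (intro mult_left_mono) auto
      finally show ?thesis .
    qed
  qed (use d in auto)
  then have 1: "norm (u (t + d) - u t - d *\<^sub>R u' t) \<le> d * (B * d)" using d by simp
  have "norm (d *\<^sub>R u' t) = norm (u (t + d) - u t - (u (t + d) - u t - d *\<^sub>R u' t))" by simp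
  also have "\<dots> \<le> norm (u (t + d)) + norm (u t) + norm (u (t + d) - u t - d *\<^sub>R u' t)"
    using norm_triangle_ineq4[of "u (t + d) - u t" "u (t + d) - u t - d *\<^sub>R u' t"] norm_triangle_ineq4[of "u (t + d)" "u t"] by linarith
  also have "\<dots> \<le> 2 * A + d * (B * d)" using A[of t] A[of "t + d"] 1 by linarith
  finally have "d * norm (u' t) \<le> 2 * A + d * (B * d)" using d by simp
  then have "norm (u' t) \<le> (2 * A + d * (B * d)) / d" using d by (simp add: pos_le_divide_eq mult.commute)
  also have "\<dots> = 2 * A / d + B * d" using d by (simp add: add_divide_distrib)
  finally show ?thesis .
qed

text \<open>Interpolation with a step that shrinks as |r| grows.\<close>

lemma rapid_decay_derivative:
  fixes u :: "real \<Rightarrow> real \<Rightarrow> complex"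
  assumes u: "\<And>r t. (u r has_vector_derivative u' r t) (at t)" and u': "\<And>r t. (u' r has_vector_derivative u'' r t) (at t)"
    and A: "\<And>N. \<exists>A. \<forall>r t. norm (u r t) \<le> A / (1 + \<bar>r\<bar>) ^ N" and B: "\<And>r t. norm (u'' r t) \<le> B * (1 + \<bar>r\<bar>) ^ 3"
  shows "\<exists>A. \<forall>r t. norm (u' r t) \<le> A / (1 + \<bar>r\<bar>) ^ N"
proof -
  \<comment> \<open>The step will be (1 + |r|)^(-(N + 3)). It turns the growth of order 3 of u''
    into decay of order N; dividing u by it loses order N + 3, so u is taken with decay of order N +
    (N + 3).\<close>
  obtain A where A': "\<And>r t. norm (u r t) \<le> A / (1 + \<bar>r\<bar>) ^ (N + (N + 3))" using A[of "N + (N + 3)"] by blast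
  have "norm (u' r t) \<le> (2 * A + B) / (1 + \<bar>r\<bar>) ^ N" for r t
  proof -
    let ?p = "1 + \<bar>r\<bar>"
    have p: "?p > 0" by simp
    have pn: "?p ^ n > 0" for n using p by simp
    have "norm (u' r t) \<le> 2 * (A / ?p ^ (N + (N + 3))) / (1 / ?p ^ (N + 3)) + (B * ?p ^ 3) * (1 / ?p ^ (N + 3))"
      by (rule derivative_interpolation[OF u u' A' B]) (use pn in simp)
    also have "\<dots> = (2 * A + B) / ?p ^ N"
    proof -
      have "?p ^ (N + (N + 3)) = ?p ^ N * ?p ^ (N + 3)" "?p ^ (N + 3) = ?p ^ N * ?p ^ 3" by (simp_all only: power_add)
      then show ?thesis using pn[of N] pn[of 3] by (simp add: field_simps)
    qed
    finally show ?thesis .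
  qed
  then show ?thesis by blast
qed

section \<open>Regularity of the ray integral\<close>

lemma inverse_weight_integrable: "integrable lborel (\<lambda>r::real. 1 / (1 + \<bar>r\<bar>)\<^sup>2)"
proof (rule Bochner_Integration.integrable_bound[OF inverse_1_plus_square_integrable])
  show "AE r::real in lborel. norm (1 / (1 + \<bar>r\<bar>)\<^sup>2) \<le> norm (inverse (1 + r\<^sup>2))"
  proof (rule AE_I2)
    fix r :: real
    have "1 + r\<^sup>2 \<le> (1 + \<bar>r\<bar>)\<^sup>2" by (simp add: power2_sum)
    moreover have "1 + r\<^sup>2 > 0" by (simp add: add_pos_nonneg)
    ultimately have "inverse ((1 + \<bar>r\<bar>)\<^sup>2) \<le> inverse (1 + r\<^sup>2)" by (rule le_imp_inverse_le)
    then show "norm (1 / (1 + \<bar>r\<bar>)\<^sup>2) \<le> norm (inverse (1 + r\<^sup>2))"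
      by (simp add: divide_inverse abs_of_nonneg)
  qed
qed measurable

lemma continuous_periodic_bounded:
  fixes f :: "real \<Rightarrow> complex"
  assumes c: "continuous_on UNIV f" and p: "\<And>t. f (t + 2 * pi) = f t"
  shows "\<exists>B. \<forall>t. norm (f t) \<le> B"
proof -
  have "bounded (f ` {0..2 * pi})"
    by (intro compact_imp_bounded compact_continuous_image continuous_on_subset[OF c]) auto
  then obtain B where B: "\<And>t. t \<in> {0..2 * pi} \<Longrightarrow> norm (f t) \<le> B" unfolding bounded_iff by blast
  interpret periodic_fun_simple f "2 * pi" by unfold_locales (rule p)
  have "norm (f t) \<le> B" for t
  proof -
    define n where "n = \<lfloor>t / (2 * pi)\<rfloor>"
    have "of_int n \<le> t / (2 * pi)" "t / (2 * pi) < of_int n + 1" unfolding n_def by linarith+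
    then have "t - of_int n * (2 * pi) \<in> {0..2 * pi}" by (simp add: field_simps)
    moreover have "f (t - of_int n * (2 * pi)) = f t" using minus_of_int[of t n] by simp
    ultimately show ?thesis using B by metis
  qed
  then show ?thesis by blast
qed

lemma periodic_derivative:
  fixes f :: "real \<Rightarrow> complex"
  assumes D: "\<And>t. (f has_vector_derivative f' t) (at t)" and p: "\<And>t. f (t + 2 * pi) = f t"
  shows "f' (t + 2 * pi) = f' t"
proof -
  have "((\<lambda>t. t + 2 * pi) has_vector_derivative 1) (at t)" by (auto intro!: derivative_eq_intros)
  from vector_diff_chain_at[OF this D] have "(f has_vector_derivative f' (t + 2 * pi)) (at t)" by (simp add: o_def p)
  then show ?thesis using D vector_derivative_unique_at by blast
qed

text \<open>The integral over the ray at angle \<open>t\<close>; by polar coordinates its Fourier coefficients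
  are the pairings of \<open>A\<^sub>k f\<^sub>\<psi>\<close> with a test function.\<close>

definition ray_integral :: "(plane \<Rightarrow> complex) \<Rightarrow> (plane \<Rightarrow> complex) \<Rightarrow> (plane \<Rightarrow> complex) \<Rightarrow> real \<Rightarrow> complex" where
  "ray_integral \<psi> F \<Phi> t = \<psi> (omega t) * (LINT r|lborel. indicator {0<..} r *\<^sub>R (r *\<^sub>R (F (r *\<^sub>R omega t) * \<Phi> (r *\<^sub>R omega t))))"

lemma omega_periodic: "omega (t + 2 * pi) = omega t"
  by (simp add: plane_eq_iff)

text \<open>Periodicity passes to the derivatives, so their continuity already bounds them
  globally.\<close>

lemma smooth_circle_derivs:
  assumes "smooth_on_circle \<psi>"
  obtains P1 P2 B where "\<And>t. ((\<lambda>t. \<psi> (omega t)) has_vector_derivative P1 t) (at t)"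
    "\<And>t. (P1 has_vector_derivative P2 t) (at t)"
    "\<And>t. norm (\<psi> (omega t)) \<le> B" "\<And>t. norm (P1 t) \<le> B" "\<And>t. norm (P2 t) \<le> B"
proof -
  define P where "P = (\<lambda>t. \<psi> (omega t))"
  have C: "Ck 3 UNIV P" using assms by (simp add: smooth_on_circle_def P_def smooth_on_iff_Ck)
  define D where "D = (\<lambda>(f :: real \<Rightarrow> complex) t. frechet_derivative f (at t) 1)"
  have vd: "(f has_vector_derivative D f t) (at t)" "Ck n UNIV (D f)" if "Ck (Suc n) UNIV f" for f n t
  proof -
    note fd = Ck_SucD(1)[OF that UNIV_I, of t]
    have "frechet_derivative f (at t) h = h *\<^sub>R D f t" for h
      using linear_cmul[OF has_derivative_linear[OF fd], of h 1] by (simp add: D_def)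
    then have "frechet_derivative f (at t) = (\<lambda>h. h *\<^sub>R D f t)" by auto
    then show "(f has_vector_derivative D f t) (at t)" using fd by (simp add: has_vector_derivative_def)
    show "Ck n UNIV (D f)" using Ck_SucD(2)[OF that, of 1] by (simp add: D_def)
  qed
  have C2: "Ck (Suc (Suc (Suc 0))) UNIV P" using C by (simp only: numeral_3_eq_3)
  have C1: "Ck (Suc (Suc 0)) UNIV (D P)" by (rule vd(2)[OF C2])
  have C0: "Ck (Suc 0) UNIV (D (D P))" by (rule vd(2)[OF C1])
  have p0: "P (t + 2 * pi) = P t" for t by (simp add: P_def omega_periodic)
  have p1: "D P (t + 2 * pi) = D P t" for t by (rule periodic_derivative[OF vd(1)[OF C2] p0])
  have p2: "D (D P) (t + 2 * pi) = D (D P) t" for t by (rule periodic_derivative[OF vd(1)[OF C1] p1])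
  have c: "continuous_on UNIV P" "continuous_on UNIV (D P)" "continuous_on UNIV (D (D P))"
    by (auto intro!: continuous_at_imp_continuous_on has_vector_derivative_continuous[OF vd(1)[OF C2]]
          has_vector_derivative_continuous[OF vd(1)[OF C1]] has_vector_derivative_continuous[OF vd(1)[OF C0]])
  obtain B0 B1 B2 where "\<And>t. norm (P t) \<le> B0" "\<And>t. norm (D P t) \<le> B1" "\<And>t. norm (D (D P) t) \<le> B2"
    using continuous_periodic_bounded[OF c(1) p0] continuous_periodic_bounded[OF c(2) p1] continuous_periodic_bounded[OF c(3) p2] by blast
  then have b: "norm (P t) \<le> max B0 (max B1 B2)" "norm (D P t) \<le> max B0 (max B1 B2)" "norm (D (D P) t) \<le> max B0 (max B1 B2)" for t
    by (simp_all add: le_max_iff_disj)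
  show ?thesis
    by (rule that[of "D P" "D (D P)" "max B0 (max B1 B2)"]) (use vd(1)[OF C2] vd(1)[OF C1] b in \<open>auto simp: P_def\<close>)
qed

text \<open>The transform of f and its first two angular derivatives decay rapidly and absorb the
  polynomial growth of those of g. This dominates both differentiations under the radial
  integral.\<close>

lemma ray_integral_C2:
  assumes psi: "smooth_on_circle \<psi>"
    and f[measurable]: "f \<in> borel_measurable borel" and f3: "integrable lborel (\<lambda>x. (1 + norm x) ^ 3 * norm (f x))"
    and rapid: "\<And>N. \<exists>A. \<forall>\<xi>. norm (ft 1 f \<xi>) \<le> A / (1 + norm \<xi>) ^ N"
    and g[measurable]: "g \<in> borel_measurable borel" and g3: "integrable lborel (\<lambda>x. (1 + norm x) ^ 3 * norm (g x))"
  obtains G' G'' B where "periodic_C2 (ray_integral \<psi> (\<lambda>\<xi>. ft 1 f (- \<xi>)) (ft 1 g)) G' G'' B"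
proof -
  obtain U1 U2 U3 C where U: "\<And>r t. ((\<lambda>t. ft 1 f (r *\<^sub>R omega t)) has_vector_derivative U1 r t) (at t)"
    "\<And>r t. (U1 r has_vector_derivative U2 r t) (at t)" "\<And>r t. (U2 r has_vector_derivative U3 r t) (at t)"
    "\<And>r t. norm (U2 r t) \<le> C * (1 + \<bar>r\<bar>) ^ 3" "\<And>r t. norm (U3 r t) \<le> C * (1 + \<bar>r\<bar>) ^ 3"
    by (rule ft_circle_derivs[OF f f3], rule that)
  obtain V1 V2 V3 D where V: "\<And>r t. ((\<lambda>t. ft 1 g (r *\<^sub>R omega t)) has_vector_derivative V1 r t) (at t)"
    "\<And>r t. (V1 r has_vector_derivative V2 r t) (at t)"
    "\<And>r t. norm (ft 1 g (r *\<^sub>R omega t)) \<le> D * (1 + \<bar>r\<bar>) ^ 3"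
    "\<And>r t. norm (V1 r t) \<le> D * (1 + \<bar>r\<bar>) ^ 3" "\<And>r t. norm (V2 r t) \<le> D * (1 + \<bar>r\<bar>) ^ 3"
    by (rule ft_circle_derivs[OF g g3], rule that)
  obtain P1 P2 Bp where P: "\<And>t. ((\<lambda>t. \<psi> (omega t)) has_vector_derivative P1 t) (at t)"
    "\<And>t. (P1 has_vector_derivative P2 t) (at t)"
    "\<And>t. norm (\<psi> (omega t)) \<le> Bp" "\<And>t. norm (P1 t) \<le> Bp" "\<And>t. norm (P2 t) \<le> Bp"
    by (rule smooth_circle_derivs[OF psi], rule that)
  define U0 where "U0 r t = ft 1 f (r *\<^sub>R omega t)" for r t
  define V0 where "V0 r t = ft 1 g (r *\<^sub>R omega t)" for r t
  have r0: "\<exists>A. \<forall>r t. norm (U0 r t) \<le> A / (1 + \<bar>r\<bar>) ^ N" for N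
    using rapid[of N] by (auto simp: U0_def) (metis norm_omega norm_scaleR mult_1_right real_norm_def)
  have r1: "\<exists>A. \<forall>r t. norm (U1 r t) \<le> A / (1 + \<bar>r\<bar>) ^ N" for N
    by (rule rapid_decay_derivative[OF _ U(2) r0 U(4)]) (use U(1) in \<open>simp add: U0_def\<close>)
  have r2: "\<exists>A. \<forall>r t. norm (U2 r t) \<le> A / (1 + \<bar>r\<bar>) ^ N" for N
    by (rule rapid_decay_derivative[OF U(2) U(3) r1 U(5)])
  \<comment> \<open>Order 6 absorbs the growth of order 3 from g and the factor r of polar
    coordinates, and leaves the integrable weight (1 + |r|)^(-2).\<close>
  obtain A0 A1 A2 where A012: "\<And>r t. norm (U0 r t) \<le> A0 / (1 + \<bar>r\<bar>) ^ 6" "\<And>r t. norm (U1 r t) \<le> A1 / (1 + \<bar>r\<bar>) ^ 6"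
    "\<And>r t. norm (U2 r t) \<le> A2 / (1 + \<bar>r\<bar>) ^ 6" using r0 r1 r2 by blast
  define A where "A = max A0 (max A1 A2)"
  have A: "norm (U0 r t) \<le> A / (1 + \<bar>r\<bar>) ^ 6" "norm (U1 r t) \<le> A / (1 + \<bar>r\<bar>) ^ 6" "norm (U2 r t) \<le> A / (1 + \<bar>r\<bar>) ^ 6" for r t
    by (rule order_trans[OF A012(1)] order_trans[OF A012(2)] order_trans[OF A012(3)];
        simp add: A_def divide_right_mono)+
  have D0: "D \<ge> 0" using order_trans[OF norm_ge_zero V(3)[of 0 0]] by simp
  \<comment> \<open>The argument -r accounts for the transform of f being taken at -xi; the
    estimates depend on |r| only.\<close>
  define I0 where "I0 t r = indicator {0<..} r *\<^sub>R (r *\<^sub>R (U0 (- r) t * V0 r t))" for t r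
  define I1 where "I1 t r = indicator {0<..} r *\<^sub>R (r *\<^sub>R (U0 (- r) t * V1 r t + U1 (- r) t * V0 r t))" for t r
  define I2 where "I2 t r = indicator {0<..} r *\<^sub>R (r *\<^sub>R ((U0 (- r) t * V2 r t + U1 (- r) t * V1 r t) + (U1 (- r) t * V1 r t + U2 (- r) t * V0 r t)))" for t r
  define K where "K r = 4 * (A * D) / (1 + \<bar>r\<bar>)\<^sup>2" for r
  have Ki: "integrable lborel K"
    using integrable_mult_right[OF inverse_weight_integrable, of "4 * (A * D)"] by (simp add: K_def[abs_def])
  have prod: "norm (r *\<^sub>R (p * q)) \<le> A * D / (1 + \<bar>r\<bar>)\<^sup>2"
    if "norm p \<le> A / (1 + \<bar>r\<bar>) ^ 6" "norm q \<le> D * (1 + \<bar>r\<bar>) ^ 3" for p q :: complex and r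
  proof -
    let ?p = "1 + \<bar>r\<bar>"
    have p: "?p > 0" by simp
    have "norm (r *\<^sub>R (p * q)) \<le> ?p * ((A / ?p ^ 6) * (D * ?p ^ 3))"
      unfolding norm_scaleR norm_mult using that order_trans[OF norm_ge_zero that(1)]
      by (intro mult_mono) auto
    also have "\<dots> = A * D / ?p\<^sup>2"
    proof -
      define y where "y = ?p"
      have "y > 0" using p by (simp add: y_def)
      then have "y * ((A / y ^ 6) * (D * y ^ 3)) = A * D / y\<^sup>2" by (simp add: field_simps power_numeral_reduce)
      then show ?thesis by (simp only: y_def)
    qed
    finally show ?thesis .
  qed
  have A0': "A \<ge> 0" using order_trans[OF norm_ge_zero A(1)[of 0 0]] by simp
  have bI: "norm (I0 t r) \<le> K r" "norm (I1 t r) \<le> K r" "norm (I2 t r) \<le> K r" for t r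
  proof -
    have An: "norm (U0 (- r) t) \<le> A / (1 + \<bar>r\<bar>) ^ 6" "norm (U1 (- r) t) \<le> A / (1 + \<bar>r\<bar>) ^ 6" "norm (U2 (- r) t) \<le> A / (1 + \<bar>r\<bar>) ^ 6"
      using A[of "- r" t] by simp_all
    have V0b: "norm (V0 r t) \<le> D * (1 + \<bar>r\<bar>) ^ 3" using V(3) by (simp add: V0_def)
    have ind: "norm (indicator {0<..} r *\<^sub>R z) \<le> norm z" for z :: complex by (simp add: indicator_def)
    have q: "A * D / (1 + \<bar>r\<bar>)\<^sup>2 \<ge> 0" using A0' D0 by simp
    have K4: "K r = A * D / (1 + \<bar>r\<bar>)\<^sup>2 + A * D / (1 + \<bar>r\<bar>)\<^sup>2 + (A * D / (1 + \<bar>r\<bar>)\<^sup>2 + A * D / (1 + \<bar>r\<bar>)\<^sup>2)"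
      by (simp add: K_def)
    note p1 = prod[OF An(1) V0b] prod[OF An(1) V(4)[of r t]] prod[OF An(2) V0b] prod[OF An(1) V(5)[of r t]] prod[OF An(2) V(4)[of r t]] prod[OF An(3) V0b]
    show "norm (I0 t r) \<le> K r"
      unfolding I0_def K4 by (rule order_trans[OF ind order_trans[OF p1(1)]]) (use q in linarith)
    have "norm (r *\<^sub>R (U0 (- r) t * V1 r t) + r *\<^sub>R (U1 (- r) t * V0 r t)) \<le> K r"
      unfolding K4 by (rule order_trans[OF norm_triangle_ineq order_trans[OF add_mono[OF p1(2) p1(3)]]]) (use q in linarith)
    then show "norm (I1 t r) \<le> K r"
      unfolding I1_def scaleR_add_right[of r] by (rule order_trans[OF ind])
    have "norm ((r *\<^sub>R (U0 (- r) t * V2 r t) + r *\<^sub>R (U1 (- r) t * V1 r t)) + (r *\<^sub>R (U1 (- r) t * V1 r t) + r *\<^sub>R (U2 (- r) t * V0 r t))) \<le> K r"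
      unfolding K4
      by (intro order_trans[OF norm_triangle_ineq] add_mono order_trans[OF norm_triangle_ineq] p1)
    then show "norm (I2 t r) \<le> K r"
      unfolding I2_def scaleR_add_right[of r] by (rule order_trans[OF ind])
  qed
  have U0: "((\<lambda>t. U0 r t) has_vector_derivative U1 r t) (at t)" and V0: "((\<lambda>t. V0 r t) has_vector_derivative V1 r t) (at t)" for r t
    unfolding U0_def V0_def by (rule U(1) V(1))+
  have dI0: "((\<lambda>t. I0 t r) has_vector_derivative I1 t r) (at t)" for r t
    unfolding I0_def I1_def
    by (intro bounded_linear.has_vector_derivative[OF bounded_linear_scaleR_right] has_vector_derivative_mult U0 V0)
  have dI1: "((\<lambda>t. I1 t r) has_vector_derivative I2 t r) (at t)" for r t
    unfolding I1_def I2_def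
    by (intro bounded_linear.has_vector_derivative[OF bounded_linear_scaleR_right] has_vector_derivative_add has_vector_derivative_mult U0 V0 U V)
  have I0m: "integrable lborel (I0 t)" for t
  proof (rule Bochner_Integration.integrable_bound[OF Ki])
    show "I0 t \<in> borel_measurable lborel" unfolding I0_def U0_def V0_def by measurable
    show "AE r in lborel. norm (I0 t r) \<le> norm (K r)" by (intro AE_I2) (metis bI(1) order_trans real_norm_def abs_ge_self)
  qed
  define J0 where "J0 t = (LINT r|lborel. I0 t r)" for t
  define J1 where "J1 t = (LINT r|lborel. I1 t r)" for t
  define J2 where "J2 t = (LINT r|lborel. I2 t r)" for t
  note h1 = has_vector_derivative_integral[where f = I0 and f' = I1, OF I0m dI0 bI(2) Ki]
  have J0: "(J0 has_vector_derivative J1 t) (at t)" for t unfolding J0_def[abs_def] J1_def by (rule h1(2))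
  note h2 = has_vector_derivative_integral[where f = I1 and f' = I2, OF h1(1) dI1 bI(3) Ki]
  have J1: "(J1 has_vector_derivative J2 t) (at t)" for t unfolding J1_def[abs_def] J2_def by (rule h2(2))
  define M where "M = (LINT r|lborel. K r)"
  have bJ: "norm (J0 t) \<le> M" "norm (J1 t) \<le> M" "norm (J2 t) \<le> M" for t
    unfolding J0_def J1_def J2_def M_def
    using I0m[of t] h1(1)[of t] h2(1)[of t] Ki bI
    by (auto intro!: order_trans[OF integral_norm_bound] Bochner_Integration.integral_mono)
  have M0: "M \<ge> 0" using order_trans[OF norm_ge_zero bJ(1)] .
  have R: "ray_integral \<psi> (\<lambda>\<xi>. ft 1 f (- \<xi>)) (ft 1 g) = (\<lambda>t. \<psi> (omega t) * J0 t)"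
    by (simp add: fun_eq_iff ray_integral_def J0_def I0_def U0_def V0_def)
  show ?thesis
  proof (rule that)
    show "periodic_C2 (ray_integral \<psi> (\<lambda>\<xi>. ft 1 f (- \<xi>)) (ft 1 g)) (\<lambda>t. \<psi> (omega t) * J1 t + P1 t * J0 t)
      (\<lambda>t. (\<psi> (omega t) * J2 t + P1 t * J1 t) + (P1 t * J1 t + P2 t * J0 t)) ((Bp * M + Bp * M) + (Bp * M + Bp * M))"
    proof
      fix t
      show "ray_integral \<psi> (\<lambda>\<xi>. ft 1 f (- \<xi>)) (ft 1 g) (t + 2 * pi) = ray_integral \<psi> (\<lambda>\<xi>. ft 1 f (- \<xi>)) (ft 1 g) t"
        by (simp add: ray_integral_def omega_periodic)
      show "(ray_integral \<psi> (\<lambda>\<xi>. ft 1 f (- \<xi>)) (ft 1 g) has_vector_derivative \<psi> (omega t) * J1 t + P1 t * J0 t) (at t)"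
        unfolding R by (intro has_vector_derivative_mult P J0)
      show "((\<lambda>t. \<psi> (omega t) * J1 t + P1 t * J0 t) has_vector_derivative
          (\<psi> (omega t) * J2 t + P1 t * J1 t) + (P1 t * J1 t + P2 t * J0 t)) (at t)"
        by (intro has_vector_derivative_add has_vector_derivative_mult P J0 J1)
      have m: "norm (p * q) \<le> Bp * M" if "norm p \<le> Bp" "norm q \<le> M" for p q :: complex
        unfolding norm_mult using that order_trans[OF norm_ge_zero that(1)] by (intro mult_mono) auto
      show "norm ((\<psi> (omega t) * J2 t + P1 t * J1 t) + (P1 t * J1 t + P2 t * J0 t)) \<le> (Bp * M + Bp * M) + (Bp * M + Bp * M)"
        by (intro order_trans[OF norm_triangle_ineq] add_mono order_trans[OF norm_triangle_ineq] m P bJ)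
    qed
  qed
qed

section \<open>The filtered Radon transform on the Fourier side\<close>

text \<open>1 / v is odd, so only the sine part of the exponential survives, and the integral of sin
  (sigma v) / v is a difference of values of the sine integral.\<close>

lemma bounded_kernel_integral:
  fixes a b \<sigma> :: real
  assumes a: "0 < a" and ab: "a \<le> b"
  defines "S \<equiv> {v. a < \<bar>v\<bar> \<and> \<bar>v\<bar> \<le> b}"
  shows "integrable lborel (\<lambda>v. complex_of_real (indicator S v / v))"
    and "(LINT v|lborel. exp (- \<i> * of_real (\<sigma> * v)) * complex_of_real (indicator S v / v)) =
      - 2 * \<i> * of_real (Si (\<sigma> * b) - Si (\<sigma> * a))"
proof -
  have [measurable]: "S \<in> sets borel" unfolding S_def by measurable
  let ?e = "\<lambda>v. exp (- \<i> * complex_of_real (\<sigma> * v))"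
  define J where "J w v = complex_of_real (indicator {a..b} v) * (w v / of_real v)" for w :: "real \<Rightarrow> complex" and v
  have Ji: "integrable lborel (J w)" if "continuous_on {a..b} w" for w
  proof -
    have "set_integrable lborel {a..b} (\<lambda>v. w v / of_real v)"
      by (rule borel_integrable_atLeastAtMost') (use that a in \<open>auto intro!: continuous_intros\<close>)
    then show ?thesis by (simp add: set_integrable_def J_def[abs_def] scaleR_conv_of_real)
  qed
  have J2: "integrable lborel (\<lambda>v. J w (- v))" if "continuous_on {a..b} w" for w
    using lborel_integral_affine(2)[of "J w" "- 1" 0] Ji[OF that] borel_measurable_integrable[OF Ji[OF that]] by simp
  \<comment> \<open>S leaves out the inner endpoints, so it differs from the union of the two closed
    intervals only at a and -a.\<close>
  have split: "AE v in lborel. w v * complex_of_real (indicator S v / v) = J w v - J (\<lambda>v. w (- v)) (- v)" for w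
    using AE_lborel_singleton[of a] AE_lborel_singleton[of "- a"]
    by eventually_elim (use a in \<open>auto simp: J_def S_def indicator_def abs_if split: if_splits\<close>)
  have Sm: "integrable lborel (\<lambda>v. w v * complex_of_real (indicator S v / v))"
    if "continuous_on UNIV w" for w
  proof -
    have [measurable]: "w \<in> borel_measurable borel" by (rule borel_measurable_continuous_onI[OF that])
    have c: "continuous_on {a..b} w" "continuous_on {a..b} (\<lambda>v. w (- v))"
      by (auto intro!: continuous_on_compose2[OF that] continuous_intros)
    have "integrable lborel (\<lambda>v. J w v - J (\<lambda>v. w (- v)) (- v))"
      by (intro Bochner_Integration.integrable_diff Ji J2 c)
    then show ?thesis
      by (rule integrable_cong_AE_imp) (use split[of w] in auto)
  qed
  show "integrable lborel (\<lambda>v. complex_of_real (indicator S v / v))"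
    using Sm[of "\<lambda>_. 1"] by simp
  have c: "continuous_on UNIV ?e" "continuous_on {a..b} ?e" "continuous_on {a..b} (\<lambda>v. ?e (- v))"
    by (auto intro!: continuous_intros)
  have "(LINT v|lborel. ?e v * complex_of_real (indicator S v / v)) = (LINT v|lborel. J ?e v - J (\<lambda>v. ?e (- v)) (- v))"
    by (rule integral_cong_AE) (use split[of ?e] borel_measurable_integrable[OF Sm[OF c(1)]]
        borel_measurable_integrable[OF Ji[OF c(2)]] borel_measurable_integrable[OF J2[OF c(3)]] in auto)
  also have "\<dots> = (LINT v|lborel. J ?e v) - (LINT v|lborel. J (\<lambda>v. ?e (- v)) (- v))"
    by (rule Bochner_Integration.integral_diff[OF Ji[OF c(2)] J2[OF c(3)]])
  also have "(LINT v|lborel. J (\<lambda>v. ?e (- v)) (- v)) = (LINT v|lborel. J (\<lambda>v. ?e (- v)) v)"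
    using lborel_integral_affine(1)[of "J (\<lambda>v. ?e (- v))" "- 1" 0] borel_measurable_integrable[OF Ji[OF c(3)]] by simp
  also have "(LINT v|lborel. J ?e v) - \<dots> = (LINT v|lborel. J ?e v - J (\<lambda>v. ?e (- v)) v)"
    by (rule Bochner_Integration.integral_diff[OF Ji[OF c(2)] Ji[OF c(3)], symmetric])
  also have "\<dots> = (LINT v|lborel. - 2 * \<i> * complex_of_real (indicator {a..b} v *\<^sub>R (sin (\<sigma> * v) / v)))"
  proof (rule Bochner_Integration.integral_cong[OF refl])
    fix v
    have "?e v - ?e (- v) = - 2 * \<i> * complex_of_real (sin (\<sigma> * v))"
      by (simp add: complex_eq_iff Re_exp Im_exp)
    then show "J ?e v - J (\<lambda>v. ?e (- v)) v = - 2 * \<i> * complex_of_real (indicator {a..b} v *\<^sub>R (sin (\<sigma> * v) / v))"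
      by (simp add: J_def right_diff_distrib[symmetric] diff_divide_distrib[symmetric] del: minus_mult_minus)
  qed
  also have "\<dots> = - 2 * \<i> * of_real (LINT v|lborel. indicator {a..b} v *\<^sub>R (sin (\<sigma> * v) / v))"
    by (simp only: Bochner_Integration.integral_mult_right_zero integral_complex_of_real)
  also have "(LINT v|lborel. indicator {a..b} v *\<^sub>R (sin (\<sigma> * v) / v)) = Si (\<sigma> * b) - Si (\<sigma> * a)"
  proof (rule integral_FTC_atLeastAtMost[OF ab])
    fix v assume v: "a \<le> v" "v \<le> b"
    have "((\<lambda>v. Si (\<sigma> * v)) has_real_derivative sinc (\<sigma> * v) * \<sigma>) (at v within {a..b})"
      by (rule DERIV_chain2[OF DERIV_Si]) (auto intro!: derivative_eq_intros)
    moreover have "sinc (\<sigma> * v) * \<sigma> = sin (\<sigma> * v) / v" using v a by (cases "\<sigma> = 0") (simp_all)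
    ultimately show "((\<lambda>v. Si (\<sigma> * v)) has_vector_derivative sin (\<sigma> * v) / v) (at v within {a..b})"
      by (simp add: has_real_derivative_iff_has_vector_derivative)
  qed (use a in \<open>auto intro!: continuous_intros\<close>)
  finally show "(LINT v|lborel. ?e v * complex_of_real (indicator S v / v)) =
      - 2 * \<i> * of_real (Si (\<sigma> * b) - Si (\<sigma> * a))" .
qed

text \<open>The truncated Hilbert integrals are multipliers given by the sine integral, and
  \<open>Si (\<sigma> b) - Si (\<sigma> a) \<rightarrow> (\<pi> / 2) sgn \<sigma>\<close>. Since the support is compact, the truncation at \<open>b\<close> has
  no effect for large \<open>b\<close>.\<close>

lemma calH_fourier:
  fixes g u :: "real \<Rightarrow> complex"
  assumes g: "\<And>p. g p = (LINT \<sigma>|lborel. exp (\<i> * of_real (\<sigma> * p)) * u \<sigma>)"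
    and u: "integrable lborel u" and u1: "integrable lborel (\<lambda>\<sigma>. of_real \<sigma> * u \<sigma>)"
    and supp: "\<And>p. R < \<bar>p\<bar> \<Longrightarrow> g p = 0"
  shows "calH g p = 1 / of_real (4 * pi) * (LINT \<sigma>|lborel. exp (\<i> * of_real (\<sigma> * p)) * (of_real \<bar>\<sigma>\<bar> * u \<sigma>))"
proof -
  have um[measurable]: "u \<in> borel_measurable borel" using borel_measurable_integrable[OF u] by simp
  define E where "E q \<sigma> = exp (\<i> * complex_of_real (\<sigma> * q))" for q \<sigma>
  have E1: "norm (E q \<sigma>) = 1" for q \<sigma> unfolding E_def by (rule norm_exp_i_times)
  have [measurable]: "E q \<in> borel_measurable borel" for q unfolding E_def by measurable
  define w where "w \<sigma> = of_real \<sigma> * u \<sigma>" for \<sigma>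
  have wi: "integrable lborel w" using u1 by (simp add: w_def[abs_def])
  have [measurable]: "w \<in> borel_measurable borel" unfolding w_def[abs_def] by measurable
  define g' where "g' q = (LINT \<sigma>|lborel. \<i> * (E q \<sigma> * w \<sigma>))" for q
  have Eu: "integrable lborel (\<lambda>\<sigma>. E q \<sigma> * u \<sigma>)" for q
    by (rule Bochner_Integration.integrable_bound[OF u]) (auto simp: norm_mult E1)
  have D: "(g has_vector_derivative g' q) (at q)" for q
    unfolding g[abs_def] g'_def E_def[symmetric]
  proof (rule has_vector_derivative_integral(2)[where f = "\<lambda>q \<sigma>. E q \<sigma> * u \<sigma>" and f' = "\<lambda>q \<sigma>. \<i> * (E q \<sigma> * w \<sigma>)", OF Eu])
    fix q \<sigma>
    have "((\<lambda>q. \<i> * complex_of_real (\<sigma> * q)) has_vector_derivative \<i> * of_real \<sigma>) (at q)"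
      by (auto intro!: derivative_eq_intros simp: has_vector_derivative_def scaleR_conv_of_real)
    from field_vector_diff_chain_at[OF this DERIV_exp]
    have "((\<lambda>q. E q \<sigma>) has_vector_derivative \<i> * of_real \<sigma> * E q \<sigma>) (at q)"
      by (simp add: E_def o_def)
    from bounded_linear.has_vector_derivative[OF bounded_linear_mult_left this, of "u \<sigma>"]
    show "((\<lambda>q. E q \<sigma> * u \<sigma>) has_vector_derivative \<i> * (E q \<sigma> * w \<sigma>)) (at q)"
      by (simp add: w_def mult_ac)
    show "norm (\<i> * (E q \<sigma> * w \<sigma>)) \<le> norm (w \<sigma>)" by (simp add: norm_mult E1)
  qed (use wi in auto)
  have vd: "vector_derivative g (at q) = g' q" for q by (rule vector_derivative_at[OF D])
  have supp': "g' q = 0" if "R < \<bar>q\<bar>" for q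
  proof -
    have "(g has_vector_derivative 0) (at q)"
    proof (rule has_vector_derivative_transform_within_open)
      show "((\<lambda>_. 0) has_vector_derivative 0) (at q)" by simp
      show "open {q. R < \<bar>q\<bar>}" by (intro open_Collect_less continuous_intros)
    qed (use that supp in auto)
    then show ?thesis using D vector_derivative_unique_at by blast
  qed
  obtain M where M: "\<And>T. \<bar>Si T\<bar> \<le> M" using bounded_Si by blast
  have M0: "M \<ge> 0" using order_trans[OF abs_ge_zero M] .
  \<comment> \<open>The limit of the truncated integrals as a tends to 0. It will turn out not to
    depend on b once b is large, which allows b to be sent to infinity.\<close>
  define Q where "Q b = (LINT \<sigma>|lborel. E p \<sigma> * w \<sigma> * of_real (2 * Si (\<sigma> * b)))" for b
  define T where "T a = (LINT t:{t. a < \<bar>p - t\<bar>}|lborel. g' t / of_real (p - t))" for a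
  \<comment> \<open>For b >= |p| + R the condition |p - t| <= b cuts away only points where g'
    vanishes, so the truncated integral has a kernel with bounded support and Fubini
    applies.\<close>
  have T: "T a = (LINT \<sigma>|lborel. E p \<sigma> * w \<sigma> * of_real (2 * (Si (\<sigma> * b) - Si (\<sigma> * a))))"
    if a: "0 < a" and ab: "a \<le> b" and b: "\<bar>p\<bar> + R \<le> b" for a b
  proof -
    define S where "S = {v. a < \<bar>v\<bar> \<and> \<bar>v\<bar> \<le> b}"
    note K = bounded_kernel_integral[OF a ab, folded S_def]
    have [measurable]: "S \<in> sets borel" unfolding S_def by measurable
    have "g' = (\<lambda>q. \<i> * ft 1 w q)" by (simp add: fun_eq_iff g'_def E_def ft_def)
    then have [measurable]: "g' \<in> borel_measurable borel" by simp
    have "T a = (LINT t|lborel. complex_of_real (indicator S (p - t) / (p - t)) * g' t)"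
      unfolding T_def set_lebesgue_integral_def
      by (rule Bochner_Integration.integral_cong[OF refl])
         (use b supp' in \<open>auto simp: S_def indicator_def scaleR_conv_of_real\<close>)
    also have "\<dots> = (LINT v|lborel. complex_of_real (indicator S v / v) * g' (p - v))"
      by (subst lborel_integral_affine(1)[of _ "- 1" p]) auto
    also have "\<dots> = (LINT v|lborel. LINT \<sigma>|lborel. E (p - v) \<sigma> * (complex_of_real (indicator S v / v) * (\<i> * w \<sigma>)))"
      unfolding g'_def by (subst Bochner_Integration.integral_mult_right_zero[symmetric]) (simp add: mult_ac)
    also have "\<dots> = (LINT \<sigma>|lborel. LINT v|lborel. E (p - v) \<sigma> * (complex_of_real (indicator S v / v) * (\<i> * w \<sigma>)))"
    proof (rule lborel_pair.Fubini_integral[symmetric])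
      show "integrable (lborel \<Otimes>\<^sub>M lborel) (\<lambda>(v, \<sigma>). E (p - v) \<sigma> * (complex_of_real (indicator S v / v) * (\<i> * w \<sigma>)))"
        by (rule integrable_pair_mult_bounded[OF K(1)]) (use wi in \<open>auto simp: E1 E_def\<close>)
    qed
    also have "\<dots> = (LINT \<sigma>|lborel. E p \<sigma> * w \<sigma> * of_real (2 * (Si (\<sigma> * b) - Si (\<sigma> * a))))"
    proof (rule Bochner_Integration.integral_cong[OF refl])
      fix \<sigma>
      have e: "E (p - v) \<sigma> = E p \<sigma> * exp (- \<i> * of_real (\<sigma> * v))" for v
        unfolding E_def mult_exp_exp by (simp add: algebra_simps)
      have "(LINT v|lborel. E (p - v) \<sigma> * (complex_of_real (indicator S v / v) * (\<i> * w \<sigma>))) =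
          (LINT v|lborel. (E p \<sigma> * (\<i> * w \<sigma>)) * (exp (- \<i> * of_real (\<sigma> * v)) * complex_of_real (indicator S v / v)))"
        unfolding e by (simp add: mult_ac)
      also have "\<dots> = (E p \<sigma> * (\<i> * w \<sigma>)) * (- 2 * \<i> * of_real (Si (\<sigma> * b) - Si (\<sigma> * a)))"
        by (simp only: Bochner_Integration.integral_mult_right_zero K(2))
      finally show "(LINT v|lborel. E (p - v) \<sigma> * (complex_of_real (indicator S v / v) * (\<i> * w \<sigma>))) =
          E p \<sigma> * w \<sigma> * of_real (2 * (Si (\<sigma> * b) - Si (\<sigma> * a)))"
        by (simp add: mult_ac)
    qed
    finally show ?thesis .
  qed
  have lim_T: "(T \<longlongrightarrow> Q b) (at_right 0)" if b: "\<bar>p\<bar> + R \<le> b" "0 < b" for b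
    \<comment> \<open>Passing to x = 1 / a puts the limit into the form of dominated convergence at
      infinity.\<close>
    unfolding filterlim_at_right_to_top
  proof -
    have "((\<lambda>x. LINT \<sigma>|lborel. E p \<sigma> * w \<sigma> * of_real (2 * (Si (\<sigma> * b) - Si (\<sigma> * inverse x)))) \<longlongrightarrow> Q b) at_top"
      unfolding Q_def
    proof (rule integral_dominated_convergence_at_top[where w = "\<lambda>\<sigma>. norm (w \<sigma>) * (4 * M)"])
      show "AE \<sigma> in lborel. ((\<lambda>x. E p \<sigma> * w \<sigma> * of_real (2 * (Si (\<sigma> * b) - Si (\<sigma> * inverse x)))) \<longlongrightarrow> E p \<sigma> * w \<sigma> * of_real (2 * Si (\<sigma> * b))) at_top"
      proof (rule AE_I2)
        fix \<sigma> :: real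
        have z: "((\<lambda>x. \<sigma> * inverse x) \<longlongrightarrow> \<sigma> * 0) at_top"
          by (intro tendsto_mult tendsto_const tendsto_inverse_0_at_top filterlim_ident)
        have "((\<lambda>x. Si (\<sigma> * inverse x)) \<longlongrightarrow> Si (\<sigma> * 0)) at_top"
          by (rule isCont_tendsto_compose[OF isCont_Si z])
        then have "((\<lambda>x. Si (\<sigma> * inverse x)) \<longlongrightarrow> 0) at_top" using Si_neg[of 0] by simp
        then have "((\<lambda>x. E p \<sigma> * w \<sigma> * of_real (2 * (Si (\<sigma> * b) - Si (\<sigma> * inverse x)))) \<longlongrightarrow> E p \<sigma> * w \<sigma> * of_real (2 * (Si (\<sigma> * b) - 0))) at_top"
          by (intro tendsto_intros)
        then show "((\<lambda>x. E p \<sigma> * w \<sigma> * of_real (2 * (Si (\<sigma> * b) - Si (\<sigma> * inverse x)))) \<longlongrightarrow> E p \<sigma> * w \<sigma> * of_real (2 * Si (\<sigma> * b))) at_top"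
          by simp
      qed
      show "\<forall>\<^sub>F x in at_top. AE \<sigma> in lborel. norm (E p \<sigma> * w \<sigma> * of_real (2 * (Si (\<sigma> * b) - Si (\<sigma> * inverse x)))) \<le> norm (w \<sigma>) * (4 * M)"
      proof (intro always_eventually allI AE_I2)
        fix x \<sigma> :: real
        have "\<bar>2 * (Si (\<sigma> * b) - Si (\<sigma> * inverse x))\<bar> \<le> 4 * M" using M[of "\<sigma> * b"] M[of "\<sigma> * inverse x"]
            abs_triangle_ineq4[of "Si (\<sigma> * b)" "Si (\<sigma> * inverse x)"] by (simp add: abs_mult)
        then show "norm (E p \<sigma> * w \<sigma> * of_real (2 * (Si (\<sigma> * b) - Si (\<sigma> * inverse x)))) \<le> norm (w \<sigma>) * (4 * M)"
          unfolding norm_mult norm_of_real E1 mult_1_left by (intro mult_left_mono) auto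
      qed
    qed (use wi in auto)
    moreover have "\<forall>\<^sub>F x in at_top. (LINT \<sigma>|lborel. E p \<sigma> * w \<sigma> * of_real (2 * (Si (\<sigma> * b) - Si (\<sigma> * inverse x)))) = T (inverse x)"
      using eventually_ge_at_top[of "inverse b"] eventually_gt_at_top[of 0]
    proof eventually_elim
      case (elim x)
      then have "inverse x \<le> b" using b le_imp_inverse_le[of "inverse b" x] by simp
      then show ?case using T[of "inverse x" b] elim b by simp
    qed
    ultimately show "((\<lambda>x. T (inverse x)) \<longlongrightarrow> Q b) at_top" by (rule Lim_transform_eventually)
  qed
  define b0 where "b0 = max 1 (\<bar>p\<bar> + R)"
  have Qb: "Q b = Q b0" if "b0 \<le> b" for b
    by (rule tendsto_unique[OF _ lim_T lim_T]) (use that in \<open>auto simp: b0_def\<close>)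
  have "(Q \<longlongrightarrow> (LINT \<sigma>|lborel. E p \<sigma> * w \<sigma> * of_real (2 * (pi / 2 * sgn \<sigma>)))) at_top"
    unfolding Q_def[abs_def]
  proof (rule integral_dominated_convergence_at_top[where w = "\<lambda>\<sigma>. norm (w \<sigma>) * (2 * M)"])
    show "AE \<sigma> in lborel. ((\<lambda>b. E p \<sigma> * w \<sigma> * of_real (2 * Si (\<sigma> * b))) \<longlongrightarrow> E p \<sigma> * w \<sigma> * of_real (2 * (pi / 2 * sgn \<sigma>))) at_top"
    proof (rule AE_I2)
      fix \<sigma> :: real
      have "((\<lambda>b. Si (\<sigma> * b)) \<longlongrightarrow> pi / 2 * sgn \<sigma>) at_top"
      proof (cases "\<sigma> = 0")
        case False
        have "((\<lambda>b. sgn \<sigma> * Si (\<bar>\<sigma>\<bar> * b)) \<longlongrightarrow> sgn \<sigma> * (pi / 2)) at_top"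
          by (intro tendsto_intros filterlim_compose[OF Si_at_top] filterlim_tendsto_pos_mult_at_top[OF tendsto_const] filterlim_ident)
             (use False in auto)
        moreover have "\<forall>\<^sub>F b in at_top. sgn \<sigma> * Si (\<bar>\<sigma>\<bar> * b) = Si (\<sigma> * b)"
          using eventually_ge_at_top[of 0]
        proof eventually_elim
          case (elim b)
          have "Si (\<sigma> * b) = - Si (- \<sigma> * b)" if "\<sigma> < 0"
            using Si_neg[of "- \<sigma> * b"] that elim by (simp add: mult_nonpos_nonneg)
          then show ?case using False by (cases "\<sigma> < 0") (auto simp: abs_if sgn_if)
        qed
        ultimately show ?thesis by (simp add: Lim_transform_eventually mult.commute)
      qed (use Si_neg[of 0] in simp)
      then show "((\<lambda>b. E p \<sigma> * w \<sigma> * of_real (2 * Si (\<sigma> * b))) \<longlongrightarrow> E p \<sigma> * w \<sigma> * of_real (2 * (pi / 2 * sgn \<sigma>))) at_top"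
        by (intro tendsto_intros)
    qed
    show "\<forall>\<^sub>F b in at_top. AE \<sigma> in lborel. norm (E p \<sigma> * w \<sigma> * of_real (2 * Si (\<sigma> * b))) \<le> norm (w \<sigma>) * (2 * M)"
    proof (intro always_eventually allI AE_I2)
      fix b \<sigma> :: real
      have "\<bar>2 * Si (\<sigma> * b)\<bar> \<le> 2 * M" using M[of "\<sigma> * b"] by simp
      then show "norm (E p \<sigma> * w \<sigma> * of_real (2 * Si (\<sigma> * b))) \<le> norm (w \<sigma>) * (2 * M)"
        unfolding norm_mult[of _ "of_real _"] norm_mult norm_of_real E1 mult_1_left by (intro mult_left_mono) auto
    qed
  qed (use wi in auto)
  then have lim_Q: "(Q \<longlongrightarrow> (LINT \<sigma>|lborel. E p \<sigma> * w \<sigma> * of_real (2 * (pi / 2 * sgn \<sigma>)))) at_top" .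
  have "\<forall>\<^sub>F b in at_top. Q b0 = Q b"
    using eventually_ge_at_top[of b0] by eventually_elim (rule Qb[symmetric])
  \<comment> \<open>Q is eventually constant, so its value at \<open>b0\<close> equals its limit at
    infinity, where the sine integral has become pi / 2 times the sign of sigma.\<close>
  from Lim_transform_eventually[OF tendsto_const this]
  have "Q b0 = (LINT \<sigma>|lborel. E p \<sigma> * w \<sigma> * of_real (2 * (pi / 2 * sgn \<sigma>)))"
    by (rule tendsto_unique[OF trivial_limit_at_top_linorder _ lim_Q])
  also have "\<dots> = (LINT \<sigma>|lborel. of_real pi * (E p \<sigma> * (of_real \<bar>\<sigma>\<bar> * u \<sigma>)))"
    by (rule Bochner_Integration.integral_cong[OF refl]) (auto simp: w_def sgn_if abs_if)
  also have "\<dots> = of_real pi * (LINT \<sigma>|lborel. E p \<sigma> * (of_real \<bar>\<sigma>\<bar> * u \<sigma>))"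
    by (rule Bochner_Integration.integral_mult_right_zero)
  finally have "Q b0 = of_real pi * (LINT \<sigma>|lborel. E p \<sigma> * (of_real \<bar>\<sigma>\<bar> * u \<sigma>))" .
  moreover have "Lim (at_right 0) T = Q b0"
    by (rule tendsto_Lim[OF _ lim_T]) (auto simp: b0_def)
  ultimately have "hilbert_transform g' p = (LINT \<sigma>|lborel. E p \<sigma> * (of_real \<bar>\<sigma>\<bar> * u \<sigma>))"
    by (simp add: hilbert_transform_def T_def[abs_def])
  then show ?thesis
    by (simp add: calH_def vd E_def)
qed

text \<open>One member of the family at fixed h. Band limitation survives as rapid decrease of its
  transform.\<close>

locale bandlimited_function =
  fixes f :: "plane \<Rightarrow> complex" and R :: real
  assumes cont: "continuous_on UNIV f"
    and supp: "\<And>x. R < norm x \<Longrightarrow> f x = 0"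
    and rapid: "\<And>N. \<exists>A. \<forall>\<xi>. norm (ft 1 f \<xi>) \<le> A / (1 + norm \<xi>) ^ N"
begin

lemma f_measurable [measurable]: "f \<in> borel_measurable borel"
  by (rule borel_measurable_continuous_onI[OF cont])

lemma compactly_supported_integrable:
  fixes w :: "plane \<Rightarrow> 'b::euclidean_space"
  assumes "continuous_on UNIV w" and "\<And>x. R < norm x \<Longrightarrow> w x = 0"
  shows "integrable lborel w"
proof -
  have "integrable lborel (\<lambda>x. indicator (cball 0 R) x *\<^sub>R w x)"
    by (rule borel_integrable_compact[OF compact_cball continuous_on_subset[OF assms(1)]]) simp
  moreover have "indicator (cball 0 R) x *\<^sub>R w x = w x" for x
    using assms(2)[of x] by (cases "norm x \<le> R") auto
  ultimately show ?thesis by simp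
qed

lemma f_integrable: "integrable lborel f"
  by (rule compactly_supported_integrable[OF cont supp])

lemma f_L12: "f \<in> L12"
proof -
  have "integrable lborel (\<lambda>x. (norm (f x))\<^sup>2)"
    by (rule compactly_supported_integrable) (auto simp: supp intro!: continuous_intros cont)
  then show ?thesis by (simp add: L12_def L2_def f_integrable)
qed

lemma f_weighted_integrable: "integrable lborel (\<lambda>x. (1 + norm x) ^ N * norm (f x))"
  by (rule compactly_supported_integrable) (auto simp: supp intro!: continuous_intros cont)

lemma f_bounded: "\<exists>M. \<forall>x. norm (f x) \<le> M"
proof -
  have "bounded (f ` cball 0 R)"
    by (intro compact_imp_bounded compact_continuous_image continuous_on_subset[OF cont]) auto
  then obtain M where M: "\<forall>x\<in>cball 0 R. norm (f x) \<le> M" unfolding bounded_iff by auto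
  have "norm (f x) \<le> max 0 M" for x
    using M[rule_format, of x] supp[of x] by (cases "norm x \<le> R") (auto simp: le_max_iff_disj)
  then show ?thesis by blast
qed

lemma norm_slice:
  assumes "norm \<omega> = 1"
  shows "\<bar>p\<bar> \<le> norm (p *\<^sub>R \<omega> + t *\<^sub>R perp \<omega>)" "\<bar>t\<bar> \<le> norm (p *\<^sub>R \<omega> + t *\<^sub>R perp \<omega>)"
    "(p *\<^sub>R \<omega> + t *\<^sub>R perp \<omega>) \<bullet> \<omega> = p"
proof -
  let ?x = "p *\<^sub>R \<omega> + t *\<^sub>R perp \<omega>"
  have o: "\<omega> \<bullet> \<omega> = 1" "perp \<omega> \<bullet> perp \<omega> = 1" "perp \<omega> \<bullet> \<omega> = 0"
    using assms norm_perp[of \<omega>] by (simp_all add: norm_eq_1 inner_plane)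
  show 1: "?x \<bullet> \<omega> = p" by (simp add: inner_add_left o)
  have 2: "?x \<bullet> perp \<omega> = t" using o(3) by (simp add: inner_add_left o inner_commute[of \<omega>])
  show "\<bar>p\<bar> \<le> norm ?x" using Cauchy_Schwarz_ineq2[of ?x \<omega>] assms by (simp only: 1 mult_1_right)
  show "\<bar>t\<bar> \<le> norm ?x" using Cauchy_Schwarz_ineq2[of ?x "perp \<omega>"] assms by (simp only: 2 norm_perp mult_1_right)
qed

text \<open>\<open>ft 1 f (- xi)\<close> is the usual Fourier transform of f at xi, so this is a
  slice of it multiplied by the ramp filter |sigma|.\<close>

definition filtered_slice :: "plane \<Rightarrow> real \<Rightarrow> complex" where
  "filtered_slice \<omega> \<sigma> = of_real \<bar>\<sigma>\<bar> * ft 1 f (- (\<sigma> *\<^sub>R \<omega>))"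

definition half_line_pairing :: "plane \<Rightarrow> (plane \<Rightarrow> complex) \<Rightarrow> complex" where
  "half_line_pairing \<omega> g = (LINT r|lborel. indicator {0<..} r *\<^sub>R (r *\<^sub>R (ft 1 f (- (r *\<^sub>R \<omega>)) * ft 1 g (r *\<^sub>R \<omega>))))"

context
  fixes \<omega> :: plane
  assumes w: "norm \<omega> = 1"
begin

text \<open>Continuity and boundedness serve the Fourier inversion in p, the support condition
  serves \<open>calH_fourier\<close>.\<close>

lemma radon_supp: "R < \<bar>p\<bar> \<Longrightarrow> radon f \<omega> p = 0"
    and radon_cont: "isCont (radon f \<omega>) p"
    and radon_bounded: "\<exists>M. \<forall>p. norm (radon f \<omega> p) \<le> M"
proof -
  show "radon f \<omega> p = 0" if "R < \<bar>p\<bar>"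
  proof -
    have "f (p *\<^sub>R \<omega> + t *\<^sub>R perp \<omega>) = 0" for t
      by (rule supp[OF less_le_trans[OF that norm_slice(1)[OF w]]])
    then show ?thesis by (simp add: radon_def)
  qed
  obtain M where M: "\<And>x. norm (f x) \<le> M" using f_bounded by blast
  \<comment> \<open>A point of the line has norm at least |t|, so the integrands vanish outside
    [-R, R] for all p simultaneously and share this majorant.\<close>
  let ?K = "\<lambda>t. M * indicator {- R..R} t"
  have K: "integrable lborel ?K"
    by (intro integrable_mult_right integrable_real_indicator) (auto simp: emeasure_lborel_Icc_eq)
  have b: "norm (f (p *\<^sub>R \<omega> + t *\<^sub>R perp \<omega>)) \<le> ?K t" for p t
    using M[of "p *\<^sub>R \<omega> + t *\<^sub>R perp \<omega>"] supp[OF less_le_trans[OF _ norm_slice(2)[OF w]], of t p]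
    by (cases "\<bar>t\<bar> \<le> R") (auto simp: indicator_def abs_le_iff)
  have c: "continuous_on UNIV (\<lambda>t. f (p *\<^sub>R \<omega> + t *\<^sub>R perp \<omega>))" for p
    by (intro continuous_on_compose2[OF cont] continuous_intros) auto
  note [measurable] = borel_measurable_continuous_onI[OF c]
  show "isCont (radon f \<omega>) p"
    unfolding continuous_at_sequentially o_def
  proof (intro allI impI)
    fix q assume q: "q \<longlonglongrightarrow> p"
    show "(\<lambda>n. radon f \<omega> (q n)) \<longlonglongrightarrow> radon f \<omega> p"
      unfolding radon_def
    proof (rule integral_dominated_convergence[where w = ?K])
      show "AE t in lborel. (\<lambda>n. f (q n *\<^sub>R \<omega> + t *\<^sub>R perp \<omega>)) \<longlonglongrightarrow> f (p *\<^sub>R \<omega> + t *\<^sub>R perp \<omega>)"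
        by (intro AE_I2 continuous_on_tendsto_compose[OF cont] tendsto_intros q) auto
    qed (use b K in auto)
  qed
  have "norm (radon f \<omega> p) \<le> (LINT t|lborel. ?K t)" for p
    unfolding radon_def
    by (rule order_trans[OF integral_norm_bound], rule Bochner_Integration.integral_mono)
       (use b K in \<open>auto intro!: Bochner_Integration.integrable_bound[OF K] order_trans[OF b abs_ge_self] simp del: abs_mult\<close>)
  then show "\<exists>M. \<forall>p. norm (radon f \<omega> p) \<le> M" by blast
qed

text \<open>In coordinates rotated to omega the wave is constant along the lines of
  integration.\<close>

lemma fourier_slice: "ft (- 1) (radon f \<omega>) \<sigma> = ft 1 f (- (\<sigma> *\<^sub>R \<omega>))"
proof -
  let ?F = "\<lambda>x. exp (\<i> * of_real (1 * (x \<bullet> (- (\<sigma> *\<^sub>R \<omega>))))) * f x"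
  have e: "(p *\<^sub>R \<omega> + t *\<^sub>R perp \<omega>) \<bullet> (- (\<sigma> *\<^sub>R \<omega>)) = - (p * \<sigma>)" for p t
    using norm_slice(3)[OF w, of p t] by simp
  have "ft 1 f (- (\<sigma> *\<^sub>R \<omega>)) = (LINT p|lborel. LINT t|lborel. ?F (p *\<^sub>R \<omega> + t *\<^sub>R perp \<omega>))"
    unfolding ft_def by (rule integral_rotate(1)[OF ft_integrand[OF f_integrable] w])
  also have "\<dots> = ft (- 1) (radon f \<omega>) \<sigma>"
    unfolding e by (simp add: ft_def radon_def)
  finally show ?thesis by simp
qed

lemma slice_integrable:
  "integrable lborel (\<lambda>\<sigma>. ft 1 f (- (\<sigma> *\<^sub>R \<omega>)))" "integrable lborel (\<lambda>\<sigma>. of_real \<sigma> * ft 1 f (- (\<sigma> *\<^sub>R \<omega>)))"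
  "integrable lborel (filtered_slice \<omega>)"
proof -
  obtain A where A: "\<And>\<xi>. norm (ft 1 f \<xi>) \<le> A / (1 + norm \<xi>) ^ 3" using rapid[of 3] by blast
  let ?K = "\<lambda>\<sigma>. A * (1 / (1 + \<bar>\<sigma>\<bar>)\<^sup>2)"
  have K: "integrable lborel ?K" by (intro integrable_mult_right inverse_weight_integrable)
  have [measurable]: "(\<lambda>\<sigma>. ft 1 f (- (\<sigma> *\<^sub>R \<omega>))) \<in> borel_measurable borel" by measurable
  have A0: "0 \<le> A" using order_trans[OF norm_ge_zero A[of 0]] by simp
  have a: "norm (ft 1 f (- (\<sigma> *\<^sub>R \<omega>))) \<le> A / (1 + \<bar>\<sigma>\<bar>) ^ 3" for \<sigma>
    using A[of "- (\<sigma> *\<^sub>R \<omega>)"] w by simp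
  have b1: "\<bar>\<sigma>\<bar> * norm (ft 1 f (- (\<sigma> *\<^sub>R \<omega>))) \<le> ?K \<sigma>" "norm (ft 1 f (- (\<sigma> *\<^sub>R \<omega>))) \<le> ?K \<sigma>" for \<sigma>
  proof -
    define y where "y = 1 + \<bar>\<sigma>\<bar>"
    have y: "y \<ge> 1" by (simp add: y_def)
    have e: "y * (A / y ^ 3) = A * (1 / y\<^sup>2)" using y by (simp add: field_simps power_numeral_reduce)
    have "\<bar>\<sigma>\<bar> * norm (ft 1 f (- (\<sigma> *\<^sub>R \<omega>))) \<le> y * (A / y ^ 3)" "1 * norm (ft 1 f (- (\<sigma> *\<^sub>R \<omega>))) \<le> y * (A / y ^ 3)"
      using a[of \<sigma>] by (intro mult_mono; simp add: y_def)+
    then show "\<bar>\<sigma>\<bar> * norm (ft 1 f (- (\<sigma> *\<^sub>R \<omega>))) \<le> ?K \<sigma>" "norm (ft 1 f (- (\<sigma> *\<^sub>R \<omega>))) \<le> ?K \<sigma>"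
      unfolding e by (simp_all add: y_def)
  qed
  have n: "norm (?K \<sigma>) = ?K \<sigma>" for \<sigma> using A0 by simp
  have i: "integrable lborel v" if "v \<in> borel_measurable borel" "\<And>\<sigma>. norm (v \<sigma>) \<le> ?K \<sigma>" for v :: "real \<Rightarrow> complex"
    by (rule Bochner_Integration.integrable_bound[OF K]) (use that in \<open>simp_all only: n, auto\<close>)
  show "integrable lborel (\<lambda>\<sigma>. ft 1 f (- (\<sigma> *\<^sub>R \<omega>)))" by (rule i) (use b1 in measurable)
  show "integrable lborel (\<lambda>\<sigma>. of_real \<sigma> * ft 1 f (- (\<sigma> *\<^sub>R \<omega>)))"
    by (rule i) (use b1 in \<open>simp_all only: norm_mult norm_of_real, measurable\<close>)
  show "integrable lborel (filtered_slice \<omega>)"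
    unfolding filtered_slice_def[abs_def]
    by (rule i) (use b1 in \<open>simp_all only: norm_mult norm_of_real abs_idempotent, measurable\<close>)
qed

text \<open>1 / (8 pi^2) is the 1 / (4 pi) of \<open>calH\<close> times the 1 / (2 pi) of Fourier
  inversion in one dimension.\<close>

lemma calH_radon: "calH (radon f \<omega>) p = of_real (1 / (8 * pi\<^sup>2)) * ft 1 (filtered_slice \<omega>) p"
proof -
  let ?u = "\<lambda>\<sigma>. ft 1 f (- (\<sigma> *\<^sub>R \<omega>)) / of_real (2 * pi)"
  obtain M where M: "\<And>p. norm (radon f \<omega> p) \<le> M" using radon_bounded by blast
  have gi: "integrable lborel (radon f \<omega>)"
    using integral_rotate(2)[OF f_integrable w] by (simp add: radon_def[abs_def])
  have hat: "ft (- 1) (radon f \<omega>) = (\<lambda>\<sigma>. ft 1 f (- (\<sigma> *\<^sub>R \<omega>)))"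
    by (rule ext) (rule fourier_slice)
  have rep: "radon f \<omega> p = (LINT \<sigma>|lborel. exp (\<i> * of_real (\<sigma> * p)) * ?u \<sigma>)" for p
  proof -
    have "ft (- (- 1)) (ft (- 1) (radon f \<omega>)) p = of_real ((2 * pi / \<bar>- 1\<bar>) ^ DIM(real)) * radon f \<omega> p"
      by (rule ft_inversion[OF gi M radon_cont]) (simp_all add: hat slice_integrable)
    then have "ft 1 (\<lambda>\<sigma>. ft 1 f (- (\<sigma> *\<^sub>R \<omega>))) p = of_real (2 * pi) * radon f \<omega> p" by (simp add: hat)
    then have "radon f \<omega> p = ft 1 (\<lambda>\<sigma>. ft 1 f (- (\<sigma> *\<^sub>R \<omega>))) p / of_real (2 * pi)" by simp
    then show ?thesis by (simp add: ft_def)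
  qed
  have "calH (radon f \<omega>) p = 1 / of_real (4 * pi) * (LINT \<sigma>|lborel. exp (\<i> * of_real (\<sigma> * p)) * (of_real \<bar>\<sigma>\<bar> * ?u \<sigma>))"
  proof (rule calH_fourier[OF rep])
    show "integrable lborel ?u" using slice_integrable(1) by simp
    show "integrable lborel (\<lambda>\<sigma>. of_real \<sigma> * ?u \<sigma>)" using slice_integrable(2) by simp
  qed (rule radon_supp)
  also have "(LINT \<sigma>|lborel. exp (\<i> * of_real (\<sigma> * p)) * (of_real \<bar>\<sigma>\<bar> * ?u \<sigma>)) = ft 1 (filtered_slice \<omega>) p / of_real (2 * pi)"
    by (simp add: ft_def filtered_slice_def)
  finally show ?thesis by (simp add: power2_eq_square)
qed

lemma backprojection_pairing:
  assumes g: "integrable lborel g"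
  shows "(LINT x|lborel. ft 1 (filtered_slice \<omega>) (x \<bullet> \<omega>) * g x) = (LINT \<sigma>|lborel. (filtered_slice \<omega> \<sigma>) * ft 1 g (\<sigma> *\<^sub>R \<omega>))"
proof -
  have k: "integrable (lborel \<Otimes>\<^sub>M lborel) (\<lambda>(\<sigma>, x). exp (\<i> * of_real (1 * (x \<bullet> (\<sigma> *\<^sub>R \<omega>)))) * ((filtered_slice \<omega> \<sigma>) * g x))"
    by (rule integrable_pair_mult_bounded[OF slice_integrable(3) g]) auto
  have "(LINT x|lborel. ft 1 (filtered_slice \<omega>) (x \<bullet> \<omega>) * g x) =
      (LINT x|lborel. LINT \<sigma>|lborel. exp (\<i> * of_real (1 * (x \<bullet> (\<sigma> *\<^sub>R \<omega>)))) * ((filtered_slice \<omega> \<sigma>) * g x))"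
    unfolding ft_def
    by (subst integral_mult_left_zero[symmetric]) (simp add: mult_ac)
  also have "\<dots> = (LINT \<sigma>|lborel. LINT x|lborel. exp (\<i> * of_real (1 * (x \<bullet> (\<sigma> *\<^sub>R \<omega>)))) * ((filtered_slice \<omega> \<sigma>) * g x))"
    by (rule lborel_pair.Fubini_integral) (use k in simp)
  also have "\<dots> = (LINT \<sigma>|lborel. (filtered_slice \<omega> \<sigma>) * ft 1 g (\<sigma> *\<^sub>R \<omega>))"
    unfolding ft_def
    by (subst Bochner_Integration.integral_mult_right_zero[symmetric]) (simp add: mult_ac)
  finally show ?thesis .
qed

end

text \<open>The line is cut at 0 and its negative half is reflected. This is where the opposite
  direction -omega enters.\<close>

lemma line_pairing_split:
  assumes w: "norm \<omega> = 1" and g: "integrable lborel g"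
  shows "(LINT \<sigma>|lborel. filtered_slice \<omega> \<sigma> * ft 1 g (\<sigma> *\<^sub>R \<omega>)) = half_line_pairing \<omega> g + half_line_pairing (- \<omega>) g"
proof -
  have w': "norm (- \<omega>) = 1" using w by simp
  define q where "q \<omega> r = indicator {0<..} r *\<^sub>R (r *\<^sub>R (ft 1 f (- (r *\<^sub>R \<omega>)) * ft 1 g (r *\<^sub>R \<omega>)))" for \<omega> :: plane and r
  have [measurable]: "g \<in> borel_measurable borel" using borel_measurable_integrable[OF g] by simp
  have qi: "integrable lborel (q \<omega>)" if w: "norm \<omega> = 1" for \<omega>
  proof (rule Bochner_Integration.integrable_bound[OF integrable_mult_left[OF integrable_norm[OF slice_integrable(3)[OF w]]]])
    show "q \<omega> \<in> borel_measurable lborel" unfolding q_def by measurable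
    show "AE r in lborel. norm (q \<omega> r) \<le> norm (norm (filtered_slice \<omega> r) * (LINT x|lborel. norm (g x)))"
    proof (rule AE_I2)
      fix r
      have "norm (q \<omega> r) \<le> \<bar>r\<bar> * norm (ft 1 f (- (r *\<^sub>R \<omega>))) * norm (ft 1 g (r *\<^sub>R \<omega>))"
        by (cases "r > 0") (simp_all add: q_def norm_mult not_less mult_nonpos_nonneg)
      also have "\<dots> \<le> \<bar>r\<bar> * norm (ft 1 f (- (r *\<^sub>R \<omega>))) * (LINT x|lborel. norm (g x))"
        by (intro mult_left_mono norm_ft_le g) simp
      finally show "norm (q \<omega> r) \<le> norm (norm (filtered_slice \<omega> r) * (LINT x|lborel. norm (g x)))"
        by (simp add: filtered_slice_def norm_mult)
    qed
  qed
  have "filtered_slice \<omega> \<sigma> * ft 1 g (\<sigma> *\<^sub>R \<omega>) = q \<omega> \<sigma> + q (- \<omega>) (- \<sigma>)" for \<sigma>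
    by (cases "\<sigma> > 0"; cases "\<sigma> = 0") (auto simp: filtered_slice_def q_def indicator_def scaleR_conv_of_real)
  then have "(LINT \<sigma>|lborel. filtered_slice \<omega> \<sigma> * ft 1 g (\<sigma> *\<^sub>R \<omega>)) = (LINT \<sigma>|lborel. q \<omega> \<sigma> + q (- \<omega>) (- \<sigma>))" by simp
  also have "\<dots> = (LINT \<sigma>|lborel. q \<omega> \<sigma>) + (LINT \<sigma>|lborel. q (- \<omega>) (- \<sigma>))"
    using lborel_integral_affine(2)[of "q (- \<omega>)" "- 1" 0] borel_measurable_integrable[OF qi[OF w']] qi[OF w] qi[OF w']
    by (intro Bochner_Integration.integral_add) auto
  also have "(LINT \<sigma>|lborel. q (- \<omega>) (- \<sigma>)) = (LINT \<sigma>|lborel. q (- \<omega>) \<sigma>)"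
    using lborel_integral_affine(1)[of "q (- \<omega>)" "- 1" 0] borel_measurable_integrable[OF qi[OF w']] by simp
  finally show ?thesis by (simp add: half_line_pairing_def q_def[abs_def])
qed

end

section \<open>The summation formula\<close>

text \<open>At fixed h the decay outside a ball around \<open>B\<close> is carried over to the
  unscaled frequency. Inside the ball the frequencies are bounded and the L1 norm bounds the
  transform.\<close>

lemma semiclassically_band_limited_imp_bandlimited_function:
  assumes sbl: "semiclassically_band_limited H f" and hH: "h \<in> H" and h: "h > 0"
  obtains R where "bandlimited_function (f h) R"
proof -
  have cont: "continuous_on UNIV (f h)" using sbl hH by (auto simp: semiclassically_band_limited_def)
  have "\<exists>K. compact K \<and> (\<forall>h\<in>H. \<forall>x. x \<notin> K \<longrightarrow> f h x = 0)"
    using sbl unfolding semiclassically_band_limited_def by (elim conjE)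
  then obtain K where K: "compact K" "\<And>x. x \<notin> K \<Longrightarrow> f h x = 0" using hH by blast
  obtain R where R: "\<And>x. x \<in> K \<Longrightarrow> norm x \<le> R"
    using compact_imp_bounded[OF K(1)] unfolding bounded_iff by blast
  have supp: "f h x = 0" if "R < norm x" for x using K(2)[of x] R[of x] that by linarith
  have i: "integrable lborel (f h)"
  proof -
    have "integrable lborel (\<lambda>x. indicator K x *\<^sub>R f h x)"
      by (rule borel_integrable_compact[OF K(1) continuous_on_subset[OF cont]]) simp
    moreover have "indicator K x *\<^sub>R f h x = f h x" for x using K(2)[of x] by (cases "x \<in> K") auto
    ultimately show ?thesis by simp
  qed
  define M where "M = (LINT x|lborel. norm (f h x))"
  have M: "norm (ft 1 (f h) \<xi>) \<le> M" for \<xi> unfolding M_def by (rule norm_ft_le[OF i])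
  have M0: "M \<ge> 0" by (simp add: M_def)
  have "\<exists>B. compact B \<and> (\<forall>U. open U \<and> B \<subseteq> U \<longrightarrow> (\<forall>N::nat. \<exists>C. \<forall>h\<in>H. \<forall>\<xi>. \<xi> \<notin> U \<longrightarrow>
      norm (fourier_h h (f h) \<xi>) \<le> C * h ^ N * japanese_bracket \<xi> powr (- real N)))"
    using sbl unfolding semiclassically_band_limited_def by (elim conjE)
  then obtain B where B: "compact B" "\<forall>U. open U \<and> B \<subseteq> U \<longrightarrow> (\<forall>N::nat. \<exists>C. \<forall>h\<in>H. \<forall>\<xi>. \<xi> \<notin> U \<longrightarrow>
      norm (fourier_h h (f h) \<xi>) \<le> C * h ^ N * japanese_bracket \<xi> powr (- real N))" by (elim exE conjE)
  obtain b where b: "b > 0" "B \<subseteq> ball 0 b" using bounded_subset_ballD[OF compact_imp_bounded[OF B(1)]] by blast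
  \<comment> \<open>Chosen so that 1 + |xi| <= \<open>\<kappa>\<close> times the bracket of h xi.
    With p = h |xi| it combines 1 + |xi| <= (1 + 1 / h) (1 + p) with (1 + p) / 2 <= sqrt (1 +
    p^2).\<close>
  define \<kappa> where "\<kappa> = 2 * (1 + 1 / h)"
  have \<kappa>: "\<kappa> > 0" using h by (simp add: \<kappa>_def add_pos_pos)
  have "\<exists>A. \<forall>\<xi>. norm (ft 1 (f h) \<xi>) \<le> A / (1 + norm \<xi>) ^ N" for N
  proof -
    obtain C where C: "\<And>\<xi>. \<xi> \<notin> ball 0 b \<Longrightarrow> norm (fourier_h h (f h) \<xi>) \<le> C * h ^ N * japanese_bracket \<xi> powr (- real N)"
      using B(2)[rule_format, of "ball 0 b" N] b(2) hH by auto
    define A where "A = \<bar>C\<bar> * h ^ N * \<kappa> ^ N + M * (1 + b / h) ^ N"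
    have "norm (ft 1 (f h) \<xi>) \<le> A / (1 + norm \<xi>) ^ N" for \<xi>
    proof -
      define y where "y = 1 + norm \<xi>"
      have y: "y > 0" by (simp add: y_def add_pos_nonneg)
      have yN: "y ^ N > 0" using y by simp
      have "norm (ft 1 (f h) \<xi>) * y ^ N \<le> A"
      proof (cases "- (h *\<^sub>R \<xi>) \<in> ball 0 b")
        case True
        then have "y \<le> 1 + b / h" using h by (simp add: y_def field_simps)
        then have "norm (ft 1 (f h) \<xi>) * y ^ N \<le> M * (1 + b / h) ^ N"
          using M M0 y by (intro mult_mono power_mono) auto
        moreover have "0 \<le> \<bar>C\<bar> * h ^ N * \<kappa> ^ N" using h \<kappa> by simp
        ultimately show ?thesis unfolding A_def by linarith
      next
        case False
        define p where "p = h * norm \<xi>"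
        have p: "p \<ge> 0" using h by (simp add: p_def)
        define J where "J = japanese_bracket (- (h *\<^sub>R \<xi>))"
        have J: "J = sqrt (1 + p\<^sup>2)" using h by (simp add: J_def japanese_bracket_def p_def)
        have J1: "J \<ge> 1" by (simp add: J)
        have "0 \<le> (p - 1)\<^sup>2 + 2 + 2 * p\<^sup>2" by simp
        then have "((1 + p) / 2)\<^sup>2 \<le> 1 + p\<^sup>2" by (simp add: power2_eq_square field_simps)
        then have pJ: "(1 + p) / 2 \<le> J" unfolding J by (rule real_le_rsqrt)
        have "(1 + 1 / h) * (1 + p) = y + (p + 1 / h)" using h by (simp add: y_def p_def distrib_left distrib_right)
        then have "y \<le> (1 + 1 / h) * (1 + p)" using p h by simp
        also have "\<dots> = \<kappa> * ((1 + p) / 2)" by (simp add: \<kappa>_def)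
        also have "\<dots> \<le> \<kappa> * J" by (rule mult_left_mono[OF pJ]) (use \<kappa> in simp)
        finally have yJ: "y \<le> \<kappa> * J" .
        have "ft 1 (f h) \<xi> = fourier_h h (f h) (- (h *\<^sub>R \<xi>))"
          using h by (simp add: fourier_h_eq_ft ft_def)
        then have "norm (ft 1 (f h) \<xi>) \<le> C * h ^ N * J powr (- real N)"
          using C[OF False] by (simp add: J_def)
        also have "\<dots> \<le> \<bar>C\<bar> * h ^ N * J powr (- real N)" using h by (intro mult_right_mono) auto
        also have "J powr (- real N) = 1 / J ^ N" using J1 by (simp add: powr_minus powr_realpow divide_inverse)
        finally have "norm (ft 1 (f h) \<xi>) * y ^ N \<le> (\<bar>C\<bar> * h ^ N * (1 / J ^ N)) * (\<kappa> * J) ^ N"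
          using yJ y h J1 by (intro mult_mono power_mono) auto
        also have "\<dots> = \<bar>C\<bar> * h ^ N * \<kappa> ^ N" using J1 by (simp add: power_mult_distrib)
        also have "\<dots> \<le> A" using M0 b h by (simp add: A_def)
        finally show ?thesis .
      qed
      then have "norm (ft 1 (f h) \<xi>) \<le> A / y ^ N" using yN by (simp add: pos_le_divide_eq)
      then show ?thesis by (simp add: y_def)
    qed
    then show ?thesis by blast
  qed
  then have "bandlimited_function (f h) R" by unfold_locales (use cont supp in auto)
  then show ?thesis by (rule that)
qed

text \<open>Mediates between the two scales in play: \<open>f_psi\<close> is a multiplier with h =
  1, \<open>calA\<close> one with the given h.\<close>

lemma fourier_pair_rescale:
  assumes f: "fourier_pair c f F" and d: "d > 0"
  shows "fourier_pair (c / d) f (\<lambda>\<xi>. F (\<xi> /\<^sub>R d))"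
  unfolding fourier_pair_def
proof (intro conjI ballI fourier_pair_D(1)[OF f])
  note [measurable] = L2_D(1)[OF fourier_pair_D(2)[OF f]]
  have "integrable lborel (\<lambda>\<xi>. (norm (F (\<xi> /\<^sub>R d)))\<^sup>2)"
    using lborel_integral_affine(2)[of "\<lambda>\<xi>. (norm (F \<xi>))\<^sup>2" "inverse d" 0] d L2_D(2)[OF fourier_pair_D(2)[OF f]] by simp
  then show "(\<lambda>\<xi>. F (\<xi> /\<^sub>R d)) \<in> L2" by (simp add: L2_def)
  fix g assume g: "g \<in> L12"
  note [measurable] = L2_D(1)[OF L12_D(1)[OF g]]
  define g' where "g' = (\<lambda>x. g (d *\<^sub>R x))"
  have g': "g' \<in> L12"
    using lborel_integral_affine(2)[of "\<lambda>x. (norm (g x))\<^sup>2" d 0] lborel_integral_affine(2)[of g d 0] d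
      L12_D[OF g] L2_D(2)[OF L12_D(1)[OF g]]
    by (auto simp: L12_def L2_def g'_def)
  have ft: "ft (c / d) g x = d\<^sup>2 *\<^sub>R ft c g' x" for x
  proof -
    have "ft (c / d) g x = \<bar>d\<bar> ^ DIM(plane) *\<^sub>R (LINT u|lborel. exp (\<i> * of_real (c / d * ((0 + d *\<^sub>R u) \<bullet> x))) * g (0 + d *\<^sub>R u))"
      unfolding ft_def by (rule lborel_integral_affine(1)) (use d in auto)
    then show ?thesis using d by (simp add: ft_def g'_def)
  qed
  have "(LINT \<xi>|lborel. F (\<xi> /\<^sub>R d) * g \<xi>) = \<bar>d\<bar> ^ DIM(plane) *\<^sub>R (LINT u|lborel. F ((0 + d *\<^sub>R u) /\<^sub>R d) * g (0 + d *\<^sub>R u))"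
    by (rule lborel_integral_affine(1)) (use d in auto)
  also have "\<dots> = d\<^sup>2 *\<^sub>R (LINT u|lborel. F u * g' u)"
    using d by (simp add: g'_def)
  also have "(LINT u|lborel. F u * g' u) = (LINT x|lborel. f x * ft c g' x)" by (rule fourier_pair_D(3)[OF f g'])
  also have "d\<^sup>2 *\<^sub>R \<dots> = (LINT x|lborel. f x * ft (c / d) g x)"
    unfolding ft by simp
  finally show "(LINT \<xi>|lborel. F (\<xi> /\<^sub>R d) * g \<xi>) = (LINT x|lborel. f x * ft (c / d) g x)" .
qed

lemma fourier_pair_pairing:
  assumes "fourier_pair (- 1) u U" and "\<phi> \<in> L12"
  shows "(LINT x|lborel. u x * \<phi> x) = of_real (1 / (4 * pi\<^sup>2)) * (LINT \<xi>|lborel. U \<xi> * ft 1 \<phi> \<xi>)"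
proof -
  have "fourier_pair 1 U (\<lambda>x. of_real ((2 * pi)\<^sup>2) * u x)" using fourier_pair_inverse[OF assms(1)] by simp
  from fourier_pair_D(3)[OF this assms(2)]
  have "of_real ((2 * pi)\<^sup>2) * (LINT x|lborel. u x * \<phi> x) = (LINT \<xi>|lborel. U \<xi> * ft 1 \<phi> \<xi>)"
    by (simp add: mult.assoc)
  then show ?thesis by (simp add: field_simps power2_eq_square)
qed

lemma L2_tempered_function: "u \<in> L2 \<Longrightarrow> tempered_function u"
  unfolding tempered_function_def using L2_D(1) L2_mult_integrable schwartz_L12 L12_D(1) by blast

lemma omega_polar_angle: "\<xi> \<noteq> 0 \<Longrightarrow> omega (polar_angle \<xi>) = \<xi> /\<^sub>R norm \<xi>"
proof -
  assume nz: "\<xi> \<noteq> 0"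
  let ?z = "Complex (\<xi> $ 1) (\<xi> $ 2)"
  have "?z \<noteq> 0" using nz by (auto simp: complex_eq_iff plane_eq_iff)
  then have "cis (polar_angle \<xi>) = sgn ?z" by (simp add: polar_angle_def cis_Arg)
  moreover have "norm ?z = norm \<xi>"
    by (simp add: cmod_def norm_plane[symmetric])
  ultimately have "cis (polar_angle \<xi>) = ?z /\<^sub>R norm \<xi>" by (simp add: sgn_div_norm)
  then show ?thesis by (simp add: plane_eq_iff complex_eq_iff)
qed

definition radial_mult :: "(plane \<Rightarrow> complex) \<Rightarrow> plane \<Rightarrow> complex" where
  "radial_mult \<psi> \<xi> = \<psi> (\<xi> /\<^sub>R norm \<xi>)"

lemma radial_mult:
  assumes "smooth_on_circle \<psi>"
  shows "radial_mult \<psi> \<in> borel_measurable borel" "\<exists>M. \<forall>\<xi>. norm (radial_mult \<psi> \<xi>) \<le> M"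
    "r > 0 \<Longrightarrow> radial_mult \<psi> (r *\<^sub>R omega t) = \<psi> (omega t)"
proof -
  obtain P1 P2 B where P: "\<And>t. ((\<lambda>t. \<psi> (omega t)) has_vector_derivative P1 t) (at t)" "\<And>t. norm (\<psi> (omega t)) \<le> B"
    by (rule smooth_circle_derivs[OF assms], rule that)
  have e: "radial_mult \<psi> \<xi> = (if \<xi> = 0 then \<psi> 0 else \<psi> (omega (polar_angle \<xi>)))" for \<xi>
    by (simp add: radial_mult_def omega_polar_angle)
  have "continuous_on UNIV (\<lambda>t. \<psi> (omega t))"
    by (auto intro!: continuous_at_imp_continuous_on has_vector_derivative_continuous[OF P(1)])
  from measurable_compose[OF polar_angle_measurable borel_measurable_continuous_onI[OF this]]
  have [measurable]: "(\<lambda>\<xi>. \<psi> (omega (polar_angle \<xi>))) \<in> borel_measurable borel" .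
  show "radial_mult \<psi> \<in> borel_measurable borel" unfolding e[abs_def] by measurable
  \<comment> \<open>At the origin the quotient by the norm is the zero vector, so the value of psi
    there enters the bound.\<close>
  have "norm (radial_mult \<psi> \<xi>) \<le> max B (norm (\<psi> 0))" for \<xi>
    unfolding e using P(2)[of "polar_angle \<xi>"] by (simp add: le_max_iff_disj)
  then show "\<exists>M. \<forall>\<xi>. norm (radial_mult \<psi> \<xi>) \<le> M" by blast
  show "r > 0 \<Longrightarrow> radial_mult \<psi> (r *\<^sub>R omega t) = \<psi> (omega t)" by (simp add: radial_mult_def)
qed

context bandlimited_function
begin

lemma fourier_pair_f_psi:
  assumes psi: "smooth_on_circle \<psi>"
  shows "fourier_pair (- 1) (f_psi \<psi> f) (\<lambda>\<xi>. radial_mult \<psi> \<xi> * ft 1 f (- \<xi>))"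
proof -
  obtain M where M: "\<And>\<xi>. norm (radial_mult \<psi> \<xi>) \<le> M" using radial_mult(2)[OF psi] by blast
  have "fourier_pair (- 1 / 1) (fourier_multiplier 1 (radial_mult \<psi>) f) (\<lambda>\<xi>. radial_mult \<psi> \<xi> * ft (- 1) f \<xi>)"
    by (rule fourier_pair_fourier_multiplier[OF _ radial_mult(1)[OF psi] M]) (use fourier_pair_ft[OF f_L12, of "- 1"] in auto)
  moreover have "ft (- 1) f \<xi> = ft 1 f (- \<xi>)" for \<xi> by (simp add: ft_def)
  ultimately show ?thesis by (simp add: f_psi_def radial_mult_def[abs_def])
qed

text \<open>The transform of \<open>f_psi\<close> is moved to scale h, multiplied there and moved
  back, which evaluates the multiplier at h xi.\<close>

lemma fourier_pair_calA_f_psi: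
  assumes psi: "smooth_on_circle \<psi>" and h: "h > 0"
  shows "fourier_pair (- 1) (calA s k h (f_psi \<psi> f)) (\<lambda>\<xi>. angle_mult s k h (h *\<^sub>R \<xi>) * (radial_mult \<psi> \<xi> * ft 1 f (- \<xi>)))"
proof -
  have "fourier_pair (- 1 / h) (calA s k h (f_psi \<psi> f)) (\<lambda>\<xi>. angle_mult s k h \<xi> * (radial_mult \<psi> (\<xi> /\<^sub>R h) * ft 1 f (- (\<xi> /\<^sub>R h))))"
    unfolding calA_eq
    by (rule fourier_pair_fourier_multiplier[OF h _ _ fourier_pair_rescale[OF fourier_pair_f_psi[OF psi] h], where M = 1]) (simp_all add: norm_angle_mult)
  from fourier_pair_rescale[OF this, of "1 / h"] h show ?thesis by simp
qed

text \<open>The free symbol \<open>e\<close> lets one proof cover \<open>f_psi\<close> itself, with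
  e = 1 and n = 0, and every \<open>calA\<close>. Its values on the cut do not matter, a null
  set.\<close>

lemma pairing_eq_fourier_coefficient:
  assumes psi: "smooth_on_circle \<psi>" and phi: "schwartz \<phi>"
    and U: "fourier_pair (- 1) u (\<lambda>\<xi>. e \<xi> * (radial_mult \<psi> \<xi> * ft 1 f (- \<xi>)))"
    and e: "\<And>r t. 0 < r \<Longrightarrow> - pi < t \<Longrightarrow> t < pi \<Longrightarrow> e (r *\<^sub>R omega t) = cis (of_int n * t)"
  shows "(LINT x|lborel. u x * \<phi> x) = of_real (1 / (4 * pi\<^sup>2)) * fc n (ray_integral \<psi> (\<lambda>\<xi>. ft 1 f (- \<xi>)) (ft 1 \<phi>))"
proof -
  let ?G = "ray_integral \<psi> (\<lambda>\<xi>. ft 1 f (- \<xi>)) (ft 1 \<phi>)"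
  let ?H = "\<lambda>\<xi>. (e \<xi> * (radial_mult \<psi> \<xi> * ft 1 f (- \<xi>))) * ft 1 \<phi> \<xi>"
  note L = schwartz_L12[OF phi]
  note [measurable] = L2_D(1)[OF L12_D(1)[OF L]]
  have Hi: "integrable lborel ?H"
    by (rule L2_mult_integrable[OF fourier_pair_D(2)[OF U] ft_L2(1)[OF L]]) simp
  obtain G' G'' B where "periodic_C2 ?G G' G'' B"
    using ray_integral_C2[OF psi f_measurable f_weighted_integrable rapid _ schwartz_weighted_integrable[OF phi]] by auto
  then have "continuous_on {- pi..pi} ?G"
    by (auto intro!: continuous_at_imp_continuous_on has_vector_derivative_continuous[OF periodic_C2.D1])
  then have c: "continuous_on {- pi..pi} (\<lambda>t. ?G t * cis (of_int n * t))"
    by (intro continuous_intros)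
  have "(LINT x|lborel. u x * \<phi> x) = of_real (1 / (4 * pi\<^sup>2)) * (LINT \<xi>|lborel. ?H \<xi>)"
    by (rule fourier_pair_pairing[OF U L])
  also have "(LINT \<xi>|lborel. ?H \<xi>) = (LINT t|lborel. LINT r|lborel.
     indicator {-pi<..<pi} t *\<^sub>R (indicator {0<..} r *\<^sub>R (r *\<^sub>R ?H (r *\<^sub>R omega t))))"
    by (rule integral_polar[OF Hi])
  also have "\<dots> = (LINT t|lborel. indicator {-pi<..<pi} t *\<^sub>R (?G t * cis (of_int n * t)))"
  proof (rule Bochner_Integration.integral_cong[OF refl])
    fix t
    have "indicator {-pi<..<pi} t *\<^sub>R (indicator {0<..} r *\<^sub>R (r *\<^sub>R ?H (r *\<^sub>R omega t))) =
        indicator {-pi<..<pi} t *\<^sub>R (cis (of_int n * t) * \<psi> (omega t) *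
          (indicator {0<..} r *\<^sub>R (r *\<^sub>R (ft 1 f (- (r *\<^sub>R omega t)) * ft 1 \<phi> (r *\<^sub>R omega t)))))" for r
      by (auto simp: indicator_def e radial_mult(3)[OF psi] mult_ac)
    then show "(LINT r|lborel. indicator {-pi<..<pi} t *\<^sub>R (indicator {0<..} r *\<^sub>R (r *\<^sub>R ?H (r *\<^sub>R omega t)))) =
        indicator {-pi<..<pi} t *\<^sub>R (?G t * cis (of_int n * t))"
      by (simp only: integral_scaleR_right Bochner_Integration.integral_mult_right_zero ray_integral_def mult_ac)
  qed
  also have "\<dots> = integral {-pi<..<pi} (\<lambda>t. ?G t * cis (of_int n * t))"
  proof -
    have "set_integrable lborel {-pi<..<pi} (\<lambda>t. ?G t * cis (of_int n * t))"
      by (rule set_integrable_subset[OF borel_integrable_atLeastAtMost'[OF c]]) auto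
    from set_borel_integral_eq_integral(2)[OF this] show ?thesis by (simp add: set_lebesgue_integral_def)
  qed
  also have "\<dots> = fc n ?G"
    by (simp add: fc_def integral_open_interval_real)
  finally show ?thesis .
qed

text \<open>2 s h / (8 pi^2) is regrouped as 1 / (4 pi^2), the constant of the Fourier pairing,
  times pi / m, the constant of the sampling formula.\<close>

lemma f_psi_delta_eq:
  assumes m: "m \<ge> (1::nat)" and sh: "s * h = pi / real m"
  shows "f_psi_delta s h \<psi> f x = of_real (1 / (4 * pi\<^sup>2)) * (of_real (pi / real m) *
     (\<Sum>j = 1..m. \<psi> (omega (pi * real j / real m)) *
        ft 1 (filtered_slice (omega (pi * real j / real m))) (x \<bullet> omega (pi * real j / real m))))"
proof -
  have "pi / (s * h) = real m" using m by (simp add: sh)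
  then have n: "nat \<lfloor>pi / (s * h)\<rfloor> = m" by simp
  have t: "s * h * real j = pi * real j / real m" for j by (simp add: sh)
  have c: "complex_of_real (2 * s * h) = of_real (2 * (pi / real m))" by (simp only: sh[symmetric]) (simp add: mult.assoc)
  show ?thesis
    unfolding f_psi_delta_def n t c
    by (simp add: calH_radon sum_distrib_left field_simps)
qed

lemma backprojection_measurable: "(\<lambda>x::plane. ft 1 (filtered_slice \<omega>) (x \<bullet> \<omega>)) \<in> borel_measurable borel"
proof -
  have [measurable]: "filtered_slice \<omega> \<in> borel_measurable borel"
    unfolding filtered_slice_def[abs_def] by measurable
  show ?thesis by (rule measurable_compose[OF _ ft_measurable]) measurable
qed

lemma f_psi_delta_measurable:
  assumes "m \<ge> (1::nat)" "s * h = pi / real m"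
  shows "f_psi_delta s h \<psi> f \<in> borel_measurable borel"
proof -
  note [measurable] = backprojection_measurable
  show ?thesis unfolding f_psi_delta_eq[OF assms, abs_def] by measurable
qed

lemma f_psi_delta_pairing:
  assumes m: "m \<ge> (1::nat)" and sh: "s * h = pi / real m" and phi: "schwartz \<phi>"
    and even: "\<And>\<omega>. norm \<omega> = 1 \<Longrightarrow> \<psi> (- \<omega>) = \<psi> \<omega>"
  shows "integrable lborel (\<lambda>x. f_psi_delta s h \<psi> f x * \<phi> x)"
    "(LINT x|lborel. f_psi_delta s h \<psi> f x * \<phi> x) = of_real (1 / (4 * pi\<^sup>2)) * (of_real (pi / real m) *
      (\<Sum>j = 1..2 * m. ray_integral \<psi> (\<lambda>\<xi>. ft 1 f (- \<xi>)) (ft 1 \<phi>) (pi * real j / real m)))"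
proof -
  let ?t = "\<lambda>j::nat. pi * real j / real m"
  let ?G = "ray_integral \<psi> (\<lambda>\<xi>. ft 1 f (- \<xi>)) (ft 1 \<phi>)"
  let ?c = "complex_of_real (1 / (4 * pi\<^sup>2))" and ?d = "complex_of_real (pi / real m)"
  note L = schwartz_L12[OF phi] and gi = L12_D(2)[OF schwartz_L12[OF phi]]
  note [measurable] = L2_D(1)[OF L12_D(1)[OF L]]
  note [measurable] = backprojection_measurable
  have i: "integrable lborel (\<lambda>x::plane. ft 1 (filtered_slice \<omega>) (x \<bullet> \<omega>) * \<phi> x)" if w: "norm \<omega> = 1" for \<omega>
  proof (rule Bochner_Integration.integrable_bound[OF integrable_mult_right[OF integrable_norm[OF gi], of "LINT \<sigma>|lborel. norm (filtered_slice \<omega> \<sigma>)"]])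
    show "AE x in lborel. norm (ft 1 (filtered_slice \<omega>) (x \<bullet> \<omega>) * \<phi> x) \<le>
        norm ((LINT \<sigma>|lborel. norm (filtered_slice \<omega> \<sigma>)) * norm (\<phi> x))"
      using norm_ft_le[OF slice_integrable(3)[OF w], of 1] by (intro AE_I2) (auto simp: norm_mult abs_mult intro!: mult_right_mono)
  qed measurable
  have fe: "f_psi_delta s h \<psi> f x * \<phi> x = ?c * (?d * (\<Sum>j = 1..m. \<psi> (omega (?t j)) * (ft 1 (filtered_slice (omega (?t j))) (x \<bullet> omega (?t j)) * \<phi> x)))" for x
    unfolding f_psi_delta_eq[OF m sh] by (simp add: sum_distrib_left sum_distrib_right mult_ac)
  show "integrable lborel (\<lambda>x. f_psi_delta s h \<psi> f x * \<phi> x)"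
    unfolding fe by (intro integrable_mult_right Bochner_Integration.integrable_sum i) simp
  have G: "?G t = \<psi> (omega t) * half_line_pairing (omega t) \<phi>" for t
    by (simp add: ray_integral_def half_line_pairing_def)
  have opi: "omega (t + pi) = - omega t" for t by (simp add: plane_eq_iff)
  have pair: "(LINT x|lborel. ft 1 (filtered_slice (omega t)) (x \<bullet> omega t) * \<phi> x) =
      half_line_pairing (omega t) \<phi> + half_line_pairing (- omega t) \<phi>" for t
    using backprojection_pairing[OF norm_omega gi, of t] line_pairing_split[OF norm_omega gi, of t] by simp
  \<comment> \<open>Evenness of psi gives the half line of -omega the same weight as that of
    omega.\<close>
  have GG: "\<psi> (omega t) * (LINT x|lborel. ft 1 (filtered_slice (omega t)) (x \<bullet> omega t) * \<phi> x) = ?G t + ?G (t + pi)" for t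
    by (simp add: G opi pair even distrib_left)
  have "(LINT x|lborel. f_psi_delta s h \<psi> f x * \<phi> x) =
      ?c * (?d * (\<Sum>j = 1..m. \<psi> (omega (?t j)) * (LINT x|lborel. ft 1 (filtered_slice (omega (?t j))) (x \<bullet> omega (?t j)) * \<phi> x)))"
    unfolding fe Bochner_Integration.integral_mult_right_zero
    by (subst Bochner_Integration.integral_sum)
       (simp_all only: Bochner_Integration.integral_mult_right_zero integrable_mult_right i norm_omega)
  also have "(\<Sum>j = 1..m. \<psi> (omega (?t j)) * (LINT x|lborel. ft 1 (filtered_slice (omega (?t j))) (x \<bullet> omega (?t j)) * \<phi> x)) =
      (\<Sum>j = 1..m. ?G (?t j)) + (\<Sum>j = 1..m. ?G (?t (j + m)))"
  proof -
    \<comment> \<open>The opposite directions are the samples with index m + 1, ..., 2 m of the full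
      circle.\<close>
    have "?t (j + m) = ?t j + pi" for j using m by (simp add: field_simps)
    then show ?thesis by (simp only: GG sum.distrib)
  qed
  also have "(\<Sum>j = 1..m. ?G (?t (j + m))) = (\<Sum>j = m + 1..2 * m. ?G (?t j))"
    using sum.shift_bounds_cl_nat_ivl[of "\<lambda>j. ?G (?t j)" 1 m m] by (simp add: mult_2)
  also have "(\<Sum>j = 1..m. ?G (?t j)) + \<dots> = (\<Sum>j = 1..2 * m. ?G (?t j))"
    using sum.ub_add_nat[of 1 m "\<lambda>j. ?G (?t j)" m] by (simp add: mult_2)
  finally show "(LINT x|lborel. f_psi_delta s h \<psi> f x * \<phi> x) = ?c * (?d * (\<Sum>j = 1..2 * m. ?G (?t j)))" .
qed

text \<open>The multiplier is homogeneous of degree 0, so the scaling by h disappears, and 2 pi k /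
  (s h) is the integer 2 m k.\<close>

lemma angle_mult_polar:
  assumes m: "m \<ge> (1::nat)" and sh: "s * h = pi / real m" and h: "h > 0"
    and "0 < r" "- pi < t" "t < pi"
  shows "angle_mult s k h (h *\<^sub>R (r *\<^sub>R omega t)) = cis (of_int (2 * int m * k) * t)"
proof -
  have "polar_angle ((h * r) *\<^sub>R omega t) = t" using assms by (intro polar_angle_polar) auto
  moreover have "2 * pi * of_int k * t / (s * h) = of_int (2 * int m * k) * t" using m by (simp add: sh)
  ultimately show ?thesis by (simp add: angle_mult_eq cis_conv_exp del: of_real_mult)
qed

theorem aliasing_formula:
  assumes s: "s > 0" and h: "h \<in> h_values s" and psi: "smooth_on_circle \<psi>"
    and even: "\<And>\<omega>. norm \<omega> = 1 \<Longrightarrow> \<psi> (- \<omega>) = \<psi> \<omega>"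
  shows "tempered_has_sum (\<lambda>k. calA s k h (f_psi \<psi> f)) (UNIV - {0 :: int})
     (\<lambda>x. f_psi_delta s h \<psi> f x - f_psi \<psi> f x)"
proof -
  obtain m :: nat where m: "m \<ge> 1" and hm: "h = pi / (s * real m)" using h by (auto simp: h_values_def)
  have sh: "s * h = pi / real m" using s m by (simp add: hm)
  have h0: "h > 0" by (rule h_values_pos[OF s h])
  have L2: "f_psi \<psi> f \<in> L2" "calA s k h (f_psi \<psi> f) \<in> L2" for k
    using fourier_pair_D(1)[OF fourier_pair_f_psi[OF psi]] fourier_pair_D(1)[OF fourier_pair_calA_f_psi[OF psi h0]] by auto
  show ?thesis
    unfolding tempered_has_sum_def
  proof (intro conjI ballI allI impI)
    show "tempered_function (calA s k h (f_psi \<psi> f))" for k by (rule L2_tempered_function[OF L2(2)])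
    have i: "integrable lborel (\<lambda>x. f_psi \<psi> f x * \<phi> x)" if "schwartz \<phi>" for \<phi>
      using L2_tempered_function[OF L2(1)] that by (simp add: tempered_function_def)
    show "tempered_function (\<lambda>x. f_psi_delta s h \<psi> f x - f_psi \<psi> f x)"
      unfolding tempered_function_def
    proof (intro conjI allI impI)
      show "integrable lborel (\<lambda>x. (f_psi_delta s h \<psi> f x - f_psi \<psi> f x) * \<phi> x)" if phi: "schwartz \<phi>" for \<phi>
        unfolding left_diff_distrib
        by (rule Bochner_Integration.integrable_diff[OF f_psi_delta_pairing(1)[where \<psi> = \<psi>, OF m sh phi even] i[OF phi]])
      note [measurable] = f_psi_delta_measurable[OF m sh, of \<psi>] L2_D(1)[OF L2(1)]
      show "(\<lambda>x. f_psi_delta s h \<psi> f x - f_psi \<psi> f x) \<in> borel_measurable borel" by measurable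
    qed
    fix \<phi> :: "plane \<Rightarrow> complex" assume phi: "schwartz \<phi>"
    let ?G = "ray_integral \<psi> (\<lambda>\<xi>. ft 1 f (- \<xi>)) (ft 1 \<phi>)" and ?c = "complex_of_real (1 / (4 * pi\<^sup>2))"
    have "\<phi> \<in> borel_measurable borel" by (rule L2_D(1)[OF L12_D(1)[OF schwartz_L12[OF phi]]])
    then obtain G' G'' B where G: "periodic_C2 ?G G' G'' B"
      using ray_integral_C2[OF psi f_measurable f_weighted_integrable rapid _ schwartz_weighted_integrable[OF phi]] by auto
    have p0: "(LINT x|lborel. f_psi \<psi> f x * \<phi> x) = ?c * fc 0 ?G"
      by (rule pairing_eq_fourier_coefficient[OF psi phi, where e = "\<lambda>_. 1"]) (use fourier_pair_f_psi[OF psi] in simp_all)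
    have pk: "(LINT x|lborel. calA s k h (f_psi \<psi> f) x * \<phi> x) = ?c * fc (2 * int m * k) ?G" for k
      by (rule pairing_eq_fourier_coefficient[OF psi phi fourier_pair_calA_f_psi[OF psi h0] angle_mult_polar[OF m sh h0]])
    have pd: "(LINT x|lborel. f_psi_delta s h \<psi> f x * \<phi> x) = ?c * (of_real (pi / real m) * (\<Sum>j = 1..2 * m. ?G (pi * real j / real m)))"
      by (rule f_psi_delta_pairing(2)[OF m sh phi]) (rule even)
    have "((\<lambda>k. ?c * fc (2 * int m * k) ?G) has_sum (LINT x|lborel. f_psi_delta s h \<psi> f x * \<phi> x)) UNIV"
      unfolding pd
      by (rule has_sum_cmult_right[OF periodic_C2.sampling_has_sum[OF G m]])
    \<comment> \<open>The term k = 0 of the sampling formula is the pairing with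
      \<open>f_psi\<close>; removing it leaves the aliased terms.\<close>
    moreover have "((\<lambda>k. ?c * fc (2 * int m * k) ?G) has_sum (?c * fc 0 ?G)) {0}"
      using has_sum_finite[of "{0}" "\<lambda>k. ?c * fc (2 * int m * k) ?G"] by simp
    ultimately have "((\<lambda>k. ?c * fc (2 * int m * k) ?G) has_sum
        ((LINT x|lborel. f_psi_delta s h \<psi> f x * \<phi> x) - (LINT x|lborel. f_psi \<psi> f x * \<phi> x))) (UNIV - {0})"
      unfolding p0 by (rule has_sum_Diff) simp
    moreover have "(LINT x|lborel. (f_psi_delta s h \<psi> f x - f_psi \<psi> f x) * \<phi> x) =
        (LINT x|lborel. f_psi_delta s h \<psi> f x * \<phi> x) - (LINT x|lborel. f_psi \<psi> f x * \<phi> x)"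
      unfolding left_diff_distrib
      by (rule Bochner_Integration.integral_diff[OF f_psi_delta_pairing(1)[where \<psi> = \<psi>, OF m sh phi even] i[OF phi]])
    ultimately show "((\<lambda>k. LINT x|lborel. calA s k h (f_psi \<psi> f) x * \<phi> x) has_sum
        (LINT x|lborel. (f_psi_delta s h \<psi> f x - f_psi \<psi> f x) * \<phi> x)) (UNIV - {0})"
      unfolding pk by simp
  qed
qed

end

theorem theorem4p1:
  fixes s :: real
    and \<psi> :: "real ^ 2 \<Rightarrow> complex"
    and f :: "real \<Rightarrow> real ^ 2 \<Rightarrow> complex"
  assumes "s > 0"
    and "smooth_on_circle \<psi>"
    and "\<And>\<omega>. norm \<omega> = 1 \<Longrightarrow> \<psi> (- \<omega>) = \<psi> \<omega>"
    and "semiclassically_band_limited (h_values s) f"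
  shows "(\<forall>h\<in>h_values s.
           tempered_has_sum (\<lambda>k. calA s k h (f_psi \<psi> (f h))) (UNIV - {0 :: int})
             (\<lambda>x. f_psi_delta s h \<psi> (f h) x - f_psi \<psi> (f h) x))
         \<and> (\<forall>k :: int. k \<noteq> 0 \<longrightarrow>
             (\<forall>h\<in>h_values s. unitary_L2 (calA s k h)) \<and>
             elliptic_semiclassical_FIO0 (h_values s) (C_rel s k) (calA s k))"
proof (intro conjI ballI allI impI)
  fix h assume h: "h \<in> h_values s"
  obtain R where "bandlimited_function (f h) R"
    using semiclassically_band_limited_imp_bandlimited_function[OF assms(4) h h_values_pos[OF assms(1) h]] .
  then show "tempered_has_sum (\<lambda>k. calA s k h (f_psi \<psi> (f h))) (UNIV - {0 :: int})
      (\<lambda>x. f_psi_delta s h \<psi> (f h) x - f_psi \<psi> (f h) x)"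
    by (rule bandlimited_function.aliasing_formula[OF _ assms(1) h assms(2,3)])
qed (use assms(1) in \<open>auto intro: unitary_calA elliptic_FIO_calA\<close>)

end
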